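(* Let $N\ge 1$, $\lambda\le 0$, $0\le\alpha<\frac{4}{N-2}$ ($0\le\alpha<\infty$ if $N=1$), let $\varphi\in H^1(\mathbb{R}^N)$ and let $u$ be the corresponding solution of $$i\frac{\partial u}{\partial t}+\Delta u+\lambda|u|^\alpha u=0,\quad (t,x)\in[0,\infty)\times\mathbb{R}^N,\qquad u(0)=\varphi .$$ If $\alpha\le\frac4N$, assume further that $\varphi\in X$. If $\varphi\not\equiv 0$, then for every $r\in[2,\infty]$, $$\liminf_{t\to\infty}|t|^{N\left(\frac12-\frac1r\right)}\|u(t)\|_{L^r}>0 .$$
   Context: Functions are complex-valued, $L^p=L^p(\mathbb{R}^N;\mathbb{C})$, and $\|f\|_{L^p}=\infty$ by convention if $f\notin L^p$. For $N=2$, $\frac{4}{N-2}$ is read as $\infty$. $X=\{\psi\in H^1(\mathbb{R}^N):\ \|\psi\|_X<\infty\}$ with $\|\psi\|_X^2=\|\psi\|_{H^1}^2+\int_{\mathbb{R}^N}|x|^2|\psi(x)|^2dx$. For $\varphi\in H^1(\mathbb{R}^N)$, the corresponding solution is the unique maximal solution $u\in C((-T_*,T^* );H^1(\mathbb{R}^N))$ of the equation with $u(0)=\varphi$; it satisfies $\|u(t)\|_{L^2}=\|\varphi\|_{L^2}$ for all $t$, and it is known that $T_*=T^*=\infty$ when $\lambda\le 0$. If $\varphi\in X$ then $u\in C((-T_*,T^* );X)$. *)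

theory Defs
  imports "HOL-Analysis.Analysis" "HOL-Probability.Essential_Supremum"
begin

text \<open>
  The space \<open>\<real>\<^sup>N\<close> is a type \<open>'a :: euclidean_space\<close> with \<open>N = DIM('a)\<close> (so \<open>N \<ge> 1\<close> holds
  automatically), with Lebesgue measure. Elements of Lebesgue and Sobolev spaces are represented
  by functions, and equality in these spaces is equality almost everywhere.
\<close>

section \<open>Lebesgue norms\<close>

text \<open>The power \<open>x\<^sup>a\<close> for \<open>a > 0\<close>.\<close>

definition ennpow :: "ennreal \<Rightarrow> real \<Rightarrow> ennreal" where
  "ennpow x a = (if x = \<infinity> then \<infinity> else ennreal (enn2real x powr a))"

text \<open>Meant for \<open>1 \<le> p\<close>; the value is \<open>\<infinity>\<close> exactly when \<open>f\<close> is not in \<open>L\<^sup>p\<close>.\<close>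

definition Lp_norm :: "ennreal \<Rightarrow> ('a::euclidean_space \<Rightarrow> complex) \<Rightarrow> ennreal" where
  "Lp_norm p f =
     (if f \<notin> borel_measurable lebesgue then \<infinity>
      else if p = \<infinity> then esssup lebesgue (\<lambda>x. ennreal (cmod (f x)))
      else ennpow (\<integral>\<^sup>+ x. ennreal (cmod (f x) powr enn2real p) \<partial>lebesgue) (1 / enn2real p))"

section \<open>Weak derivatives and Sobolev spaces\<close>

definition partial_deriv :: "'a::euclidean_space \<Rightarrow> ('a \<Rightarrow> complex) \<Rightarrow> 'a \<Rightarrow> complex" where
  "partial_deriv b f x = frechet_derivative f (at x) b"

text \<open>\<open>C\<^sup>k\<close> on the whole space: all iterated partial derivatives up to order \<open>k\<close> exist and are
  continuous.\<close>

primrec Ck :: "nat \<Rightarrow> ('a::euclidean_space \<Rightarrow> complex) \<Rightarrow> bool" where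
  "Ck 0 f \<longleftrightarrow> continuous_on UNIV f"
| "Ck (Suc k) f \<longleftrightarrow> (\<forall>x. f differentiable (at x)) \<and> (\<forall>b\<in>Basis. Ck k (partial_deriv b f))"

definition test_function :: "('a::euclidean_space \<Rightarrow> complex) \<Rightarrow> bool" where
  "test_function \<eta> \<longleftrightarrow> (\<forall>k. Ck k \<eta>) \<and> compact (closure {x. \<eta> x \<noteq> 0})"

text \<open>The bilinear (not sesquilinear) duality pairing.\<close>

definition pairing :: "('a::euclidean_space \<Rightarrow> complex) \<Rightarrow> ('a \<Rightarrow> complex) \<Rightarrow> complex" where
  "pairing f g = (\<integral>x. f x * g x \<partial>lebesgue)"

text \<open>\<open>g \<in> L\<^sup>2\<close> is the distributional derivative of \<open>f\<close> in the direction \<open>b\<close>.\<close>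

definition has_weak_partial ::
  "'a::euclidean_space \<Rightarrow> ('a \<Rightarrow> complex) \<Rightarrow> ('a \<Rightarrow> complex) \<Rightarrow> bool" where
  "has_weak_partial b f g \<longleftrightarrow>
     Lp_norm 2 g < \<infinity> \<and>
     (\<forall>\<eta>. test_function \<eta> \<longrightarrow> pairing f (partial_deriv b \<eta>) = - pairing g \<eta>)"

definition H1 :: "('a::euclidean_space \<Rightarrow> complex) set" where
  "H1 = {f. Lp_norm 2 f < \<infinity> \<and> (\<forall>b\<in>Basis. \<exists>g. has_weak_partial b f g)}"

text \<open>A representative of the weak derivative, which is unique up to null sets.\<close>

definition weak_partial :: "'a::euclidean_space \<Rightarrow> ('a \<Rightarrow> complex) \<Rightarrow> 'a \<Rightarrow> complex" where
  "weak_partial b f = (SOME g. has_weak_partial b f g)"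

definition H1_norm :: "('a::euclidean_space \<Rightarrow> complex) \<Rightarrow> ennreal" where
  "H1_norm f = ennpow ((Lp_norm 2 f)\<^sup>2 + (\<Sum>b\<in>Basis. (Lp_norm 2 (weak_partial b f))\<^sup>2)) (1/2)"

definition X_norm :: "('a::euclidean_space \<Rightarrow> complex) \<Rightarrow> ennreal" where
  "X_norm f = ennpow ((H1_norm f)\<^sup>2
     + (\<integral>\<^sup>+ x. ennreal ((norm x)\<^sup>2 * (cmod (f x))\<^sup>2) \<partial>lebesgue)) (1/2)"

definition X_space :: "('a::euclidean_space \<Rightarrow> complex) set" where
  "X_space = {f \<in> H1. X_norm f < \<infinity>}"

text \<open>Elements of \<open>H\<^sup>-\<^sup>1\<close>, the dual of \<open>H\<^sup>1\<close>, are represented by functionals \<open>L\<close>, of which only the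
  values on \<^const>\<open>H1\<close> matter. A function \<open>f \<in> L\<^sup>2\<close> is embedded as \<^term>\<open>pairing f\<close>.\<close>

definition Hm1_norm :: "(('a::euclidean_space \<Rightarrow> complex) \<Rightarrow> complex) \<Rightarrow> ennreal" where
  "Hm1_norm L = (SUP v\<in>{v \<in> H1. H1_norm v \<le> 1}. ennreal (cmod (L v)))"

section \<open>The nonlinear Schroedinger equation\<close>

text \<open>The Laplacian as a map from \<open>H\<^sup>1\<close> to \<open>H\<^sup>-\<^sup>1\<close>.\<close>

definition weak_laplacian ::
  "('a::euclidean_space \<Rightarrow> complex) \<Rightarrow> ('a \<Rightarrow> complex) \<Rightarrow> complex" where
  "weak_laplacian f v = - (\<Sum>b\<in>Basis. pairing (weak_partial b f) (weak_partial b v))"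

definition nonlinearity :: "real \<Rightarrow> ('a::euclidean_space \<Rightarrow> complex) \<Rightarrow> 'a \<Rightarrow> complex" where
  "nonlinearity \<alpha> f x = of_real (cmod (f x) powr \<alpha>) * f x"

definition time_interval :: "ereal \<Rightarrow> ereal \<Rightarrow> real set" where
  "time_interval Tm Tp = {t. - Tm < ereal t \<and> ereal t < Tp}"

text \<open>\<open>u \<in> C((-Tm, Tp); H\<^sup>1)\<close> solves the equation with initial value \<open>\<phi>\<close>: moreover
  \<open>u \<in> C\<^sup>1((-Tm, Tp); H\<^sup>-\<^sup>1)\<close>, with derivative \<open>u'\<close>, and the equation holds in \<open>H\<^sup>-\<^sup>1\<close> at every time.
  For energy-subcritical \<open>\<alpha>\<close> the function \<open>|f|\<^sup>\<alpha> f v\<close> is integrable for all \<open>f, v \<in> H\<^sup>1\<close>, so the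
  pairing with the nonlinearity is a genuine integral.\<close>

definition nls_solution ::
  "real \<Rightarrow> real \<Rightarrow> ('a::euclidean_space \<Rightarrow> complex) \<Rightarrow> ereal \<Rightarrow> ereal \<Rightarrow> (real \<Rightarrow> 'a \<Rightarrow> complex) \<Rightarrow> bool"
  where
  "nls_solution lam \<alpha> \<phi> Tm Tp u \<longleftrightarrow>
     0 < Tm \<and> 0 < Tp \<and>
     (\<forall>t \<in> time_interval Tm Tp.
        u t \<in> H1 \<and> ((\<lambda>s. H1_norm (\<lambda>x. u s x - u t x)) \<longlongrightarrow> 0) (at t)) \<and>
     (\<exists>u' :: real \<Rightarrow> ('a \<Rightarrow> complex) \<Rightarrow> complex. \<forall>t \<in> time_interval Tm Tp.
        ((\<lambda>s. Hm1_norm (\<lambda>v. pairing (\<lambda>x. u s x - u t x) v / of_real (s - t) - u' t v))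
           \<longlongrightarrow> 0) (at t) \<and>
        ((\<lambda>s. Hm1_norm (\<lambda>v. u' s v - u' t v)) \<longlongrightarrow> 0) (at t) \<and>
        (\<forall>v \<in> H1. \<i> * u' t v + weak_laplacian (u t) v
                    + of_real lam * pairing (nonlinearity \<alpha> (u t)) v = 0)) \<and>
     (AE x in lebesgue. u 0 x = \<phi> x)"

text \<open>\<open>u\<close> is the unique maximal solution, with maximal existence interval \<open>(-Tm, Tp)\<close>: every
  solution with the same initial value is a restriction of \<open>u\<close>. For \<open>lam \<le> 0\<close> and
  energy-subcritical \<open>\<alpha>\<close> it is known that \<open>Tm = Tp = \<infinity>\<close>.\<close>

definition nls_maximal_solution ::
  "real \<Rightarrow> real \<Rightarrow> ('a::euclidean_space \<Rightarrow> complex) \<Rightarrow> ereal \<Rightarrow> ereal \<Rightarrow> (real \<Rightarrow> 'a \<Rightarrow> complex) \<Rightarrow> bool"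
  where
  "nls_maximal_solution lam \<alpha> \<phi> Tm Tp u \<longleftrightarrow>
     nls_solution lam \<alpha> \<phi> Tm Tp u \<and>
     (\<forall>Sm Sp w. nls_solution lam \<alpha> \<phi> Sm Sp w \<longrightarrow>
        Sm \<le> Tm \<and> Sp \<le> Tp \<and>
        (\<forall>t \<in> time_interval Sm Sp. AE x in lebesgue. w t x = u t x))"

end

theory Submission
 imports Defs "HOL-Probability.Distributions"
begin

text \<open>
Scattering is not needed, nor is a weighted space: for \<open>\<rho>\<close> large, the mass outside the ball of radius \<open>\<rho>T\<close>
changes by at most a constant times \<open>\<parallel>\<nabla>u\<parallel> \<parallel>u\<parallel> / \<rho>\<close> up to time \<open>T\<close>, so that half of the mass stays inside and
Hoelder's inequality against a Gaussian of width \<open>\<rho>T\<close> bounds the \<open>L\<^sup>r\<close> norm below by a multiple of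
\<open>T\<^sup>-\<^sup>N\<^sup>(\<^sup>1\<^sup>/\<^sup>2\<^sup>-\<^sup>1\<^sup>/\<^sup>r\<^sup>)\<close>. What is needed is a bound on \<open>\<nabla>u\<close> uniform in time. For \<open>\<alpha> > 0\<close> the energy provides it: since \<open>\<Delta>u\<close> is only a distribution, its decrease is derived from the \<open>L\<^sup>2\<close> norm of \<open>u(t, x + y) - u(t, x)\<close>
as \<open>y\<close> tends to 0. Here the nonlinearity is truncated, and the error is controlled by a Strichartz estimate with a loss.
The latter rests on the explicit kernel of \<open>e\<^sup>(\<^sup>\<epsilon>\<^sup>+\<^sup>i\<^sup>t\<^sup>)\<^sup>\<Delta>\<close>, real interpolation, a \<open>TT\<^sup>*\<close> argument on a time grid and Duhamel's formula.
\<close>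

text \<open>Formally the energy identity tests the equation with the time derivative of u, which
  lies only in H^-1, while |u|^\<alpha> u need not lie in H^1. The differences W = u(t, x + y) -
  u(t, x) do lie in H^1, and the time derivative of their squared L^2 norm contains only the
  nonlinearity. After division by |y|^2 it should tend to the derivative of the potential energy,
  but |u|^\<alpha> |W|^2 / |y|^2 has no evident majorant when only H^1 is known. For a globally
  Lipschitz truncation at level M the limit is harmless; the remainder is M^(-l) times the squared
  L^r norm of W, and this is of order |y|^2 only after integration in time. The Strichartz estimate
  provides that: it bounds the L^2 norm in time of the L^r norm of W by the initial L^2 norm, which
  is at most |y| times the gradient. Since a = N(1/2 - 1/r) < 1, the factor |t|^(-a) is integrable
  on bounded intervals and Schur's test takes the place of Hardy-Littlewood-Sobolev; this is the
  loss. Fourier transforms are avoided: contractivity in L^2 comes from moving complex time between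
  the two factors of a pairing.\<close>

section \<open>Affine substitutions and Hoelder's inequality\<close>

lemma integrable_dominated:
 fixes f :: "'m \<Rightarrow> 'b::{banach, second_countable_topology}" and g :: "'m \<Rightarrow> real"
 assumes "integrable M g" "f \<in> borel_measurable M" "\<And>x. norm (f x) \<le> g x"
 shows "integrable M f"
 by (rule Bochner_Integration.integrable_bound[OF assms(1,2)]) (use assms(3) in \<open>auto intro!: AE_I2 intro: order_trans[OF _ abs_ge_self]\<close>)

lemma lborel_nn_integral_affine:
 fixes f :: "'a::euclidean_space \<Rightarrow> ennreal"
 assumes [measurable]: "f \<in> borel_measurable borel" and c: "c \<noteq> 0"
 shows "(\<integral>\<^sup>+x. f x \<partial>lborel) = ennreal (\<bar>c\<bar> ^ DIM('a)) * (\<integral>\<^sup>+x. f (t + c *\<^sub>R x) \<partial>lborel)"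
 by (subst lborel_affine[OF c, of t])
  (simp add: nn_integral_density nn_integral_distr nn_integral_cmult)

lemma lborel_integrable_affine_iff:
 fixes f :: "'a::euclidean_space \<Rightarrow> 'b::{banach, second_countable_topology}"
 assumes [measurable]: "f \<in> borel_measurable borel" and c: "c \<noteq> 0"
 shows "integrable lborel (\<lambda>x. f (t + c *\<^sub>R x)) \<longleftrightarrow> integrable lborel f"
proof -
 have "(\<integral>\<^sup>+x. norm (f x) \<partial>lborel) < \<infinity> \<longleftrightarrow> (\<integral>\<^sup>+x. norm (f (t + c *\<^sub>R x)) \<partial>lborel) < \<infinity>"
  using c by (subst lborel_nn_integral_affine[of "\<lambda>x. ennreal (norm (f x))", OF _ c, of t])
   (auto simp: ennreal_mult_less_top less_top[symmetric] ennreal_mult_eq_top_iff)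
 then show ?thesis
  by (auto simp: integrable_iff_bounded)
qed

lemma lborel_integral_affine:
 fixes f :: "'a::euclidean_space \<Rightarrow> 'b::{banach, second_countable_topology}"
 assumes [measurable]: "f \<in> borel_measurable borel" and c: "c \<noteq> 0"
 shows "(LBINT x. f x) = \<bar>c\<bar> ^ DIM('a) *\<^sub>R (LBINT x. f (t + c *\<^sub>R x))"
 by (subst lborel_affine[OF c, of t])
  (simp add: integral_density integral_distr)

lemma lborel_integrable_translate_iff [simp]:
 fixes f :: "'a::euclidean_space \<Rightarrow> 'b::{banach, second_countable_topology}"
 assumes "f \<in> borel_measurable borel"
 shows "integrable lborel (\<lambda>x. f (x + t)) \<longleftrightarrow> integrable lborel f"
 using lborel_integrable_affine_iff[OF assms, of 1 t] by (simp add: add.commute)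

lemma lborel_integral_translate:
 fixes f :: "'a::euclidean_space \<Rightarrow> 'b::{banach, second_countable_topology}"
 assumes "f \<in> borel_measurable borel"
 shows "(LBINT x. f (x + t)) = (LBINT x. f x)"
 using lborel_integral_affine[OF assms, of 1 t] by (simp add: add.commute)

lemma lborel_nn_integral_translate:
 fixes f :: "'a::euclidean_space \<Rightarrow> ennreal"
 assumes "f \<in> borel_measurable borel"
 shows "(\<integral>\<^sup>+x. f (x + t) \<partial>lborel) = (\<integral>\<^sup>+x. f x \<partial>lborel)"
 using lborel_nn_integral_affine[OF assms, of 1 t] by (simp add: add.commute)

lemma Holder:
 fixes f g :: "'m \<Rightarrow> real"
 assumes pq: "p > 1" "q > 1" "1/p + 1/q = 1"
  and [measurable]: "f \<in> borel_measurable M" "g \<in> borel_measurable M"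
  and nn: "\<And>x. 0 \<le> f x" "\<And>x. 0 \<le> g x"
  and int: "integrable M (\<lambda>x. f x powr p)" "integrable M (\<lambda>x. g x powr q)"
 shows "integrable M (\<lambda>x. f x * g x)"
  and "(\<integral>x. f x * g x \<partial>M) \<le> (\<integral>x. f x powr p \<partial>M) powr (1/p) * (\<integral>x. g x powr q \<partial>M) powr (1/q)"
proof -
 show I: "integrable M (\<lambda>x. f x * g x)"
 proof (rule Bochner_Integration.integrable_bound)
  show "integrable M (\<lambda>x. f x powr p / p + g x powr q / q)" using int by auto
  have "f x * g x \<le> f x powr p / p + g x powr q / q" for x
   using Youngs_inequality[OF pq nn(1) nn(2)] .
  then show "AE x in M. norm (f x * g x) \<le> norm (f x powr p / p + g x powr q / q)"
   using nn pq by (auto simp: abs_mult)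
 qed auto
 let ?A = "\<integral>x. f x powr p \<partial>M" and ?B = "\<integral>x. g x powr q \<partial>M"
 have A: "?A \<ge> 0" and B: "?B \<ge> 0" by auto
 show "(\<integral>x. f x * g x \<partial>M) \<le> ?A powr (1/p) * ?B powr (1/q)"
 \<comment> \<open>The other case divides by both norms before integrating Young's
   inequality.\<close>
 proof (cases "?A = 0 \<or> ?B = 0")
  case True
  then have "AE x in M. f x * g x = 0"
  proof
   assume "?A = 0"
   then have "AE x in M. f x powr p = 0"
    using int by (subst (asm) integral_nonneg_eq_0_iff_AE) auto
   then show ?thesis by eventually_elim auto
  next
   assume "?B = 0"
   then have "AE x in M. g x powr q = 0"
    using int by (subst (asm) integral_nonneg_eq_0_iff_AE) auto
   then show ?thesis by eventually_elim auto
  qed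
  then have "(\<integral>x. f x * g x \<partial>M) = (\<integral>x. 0 \<partial>M)"
   by (intro integral_cong_AE) auto
  then show ?thesis by simp
 next
  case False
  then have A: "?A > 0" and B: "?B > 0" using A B by (simp_all add: order_less_le)
  let ?a = "?A powr (1/p)" and ?b = "?B powr (1/q)"
  have ab: "?a > 0" "?b > 0" using A B by auto
  have app: "?a powr p = ?A" "?b powr q = ?B" using A B pq by (auto simp: powr_powr)
  have "(\<integral>x. f x * g x / (?a * ?b) \<partial>M) \<le> (\<integral>x. f x powr p / ?A / p + g x powr q / ?B / q \<partial>M)"
  proof (rule integral_mono)
   fix x
   have "(f x / ?a) * (g x / ?b) \<le> (f x / ?a) powr p / p + (g x / ?b) powr q / q"
    using ab nn by (intro Youngs_inequality[OF pq]) auto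
   also have "... = f x powr p / ?A / p + g x powr q / ?B / q"
    using ab nn app by (simp add: powr_divide)
   finally show "f x * g x / (?a * ?b) \<le> ..." by (simp add: field_simps)
  qed (use I int in auto)
  also have "... = 1" using int A B pq by simp
  finally show ?thesis using ab by (simp add: field_simps)
 qed
qed

section \<open>Lebesgue spaces of Borel functions\<close>

text \<open>Borel rather than Lebesgue measurability: it survives compositions such as f (x - y),
  which convolutions and Fubini's theorem need. Lebesgue measurable functions enter only at the end,
  through \<open>rep\<close>.\<close>

definition lp :: "real \<Rightarrow> ('a::euclidean_space \<Rightarrow> 'b::{banach, second_countable_topology}) \<Rightarrow> bool" where
 "lp p f \<longleftrightarrow> f \<in> borel_measurable borel \<and> integrable lborel (\<lambda>x. norm (f x) powr p)"

text \<open>Outside the Lebesgue space the Bochner integral defaults to 0, and so does this norm;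
  estimates therefore carry membership separately.\<close>

definition np :: "real \<Rightarrow> ('a::euclidean_space \<Rightarrow> 'b::{banach, second_countable_topology}) \<Rightarrow> real" where
 "np p f = (LBINT x. norm (f x) powr p) powr (1/p)"

text \<open>The exponent 2 gets a version with a genuine square, in which quadratic identities can
  be expanded; \<open>lp_2\<close> and \<open>np_2\<close> transfer the general facts.\<close>

definition sq :: "('a::euclidean_space \<Rightarrow> 'b::{banach, second_countable_topology}) \<Rightarrow> bool" where
 "sq f \<longleftrightarrow> f \<in> borel_measurable borel \<and> integrable lborel (\<lambda>x. (norm (f x))^2)"

definition n2 :: "('a::euclidean_space \<Rightarrow> 'b::{banach, second_countable_topology}) \<Rightarrow> real" where
 "n2 f = sqrt (LBINT x. (norm (f x))^2)"

lemma lp_measurable [measurable_dest]: "lp p f \<Longrightarrow> f \<in> borel_measurable borel"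
 by (simp add: lp_def)

lemma sq_measurable [measurable_dest]: "sq f \<Longrightarrow> f \<in> borel_measurable borel"
 by (simp add: sq_def)

lemma np_nonneg [simp]: "0 \<le> np p f" by (simp add: np_def)

lemma n2_nonneg [simp]: "0 \<le> n2 f" by (simp add: n2_def)

lemma n2_square: "(n2 f)^2 = (LBINT x. (norm (f x))^2)"
 by (simp add: n2_def)

lemma norm_powr_2 [simp]: "norm x powr 2 = (norm x)^2"
 by (simp add: powr_numeral)

lemma lp_2 [simp]: "lp 2 f = sq f" by (simp add: lp_def sq_def)

lemma np_2 [simp]: "np 2 f = n2 f"
 by (simp add: np_def n2_def powr_half_sqrt)

lemma np_powr: "p > 0 \<Longrightarrow> np p f powr p = (LBINT x. norm (f x) powr p)"
 by (simp add: np_def powr_powr)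

lemma lp_mono:
 fixes f :: "'a::euclidean_space \<Rightarrow> 'b::{banach, second_countable_topology}"
  and g :: "'a \<Rightarrow> 'c::{banach, second_countable_topology}"
 assumes "lp p g" "f \<in> borel_measurable borel" "0 \<le> p" "\<And>x. norm (f x) \<le> norm (g x)"
 shows "lp p f" "np p f \<le> np p g"
proof -
 have I: "norm (f x) powr p \<le> norm (g x) powr p" for x using assms by (auto intro: powr_mono2)
 show f: "lp p f"
  using assms(1,2) I unfolding lp_def by (auto intro: Bochner_Integration.integrable_bound)
 show "np p f \<le> np p g"
  unfolding np_def using f assms I
  by (auto intro!: powr_mono2 integral_mono simp: lp_def)
qed

lemma lp_translate: "lp p f \<Longrightarrow> lp p (\<lambda>x. f (x + t))"
 unfolding lp_def using lborel_integrable_translate_iff[of "\<lambda>x. norm (f x) powr p" t] by auto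

lemma np_translate: "lp p f \<Longrightarrow> np p (\<lambda>x. f (x + t)) = np p f"
 unfolding lp_def np_def using lborel_integral_translate[of "\<lambda>x. norm (f x) powr p" t] by auto

lemma sq_translate: "sq f \<Longrightarrow> sq (\<lambda>x. f (x + t))"
 using lp_translate[of 2] by simp

lemma n2_translate: "sq f \<Longrightarrow> n2 (\<lambda>x. f (x + t)) = n2 f"
 using np_translate[of 2] by simp

lemma lp_scaleR: "lp p f \<Longrightarrow> lp p (\<lambda>x. c *\<^sub>R f x)"
 unfolding lp_def by (auto simp: powr_mult)

lemma np_scaleR: "p > 0 \<Longrightarrow> np p (\<lambda>x. c *\<^sub>R f x) = \<bar>c\<bar> * np p f"
 unfolding np_def by (auto simp: powr_mult powr_powr)

lemma sq_bound:
 fixes f :: "'a::euclidean_space \<Rightarrow> 'b::{banach, second_countable_topology}"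
  and g :: "'a \<Rightarrow> 'c::{banach, second_countable_topology}"
 assumes "sq g" "f \<in> borel_measurable borel" "\<And>x. norm (f x) \<le> C * norm (g x)" "C \<ge> 0"
 shows "sq f" "n2 f \<le> C * n2 g"
 using lp_mono[of 2 "\<lambda>x. C *\<^sub>R g x" f] assms lp_scaleR[of 2 g C] np_scaleR[of 2 C g] by auto

lemma lp_cmult:
 fixes f :: "'a::euclidean_space \<Rightarrow> 'b::{real_normed_field, banach, second_countable_topology}"
 shows "lp p f \<Longrightarrow> lp p (\<lambda>x. c * f x)"
 unfolding lp_def by (auto simp: powr_mult norm_mult)

lemma np_cmult:
 fixes f :: "'a::euclidean_space \<Rightarrow> 'b::{real_normed_field, banach, second_countable_topology}"
 shows "p > 0 \<Longrightarrow> np p (\<lambda>x. c * f x) = norm c * np p f"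
 unfolding np_def by (auto simp: powr_mult norm_mult powr_powr)

lemma lp_add:
 assumes "lp p f" "lp p g" "p \<ge> 1"
 shows "lp p (\<lambda>x. f x + g x)"
proof -
 have [measurable]: "f \<in> borel_measurable borel" "g \<in> borel_measurable borel"
  using assms by (auto simp: lp_def)
 have "norm (f x + g x) powr p \<le> 2 powr p * (norm (f x) powr p + norm (g x) powr p)" for x
 proof -
  have "norm (f x + g x) powr p \<le> (2 * max (norm (f x)) (norm (g x))) powr p"
   using assms(3) norm_triangle_ineq[of "f x" "g x"] by (intro powr_mono2) auto
  also have "... = 2 powr p * max (norm (f x) powr p) (norm (g x) powr p)"
   using assms(3) by (auto simp: powr_mult max_def powr_mono2 intro!: antisym powr_mono2)
  also have "... \<le> 2 powr p * (norm (f x) powr p + norm (g x) powr p)"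
   by (intro mult_left_mono) auto
  finally show ?thesis .
 qed
 note bd = this
 have "integrable lborel (\<lambda>x. norm (f x + g x) powr p)"
 proof (rule integrable_dominated)
  show "integrable lborel (\<lambda>x. 2 powr p * (norm (f x) powr p + norm (g x) powr p))"
   using assms by (simp add: lp_def)
  show "norm (norm (f x + g x) powr p) \<le> 2 powr p * (norm (f x) powr p + norm (g x) powr p)" for x
   using bd[of x] by simp
 qed measurable
 then show ?thesis
  by (simp add: lp_def)
qed

lemma lp_diff:
 assumes "lp p f" "lp p g" "p \<ge> 1"
 shows "lp p (\<lambda>x. f x - g x)"
 using lp_add[OF assms(1) lp_scaleR[OF assms(2), of "-1"] assms(3)] by simp

lemma lp_Holder:
 fixes f :: "'a::euclidean_space \<Rightarrow> 'b::{banach, second_countable_topology}"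
  and g :: "'a \<Rightarrow> 'c::{banach, second_countable_topology}"
 assumes pq: "p > 1" "q > 1" "1/p + 1/q = 1" and f: "lp p f" and g: "lp q g"
 shows "integrable lborel (\<lambda>x. norm (f x) * norm (g x))"
  and "(LBINT x. norm (f x) * norm (g x)) \<le> np p f * np q g"
 using Holder[OF pq, of "\<lambda>x. norm (f x)" lborel "\<lambda>x. norm (g x)"] f g
 by (auto simp: lp_def np_def)

lemma lp_Holder_mult:
 fixes f g :: "'a::euclidean_space \<Rightarrow> complex"
 assumes pq: "p > 1" "q > 1" "1/p + 1/q = 1" and f: "lp p f" and g: "lp q g"
 shows "integrable lborel (\<lambda>x. f x * g x)"
  and "norm (LBINT x. f x * g x) \<le> np p f * np q g"
proof -
 note [measurable] = f g
 have [measurable]: "f \<in> borel_measurable borel" "g \<in> borel_measurable borel"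
  using f g by (auto simp: lp_def)
 show "integrable lborel (\<lambda>x. f x * g x)"
  by (rule Bochner_Integration.integrable_bound[OF lp_Holder(1)[OF pq f g]])
   (auto simp: norm_mult)
 have "norm (LBINT x. f x * g x) \<le> (LBINT x. norm (f x * g x))" by (rule integral_norm_bound)
 also have "... \<le> np p f * np q g" using lp_Holder(2)[OF pq f g] by (simp add: norm_mult)
 finally show "norm (LBINT x. f x * g x) \<le> np p f * np q g" .
qed

lemmas sq_CS_norm = lp_Holder[of 2 2, simplified]
lemmas sq_CS = lp_Holder_mult[of 2 2, simplified]

text \<open>Minkowski's inequality: pair |f + g| with |f + g|^(p - 1), whose norm in the dual space
  is the (p - 1)-st power of the norm of f + g, and cancel that power.\<close>

lemma np_triangle:
 assumes f: "lp p f" and g: "lp p g" and p: "p > 1"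
 shows "np p (\<lambda>x. f x + g x) \<le> np p f + np p g"
proof (cases "np p (\<lambda>x. f x + g x) = 0")
 case False
 let ?h = "\<lambda>x. f x + g x"
 define q where "q = p / (p - 1)"
 have q: "q > 1" "1/p + 1/q = 1" "(p - 1) * q = p" using p by (auto simp: q_def field_simps)
 have h: "lp p ?h" using f g p by (intro lp_add) auto
 have [measurable]: "f \<in> borel_measurable borel" "g \<in> borel_measurable borel"
  using f g by (auto simp: lp_def)
 let ?k = "\<lambda>x. norm (?h x) powr (p - 1)"
 have k: "lp q ?k" using h q by (simp add: lp_def powr_powr)
 have nk: "np q ?k = np p ?h powr (p - 1)"
  using q p by (simp add: np_def powr_powr) (simp add: q_def field_simps)
 have "np p ?h powr p = (LBINT x. norm (?h x) * ?k x)"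
  using p by (auto simp: np_powr powr_mult_base intro!: Bochner_Integration.integral_cong)
 also have "... \<le> (LBINT x. norm (f x) * norm (?k x) + norm (g x) * norm (?k x))"
 proof (rule integral_mono)
  show "integrable lborel (\<lambda>x. norm (?h x) * ?k x)" using lp_Holder(1)[OF p q(1,2) h k] by simp
  show "integrable lborel (\<lambda>x. norm (f x) * norm (?k x) + norm (g x) * norm (?k x))"
   using lp_Holder(1)[OF p q(1,2) f k] lp_Holder(1)[OF p q(1,2) g k] by simp
  show "norm (?h x) * ?k x \<le> norm (f x) * norm (?k x) + norm (g x) * norm (?k x)" for x
   using mult_right_mono[OF norm_triangle_ineq[of "f x" "g x"], of "?k x"] by (simp add: distrib_right)
 qed
 also have "... \<le> np p f * np q ?k + np p g * np q ?k"
  using lp_Holder[OF p q(1,2) f k] lp_Holder[OF p q(1,2) g k] by simp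
 also have "... = (np p f + np p g) * np p ?h powr (p - 1)" by (simp add: nk distrib_right)
 finally have "np p ?h * np p ?h powr (p - 1) \<le> (np p f + np p g) * np p ?h powr (p - 1)"
  using powr_mult_base[of "np p ?h" "p - 1"] by simp
 moreover have "np p ?h powr (p - 1) > 0" using False by simp
 ultimately show ?thesis by simp
qed simp

lemmas sq_add = lp_add[of 2, simplified] and sq_diff = lp_diff[of 2, simplified]
lemmas sq_cmult = lp_cmult[of 2, simplified] and n2_cmult = np_cmult[of 2, simplified]
lemmas sq_scaleR = lp_scaleR[of 2, simplified] and n2_scaleR = np_scaleR[of 2, simplified]
lemmas n2_triangle = np_triangle[of 2, simplified]

lemma np_diff_comm: "np p (\<lambda>x. f x - g x) = np p (\<lambda>x. g x - f x)"
 by (simp add: np_def norm_minus_commute)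

lemmas n2_diff_comm = np_diff_comm[of 2, simplified]

lemma np_triangle_diff:
 assumes f: "lp p f" and g: "lp p g" and p: "p > 1"
 shows "\<bar>np p f - np p g\<bar> \<le> np p (\<lambda>x. f x - g x)"
 using np_triangle[OF lp_diff[OF f g] g] np_triangle[OF lp_diff[OF g f] f] p
  np_diff_comm[of p f g] by simp

lemmas n2_triangle_diff = np_triangle_diff[of 2, simplified]

lemma borel_measurable_cnj [measurable (raw)]:
 "f \<in> borel_measurable M \<Longrightarrow> (\<lambda>x. cnj (f x)) \<in> borel_measurable M"
 by (rule measurable_compose[where g=cnj and N=borel])
  (auto intro!: borel_measurable_continuous_onI continuous_intros)

lemma sq_cnj: "sq f \<Longrightarrow> sq (\<lambda>x. cnj (f x))" by (auto simp: sq_def)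
lemma lp_cnj: "lp p f \<Longrightarrow> lp p (\<lambda>x. cnj (f x))" by (auto simp: lp_def)
lemma n2_cnj [simp]: "n2 (\<lambda>x. cnj (f x)) = n2 f" by (simp add: n2_def)
lemma np_cnj [simp]: "np p (\<lambda>x. cnj (f x)) = np p f" by (simp add: np_def)

lemma n2_eq_0_AE:
 assumes "sq f" "n2 f = 0" shows "AE x in lborel. f x = 0"
proof -
 have "(LBINT x. (norm (f x))^2) = 0" using assms n2_square[of f] by simp
 then have "AE x in lborel. (norm (f x))^2 = 0"
  using assms by (subst (asm) integral_nonneg_eq_0_iff_AE) (auto simp: sq_def)
 then show ?thesis by eventually_elim auto
qed

lemma np_cong_AE:
 assumes "AE x in lborel. f x = g x" "f \<in> borel_measurable borel" "g \<in> borel_measurable borel"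
 shows "np p f = np p g"
 unfolding np_def using assms by (subst integral_cong_AE[of _ _ "\<lambda>x. norm (g x) powr p"]) auto

lemmas n2_cong_AE = np_cong_AE[where p = 2, simplified]

lemma sq_nn_integral:
 assumes "f \<in> borel_measurable borel"
 shows "sq f \<longleftrightarrow> (\<integral>\<^sup>+x. ennreal ((norm (f x))^2) \<partial>lborel) < \<infinity>"
 using assms by (auto simp: sq_def integrable_iff_bounded)

lemma n2_nn_integral:
 assumes "sq f"
 shows "(\<integral>\<^sup>+x. ennreal ((norm (f x))^2) \<partial>lborel) = ennreal ((n2 f)^2)"
 using assms by (subst nn_integral_eq_integral) (auto simp: sq_def n2_square)

lemma sq_n2_le_nn:
 assumes "f \<in> borel_measurable borel" "(\<integral>\<^sup>+x. ennreal ((norm (f x))^2) \<partial>lborel) \<le> ennreal (C^2)" "C \<ge> 0"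
 shows "sq f" "n2 f \<le> C"
proof -
 show "sq f" using assms(1,2) by (auto simp: sq_nn_integral intro: le_less_trans)
 then have "(n2 f)^2 \<le> C^2" using assms by (simp add: n2_nn_integral)
 then show "n2 f \<le> C" using assms(3) by (simp add: power2_le_iff_abs_le)
qed

lemma n2_dominated_convergence:
 fixes f :: "nat \<Rightarrow> 'a::euclidean_space \<Rightarrow> 'b::{banach, second_countable_topology}"
 assumes w: "sq w" and f: "\<And>n. f n \<in> borel_measurable borel"
  and lim: "AE x in lborel. (\<lambda>n. f n x) \<longlonglongrightarrow> 0" and bd: "\<And>n x. norm (f n x) \<le> norm (w x)"
 shows "(\<lambda>n. n2 (f n)) \<longlonglongrightarrow> 0"
proof -
 have "(\<lambda>n. LBINT x. (norm (f n x))^2) \<longlonglongrightarrow> (\<integral>x. 0 \<partial>(lborel::'a measure))"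
 proof (rule integral_dominated_convergence)
  show "integrable lborel (\<lambda>x. (norm (w x))^2)" using w by (simp add: sq_def)
  show "AE x in lborel. (\<lambda>n. (norm (f n x))^2) \<longlonglongrightarrow> 0"
   using lim
  proof eventually_elim
   fix x assume "(\<lambda>n. f n x) \<longlonglongrightarrow> 0"
   then have "(\<lambda>n. (norm (f n x))^2) \<longlonglongrightarrow> (norm (0::'b))^2" by (intro tendsto_intros)
   then show "(\<lambda>n. (norm (f n x))^2) \<longlonglongrightarrow> 0" by simp
  qed
  show "AE x in lborel. norm ((norm (f n x))^2) \<le> (norm (w x))^2" for n
   using bd by (auto intro: power_mono)
 qed (use f w in auto)
 then have "(\<lambda>n. sqrt (LBINT x. (norm (f n x))^2)) \<longlonglongrightarrow> sqrt 0"
  by (intro tendsto_real_sqrt) simp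
 then show ?thesis by (simp add: n2_def)
qed

lemma tendsto_zero_le:
 fixes f g :: "_ \<Rightarrow> real"
 assumes "(g \<longlongrightarrow> 0) F" "\<forall>\<^sub>F n in F. f n \<le> g n" "\<And>n. 0 \<le> f n"
 shows "(f \<longlongrightarrow> 0) F"
 using assms by (intro tendsto_sandwich[OF _ assms(2) tendsto_const assms(1)]) auto

section \<open>Continuity of translations\<close>

text \<open>Sequential, so that dominated convergence applies directly. The class is closed under
  L^2 limits and finite sums and grows from indicators of open sets to Borel sets, simple functions
  and all of L^2.\<close>

definition cont_tr :: "('a::euclidean_space \<Rightarrow> complex) \<Rightarrow> bool" where
 "cont_tr f \<longleftrightarrow> sq f \<and> (\<forall>T. T \<longlonglongrightarrow> 0 \<longrightarrow> (\<lambda>n::nat. n2 (\<lambda>x. f (x + T n) - f x)) \<longlonglongrightarrow> 0)"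

lemma n2_triangle3:
 assumes "sq a" "sq b" "sq c"
 shows "n2 (\<lambda>x. a x + b x + c x) \<le> n2 a + n2 b + n2 c"
 using n2_triangle[OF sq_add[OF assms(1,2)] assms(3)] n2_triangle[OF assms(1,2)] by simp

lemma cont_tr_limit:
 assumes f: "sq f" and ap: "\<And>e. e > 0 \<Longrightarrow> \<exists>g. cont_tr g \<and> n2 (\<lambda>x. f x - g x) < e"
 shows "cont_tr f"
 unfolding cont_tr_def
proof (intro conjI allI impI)
 fix T :: "nat \<Rightarrow> 'a" assume T: "T \<longlonglongrightarrow> 0"
 show "(\<lambda>n. n2 (\<lambda>x. f (x + T n) - f x)) \<longlonglongrightarrow> 0"
 proof (rule LIMSEQ_I)
  fix e :: real assume e: "e > 0"
  obtain g where g: "cont_tr g" and fg: "n2 (\<lambda>x. f x - g x) < e / 3" using ap[of "e/3"] e by auto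
  have sg: "sq g" using g by (simp add: cont_tr_def)
  have sd: "sq (\<lambda>x. f x - g x)" using sq_diff[OF f sg] .
  have "(\<lambda>n. n2 (\<lambda>x. g (x + T n) - g x)) \<longlonglongrightarrow> 0" using g T by (simp add: cont_tr_def)
  from LIMSEQ_D[OF this, of "e/3"] e obtain N where N: "\<And>n. n \<ge> N \<Longrightarrow> n2 (\<lambda>x. g (x + T n) - g x) < e/3"
   by auto
  have "norm (n2 (\<lambda>x. f (x + T n) - f x) - 0) < e" if "n \<ge> N" for n
  proof -
   have "n2 (\<lambda>x. f (x + T n) - f x) =
     n2 (\<lambda>x. (f (x + T n) - g (x + T n)) + (g (x + T n) - g x) + (g x - f x))"
    by (rule arg_cong[where f=n2]) (auto simp: fun_eq_iff)
   also have "... \<le> n2 (\<lambda>x. f (x + T n) - g (x + T n)) + n2 (\<lambda>x. g (x + T n) - g x) + n2 (\<lambda>x. g x - f x)"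
    by (intro n2_triangle3 sq_diff sq_translate f sg)
   also have "n2 (\<lambda>x. f (x + T n) - g (x + T n)) = n2 (\<lambda>x. f x - g x)"
    using n2_translate[OF sd] .
   also have "n2 (\<lambda>x. g x - f x) = n2 (\<lambda>x. f x - g x)" by (rule n2_diff_comm)
   finally show ?thesis using N[OF that] fg by simp
  qed
  then show "\<exists>no. \<forall>n\<ge>no. norm (n2 (\<lambda>x. f (x + T n) - f x) - 0) < e" by blast
 qed
qed (rule f)

lemma cont_tr_add:
 assumes "cont_tr f" "cont_tr g" shows "cont_tr (\<lambda>x. f x + g x)"
 unfolding cont_tr_def
proof (intro conjI allI impI)
 have s: "sq f" "sq g" using assms by (auto simp: cont_tr_def)
 then show "sq (\<lambda>x. f x + g x)" by (rule sq_add)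
 fix T :: "nat \<Rightarrow> 'a" assume T: "T \<longlonglongrightarrow> 0"
 show "(\<lambda>n. n2 (\<lambda>x. f (x + T n) + g (x + T n) - (f x + g x))) \<longlonglongrightarrow> 0"
 proof (rule tendsto_zero_le)
  show "(\<lambda>n. n2 (\<lambda>x. f (x + T n) - f x) + n2 (\<lambda>x. g (x + T n) - g x)) \<longlonglongrightarrow> 0"
   using assms T by (auto simp: cont_tr_def intro!: tendsto_add_zero)
  have "n2 (\<lambda>x. f (x + T n) + g (x + T n) - (f x + g x)) =
    n2 (\<lambda>x. (f (x + T n) - f x) + (g (x + T n) - g x))" for n
   by (rule arg_cong[where f=n2]) (auto simp: fun_eq_iff)
  then show "\<forall>\<^sub>F n in sequentially. n2 (\<lambda>x. f (x + T n) + g (x + T n) - (f x + g x))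
    \<le> n2 (\<lambda>x. f (x + T n) - f x) + n2 (\<lambda>x. g (x + T n) - g x)"
   using n2_triangle[OF sq_diff sq_diff] s by (auto intro!: always_eventually sq_translate n2_triangle sq_diff)
 qed simp
qed

lemma cont_tr_sum:
 "finite I \<Longrightarrow> (\<And>i. i \<in> I \<Longrightarrow> cont_tr (f i)) \<Longrightarrow> cont_tr (\<lambda>x. \<Sum>i\<in>I. f i x)"
proof (induction I rule: finite_induct)
 case empty
 then show ?case by (simp add: cont_tr_def sq_def n2_def)
next
 case (insert i I)
 then show ?case by (simp add: cont_tr_add)
qed

lemma sq_indicator:
 assumes "A \<in> sets borel" "emeasure lborel A < \<infinity>"
 shows "sq (\<lambda>x. indicator A x * (c::complex))"
  and "(n2 (\<lambda>x. indicator A x * (c::complex)))^2 = (cmod c)^2 * measure lborel A"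
proof -
 have *: "(cmod (indicator A x * c))^2 = indicator A x * (cmod c)^2" for x
  by (auto simp: indicator_def)
 show "sq (\<lambda>x. indicator A x * c)"
  using assms by (auto simp: sq_def *)
 show "(n2 (\<lambda>x. indicator A x * c))^2 = (cmod c)^2 * measure lborel A"
  using assms unfolding n2_square * by simp
qed

text \<open>Expanding the square leaves the measure of U and that of its intersection with a
  translate. In the product of indicators only points x of U count, and for these x + T n is
  eventually in U by openness.\<close>

lemma cont_tr_indicator_open:
 fixes c :: complex
 assumes U: "open U" "emeasure lborel U < \<infinity>"
 shows "cont_tr (\<lambda>x. indicator U x * c)"
 unfolding cont_tr_def
proof (intro conjI allI impI)
 have Ub[measurable]: "U \<in> sets borel" using U by simp
 show "sq (\<lambda>x. indicator U x * c)" by (rule sq_indicator) (use U in auto)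
 fix T :: "nat \<Rightarrow> 'a" assume T: "T \<longlonglongrightarrow> 0"
 let ?I = "\<lambda>x. indicator U x :: real"
 have iU: "integrable lborel ?I" using U by simp
 have iT: "integrable lborel (\<lambda>x. ?I (x + t))" for t
  by (subst lborel_integrable_translate_iff) (use iU in auto)
 have prod: "(\<lambda>n. LBINT x. ?I x * ?I (x + T n)) \<longlonglongrightarrow> (LBINT x. ?I x)"
 proof (rule integral_dominated_convergence[OF _ _ iU])
  show "AE x in lborel. (\<lambda>n. ?I x * ?I (x + T n)) \<longlonglongrightarrow> ?I x"
  proof (rule AE_I2)
   fix x
   show "(\<lambda>n. ?I x * ?I (x + T n)) \<longlonglongrightarrow> ?I x"
   proof (cases "x \<in> U")
    case True
    have "(\<lambda>n. x + T n) \<longlonglongrightarrow> x + 0" by (intro tendsto_intros T)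
    then have "\<forall>\<^sub>F n in sequentially. x + T n \<in> U"
     using topological_tendstoD[OF _ U(1)] True by simp
    then have "\<forall>\<^sub>F n in sequentially. ?I x * ?I (x + T n) = ?I x"
     by eventually_elim (use True in simp)
    then show ?thesis by (rule tendsto_eventually)
   qed simp
  qed
 qed (auto simp: indicator_def)
 have eq: "(n2 (\<lambda>x. indicator U (x + T n) * c - indicator U x * c))^2 =
   (cmod c)^2 * (2 * (LBINT x. ?I x) - 2 * (LBINT x. ?I x * ?I (x + T n)))" for n
 proof -
  have ip: "integrable lborel (\<lambda>x. ?I x * ?I (x + T n))"
   by (rule integrable_dominated[OF iU]) (auto simp: indicator_def)
  have "(n2 (\<lambda>x. indicator U (x + T n) * c - indicator U x * c))^2 =
    (LBINT x. (cmod c)^2 * (?I (x + T n) + ?I x - 2 * (?I x * ?I (x + T n))))"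
   unfolding n2_square by (intro Bochner_Integration.integral_cong) (auto simp: indicator_def)
  also have "... = (cmod c)^2 * ((LBINT x. ?I (x + T n)) + (LBINT x. ?I x) - 2 * (LBINT x. ?I x * ?I (x + T n)))"
   using iU iT[of "T n"] ip by simp
  also have "(LBINT x. ?I (x + T n)) = (LBINT x. ?I x)"
   by (rule lborel_integral_translate) simp
  finally show ?thesis by simp
 qed
 have "(\<lambda>n. (cmod c)^2 * (2 * (LBINT x. ?I x) - 2 * (LBINT x. ?I x * ?I (x + T n))))
   \<longlonglongrightarrow> (cmod c)^2 * (2 * (LBINT x. ?I x) - 2 * (LBINT x. ?I x))"
  by (intro tendsto_intros prod)
 then have "(\<lambda>n. sqrt ((n2 (\<lambda>x. indicator U (x + T n) * c - indicator U x * c))^2)) \<longlonglongrightarrow> sqrt 0"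
  unfolding eq by (intro tendsto_real_sqrt) simp
 then show "(\<lambda>n. n2 (\<lambda>x. indicator U (x + T n) * c - indicator U x * c)) \<longlonglongrightarrow> 0" by simp
qed

text \<open>Outer regularity replaces A by an open superset at a small cost in L^2.\<close>

lemma cont_tr_indicator:
 fixes c :: complex
 assumes A: "A \<in> sets borel" "emeasure lborel A < \<infinity>"
 shows "cont_tr (\<lambda>x. indicator A x * c)"
proof (rule cont_tr_limit)
 show "sq (\<lambda>x. indicator A x * c)" using A by (rule sq_indicator)
 fix e :: real assume e: "e > 0"
 \<comment> \<open>Chosen such that |c|^2 d < e^2; the added 1 covers c = 0.\<close>
 define d where "d = (e / (1 + cmod c))^2"
 have c1: "1 + cmod c > 0" by (simp add: add_pos_nonneg)
 have d: "d > 0" using e c1 by (simp add: d_def)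
 obtain U where U: "open U" "A \<subseteq> U" "emeasure lborel (U - A) < ennreal d"
  using outer_regular_lborel[OF A(1) d] by blast
 have UA: "U - A \<in> sets borel" using U A by auto
 have fin: "emeasure lborel (U - A) < \<infinity>" using U(3) by (rule less_le_trans) simp
 have "emeasure lborel U = emeasure lborel A + emeasure lborel (U - A)"
  using U A UA by (subst plus_emeasure) (auto simp: Un_absorb1)
 then have fU: "emeasure lborel U < \<infinity>" using A fin by simp
 have "(n2 (\<lambda>x. indicator A x * c - indicator U x * c))^2 = (n2 (\<lambda>x. indicator (U - A) x * (c::complex)))^2"
  unfolding n2_square using U(2) by (intro Bochner_Integration.integral_cong) (auto simp: indicator_def)
 also have "... = (cmod c)^2 * measure lborel (U - A)" using sq_indicator(2)[OF UA fin] .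
 also have "... \<le> (cmod c)^2 * d"
  using U(3) d fin by (intro mult_left_mono) (auto simp: measure_def enn2real_leI less_imp_le)
 also have "... = (cmod c / (1 + cmod c) * e)^2" by (simp add: d_def power_mult_distrib power_divide)
 also have "... < e^2"
  using c1 e by (intro power_strict_mono) (auto simp: field_simps)
 finally have "n2 (\<lambda>x. indicator A x * c - indicator U x * c) < e"
  using e by (simp add: power_less_imp_less_base)
 then show "\<exists>g. cont_tr g \<and> n2 (\<lambda>x. indicator A x * c - g x) < e"
  using cont_tr_indicator_open[OF U(1) fU] by blast
qed

lemma sq_cont_tr:
 assumes f: "sq f" shows "cont_tr f"
proof (rule cont_tr_limit[OF f])
 have fb[measurable]: "f \<in> borel_measurable lborel" using f by (simp add: sq_def)
 obtain s where s: "\<And>i. simple_function lborel (s i)" "\<And>x. (\<lambda>i. s i x) \<longlonglongrightarrow> f x"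
  "\<And>i x. norm (s i x) \<le> 2 * norm (f x)"
  using borel_measurable_implies_sequence_metric[OF fb, of 0] by (auto simp: dist_norm)
 have sb: "s i \<in> borel_measurable borel" for i using borel_measurable_simple_function[OF s(1)] by simp
 have ss: "sq (s i)" for i by (rule sq_bound(1)[OF f sb s(3)]) simp
 have ct: "cont_tr (s i)" for i
 proof -
  let ?A = "\<lambda>c. s i -` {c}"
  have fin: "finite (range (s i))" using s(1)[of i] by (simp add: simple_function_def)
  have A: "?A c \<in> sets borel" for c using sb[of i] by (auto intro: measurable_sets_borel)
  \<comment> \<open>The level set of 0 may have infinite measure, but its summand vanishes; the
    other level sets are finite by Chebyshev's inequality.\<close>
  have "cont_tr (\<lambda>x. indicator (?A c) x * c)" for c
  proof (cases "c = 0")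
   case False
   have "emeasure lborel (?A c) < \<infinity>"
   proof -
    have "ennreal ((cmod c)^2) * emeasure lborel (?A c) = (\<integral>\<^sup>+x. ennreal ((cmod c)^2) * indicator (?A c) x \<partial>lborel)"
     using A by (simp add: nn_integral_cmult_indicator)
    also have "... \<le> (\<integral>\<^sup>+x. ennreal ((cmod (s i x))^2) \<partial>lborel)"
     by (intro nn_integral_mono) (auto simp: indicator_def)
    also have "... < \<infinity>" using ss sq_nn_integral[OF sb] by blast
    finally show ?thesis using False by (auto simp: ennreal_mult_less_top)
   qed
   then show ?thesis using A by (intro cont_tr_indicator)
  qed (simp add: cont_tr_def sq_def n2_def)
  then have "cont_tr (\<lambda>x. \<Sum>c\<in>range (s i). indicator (?A c) x * c)"
   using fin by (intro cont_tr_sum)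
  also have "(\<lambda>x. \<Sum>c\<in>range (s i). indicator (?A c) x * c) = s i"
  proof
   fix x
   have "(\<Sum>c\<in>range (s i). indicator (?A c) x * c) = (\<Sum>c\<in>range (s i). if c = s i x then c else 0)"
    by (intro sum.cong) (auto simp: indicator_def)
   also have "... = s i x" using fin by simp
   finally show "(\<Sum>c\<in>range (s i). indicator (?A c) x * c) = s i x" .
  qed
  finally show ?thesis .
 qed
 have "(\<lambda>i. n2 (\<lambda>x. f x - s i x)) \<longlonglongrightarrow> 0"
 proof (rule n2_dominated_convergence)
  show "sq (\<lambda>x. 3 * f x)" using f by (rule sq_cmult)
  show "(\<lambda>x. f x - s i x) \<in> borel_measurable borel" for i using sb f by simp
  have "(\<lambda>i. f x - s i x) \<longlonglongrightarrow> f x - f x" for x by (intro tendsto_intros s)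
  then show "AE x in lborel. (\<lambda>i. f x - s i x) \<longlonglongrightarrow> 0" by simp
  show "norm (f x - s i x) \<le> norm (3 * f x)" for i x
   using norm_triangle_ineq4[of "f x" "s i x"] s(3)[of i x] by (simp add: norm_mult)
 qed
 then show "\<exists>g. cont_tr g \<and> n2 (\<lambda>x. f x - g x) < e" if "e > 0" for e
  using ct LIMSEQ_D[of _ 0 e] that by fastforce
qed

lemma n2_translate_tendsto:
 fixes f :: "'a::euclidean_space \<Rightarrow> complex"
 assumes "sq f" shows "((\<lambda>t. n2 (\<lambda>x. f (x + t) - f x)) \<longlongrightarrow> 0) (at 0)"
 unfolding tendsto_at_iff_sequentially comp_def
 using sq_cont_tr[OF assms] by (auto simp: cont_tr_def)

text \<open>By translation invariance the pair of shifts (s, t) may be replaced by (s - t, 0), so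
  continuity at 0 gives continuity everywhere.\<close>

lemma n2_translate_lipschitz:
 fixes f :: "'a::euclidean_space \<Rightarrow> complex"
 assumes f: "sq f"
 shows "\<bar>n2 (\<lambda>x. f (x + s) - f x) - n2 (\<lambda>x. f (x + t) - f x)\<bar> \<le> n2 (\<lambda>x. f (x + (s - t)) - f x)"
proof -
 have "\<bar>n2 (\<lambda>x. f (x + s) - f x) - n2 (\<lambda>x. f (x + t) - f x)\<bar> \<le>
   n2 (\<lambda>x. (f (x + s) - f x) - (f (x + t) - f x))"
  by (intro n2_triangle_diff sq_diff sq_translate f)
 also have "... = n2 (\<lambda>x. f (x + s) - f (x + t))" by simp
 also have "... = n2 (\<lambda>x. f (x + (s - t)) - f x)"
  using n2_translate[OF sq_diff[OF sq_translate[OF f, of "s - t"] f], of t]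
  by (simp add: algebra_simps)
 finally show ?thesis .
qed

lemma n2_translate_bound:
 fixes f :: "'a::euclidean_space \<Rightarrow> complex"
 assumes f: "sq f" shows "n2 (\<lambda>x. f (x + t) - f x) \<le> 2 * n2 f"
 using n2_triangle[OF sq_translate[OF f, of t] sq_scaleR[OF f, of "-1"]] n2_translate[OF f, of t]
  n2_scaleR[of "-1" f] by simp

lemma continuous_n2_translate:
 fixes f :: "'a::euclidean_space \<Rightarrow> complex"
 assumes f: "sq f" shows "continuous_on UNIV (\<lambda>t. n2 (\<lambda>x. f (x + t) - f x))"
 unfolding continuous_on_def
proof
 fix t
 let ?N = "\<lambda>t. n2 (\<lambda>x. f (x + t) - f x)"
 have "((\<lambda>s. ?N (s - t)) \<longlongrightarrow> 0) (at t)"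
  using n2_translate_tendsto[OF f] by (subst LIM_offset_zero_iff) auto
 then have "((\<lambda>s. ?N s - ?N t) \<longlongrightarrow> 0) (at t)"
  by (rule Lim_null_comparison[rotated]) (use n2_translate_lipschitz[OF f] in auto)
 then show "(?N \<longlongrightarrow> ?N t) (at t)" by (simp add: LIM_zero_iff)
qed

section \<open>Convolution\<close>

text \<open>Kernels are bounded, so that convolutions are defined everywhere.\<close>

definition ker :: "('a::euclidean_space \<Rightarrow> complex) \<Rightarrow> bool" where
 "ker k \<longleftrightarrow> k \<in> borel_measurable borel \<and> integrable lborel k \<and> (\<exists>C. \<forall>x. cmod (k x) \<le> C)"

definition n1 :: "('a::euclidean_space \<Rightarrow> complex) \<Rightarrow> real" where
 "n1 k = (LBINT x. cmod (k x))"

definition conv :: "('a::euclidean_space \<Rightarrow> complex) \<Rightarrow> ('a \<Rightarrow> complex) \<Rightarrow> 'a \<Rightarrow> complex" where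
 "conv k f x = (LBINT y. k y * f (x - y))"

lemma ker_measurable [measurable_dest]: "ker k \<Longrightarrow> k \<in> borel_measurable borel"
 by (simp add: ker_def)

lemma n1_nonneg [simp]: "0 \<le> n1 k" by (simp add: n1_def)

lemma ker_sq: assumes "ker k" shows "sq k"
proof -
 obtain C where C: "\<And>x. cmod (k x) \<le> C" using assms by (auto simp: ker_def)
 have "integrable lborel (\<lambda>x. (cmod (k x))^2)"
 proof (rule integrable_dominated)
  show "integrable lborel (\<lambda>x. C * cmod (k x))" using assms by (simp add: ker_def)
  show "norm ((cmod (k x))^2) \<le> C * cmod (k x)" for x
   using mult_right_mono[OF C[of x] norm_ge_zero[of "k x"]] by (simp add: power2_eq_square)
 qed (use assms in measurable)
 then show ?thesis using assms by (simp add: sq_def ker_def)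
qed

lemma sq_reflect:
 assumes "sq f" shows "sq (\<lambda>y. f (x - y))"
proof -
 note [measurable] = assms[THEN sq_measurable]
 show "sq (\<lambda>y. f (x - y))"
  using assms lborel_integrable_affine_iff[of "\<lambda>y. (norm (f y))^2" "-1" x] by (simp add: sq_def)
qed

lemma conv_integrable: "ker k \<Longrightarrow> sq f \<Longrightarrow> integrable lborel (\<lambda>y. k y * f (x - y))"
 by (rule sq_CS(1)[OF ker_sq sq_reflect])

lemma conv_measurable [measurable (raw)]:
 assumes [measurable]: "k \<in> borel_measurable borel" "f \<in> borel_measurable borel"
 shows "conv k f \<in> borel_measurable borel"
proof -
 have "(\<lambda>x. LBINT y. k y * f (x - y)) \<in> borel_measurable lborel" by measurable
 then show ?thesis by (simp add: conv_def[abs_def])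
qed

text \<open>Cauchy-Schwarz after splitting |k| into two square roots, then Tonelli. With extended
  nonnegative integrals it covers both convolutions and averages of translates along a
  segment.\<close>

lemma kernel_Jensen:
 fixes k :: "'a::euclidean_space \<Rightarrow> complex" and F :: "'b::euclidean_space \<Rightarrow> 'a \<Rightarrow> complex"
 assumes [measurable]: "k \<in> borel_measurable borel"
  "(\<lambda>(x, y). F x y) \<in> borel_measurable (borel \<Otimes>\<^sub>M borel)"
 shows "(\<integral>\<^sup>+x. ennreal ((cmod (LBINT y. k y * F x y))^2) \<partial>lborel) \<le>
  (\<integral>\<^sup>+y. ennreal (cmod (k y)) \<partial>lborel) *
  (\<integral>\<^sup>+y. ennreal (cmod (k y)) * (\<integral>\<^sup>+x. ennreal ((cmod (F x y))^2) \<partial>lborel) \<partial>lborel)"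
proof -
 let ?A = "\<integral>\<^sup>+y. ennreal (cmod (k y)) \<partial>lborel"
 let ?B = "\<lambda>x. \<integral>\<^sup>+y. ennreal (cmod (k y)) * ennreal ((cmod (F x y))^2) \<partial>lborel" and ?f = "\<lambda>x. cmod (LBINT y. k y * F x y)" and ?s = "\<lambda>y. sqrt (cmod (k y))"
 have pt: "ennreal ((?f x)^2) \<le>
   ?A * ?B x" for x
 \<comment> \<open>A nonintegrable inner integral has the default value 0, so only the integrable
   case needs an estimate.\<close>
 proof (cases "integrable lborel (\<lambda>y. k y * F x y)")
  case True
  have "ennreal (?f x) \<le> (\<integral>\<^sup>+y. ennreal (cmod (k y * F x y)) \<partial>lborel)"
   by (rule integral_norm_bound_ennreal[OF True])
  also have "... = (\<integral>\<^sup>+y. ennreal (?s y) * ennreal (?s y * cmod (F x y)) \<partial>lborel)"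
   by (intro nn_integral_cong) (simp flip: ennreal_mult' add: norm_mult)
  finally have "(ennreal (?f x))^2 \<le>
    (\<integral>\<^sup>+y. ennreal (?s y) * ennreal (?s y * cmod (F x y)) \<partial>lborel)^2"
   by (rule power_mono) simp
  also have "... \<le> (\<integral>\<^sup>+y. (ennreal (?s y))^2 \<partial>lborel) *
    (\<integral>\<^sup>+y. (ennreal (?s y * cmod (F x y)))^2 \<partial>lborel)"
   by (rule Cauchy_Schwarz_nn_integral) measurable
  also have "(\<integral>\<^sup>+y. (ennreal (?s y))^2 \<partial>lborel) = ?A"
   by (intro nn_integral_cong) (simp add: ennreal_power)
  also have "(\<integral>\<^sup>+y. (ennreal (?s y * cmod (F x y)))^2 \<partial>lborel) =
    ?B x"
   by (intro nn_integral_cong) (simp add: ennreal_power power_mult_distrib flip: ennreal_mult')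
  finally show ?thesis by (simp add: ennreal_power)
 qed (simp add: not_integrable_integral_eq)
 have "(\<integral>\<^sup>+x. ennreal ((?f x)^2) \<partial>lborel) \<le>
   (\<integral>\<^sup>+x. ?A * ?B x \<partial>lborel)"
  by (intro nn_integral_mono pt)
 also have "... = ?A * (\<integral>\<^sup>+x. ?B x \<partial>lborel)"
  by (rule nn_integral_cmult) measurable
 also have "(\<integral>\<^sup>+x. ?B x \<partial>lborel) =
   (\<integral>\<^sup>+y. (\<integral>\<^sup>+x. ennreal (cmod (k y)) * ennreal ((cmod (F x y))^2) \<partial>lborel) \<partial>lborel)"
  by (rule lborel_pair.Fubini') measurable
 also have "... = (\<integral>\<^sup>+y. ennreal (cmod (k y)) * (\<integral>\<^sup>+x. ennreal ((cmod (F x y))^2) \<partial>lborel) \<partial>lborel)"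
  by (intro nn_integral_cong nn_integral_cmult) measurable
 finally show ?thesis .
qed

lemma n1_nn: "ker k \<Longrightarrow> (\<integral>\<^sup>+y. ennreal (cmod (k y)) \<partial>lborel) = ennreal (n1 k)"
 unfolding n1_def by (subst nn_integral_eq_integral) (auto simp: ker_def)

lemma conv_sq:
 assumes k: "ker k" and f: "sq f"
 shows "sq (conv k f)" "n2 (conv k f) \<le> n1 k * n2 f"
proof -
 have [measurable]: "k \<in> borel_measurable borel" "f \<in> borel_measurable borel"
  using k f by (auto simp: ker_def sq_def)
 have tr: "(\<integral>\<^sup>+x. ennreal ((cmod (f (x - y)))^2) \<partial>lborel) = ennreal ((n2 f)^2)" for y
  using lborel_nn_integral_translate[of "\<lambda>x. ennreal ((cmod (f x))^2)" "-y"] n2_nn_integral[OF f] by simp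
 have "(\<integral>\<^sup>+x. ennreal ((cmod (conv k f x))^2) \<partial>lborel) \<le> ennreal (n1 k) *
  (\<integral>\<^sup>+y. ennreal (cmod (k y)) * (\<integral>\<^sup>+x. ennreal ((cmod (f (x - y)))^2) \<partial>lborel) \<partial>lborel)"
  unfolding conv_def n1_nn[OF k, symmetric] by (rule kernel_Jensen) measurable
 also have "... = ennreal ((n1 k * n2 f)^2)"
 proof -
  have "(\<integral>\<^sup>+y. ennreal (cmod (k y)) * ennreal ((n2 f)^2) \<partial>lborel) = ennreal (n1 k) * ennreal ((n2 f)^2)"
   by (simp add: nn_integral_multc n1_nn[OF k])
  also have "ennreal (n1 k) * ... = ennreal (n1 k * (n1 k * (n2 f)^2))"
   by (simp add: ennreal_mult)
  finally show ?thesis unfolding tr by (simp add: power2_eq_square ac_simps)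
 qed
 finally show "sq (conv k f)" "n2 (conv k f) \<le> n1 k * n2 f"
  by (auto intro!: sq_n2_le_nn)
qed

lemma conv_diff_right:
 assumes "ker k" "sq f" "sq g" shows "conv k (\<lambda>x. f x - g x) x = conv k f x - conv k g x"
 unfolding conv_def using conv_integrable[OF assms(1,2), of x] conv_integrable[OF assms(1,3), of x]
 by (simp add: right_diff_distrib)

lemma conv_cmult_right: "conv k (\<lambda>x. c * f x) x = c * conv k f x"
 unfolding conv_def by (simp add: mult.left_commute)

lemma conv_cmult_left: "conv (\<lambda>x. c * k x) f x = c * conv k f x"
 unfolding conv_def by (simp add: mult.assoc)

lemma conv_diff_left:
 assumes "ker k" "ker l" "sq f" shows "conv (\<lambda>x. k x - l x) f x = conv k f x - conv l f x"
 unfolding conv_def using conv_integrable[OF assms(1,3), of x] conv_integrable[OF assms(2,3), of x]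
 by (simp add: left_diff_distrib)

lemma conv_translate: "conv k (\<lambda>x. f (x + t)) x = conv k f (x + t)"
 by (simp add: conv_def algebra_simps)

lemma ker_diff: "ker k \<Longrightarrow> ker l \<Longrightarrow> ker (\<lambda>x. k x - l x)"
 unfolding ker_def by (auto intro!: exI norm_triangle_le_diff add_mono)

lemma ker_cmult: "ker k \<Longrightarrow> ker (\<lambda>x. c * k x)"
 unfolding ker_def by (auto simp: norm_mult intro!: exI mult_left_mono)

lemma conv_sum_left:
 assumes "finite I" "\<And>i. i \<in> I \<Longrightarrow> ker (k i)" "sq f"
 shows "conv (\<lambda>x. \<Sum>i\<in>I. k i x) f x = (\<Sum>i\<in>I. conv (k i) f x)"
 unfolding conv_def sum_distrib_right
 by (rule Bochner_Integration.integral_sum) (use assms conv_integrable in auto)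

text \<open>Fubini's theorem for a family bounded in L^2 uniformly in y: Cauchy-Schwarz in x leaves
  a multiple of |k|. The parameter y may range over another space, such as the interval of a
  difference quotient.\<close>

lemma kernel_pairing:
 fixes k :: "'b::euclidean_space \<Rightarrow> complex" and F :: "'a::euclidean_space \<Rightarrow> 'b \<Rightarrow> complex"
 assumes k: "integrable lborel k"
  and F[measurable]: "(\<lambda>(x, y). F x y) \<in> borel_measurable (borel \<Otimes>\<^sub>M borel)"
  and sqF: "\<And>y. sq (\<lambda>x. F x y)" "\<And>y. n2 (\<lambda>x. F x y) \<le> C" and g: "sq g"
 shows "integrable lborel (\<lambda>y. k y * (LBINT x. F x y * g x))"
  and "(LBINT x. (LBINT y. k y * F x y) * g x) = (LBINT y. k y * (LBINT x. F x y * g x))"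
proof -
 have [measurable]: "k \<in> borel_measurable borel" "g \<in> borel_measurable borel"
  using k g by (auto simp: sq_def)
 let ?H = "\<lambda>(y, x). k y * F x y * g x"
 have B: "(LBINT x. norm (?H (y, x))) = cmod (k y) * (LBINT x. cmod (F x y) * cmod (g x))" for y
  by (simp add: norm_mult mult.assoc)
 have I: "integrable (lborel \<Otimes>\<^sub>M lborel) ?H"
 proof (rule lborel_pair.Fubini_integrable)
  show "integrable lborel (\<lambda>y. LBINT x. norm (?H (y, x)))"
  proof (rule integrable_dominated)
   show "integrable lborel (\<lambda>y. cmod (k y) * (C * n2 g))" using k by auto
   show "norm (LBINT x. norm (?H (y, x))) \<le> cmod (k y) * (C * n2 g)" for y
   proof -
    have "(LBINT x. cmod (F x y) * cmod (g x)) \<le> C * n2 g"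
     using sq_CS_norm(2)[OF sqF(1) g, of y] mult_right_mono[OF sqF(2)[of y] n2_nonneg[of g]] by simp
    then show ?thesis unfolding B by (simp add: abs_mult mult_left_mono)
   qed
  qed measurable
  show "AE y in lborel. integrable lborel (\<lambda>x. ?H (y, x))"
   using sq_CS(1)[OF sqF(1) g] by (auto simp: mult.assoc)
 qed measurable
 have eq: "k y * (LBINT x. F x y * g x) = (LBINT x. ?H (y, x))" for y
  by (simp add: mult.assoc)
 show "integrable lborel (\<lambda>y. k y * (LBINT x. F x y * g x))"
  unfolding eq using lborel_pair.integrable_fst'[OF I] .
 have "(LBINT x. (LBINT y. k y * F x y) * g x) = (LBINT x. (LBINT y. ?H (y, x)))"
  by (intro Bochner_Integration.integral_cong) auto
 also have "... = (LBINT y. (LBINT x. ?H (y, x)))"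
  by (rule lborel_pair.Fubini_integral) (use I in \<open>simp add: case_prod_beta\<close>)
 finally show "(LBINT x. (LBINT y. k y * F x y) * g x) = (LBINT y. k y * (LBINT x. F x y * g x))"
  unfolding eq .
qed

lemma conv_pairing:
 assumes k: "ker k" and f: "sq f" and g: "sq g"
 shows "(LBINT x. conv k f x * g x) = (LBINT y. k y * (LBINT x. f (x - y) * g x))"
proof -
 note [measurable] = f[THEN sq_measurable]
 have ik: "integrable lborel k" using k by (simp add: ker_def)
 have sqf: "sq (\<lambda>x. f (x - y))" "n2 (\<lambda>x. f (x - y)) \<le> n2 f" for y
  using sq_translate[OF f, of "-y"] n2_translate[OF f, of "-y"] by simp_all
 have m: "(\<lambda>(x, y). f (x - y)) \<in> borel_measurable (borel \<Otimes>\<^sub>M borel)" by measurable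
 show "(LBINT x. conv k f x * g x) = (LBINT y. k y * (LBINT x. f (x - y) * g x))"
  unfolding conv_def by (rule kernel_pairing(2)[OF ik m sqf g])
qed

lemma conv_adjoint:
 assumes k: "ker k" and f: "sq f" and g: "sq g" and even: "\<And>x. k (- x) = k x"
 shows "(LBINT x. conv k f x * g x) = (LBINT x. f x * conv k g x)"
proof -
 have [measurable]: "k \<in> borel_measurable borel" "f \<in> borel_measurable borel" "g \<in> borel_measurable borel"
  using k f g by (auto simp: ker_def sq_def)
 have *: "(LBINT x. f (x - y) * g x) = (LBINT x. f x * g (x + y))" for y
  using lborel_integral_translate[of "\<lambda>x. f (x - y) * g x" y] by simp
 have "(LBINT x. conv k f x * g x) = (LBINT y. k y * (LBINT x. g (x + y) * f x))"
  unfolding conv_pairing[OF k f g] * by (simp add: mult.commute)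
 also have "... = (LBINT y. k (- y) * (LBINT x. g (x + (- y)) * f x))"
  by (subst lborel_integral_affine[of _ "-1" 0]) simp_all
 also have "... = (LBINT x. conv k g x * f x)"
  unfolding conv_pairing[OF k g f] even by simp
 finally show ?thesis by (simp add: mult.commute)
qed

text \<open>As k has mass 1, f (x) is itself an average over y, so the difference is an average of
  translation differences and Jensen's inequality applies. The quantitative form is needed again for
  the heat kernel on H^1.\<close>

lemma conv_minus_self_bound:
 fixes k :: "'a::euclidean_space \<Rightarrow> real"
 assumes k: "ker (\<lambda>x. complex_of_real (k x))" "\<And>x. k x \<ge> 0" "(LBINT x. k x) = 1" and f: "sq f"
 shows "integrable lborel (\<lambda>y. k y * (n2 (\<lambda>x. f (x - y) - f x))^2)"
  and "(n2 (\<lambda>x. conv (\<lambda>x. complex_of_real (k x)) f x - f x))^2 \<le> (LBINT y. k y * (n2 (\<lambda>x. f (x - y) - f x))^2)"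
proof -
 let ?k = "\<lambda>x. complex_of_real (k x)"
 let ?n = "\<lambda>y. n2 (\<lambda>x. f (x - y) - f x)"
 note [measurable] = f[THEN sq_measurable]
 note [measurable] = k
 have "(\<lambda>x. Re (?k x)) \<in> borel_measurable borel" by measurable
 then have km[measurable]: "k \<in> borel_measurable borel" by simp
 have ik: "integrable lborel k" using k(1) by (simp add: ker_def complex_of_real_integrable_eq)
 have cnt: "continuous_on UNIV (\<lambda>y. ?n y)"
  using continuous_on_compose2[OF continuous_n2_translate[OF f], of UNIV uminus]
  by (simp add: continuous_intros)
 then have [measurable]: "(\<lambda>y. ?n y) \<in> borel_measurable borel"
  by (rule borel_measurable_continuous_onI)
 have bd: "?n y \<le> 2 * n2 f" for y using n2_translate_bound[OF f, of "-y"] by simp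
 show I: "integrable lborel (\<lambda>y. k y * (?n y)^2)"
 proof (rule integrable_dominated)
  show "integrable lborel (\<lambda>y. k y * (2 * n2 f)^2)" using ik by simp
  show "norm (k y * (?n y)^2) \<le> k y * (2 * n2 f)^2" for y
   using k(2)[of y] power_mono[OF bd[of y], of 2] by (simp only: real_norm_def abs_mult abs_of_nonneg zero_le_power2 n2_nonneg mult_left_mono)
 qed measurable
 have sd: "sq (\<lambda>x. f (x - y) - f x)" for y
  using sq_diff[OF sq_translate[OF f, of "-y"] f] by simp
 have eq: "conv ?k f x - f x = (LBINT y. ?k y * (f (x - y) - f x))" for x
 proof -
  have "(LBINT y. ?k y * (f (x - y) - f x)) = conv ?k f x - (LBINT y. ?k y * f x)"
   unfolding conv_def right_diff_distrib
   using conv_integrable[OF k(1) f, of x] k(1) by (subst Bochner_Integration.integral_diff) (auto simp: ker_def)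
  also have "(LBINT y. ?k y * f x) = f x" using k(3) by simp
  finally show ?thesis by simp
 qed
 have "(\<integral>\<^sup>+x. ennreal ((cmod (conv ?k f x - f x))^2) \<partial>lborel) \<le>
  (\<integral>\<^sup>+y. ennreal (cmod (?k y)) \<partial>lborel) *
  (\<integral>\<^sup>+y. ennreal (cmod (?k y)) * (\<integral>\<^sup>+x. ennreal ((cmod (f (x - y) - f x))^2) \<partial>lborel) \<partial>lborel)"
  unfolding eq by (rule kernel_Jensen) measurable
 also have "(\<integral>\<^sup>+y. ennreal (cmod (?k y)) \<partial>lborel) = 1"
  unfolding n1_nn[OF k(1)] n1_def using k by simp
 also have "(\<integral>\<^sup>+y. ennreal (cmod (?k y)) * (\<integral>\<^sup>+x. ennreal ((cmod (f (x - y) - f x))^2) \<partial>lborel) \<partial>lborel) =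
   (\<integral>\<^sup>+y. ennreal (k y * (?n y)^2) \<partial>lborel)"
  unfolding n2_nn_integral[OF sd] using k(2) by (simp add: ennreal_mult')
 also have "... = ennreal (LBINT y. k y * (?n y)^2)"
  by (rule nn_integral_eq_integral[OF I]) (use k in auto)
 finally have le: "(\<integral>\<^sup>+x. ennreal ((cmod (conv ?k f x - f x))^2) \<partial>lborel) \<le> 
   ennreal (LBINT y. k y * (?n y)^2)" by simp
 have "0 \<le> (LBINT y. k y * (?n y)^2)" using k(2) by simp
 then show "(n2 (\<lambda>x. conv ?k f x - f x))^2 \<le> (LBINT y. k y * (?n y)^2)"
  using le n2_nn_integral[OF sq_diff[OF conv_sq(1)[OF k(1) f] f]] by simp
qed

text \<open>The substitution y = e n * y' in the preceding bound turns the weight into the fixed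
  kernel k and shrinks the translations instead; these contribute at most 2 * n2 f, so dominated
  convergence applies.\<close>

lemma approximate_identity:
 fixes k :: "'a::euclidean_space \<Rightarrow> real"
 assumes k: "ker (\<lambda>x. complex_of_real (k x))" "\<And>x. k x \<ge> 0" "(LBINT x. k x) = 1" and f: "sq f"
  and e: "\<And>n. e n > 0" "e \<longlonglongrightarrow> 0"
 defines "kn \<equiv> \<lambda>n x. k (x /\<^sub>R e n) / e n ^ DIM('a)"
 shows "\<And>n. ker (\<lambda>x. complex_of_real (kn n x))" "\<And>n. n1 (\<lambda>x. complex_of_real (kn n x)) = 1"
  and "(\<lambda>n. n2 (\<lambda>x. conv (\<lambda>x. complex_of_real (kn n x)) f x - f x)) \<longlonglongrightarrow> 0"
proof -
 note [measurable] = k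
 have "(\<lambda>x. Re (complex_of_real (k x))) \<in> borel_measurable borel" by measurable
 then have km[measurable]: "k \<in> borel_measurable borel" by simp
 have ik: "integrable lborel k" using k(1) by (simp add: ker_def complex_of_real_integrable_eq)
 have knm[measurable]: "kn n \<in> borel_measurable borel" for n unfolding kn_def by measurable
 have ikn: "integrable lborel (kn n)" for n
  using lborel_integrable_affine_iff[of k "inverse (e n)" 0] e(1)[of n] ik by (simp add: kn_def)
 have int: "(LBINT x. kn n x) = 1" for n
 proof -
  have "1 = (LBINT x. k x)" using k by simp
  also have "... = \<bar>inverse (e n)\<bar> ^ DIM('a) * (LBINT x. k (x /\<^sub>R e n))"
   using e(1)[of n] by (subst lborel_integral_affine[of k "inverse (e n)" 0]) auto
  also have "... = (LBINT x. kn n x)"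
   using e(1)[of n] by (simp add: kn_def power_inverse divide_simps)
  finally show ?thesis by simp
 qed
 have knn: "kn n x \<ge> 0" for n x using k(2) e(1)[of n] by (simp add: kn_def)
 show kk: "ker (\<lambda>x. complex_of_real (kn n x))" for n
 proof -
  obtain C where C: "\<And>x. cmod (complex_of_real (k x)) \<le> C" using k(1) by (auto simp: ker_def)
  have "cmod (complex_of_real (kn n x)) \<le> C / e n ^ DIM('a)" for x
   using C[of "x /\<^sub>R e n"] e(1)[of n] by (simp add: kn_def divide_right_mono norm_divide norm_power)
  then show ?thesis using ikn[of n] unfolding ker_def by auto
 qed
 show "n1 (\<lambda>x. complex_of_real (kn n x)) = 1" for n
  using int[of n] knn by (simp add: n1_def)
 let ?N = "\<lambda>y. n2 (\<lambda>x. f (x - y) - f x)"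
 have cnt: "continuous_on UNIV ?N"
  using continuous_on_compose2[OF continuous_n2_translate[OF f], of UNIV uminus]
  by (simp add: continuous_intros)
 then have [measurable]: "?N \<in> borel_measurable borel"
  by (rule borel_measurable_continuous_onI)
 have bd: "?N y \<le> 2 * n2 f" for y using n2_translate_bound[OF f, of "-y"] by simp
 have scale: "(LBINT y. kn n y * (?N y)^2) = (LBINT y. k y * (?N (e n *\<^sub>R y))^2)" for n
  using e(1)[of n] by (subst lborel_integral_affine[of _ "e n" 0]) (simp_all add: kn_def)
 have "(\<lambda>n. LBINT y. k y * (?N (e n *\<^sub>R y))^2) \<longlonglongrightarrow> (\<integral>y. 0 \<partial>(lborel::'a measure))"
 proof (rule integral_dominated_convergence)
  show "integrable lborel (\<lambda>y. k y * (2 * n2 f)^2)" using ik by simp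
  show "AE y in lborel. norm (k y * (?N (e n *\<^sub>R y))^2) \<le> k y * (2 * n2 f)^2" for n
   using k(2) power_mono[OF bd n2_nonneg, where n=2]
   by (intro AE_I2) (simp only: real_norm_def abs_mult abs_of_nonneg zero_le_power2 n2_nonneg mult_left_mono)
  show "AE y in lborel. (\<lambda>n. k y * (?N (e n *\<^sub>R y))^2) \<longlonglongrightarrow> 0"
  proof (rule AE_I2)
   fix y :: 'a
   have "(\<lambda>n. e n *\<^sub>R y) \<longlonglongrightarrow> 0 *\<^sub>R y" by (intro tendsto_intros e)
   then have "(\<lambda>n. ?N (e n *\<^sub>R y)) \<longlonglongrightarrow> ?N (0 *\<^sub>R y)"
    by (rule continuous_on_tendsto_compose[OF cnt]) auto
   then have "(\<lambda>n. k y * (?N (e n *\<^sub>R y))^2) \<longlonglongrightarrow> k y * (?N (0 *\<^sub>R y))^2"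
    by (intro tendsto_intros)
   then show "(\<lambda>n. k y * (?N (e n *\<^sub>R y))^2) \<longlonglongrightarrow> 0" by (simp add: n2_def)
  qed
 qed measurable
 then have lim: "(\<lambda>n. sqrt (LBINT y. kn n y * (?N y)^2)) \<longlonglongrightarrow> sqrt 0"
  unfolding scale by (intro tendsto_real_sqrt) simp
 show "(\<lambda>n. n2 (\<lambda>x. conv (\<lambda>x. complex_of_real (kn n x)) f x - f x)) \<longlonglongrightarrow> 0"
 proof (rule tendsto_zero_le)
  show "(\<lambda>n. sqrt (LBINT y. kn n y * (?N y)^2)) \<longlonglongrightarrow> 0" using lim by simp
  show "\<forall>\<^sub>F n in sequentially. n2 (\<lambda>x. conv (\<lambda>x. complex_of_real (kn n x)) f x - f x) \<le> sqrt (LBINT y. kn n y * (?N y)^2)"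
   using conv_minus_self_bound(2)[OF kk knn int f] by (auto intro!: always_eventually real_le_rsqrt)
 qed auto
qed

section \<open>Test functions\<close>

lemma CkI:
 assumes "\<And>x. (f has_derivative D x) (at x)" "\<And>b. b \<in> Basis \<Longrightarrow> Ck k (\<lambda>x. D x b)"
 shows "Ck (Suc k) f"
proof -
 have "partial_deriv b f = (\<lambda>x. D x b)" for b
  using frechet_derivative_at[OF assms(1)] by (auto simp: partial_deriv_def fun_eq_iff)
 then show ?thesis using assms by (auto simp: differentiable_def)
qed

lemma Ck_SucD:
 assumes "Ck (Suc k) f"
 shows "(f has_derivative frechet_derivative f (at x)) (at x)" "b \<in> Basis \<Longrightarrow> Ck k (partial_deriv b f)"
 using assms by (auto simp: frechet_derivative_works)

lemma Ck_Suc_imp: "Ck (Suc k) f \<Longrightarrow> Ck k f"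
proof (induction k arbitrary: f)
 case 0
 then have "\<forall>x. f differentiable (at x)" by simp
 then show ?case by (auto intro!: continuous_at_imp_continuous_on differentiable_imp_continuous_within)
next
 case (Suc k)
 then show ?case by simp
qed

lemma Ck_const: "Ck k (\<lambda>x. c)"
proof (induction k arbitrary: c)
 case (Suc k)
 then show ?case by (intro CkI[where D="\<lambda>x h. 0"] derivative_intros) auto
qed auto

lemma Ck_add: "Ck k f \<Longrightarrow> Ck k g \<Longrightarrow> Ck k (\<lambda>x. f x + g x)"
proof (induction k arbitrary: f g)
 case (Suc k)
 show ?case
  by (rule CkI[OF has_derivative_add[OF Ck_SucD(1)[OF Suc.prems(1)] Ck_SucD(1)[OF Suc.prems(2)]]])
   (use Suc.IH Ck_SucD(2)[OF Suc.prems(1)] Ck_SucD(2)[OF Suc.prems(2)] in \<open>auto simp: partial_deriv_def[abs_def]\<close>)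
qed (auto intro: continuous_intros)

lemma Ck_mult: "Ck k f \<Longrightarrow> Ck k g \<Longrightarrow> Ck k (\<lambda>x. f x * g x)"
proof (induction k arbitrary: f g)
 case (Suc k)
 have c: "Ck k f" "Ck k g" using Suc.prems Ck_Suc_imp by auto
 show ?case
 proof (rule CkI[OF has_derivative_mult[OF Ck_SucD(1)[OF Suc.prems(1)] Ck_SucD(1)[OF Suc.prems(2)]]])
  fix b :: 'a assume b: "b \<in> Basis"
  have "Ck k (\<lambda>x. f x * partial_deriv b g x + partial_deriv b f x * g x)"
   by (intro Ck_add Suc.IH c Ck_SucD(2) Suc.prems b)
  then show "Ck k (\<lambda>x. f x * frechet_derivative g (at x) b + frechet_derivative f (at x) b * g x)"
   by (simp add: partial_deriv_def)
 qed
qed (auto intro: continuous_intros)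

lemma Ck_affine: "Ck k f \<Longrightarrow> Ck k (\<lambda>x. f (t + c *\<^sub>R x))"
proof (induction k arbitrary: f)
 case 0
 then have "continuous_on UNIV f" by simp
 then have "continuous_on UNIV (\<lambda>x. f (t + c *\<^sub>R x))"
  by (rule continuous_on_compose2) (auto intro!: continuous_intros)
 then show ?case by simp
next
 case (Suc k)
 let ?D = "\<lambda>x. frechet_derivative f (at x)"
 show ?case
 proof (rule CkI)
  show "((\<lambda>x. f (t + c *\<^sub>R x)) has_derivative (\<lambda>h. ?D (t + c *\<^sub>R x) (c *\<^sub>R h))) (at x)" for x
   by (rule has_derivative_compose[OF _ Ck_SucD(1)[OF Suc.prems]]) (auto intro!: derivative_eq_intros)
  fix b :: 'a assume b: "b \<in> Basis"
  have "?D y (c *\<^sub>R b) = of_real c * partial_deriv b f y" for y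
   using linear_cmul[OF has_derivative_linear[OF Ck_SucD(1)[OF Suc.prems]]]
   by (simp add: partial_deriv_def scaleR_conv_of_real)
  moreover have "Ck k (\<lambda>x. of_real c * partial_deriv b f (t + c *\<^sub>R x))"
   using Ck_mult[OF Ck_const Suc.IH[OF Ck_SucD(2)[OF Suc.prems b]]] .
  ultimately show "Ck k (\<lambda>x. ?D (t + c *\<^sub>R x) (c *\<^sub>R b))" by simp
 qed
qed

text \<open>The extra division by s^n makes the family closed under differentiation: the derivative
  of a member is a combination of two others, so smoothness follows by induction with n
  arbitrary.\<close>

definition bumpfun :: "nat \<Rightarrow> real \<Rightarrow> real" where
 "bumpfun n s = (if s > 0 then exp (- 1 / s) / s ^ n else 0)"

lemma bumpfun_tendsto_0: "((\<lambda>s. bumpfun n s) \<longlongrightarrow> 0) (at 0)"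
proof -
 have "((\<lambda>s. bumpfun n s) \<longlongrightarrow> 0) (at_left 0)"
  by (rule tendsto_eventually) (auto simp: bumpfun_def eventually_at_left[of "-1"] intro!: exI[of _ "-1"])
 moreover have "((\<lambda>s. bumpfun n s) \<longlongrightarrow> 0) (at_right 0)"
 proof -
  have "((\<lambda>y::real. y ^ n / exp y) \<longlongrightarrow> 0) at_top" by (rule tendsto_power_div_exp_0)
  then have "((\<lambda>s::real. (inverse s) ^ n / exp (inverse s)) \<longlongrightarrow> 0) (at_right 0)"
   by (rule filterlim_compose[OF _ filterlim_inverse_at_top_right])
  moreover have "\<forall>\<^sub>F s in at_right 0. (inverse s) ^ n / exp (inverse s) = bumpfun n s"
   by (auto simp: eventually_at_right[of 0 1] bumpfun_def exp_minus field_simps intro!: exI[of _ 1])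
  ultimately show ?thesis by (rule Lim_transform_eventually)
 qed
 ultimately show ?thesis by (simp add: filterlim_at_split)
qed

lemma bumpfun_derivative:
 "(bumpfun n has_real_derivative (- real n * bumpfun (Suc n) s + bumpfun (Suc (Suc n)) s)) (at s)"
proof (cases s "0::real" rule: linorder_cases)
 case less
 then have "\<forall>\<^sub>F x in nhds s. bumpfun n x = 0"
  by (intro eventually_mono[OF eventually_nhds_in_open[of "{..<0}"]]) (auto simp: bumpfun_def)
 then have "(bumpfun n has_real_derivative 0) (at s)"
  using DERIV_cong_ev[of s s "bumpfun n" "\<lambda>_. 0" 0 0] by auto
 then show ?thesis using less by (simp add: bumpfun_def)
next
 case greater
 have "((\<lambda>s. exp (- 1 / s) * inverse (s ^ n)) has_real_derivative
   (- real n * bumpfun (Suc n) s + bumpfun (Suc (Suc n)) s)) (at s)"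
  using greater by (auto intro!: derivative_eq_intros simp: bumpfun_def)
   (cases n; simp add: field_simps power2_eq_square)
 moreover have "\<forall>\<^sub>F x in nhds s. bumpfun n x = exp (- 1 / x) * inverse (x ^ n)"
  using greater by (intro eventually_mono[OF eventually_nhds_in_open[of "{0<..}"]])
   (auto simp: bumpfun_def field_simps)
 ultimately show ?thesis by (subst DERIV_cong_ev[OF refl _ refl]) auto
next
 case equal
 \<comment> \<open>The difference quotient at 0 is again a member of the family, and these tend to
   0.\<close>
 have "bumpfun n h / h = bumpfun (Suc n) h" for h by (simp add: bumpfun_def)
 then show ?thesis using bumpfun_tendsto_0[of "Suc n"] equal
  by (simp add: has_field_derivative_iff) (simp add: bumpfun_def)
qed

lemma Ck_inner: "Ck k (\<lambda>x. complex_of_real (x \<bullet> b))"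
proof (cases k)
 case (Suc j)
 show ?thesis unfolding Suc
  by (rule CkI[where D="\<lambda>x h. complex_of_real (h \<bullet> b)"])
   (auto intro!: derivative_eq_intros Ck_const)
qed (auto intro!: continuous_intros)

lemma Ck_bump: "Ck k (\<lambda>x::'a::euclidean_space. complex_of_real (bumpfun n (1 - x \<bullet> x)))"
proof (induction k arbitrary: n)
 case 0
 have "continuous_on UNIV (bumpfun n)"
  by (intro continuous_at_imp_continuous_on ballI DERIV_isCont[OF bumpfun_derivative])
 then have "continuous_on UNIV (\<lambda>x::'a. bumpfun n (1 - x \<bullet> x))"
  by (rule continuous_on_compose2) (auto intro!: continuous_intros)
 then show ?case by (auto intro!: continuous_intros)
next
 case (Suc k)
 let ?d = "\<lambda>s. - real n * bumpfun (Suc n) s + bumpfun (Suc (Suc n)) s"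
 show ?case
 proof (rule CkI)
  fix x :: 'a
  have "((\<lambda>x. bumpfun n (1 - x \<bullet> x)) has_derivative (\<lambda>h. (- 2 * (x \<bullet> h)) * ?d (1 - x \<bullet> x))) (at x)"
  proof -
   have "((\<lambda>x. 1 - x \<bullet> x) has_derivative (\<lambda>h. - 2 * (x \<bullet> h))) (at x)"
    by (auto intro!: derivative_eq_intros simp: inner_commute)
   from has_derivative_compose[OF this bumpfun_derivative[unfolded has_field_derivative_def]]
   show ?thesis by (simp add: mult.commute)
  qed
  then show "((\<lambda>x. complex_of_real (bumpfun n (1 - x \<bullet> x))) has_derivative
    (\<lambda>h. complex_of_real ((- 2 * (x \<bullet> h)) * ?d (1 - x \<bullet> x)))) (at x)"
   by (rule has_derivative_of_real)
 next
  fix b :: 'a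
  have "Ck k (\<lambda>x. (-2) * complex_of_real (x \<bullet> b) *
   (of_real (- real n) * complex_of_real (bumpfun (Suc n) (1 - x \<bullet> x)) + complex_of_real (bumpfun (Suc (Suc n)) (1 - x \<bullet> x))))"
   by (intro Ck_mult Ck_add Ck_const Ck_inner Suc.IH)
  then show "Ck k (\<lambda>x. complex_of_real ((- 2 * (x \<bullet> b)) * ?d (1 - x \<bullet> x)))"
   by simp
 qed
qed

lemma test_function_ker:
 assumes "test_function h"
 shows "continuous_on UNIV h" "ker h" "\<exists>R. \<forall>x. norm x > R \<longrightarrow> h x = 0"
proof -
 have "Ck 0 h" using assms unfolding test_function_def by blast
 then show c: "continuous_on UNIV h" by simp
 have comp: "compact (closure {x. h x \<noteq> 0})" using assms by (simp add: test_function_def)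
 obtain R where R: "\<And>x. x \<in> closure {x. h x \<noteq> 0} \<Longrightarrow> norm x \<le> R"
  using compact_imp_bounded[OF comp] by (auto simp: bounded_iff)
 have z: "h x = 0" if "norm x > R" for x
  using R[of x] closure_subset[of "{x. h x \<noteq> 0}"] that by fastforce
 then show "\<exists>R. \<forall>x. norm x > R \<longrightarrow> h x = 0" by blast
 have "integrable lborel (\<lambda>x. indicator (cball 0 R) x *\<^sub>R h x)"
  by (intro borel_integrable_compact continuous_on_subset[OF c]) auto
 also have "(\<lambda>x. indicator (cball 0 R) x *\<^sub>R h x) = h"
  using z by (auto simp: fun_eq_iff indicator_def not_le)
 finally have i: "integrable lborel h" .
 have "bounded (h ` cball 0 R)"
  by (intro compact_imp_bounded compact_continuous_image continuous_on_subset[OF c]) auto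
 then obtain C where C: "\<And>x. norm x \<le> R \<Longrightarrow> cmod (h x) \<le> C" by (fastforce simp: bounded_iff)
 have "cmod (h x) \<le> max C 0" for x
  using C[of x] z[of x] by (cases "norm x \<le> R") auto
 then show "ker h" using i c unfolding ker_def by (auto intro: borel_measurable_continuous_onI)
qed

lemma test_function_partial:
 assumes "test_function j" "b \<in> Basis"
 shows "continuous_on UNIV (partial_deriv b j)"
  and "((\<lambda>s. j (x + s *\<^sub>R b)) has_vector_derivative partial_deriv b j (x + s *\<^sub>R b)) (at s)"
  and "\<exists>R. \<forall>x. norm x > R \<longrightarrow> partial_deriv b j x = 0"
proof -
 have C: "Ck (Suc 0) j" using assms unfolding test_function_def by blast
 then show "continuous_on UNIV (partial_deriv b j)" using Ck_SucD(2)[OF C] assms by simp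
 have D: "(j has_derivative frechet_derivative j (at x)) (at x)" for x by (rule Ck_SucD(1)[OF C])
 have "((\<lambda>s. j (x + s *\<^sub>R b)) has_derivative (\<lambda>h. frechet_derivative j (at (x + s *\<^sub>R b)) (h *\<^sub>R b))) (at s)"
  by (rule has_derivative_compose[OF _ D]) (auto intro!: derivative_eq_intros)
 then show "((\<lambda>s. j (x + s *\<^sub>R b)) has_vector_derivative partial_deriv b j (x + s *\<^sub>R b)) (at s)"
  using linear_cmul[OF has_derivative_linear[OF D]]
  by (simp add: has_vector_derivative_def partial_deriv_def)
 obtain R where R: "\<forall>x. norm x > R \<longrightarrow> j x = 0" using test_function_ker(3)[OF assms(1)] by blast
 have "partial_deriv b j x = 0" if "norm x > R" for x
 proof -
  have "(j has_derivative (\<lambda>h. 0)) (at x)"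
  proof (rule has_derivative_transform_within_open[of "\<lambda>_. 0"])
   show "open {x. norm x > R}" by (intro open_Collect_less continuous_intros)
  qed (use R that in auto)
  then show ?thesis using frechet_derivative_at unfolding partial_deriv_def by metis
 qed
 then show "\<exists>R. \<forall>x. norm x > R \<longrightarrow> partial_deriv b j x = 0" by blast
qed

lemma test_function_affine:
 assumes "test_function h" "c \<noteq> 0"
 shows "test_function (\<lambda>x. a * h (t + c *\<^sub>R x))"
 unfolding test_function_def
proof
 show "\<forall>k. Ck k (\<lambda>x. a * h (t + c *\<^sub>R x))"
  using assms(1) by (auto simp: test_function_def intro!: Ck_mult Ck_const Ck_affine)
 obtain R where R: "\<forall>x. norm x > R \<longrightarrow> h x = 0" using test_function_ker(3)[OF assms(1)] by blast
 have "norm x \<le> (R + norm t) / \<bar>c\<bar>" if "a * h (t + c *\<^sub>R x) \<noteq> 0" for x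
 proof -
  have "norm (t + c *\<^sub>R x) \<le> R" using R that by force
  then have "\<bar>c\<bar> * norm x \<le> R + norm t"
   using norm_triangle_ineq4[of "t + c *\<^sub>R x" t] by simp
  then show ?thesis using assms(2) by (simp add: field_simps)
 qed
 then show "compact (closure {x. a * h (t + c *\<^sub>R x) \<noteq> 0})"
  by (intro compact_closure[THEN iffD2]) (auto simp: bounded_iff)
qed

text \<open>The normalised standard mollifier exp(-1 / (1 - |x|^2)) on the unit ball.\<close>

lemma bump_exists:
 obtains p :: "'a::euclidean_space \<Rightarrow> real"
 where "test_function (\<lambda>x. complex_of_real (p x))" "\<And>x. p x \<ge> 0" "(LBINT x. p x) = 1"
proof -
 let ?b = "\<lambda>x::'a. bumpfun 0 (1 - x \<bullet> x)"
 have t: "test_function (\<lambda>x. complex_of_real (?b x))"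
  unfolding test_function_def
 proof
  have "norm x \<le> 1" if "?b x \<noteq> 0" for x
   using that by (auto simp: bumpfun_def dot_square_norm abs_square_less_1 split: if_splits)
  then show "compact (closure {x. complex_of_real (?b x) \<noteq> 0})"
   by (intro compact_closure[THEN iffD2]) (auto simp: bounded_iff)
 qed (auto intro: Ck_bump)
 let ?I = "\<integral>x. ?b x \<partial>(lborel :: 'a measure)"
 have i: "integrable lborel ?b"
  using test_function_ker(2)[OF t] by (simp add: ker_def complex_of_real_integrable_eq)
 have nn: "?b x \<ge> 0" for x by (simp add: bumpfun_def)
 have "?I \<noteq> 0"
 proof
  assume "?I = 0"
  then have "AE x in lborel. ?b x = 0"
   using i nn by (subst (asm) integral_nonneg_eq_0_iff_AE) auto
  then have "AE x in lborel. x \<notin> ball (0::'a) 1"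
   by eventually_elim (auto simp: bumpfun_def dot_square_norm abs_square_less_1 not_less split: if_splits)
  then have "emeasure lborel {x::'a. norm x < 1} = 0"
   by (subst (asm) AE_iff_null) auto
  moreover have "{x::'a. norm x < 1} = ball 0 1" by auto
  ultimately have "measure lborel (ball (0::'a) 1) = 0" by (simp add: measure_def)
  then show False using content_ball_eq_0_iff[of "0::'a" 1] by simp
 qed
 then have I: "?I > 0" using nn by (simp add: order_less_le)
 show ?thesis
 proof (rule that[of "\<lambda>x. ?b x / ?I"])
  show "test_function (\<lambda>x. complex_of_real (?b x / ?I))"
   using test_function_affine[OF t, of 1 "complex_of_real (1 / ?I)" 0] by simp
 qed (use nn I in auto)
qed

section \<open>Weak derivatives and difference quotients\<close>

text \<open>A mollification of F at x is the pairing of F with a reflected, rescaled and translated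
  bump, hence 0; but mollifications tend to F in L^2.\<close>

lemma test_orthogonal_imp_null:
 fixes F :: "'a::euclidean_space \<Rightarrow> complex"
 assumes F: "sq F" and orth: "\<And>h. test_function h \<Longrightarrow> (LBINT x. F x * h x) = 0"
 shows "n2 F = 0"
proof -
 obtain p :: "'a \<Rightarrow> real" where p: "test_function (\<lambda>x. complex_of_real (p x))" "\<And>x. p x \<ge> 0" "(LBINT x. p x) = 1"
  using bump_exists by blast
 define e where "e n = inverse (real (Suc n))" for n
 have e: "e n > 0" "e \<longlonglongrightarrow> 0" for n
  unfolding e_def[abs_def] using LIMSEQ_inverse_real_of_nat by simp_all
 let ?k = "\<lambda>n x. complex_of_real (p (x /\<^sub>R e n) / e n ^ DIM('a))"
 have lim: "(\<lambda>n. n2 (\<lambda>x. conv (?k n) F x - F x)) \<longlonglongrightarrow> 0"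
  using approximate_identity(3)[OF test_function_ker(2)[OF p(1)] p(2,3) F e] .
 note [measurable] = F[THEN sq_measurable]
 have kk: "ker (?k n)" for n
  using approximate_identity(1)[OF test_function_ker(2)[OF p(1)] p(2,3) F e] .
 have "conv (?k n) F x = 0" for n x
 proof -
  have [measurable]: "?k n \<in> borel_measurable borel" using kk unfolding ker_def by blast
  have "(\<lambda>y. ?k n y * F (x - y)) \<in> borel_measurable borel" by measurable
  then have "conv (?k n) F x = (LBINT y. F y * ?k n (x - y))"
   unfolding conv_def
   by (subst lborel_integral_affine[of _ "-1" x]) (simp_all add: mult.commute)
  also have "(\<lambda>y. ?k n (x - y)) = (\<lambda>y. complex_of_real (1 / e n ^ DIM('a)) * complex_of_real (p (x /\<^sub>R e n + (- inverse (e n)) *\<^sub>R y)))"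
   by (auto simp: fun_eq_iff scaleR_diff_right)
  also have "(LBINT y. F y * ... y) = 0"
   by (rule orth[OF test_function_affine[OF p(1)]]) (use e(1)[of n] in simp)
  finally show ?thesis .
 qed
 then have "(\<lambda>n::nat. n2 F) \<longlonglongrightarrow> 0"
  using lim n2_scaleR[of "-1" F] by simp
 then show ?thesis by (simp add: LIMSEQ_const_iff)
qed

text \<open>The counterpart of \<open>has_weak_partial\<close> for Borel functions, with membership
  of f in L^2 built in.\<close>

definition wd :: "'a::euclidean_space \<Rightarrow> ('a \<Rightarrow> complex) \<Rightarrow> ('a \<Rightarrow> complex) \<Rightarrow> bool" where
 "wd b f g \<longleftrightarrow> sq f \<and> sq g \<and>
  (\<forall>h. test_function h \<longrightarrow> (LBINT x. f x * partial_deriv b h x) = - (LBINT x. g x * h x))"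

text \<open>At h = 0 the division gives 0, so the norm bounds hold for every h.\<close>

definition dq :: "'a::euclidean_space \<Rightarrow> real \<Rightarrow> ('a \<Rightarrow> complex) \<Rightarrow> 'a \<Rightarrow> complex" where
 "dq b h f x = (f (x + h *\<^sub>R b) - f x) / of_real h"

lemma wd_sq: "wd b f g \<Longrightarrow> sq f" "wd b f g \<Longrightarrow> sq g"
 by (auto simp: wd_def)

lemma wd_unique:
 assumes "wd b f g" "wd b f g'" shows "n2 (\<lambda>x. g x - g' x) = 0"
proof (rule test_orthogonal_imp_null)
 show "sq (\<lambda>x. g x - g' x)" using assms by (intro sq_diff) (auto simp: wd_def)
 fix h :: "'a \<Rightarrow> complex" assume t: "test_function h"
 have i: "integrable lborel (\<lambda>x. g x * h x)" "integrable lborel (\<lambda>x. g' x * h x)"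
  using assms ker_sq[OF test_function_ker(2)[OF t]] by (auto simp: wd_def intro: sq_CS)
 show "(LBINT x. (g x - g' x) * h x) = 0"
  using assms t i by (simp add: wd_def left_diff_distrib)
qed

lemma sq_dq: "sq f \<Longrightarrow> sq (dq b h f)"
 using sq_cmult[OF sq_diff[OF sq_translate[of f "h *\<^sub>R b"]], of f "inverse (of_real h)"]
 by (simp add: dq_def[abs_def] field_simps)

text \<open>Integration by parts for difference quotients; it rests only on translation
  invariance.\<close>

lemma dq_pairing:
 assumes "sq f" "sq g"
 shows "(LBINT x. dq b h f x * g x) = - (LBINT x. f x * dq b (- h) g x)"
proof (cases "h = 0")
 case False
 note [measurable] = assms[THEN sq_measurable]
 have i: "integrable lborel (\<lambda>x. f (x + t) * g (x + s))" for s t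
  using assms by (intro sq_CS sq_translate)
 have "(LBINT x. f (x + h *\<^sub>R b) * g x) = (LBINT x. f x * g (x - h *\<^sub>R b))"
  using lborel_integral_translate[of "\<lambda>x. f x * g (x - h *\<^sub>R b)" "h *\<^sub>R b"] by simp
 then show ?thesis
  using i[of "h *\<^sub>R b" 0] i[of 0 0] i[of 0 "- h *\<^sub>R b"] False
  by (simp add: dq_def left_diff_distrib right_diff_distrib diff_divide_distrib)
qed (simp add: dq_def)

lemma partial_deriv_translate:
 assumes "test_function h" "b \<in> Basis"
 shows "partial_deriv b (\<lambda>x. h (x + t)) x = partial_deriv b h (x + t)"
proof -
 have C: "Ck (Suc 0) h" using assms unfolding test_function_def by blast
 have "((\<lambda>x. h (x + t)) has_derivative frechet_derivative h (at (x + t))) (at x)"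
  by (rule has_derivative_compose[OF _ Ck_SucD(1)[OF C]]) (auto intro!: derivative_eq_intros)
 from frechet_derivative_at[OF this] show ?thesis by (simp add: partial_deriv_def)
qed

lemma test_function_sq:
 assumes "test_function h" "b \<in> Basis"
 shows "sq h" "sq (partial_deriv b h)" "\<exists>B. \<forall>x. cmod (partial_deriv b h x) \<le> B"
proof -
 show "sq h" by (rule ker_sq[OF test_function_ker(2)[OF assms(1)]])
 note c = test_function_partial(1)[OF assms]
 obtain R where R: "\<forall>x. norm x > R \<longrightarrow> partial_deriv b h x = 0" using test_function_partial(3)[OF assms] by blast
 have "bounded (partial_deriv b h ` cball 0 R)"
  by (intro compact_imp_bounded compact_continuous_image continuous_on_subset[OF c]) auto
 then obtain C where C: "\<And>x. norm x \<le> R \<Longrightarrow> cmod (partial_deriv b h x) \<le> C" by (fastforce simp: bounded_iff)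
 have B: "cmod (partial_deriv b h x) \<le> max C 0" for x
  using C[of x] R by (cases "norm x \<le> R") auto
 then show "\<exists>B. \<forall>x. cmod (partial_deriv b h x) \<le> B" by blast
 have ind: "sq (\<lambda>x. indicator (cball 0 R) x * (of_real (max C 0)) :: complex)"
  by (intro sq_indicator emeasure_bounded_finite) auto
 show "sq (partial_deriv b h)"
 proof (rule sq_bound(1)[OF ind _ _, of _ 1])
  show "partial_deriv b h \<in> borel_measurable borel" using c by (rule borel_measurable_continuous_onI)
  show "norm (partial_deriv b h x) \<le> 1 * norm (indicator (cball 0 R) x * complex_of_real (max C 0))" for x
   using B[of x] R by (auto simp: indicator_def not_le)
 qed simp
qed

text \<open>The difference quotient of f is almost everywhere the average of g (x + s h b) over s in
  [0, 1]. The choice c = 0 yields the uniform bound on quotients, c = 1 their convergence to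
  g.\<close>

lemma wd_dq_Jensen:
 fixes f :: "'a::euclidean_space \<Rightarrow> complex"
 assumes b: "b \<in> Basis" and w: "wd b f g" and h: "h \<noteq> 0"
  and M: "\<And>s. 0 \<le> s \<Longrightarrow> s \<le> 1 \<Longrightarrow> n2 (\<lambda>x. g (x + (s * h) *\<^sub>R b) - c * g x) \<le> M" "M \<ge> 0"
 shows "n2 (\<lambda>x. dq b h f x - c * g x) \<le> M"
proof -
 have f: "sq f" and g: "sq g" using w by (auto simp: wd_def)
 note [measurable] = f[THEN sq_measurable] g[THEN sq_measurable]
 define k :: "real \<Rightarrow> complex" where "k s = indicator {0..1} s" for s
 have km[measurable]: "k \<in> borel_measurable borel" unfolding k_def[abs_def] by measurable
 have ik: "integrable lborel k"
  unfolding k_def[abs_def] by (rule integrable_real_indicator[THEN integrable_of_real, where 'a=complex, simplified of_real_indicator]) auto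
 have k1: "(LBINT s. k s) = 1" 
 proof -
  have "k = (\<lambda>s. of_real (indicator {0..1} s))" by (auto simp: k_def fun_eq_iff indicator_def)
  then show ?thesis by simp
 qed
 \<comment> \<open>The indicator is repeated inside \<open>?F\<close> because
   \<open>kernel_pairing\<close> asks for an L^2 bound at every s, whereas M is available only on
   [0, 1].\<close>
 let ?F = "\<lambda>x s. indicator {0..1} s *\<^sub>R (g (x + (s * h) *\<^sub>R b) - c * g x)"
 define B where "B x = (LBINT s. k s * ?F x s)" for x
 have Fm: "(\<lambda>(x, s). ?F x s) \<in> borel_measurable (borel \<Otimes>\<^sub>M borel)" by measurable
 have sF0: "sq (\<lambda>x. g (x + (s * h) *\<^sub>R b) - c * g x)" for s
  by (intro sq_diff sq_translate sq_cmult g)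
 have sF: "sq (\<lambda>x. ?F x s)" for s by (intro sq_scaleR sF0)
 have nF: "n2 (\<lambda>x. ?F x s) \<le> M" for s
  using M(1)[of s] M(2) n2_scaleR[of "indicator {0..1} s" "\<lambda>x. g (x + (s * h) *\<^sub>R b) - c * g x"]
  by (auto simp: indicator_def split: if_splits)
 have "(\<integral>\<^sup>+x. ennreal ((cmod (B x))^2) \<partial>lborel) \<le>
  (\<integral>\<^sup>+s. ennreal (cmod (k s)) \<partial>lborel) *
  (\<integral>\<^sup>+s. ennreal (cmod (k s)) * (\<integral>\<^sup>+x. ennreal ((cmod (?F x s))^2) \<partial>lborel) \<partial>lborel)"
  unfolding B_def by (rule kernel_Jensen[OF km Fm])
 also have "... \<le> (\<integral>\<^sup>+s. ennreal (cmod (k s)) \<partial>lborel) * (\<integral>\<^sup>+s. ennreal (cmod (k s)) * ennreal (M^2) \<partial>lborel)"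
  unfolding n2_nn_integral[OF sF]
  by (intro mult_left_mono nn_integral_mono ennreal_leI power_mono nF) auto
 also have "... = ennreal (M^2)"
 proof -
  have "(\<integral>\<^sup>+s. ennreal (cmod (k s)) \<partial>lborel) = 1"
  proof -
   have "(\<lambda>s. ennreal (cmod (k s))) = indicator {0..1}" by (auto simp: k_def fun_eq_iff indicator_def)
   then show ?thesis by simp
  qed
  then show ?thesis by (simp add: nn_integral_multc)
 qed
 finally have Bn: "(\<integral>\<^sup>+x. ennreal ((cmod (B x))^2) \<partial>lborel) \<le> ennreal (M^2)" .
 have "(\<lambda>x. LBINT s. k s * ?F x s) \<in> borel_measurable borel" by measurable
 then have Bm: "B \<in> borel_measurable borel" unfolding B_def[abs_def] .
 have sB: "sq B" "n2 B \<le> M" using sq_n2_le_nn[OF Bm Bn M(2)] by auto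
 have sD: "sq (\<lambda>x. dq b h f x - c * g x)" by (intro sq_diff sq_dq sq_cmult f g)
 have "n2 (\<lambda>x. (dq b h f x - c * g x) - B x) = 0"
 proof (rule test_orthogonal_imp_null)
  show "sq (\<lambda>x. (dq b h f x - c * g x) - B x)" using sq_diff sD sB(1) by blast
  fix j :: "'a \<Rightarrow> complex" assume t: "test_function j"
  note s\<eta> = test_function_sq[OF t b]
  let ?P = "\<lambda>x s. indicator {0..1} s *\<^sub>R partial_deriv b j (x + (- s * h) *\<^sub>R b)"
  note [measurable] = s\<eta>(1,2)[THEN sq_measurable]
  have \<eta>m[measurable]: "j \<in> borel_measurable borel" using s\<eta> by (simp add: sq_def)
  let ?g = "\<lambda>s. LBINT x. g (x + (s * h) *\<^sub>R b) * j x"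
  have Pm: "(\<lambda>(x, s). ?P x s) \<in> borel_measurable (borel \<Otimes>\<^sub>M borel)" by measurable
  have sP: "sq (\<lambda>x. ?P x s)" for s by (intro sq_scaleR sq_translate s\<eta>)
  have nP: "n2 (\<lambda>x. ?P x s) \<le> n2 (partial_deriv b j)" for s
   using n2_scaleR[of "indicator {0..1} s" "\<lambda>x. partial_deriv b j (x + (- s * h) *\<^sub>R b)"] n2_translate[OF s\<eta>(2), of "(- s * h) *\<^sub>R b"]
   by (auto simp: indicator_def)
  \<comment> \<open>The fundamental theorem of calculus is applied to the smooth function j; f has
    only a weak derivative and receives the result through the pairing.\<close>
  have FTC: "dq b (- h) j x = (LBINT s. k s * ?P x s)" for x
  proof -
   have "(LBINT s. indicator {0..1} s *\<^sub>R ((- h) *\<^sub>R partial_deriv b j (x + (s * - h) *\<^sub>R b))) =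
     j (x + (1 * - h) *\<^sub>R b) - j (x + (0 * - h) *\<^sub>R b)"
   proof (rule integral_FTC_atLeastAtMost)
    fix s :: real
    have "((\<lambda>s. s * - h) has_vector_derivative - h) (at s)"
     by (auto intro!: derivative_eq_intros simp: has_vector_derivative_def)
    from vector_diff_chain_at[OF this test_function_partial(2)[OF t b]]
    have "((\<lambda>s. j (x + (s * - h) *\<^sub>R b)) has_vector_derivative (- h) *\<^sub>R partial_deriv b j (x + (s * - h) *\<^sub>R b)) (at s)"
     by (simp add: o_def)
    then show "((\<lambda>s. j (x + (s * - h) *\<^sub>R b)) has_vector_derivative (- h) *\<^sub>R partial_deriv b j (x + (s * - h) *\<^sub>R b)) (at s within {0..1})"
     by (rule has_vector_derivative_at_within)
    show "continuous_on {0..1} (\<lambda>s. (- h) *\<^sub>R partial_deriv b j (x + (s * - h) *\<^sub>R b))"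
     by (intro continuous_intros continuous_on_compose2[OF test_function_partial(1)[OF t b]]) auto
   qed simp
   also have "(LBINT s. indicator {0..1} s *\<^sub>R ((- h) *\<^sub>R partial_deriv b j (x + (s * - h) *\<^sub>R b))) =
     of_real (- h) * (LBINT s. k s * ?P x s)"
    by (subst integral_mult_right_zero[symmetric], intro Bochner_Integration.integral_cong)
     (auto simp: k_def indicator_def scaleR_conv_of_real)
   finally show ?thesis using h by (simp add: dq_def field_simps)
  qed
  have sgi: "integrable lborel (\<lambda>x. g (x + t) * j x)" for t by (intro sq_CS sq_translate g s\<eta>)
  have shift: "k s * (LBINT x. ?P x s * f x) = - (k s * ?g s)" for s
  proof -
   have "(LBINT x. f x * partial_deriv b j (x + (- s * h) *\<^sub>R b)) =
     - (LBINT x. g x * j (x + (- s * h) *\<^sub>R b))"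
   proof -
    have "test_function (\<lambda>x. j (x + (- s * h) *\<^sub>R b))"
     using test_function_affine[OF t, of 1 1 "(- s * h) *\<^sub>R b"] by (simp add: add.commute)
    then have "(LBINT x. f x * partial_deriv b (\<lambda>x. j (x + (- s * h) *\<^sub>R b)) x) =
     - (LBINT x. g x * j (x + (- s * h) *\<^sub>R b))"
     using w unfolding wd_def by blast
    then show ?thesis unfolding partial_deriv_translate[OF t b] .
   qed
   also have "(LBINT x. g x * j (x + (- s * h) *\<^sub>R b)) = ?g s"
    using lborel_integral_translate[of "\<lambda>x. g x * j (x + (- s * h) *\<^sub>R b)" "(s * h) *\<^sub>R b"] by simp
   finally show ?thesis by (auto simp: k_def indicator_def mult.commute)
  qed
  have Fs: "k s * (LBINT x. ?F x s * j x) = k s * ?g s - k s * (c * (LBINT x. g x * j x))" for s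
   using sgi[of "(s * h) *\<^sub>R b"] sgi[of 0]
   by (auto simp: k_def indicator_def left_diff_distrib mult.assoc)
  have ig: "integrable lborel (\<lambda>s. k s * ?g s)"
   using kernel_pairing(1)[OF ik Pm sP nP f] unfolding shift by simp
  have "(LBINT x. dq b h f x * j x) = - (LBINT x. (LBINT s. k s * ?P x s) * f x)"
   using dq_pairing[OF f s\<eta>(1), of b h] by (simp add: FTC mult.commute)
  also have "... = (LBINT s. k s * ?g s)"
   unfolding kernel_pairing(2)[OF ik Pm sP nP f] shift by simp
  finally have 1: "(LBINT x. dq b h f x * j x) = (LBINT s. k s * ?g s)" .
  have "(LBINT x. B x * j x) = (LBINT s. k s * (LBINT x. ?F x s * j x))"
   unfolding B_def by (rule kernel_pairing(2)[OF ik Fm sF nF s\<eta>(1)])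
  also have "... = (LBINT x. dq b h f x * j x) - c * (LBINT x. g x * j x)"
   unfolding Fs 1 using ig ik k1 by simp
  finally have 2: "(LBINT x. B x * j x) = ..." .
  have "integrable lborel (\<lambda>x. dq b h f x * j x)" "integrable lborel (\<lambda>x. B x * j x)" "integrable lborel (\<lambda>x. g x * j x)"
   by (intro sq_CS sq_dq f g sB s\<eta>)+
  then show "(LBINT x. (dq b h f x - c * g x - B x) * j x) = 0"
   by (simp add: left_diff_distrib mult.assoc 2)
 qed
 then have "n2 (\<lambda>x. dq b h f x - c * g x) \<le> n2 B"
  using n2_triangle[OF sq_diff[OF sD sB(1)] sB(1)] by simp
 then show ?thesis using sB(2) by simp
qed

lemma wd_dq_bound:
 assumes b: "b \<in> Basis" and w: "wd b f g"
 shows "n2 (dq b h f) \<le> n2 g"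
proof (cases "h = 0")
 case False
 have "n2 (\<lambda>x. g (x + t)) = n2 g" for t using w by (intro n2_translate) (simp add: wd_def)
 then show ?thesis using wd_dq_Jensen[OF b w False, of 0 "n2 g"] by (simp add: fun_eq_iff)
qed (simp add: dq_def[abs_def] n2_def)

lemma wd_dq_tendsto:
 assumes b: "b \<in> Basis" and w: "wd b f g"
 shows "((\<lambda>h. n2 (\<lambda>x. dq b h f x - g x)) \<longlongrightarrow> 0) (at 0)"
proof (rule tendstoI)
 fix e :: real assume e: "e > 0"
 have "sq g" using w by (simp add: wd_def)
 from tendstoD[OF n2_translate_tendsto[OF this], of "e/2"] e
 obtain d where d: "d > 0" "\<And>t. t \<noteq> 0 \<Longrightarrow> norm t < d \<Longrightarrow> n2 (\<lambda>x. g (x + t) - g x) < e/2"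
  by (auto simp: eventually_at dist_norm)
 have "n2 (\<lambda>x. dq b h f x - g x) < e" if h: "h \<noteq> 0" "\<bar>h\<bar> < d" for h
 proof -
  have "n2 (\<lambda>x. g (x + (s * h) *\<^sub>R b) - 1 * g x) \<le> e/2" if "0 \<le> s" "s \<le> 1" for s
  proof (cases "s = 0")
   case False
   have "\<bar>s * h\<bar> \<le> \<bar>h\<bar>" using that mult_left_le_one_le[of "\<bar>h\<bar>" s] by (simp add: abs_mult)
   then have "\<bar>s * h\<bar> < d" using h by simp
   then show ?thesis using d(2)[of "(s * h) *\<^sub>R b"] False h b nonzero_Basis[OF b] by simp
  qed (use e in \<open>simp add: n2_def\<close>)
  from wd_dq_Jensen[OF b w h(1) this] e show ?thesis by simp
 qed
 then show "\<forall>\<^sub>F h in at 0. dist (n2 (\<lambda>x. dq b h f x - g x)) 0 < e"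
  using d(1) by (auto simp: eventually_at)
qed

lemma wd_dq_seq:
 assumes "b \<in> Basis" "wd b f g" "H \<longlonglongrightarrow> 0" "\<And>n. H n \<noteq> 0"
 shows "(\<lambda>n::nat. n2 (\<lambda>x. dq b (H n) f x - g x)) \<longlonglongrightarrow> 0"
 using wd_dq_tendsto[OF assms(1,2)] assms(3,4)
 by (auto simp: tendsto_at_iff_sequentially comp_def)

lemma integral_mult_tendsto:
 fixes g :: "'a::euclidean_space \<Rightarrow> complex"
 assumes "(\<lambda>n. n2 (\<lambda>x. F n x - f x)) \<longlonglongrightarrow> 0" "\<And>n. sq (F n)" "sq f" "sq g"
 shows "(\<lambda>n::nat. LBINT x. F n x * g x) \<longlonglongrightarrow> (LBINT x. f x * g x)"
proof -
 have "(\<lambda>n. (LBINT x. F n x * g x) - (LBINT x. f x * g x)) \<longlonglongrightarrow> 0"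
 proof (rule Lim_null_comparison)
  show "(\<lambda>n. n2 (\<lambda>x. F n x - f x) * n2 g) \<longlonglongrightarrow> 0"
   using tendsto_mult_left_zero[OF assms(1)] .
  have "(LBINT x. F n x * g x) - (LBINT x. f x * g x) = (LBINT x. (F n x - f x) * g x)" for n
   using sq_CS(1)[OF assms(2,4)] sq_CS(1)[OF assms(3,4)] by (simp add: left_diff_distrib)
  then show "\<forall>\<^sub>F n in sequentially. norm ((LBINT x. F n x * g x) - (LBINT x. f x * g x)) \<le> n2 (\<lambda>x. F n x - f x) * n2 g"
   using sq_CS(2)[OF sq_diff[OF assms(2,3)] assms(4)] by simp
 qed
 then show ?thesis by (simp add: LIM_zero_iff)
qed

lemma line_Lipschitz:
 fixes f :: "'a::real_normed_vector \<Rightarrow> 'c::real_normed_vector"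
 assumes "\<And>x s. ((\<lambda>s. f (x + s *\<^sub>R b)) has_vector_derivative f' (x + s *\<^sub>R b)) (at s)"
  and B: "\<And>x. norm (f' x) \<le> B"
 shows "norm (f (x + h *\<^sub>R b) - f x) \<le> \<bar>h\<bar> * B"
proof -
 have "norm (f (x + h *\<^sub>R b) - f (x + 0 *\<^sub>R b)) \<le> B * norm (h - 0)"
 proof (rule differentiable_bound[of UNIV])
  show "((\<lambda>s. f (x + s *\<^sub>R b)) has_derivative (\<lambda>t. t *\<^sub>R f' (x + s *\<^sub>R b))) (at s within UNIV)" for s
   using assms(1)[of x s] by (simp add: has_vector_derivative_def)
  show "onorm (\<lambda>t. t *\<^sub>R f' (x + s *\<^sub>R b)) \<le> B" for s
   by (rule onorm_le) (use B[of "x + s *\<^sub>R b"] in \<open>simp add: mult.commute[of B] mult_left_mono\<close>)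
 qed auto
 then show ?thesis by (simp add: mult.commute)
qed

lemma line_derivative_dq:
 assumes "((\<lambda>s. f (x + s *\<^sub>R b)) has_vector_derivative D) (at 0)" "H \<longlonglongrightarrow> 0" "\<And>n. H n \<noteq> 0"
 shows "(\<lambda>n::nat. dq b (H n) f x) \<longlonglongrightarrow> D"
proof -
 have "((\<lambda>h. norm (f (x + h *\<^sub>R b) - f x - h *\<^sub>R D) / norm h) \<longlongrightarrow> 0) (at 0)"
  using assms(1) by (simp add: has_vector_derivative_def has_derivative_at)
 moreover have "\<forall>\<^sub>F h in at 0. norm (f (x + h *\<^sub>R b) - f x - h *\<^sub>R D) / norm h = norm (dq b h f x - D)"
 proof (rule eventually_at_filter[THEN iffD2], rule always_eventually, intro allI impI)
  fix h :: real assume "h \<noteq> 0"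
  then have "dq b h f x - D = (f (x + h *\<^sub>R b) - f x - h *\<^sub>R D) / of_real h"
   by (simp add: dq_def diff_divide_distrib scaleR_conv_of_real)
  then show "norm (f (x + h *\<^sub>R b) - f x - h *\<^sub>R D) / norm h = norm (dq b h f x - D)"
   by (simp add: norm_divide)
 qed
 ultimately have "((\<lambda>h. norm (dq b h f x - D)) \<longlongrightarrow> 0) (at 0)" by (rule Lim_transform_eventually)
 then have "((\<lambda>h. dq b h f x) \<longlongrightarrow> D) (at 0)"
  by (simp add: tendsto_norm_zero_iff LIM_zero_iff)
 then show ?thesis using assms(2,3) by (auto simp: tendsto_at_iff_sequentially comp_def)
qed

text \<open>\<open>Suc\<close> keeps every step nonzero, so that difference quotients along this
  sequence never take their default value.\<close>

definition inv_nat :: "nat \<Rightarrow> real" where "inv_nat n = inverse (real (Suc n))"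

lemma inv_nat_pos [simp]: "inv_nat n > 0" by (simp add: inv_nat_def)
lemma inv_nat_neq_0 [simp]: "inv_nat n \<noteq> 0" by (simp add: inv_nat_def)
lemma inv_nat_nonneg [simp]: "inv_nat n \<ge> 0" by (simp add: inv_nat_def)
lemma abs_inv_nat [simp]: "\<bar>inv_nat n\<bar> = inv_nat n" by simp
lemma inv_nat_tendsto: "inv_nat \<longlonglongrightarrow> 0" unfolding inv_nat_def[abs_def] by (rule LIMSEQ_inverse_real_of_nat)

lemma borel_measurable_dq [measurable (raw)]:
 assumes [measurable]: "f \<in> borel_measurable borel"
 shows "dq b h f \<in> borel_measurable borel"
 unfolding dq_def[abs_def] by measurable

lemma test_dq_seq:
 fixes j :: "'a::euclidean_space \<Rightarrow> complex"
 assumes t: "test_function j" and b: "b \<in> Basis" and H: "H \<longlonglongrightarrow> 0" "\<And>n. H n \<noteq> 0"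
 shows "(\<lambda>n::nat. n2 (\<lambda>x. dq b (H n) j x - partial_deriv b j x)) \<longlonglongrightarrow> 0"
proof -
 obtain R where R: "\<forall>x. norm x > R \<longrightarrow> j x = 0" using test_function_ker(3)[OF t] by blast
 obtain R' where R': "\<forall>x. norm x > R' \<longrightarrow> partial_deriv b j x = 0" using test_function_partial(3)[OF t b] by blast
 obtain B where B: "\<And>x. cmod (partial_deriv b j x) \<le> B" using test_function_sq(3)[OF t b] by blast
 have B0: "B \<ge> 0" using B[of 0] norm_ge_zero order_trans by blast
 \<comment> \<open>From N on the shifts are shorter than 1, so all quotients are supported in the
   ball \<open>?S\<close> and are dominated by a constant there.\<close>
 obtain N where N: "\<And>n. n \<ge> N \<Longrightarrow> \<bar>H n\<bar> < 1" using LIMSEQ_D[OF H(1), of 1] by auto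
 let ?S = "cball 0 (max R R' + 1) :: 'a set"
 have lip: "cmod (dq b h j x) \<le> B" for h x
  using line_Lipschitz[OF test_function_partial(2)[OF t b] B, of x h]
  by (cases "h = 0") (auto simp: dq_def norm_divide divide_simps mult.commute B0)
 have "(\<lambda>n. n2 (\<lambda>x. dq b (H (n + N)) j x - partial_deriv b j x)) \<longlonglongrightarrow> 0"
 proof (rule n2_dominated_convergence)
  show "sq (\<lambda>x. indicator ?S x * (of_real (2 * B) :: complex))"
   by (intro sq_indicator emeasure_bounded_finite) auto
  show "(\<lambda>x. dq b (H (n + N)) j x - partial_deriv b j x) \<in> borel_measurable borel" for n
   using test_function_sq(1,2)[OF t b] by (auto simp: sq_def)
  have "(\<lambda>n. dq b (H n) j x) \<longlonglongrightarrow> partial_deriv b j x" for x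
   using line_derivative_dq[OF _ H] test_function_partial(2)[OF t b, of x 0] by simp
  then have "(\<lambda>n. dq b (H (n + N)) j x - partial_deriv b j x) \<longlonglongrightarrow> 0" for x
   using LIMSEQ_ignore_initial_segment LIM_zero by blast
  then show "AE x in lborel. (\<lambda>n. dq b (H (n + N)) j x - partial_deriv b j x) \<longlonglongrightarrow> 0" by simp
  fix n x
  have h: "\<bar>H (n + N)\<bar> < 1" using N by simp
  show "norm (dq b (H (n + N)) j x - partial_deriv b j x) \<le> norm (indicator ?S x * complex_of_real (2 * B))"
  proof (cases "x \<in> ?S")
   case True
   then show ?thesis using norm_triangle_ineq4[of "dq b (H (n + N)) j x" "partial_deriv b j x"] lip[of "H (n + N)" x] B[of x] B0
    by simp
  next
   case False
   then have x: "norm x > max R R' + 1" by simp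
   have "norm x - norm (x + H (n + N) *\<^sub>R b) \<le> \<bar>H (n + N)\<bar>"
    using norm_triangle_ineq3[of "x + H (n + N) *\<^sub>R b" x] b by simp
   then have "norm (x + H (n + N) *\<^sub>R b) > R" using x h by linarith
   then show ?thesis using R R' x by (simp add: dq_def)
  qed
 qed
 then show ?thesis by (rule LIMSEQ_offset)
qed

text \<open>Convergence in L^2 along a single sequence of steps identifies the weak derivative: move
  the quotient to the test function and pass to the limit. All calculus rules below use this
  criterion and so need no test functions.\<close>

lemma wdI:
 assumes b: "b \<in> Basis" and f: "sq f" and g: "sq g" and H: "H \<longlonglongrightarrow> 0" "\<And>n. H n \<noteq> 0"
  and lim: "(\<lambda>n::nat. n2 (\<lambda>x. dq b (H n) f x - g x)) \<longlonglongrightarrow> 0"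
 shows "wd b f g"
 unfolding wd_def
proof (intro conjI f g allI impI)
 fix h :: "'a \<Rightarrow> complex" assume t: "test_function h"
 note s\<eta> = test_function_sq[OF t b]
 have 1: "(\<lambda>n. LBINT x. dq b (H n) f x * h x) \<longlonglongrightarrow> (LBINT x. g x * h x)"
  by (intro integral_mult_tendsto lim sq_dq f g s\<eta>)
 have "(\<lambda>n. LBINT x. dq b (- H n) h x * f x) \<longlonglongrightarrow> (LBINT x. partial_deriv b h x * f x)"
  using tendsto_minus[OF H(1)] H(2)
  by (intro integral_mult_tendsto test_dq_seq t b sq_dq f s\<eta>) auto
 then have "(\<lambda>n. LBINT x. dq b (H n) f x * h x) \<longlonglongrightarrow> - (LBINT x. partial_deriv b h x * f x)"
  unfolding dq_pairing[OF f s\<eta>(1)] by (intro tendsto_minus) (simp add: mult.commute)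
 from LIMSEQ_unique[OF 1 this]
 show "(LBINT x. f x * partial_deriv b h x) = - (LBINT x. g x * h x)"
  by (simp add: mult.commute)
qed

lemmas wdI_nat = wdI[OF _ _ _ inv_nat_tendsto inv_nat_neq_0]

lemma wd_seq_nat: "b \<in> Basis \<Longrightarrow> wd b f g \<Longrightarrow> (\<lambda>n. n2 (\<lambda>x. dq b (inv_nat n) f x - g x)) \<longlonglongrightarrow> 0"
 by (rule wd_dq_seq[OF _ _ inv_nat_tendsto inv_nat_neq_0])

text \<open>Integration by parts between two functions of H^1, as the limit of
  \<open>dq_pairing\<close>.\<close>

lemma wd_pairing:
 assumes b: "b \<in> Basis" and 1: "wd b f g" and 2: "wd b f' g'"
 shows "(LBINT x. f x * g' x) = - (LBINT x. g x * f' x)"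
proof -
 note s = wd_sq[OF 1] wd_sq[OF 2]
 have A: "(\<lambda>n. LBINT x. dq b (inv_nat n) f x * f' x) \<longlonglongrightarrow> (LBINT x. g x * f' x)"
  by (intro integral_mult_tendsto wd_seq_nat sq_dq b s 1)
 have "(\<lambda>n. LBINT x. dq b (- inv_nat n) f' x * f x) \<longlonglongrightarrow> (LBINT x. g' x * f x)"
  using tendsto_minus[OF inv_nat_tendsto]
  by (intro integral_mult_tendsto sq_dq wd_dq_seq b s 2) auto
 then have "(\<lambda>n. LBINT x. dq b (inv_nat n) f x * f' x) \<longlonglongrightarrow> - (LBINT x. g' x * f x)"
  unfolding dq_pairing[OF s(1,3)] by (intro tendsto_minus) (simp add: mult.commute)
 from LIMSEQ_unique[OF A this] show ?thesis by (simp add: mult.commute)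
qed

lemma wd_add:
 assumes b: "b \<in> Basis" and 1: "wd b f g" and 2: "wd b f' g'"
 shows "wd b (\<lambda>x. f x + f' x) (\<lambda>x. g x + g' x)"
proof (rule wdI_nat[OF b])
 note s = wd_sq[OF 1] wd_sq[OF 2]
 show "sq (\<lambda>x. f x + f' x)" "sq (\<lambda>x. g x + g' x)" using s by (auto intro: sq_add)
 show "(\<lambda>n. n2 (\<lambda>x. dq b (inv_nat n) (\<lambda>x. f x + f' x) x - (g x + g' x))) \<longlonglongrightarrow> 0"
 proof (rule tendsto_zero_le[OF tendsto_add_zero[OF wd_seq_nat[OF b 1] wd_seq_nat[OF b 2]]])
  have "(\<lambda>x. dq b h (\<lambda>x. f x + f' x) x - (g x + g' x)) = (\<lambda>x. (dq b h f x - g x) + (dq b h f' x - g' x))" for h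
   by (auto simp: dq_def add_divide_distrib diff_divide_distrib fun_eq_iff)
  then show "\<forall>\<^sub>F n in sequentially. n2 (\<lambda>x. dq b (inv_nat n) (\<lambda>x. f x + f' x) x - (g x + g' x))
    \<le> n2 (\<lambda>x. dq b (inv_nat n) f x - g x) + n2 (\<lambda>x. dq b (inv_nat n) f' x - g' x)"
   using n2_triangle[OF sq_diff[OF sq_dq[OF s(1)] s(2)] sq_diff[OF sq_dq[OF s(3)] s(4)]] by simp
 qed simp
qed

lemma wd_cmult:
 assumes b: "b \<in> Basis" and 1: "wd b f g"
 shows "wd b (\<lambda>x. c * f x) (\<lambda>x. c * g x)"
proof (rule wdI_nat[OF b])
 note s = wd_sq[OF 1]
 show "sq (\<lambda>x. c * f x)" "sq (\<lambda>x. c * g x)" using s by (auto intro: sq_cmult)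
 have "(\<lambda>x. dq b h (\<lambda>x. c * f x) x - c * g x) = (\<lambda>x. c * (dq b h f x - g x))" for h
  by (auto simp: dq_def fun_eq_iff field_simps)
 then show "(\<lambda>n. n2 (\<lambda>x. dq b (inv_nat n) (\<lambda>x. c * f x) x - c * g x)) \<longlonglongrightarrow> 0"
  using tendsto_mult_right_zero[OF wd_seq_nat[OF b 1]] by (simp add: n2_cmult)
qed

lemma wd_diff:
 assumes "b \<in> Basis" "wd b f g" "wd b f' g'"
 shows "wd b (\<lambda>x. f x - f' x) (\<lambda>x. g x - g' x)"
 using wd_add[OF assms(1,2) wd_cmult[OF assms(1,3), of "-1"]] by simp

lemma wd_cnj:
 assumes b: "b \<in> Basis" and 1: "wd b f g"
 shows "wd b (\<lambda>x. cnj (f x)) (\<lambda>x. cnj (g x))"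
proof (rule wdI_nat[OF b])
 note s = wd_sq[OF 1]
 show "sq (\<lambda>x. cnj (f x))" "sq (\<lambda>x. cnj (g x))" using s by (auto intro: sq_cnj)
 have "(\<lambda>x. dq b h (\<lambda>x. cnj (f x)) x - cnj (g x)) = (\<lambda>x. cnj (dq b h f x - g x))" for h
  by (auto simp: dq_def fun_eq_iff)
 then show "(\<lambda>n. n2 (\<lambda>x. dq b (inv_nat n) (\<lambda>x. cnj (f x)) x - cnj (g x))) \<longlonglongrightarrow> 0"
  using wd_seq_nat[OF b 1] by (simp del: complex_cnj_diff)
qed

lemma wd_translate:
 assumes b: "b \<in> Basis" and 1: "wd b f g"
 shows "wd b (\<lambda>x. f (x + t)) (\<lambda>x. g (x + t))"
proof (rule wdI_nat[OF b])
 note s = wd_sq[OF 1]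
 show "sq (\<lambda>x. f (x + t))" "sq (\<lambda>x. g (x + t))" using s by (auto intro: sq_translate)
 have "n2 (\<lambda>x. dq b h (\<lambda>x. f (x + t)) x - g (x + t)) = n2 (\<lambda>x. dq b h f x - g x)" for h
  using n2_translate[OF sq_diff[OF sq_dq[OF s(1)] s(2)], of b h t] by (simp add: dq_def algebra_simps)
 then show "(\<lambda>n. n2 (\<lambda>x. dq b (inv_nat n) (\<lambda>x. f (x + t)) x - g (x + t))) \<longlonglongrightarrow> 0"
  using wd_seq_nat[OF b 1] by simp
qed

lemma wd_mult:
 fixes p \<psi>' :: "'a::euclidean_space \<Rightarrow> real"
 assumes b: "b \<in> Basis" and 1: "wd b f g"
  and m: "continuous_on UNIV p" "\<psi>' \<in> borel_measurable borel"
  and D: "\<And>x s. ((\<lambda>s. p (x + s *\<^sub>R b)) has_vector_derivative \<psi>' (x + s *\<^sub>R b)) (at s)"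
  and C: "\<And>x. \<bar>p x\<bar> \<le> C" and C': "\<And>x. \<bar>\<psi>' x\<bar> \<le> C'"
 shows "wd b (\<lambda>x. of_real (p x) * f x) (\<lambda>x. of_real (p x) * g x + of_real (\<psi>' x) * f x)"
proof (rule wdI_nat[OF b])
 note s = wd_sq[OF 1]
 let ?F = "\<lambda>n x. dq b (inv_nat n) (\<lambda>x. of_real (p x) * f x) x - (of_real (p x) * g x + of_real (\<psi>' x) * f x)" and ?d = "\<lambda>n x. p (x + inv_nat n *\<^sub>R b) - p x"
 note [measurable] = s
 have [measurable]: "p \<in> borel_measurable borel" "\<psi>' \<in> borel_measurable borel"
  using m by (auto intro: borel_measurable_continuous_onI)
 have C0: "C \<ge> 0" "C' \<ge> 0" using C[of 0] C'[of 0] by linarith+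
 have b1: "sq (\<lambda>x. of_real (\<phi> x) * F x)" "n2 (\<lambda>x. of_real (\<phi> x) * F x) \<le> K * n2 F"
  if "sq F" "\<phi> \<in> borel_measurable borel" "\<And>x. \<bar>\<phi> x\<bar> \<le> K" "K \<ge> 0" for \<phi> :: "'a \<Rightarrow> real" and F :: "'a \<Rightarrow> complex" and K
 proof -
  note [measurable] = that(1)
  have bd: "norm (of_real (\<phi> x) * F x) \<le> K * norm (F x)" for x
   using that(3)[of x] by (simp add: norm_mult mult_right_mono)
  show "sq (\<lambda>x. of_real (\<phi> x) * F x)" "n2 (\<lambda>x. of_real (\<phi> x) * F x) \<le> K * n2 F"
   using sq_bound[OF that(1) _ bd that(4)] that(2) by auto
 qed
 show "sq (\<lambda>x. of_real (p x) * f x)" using b1(1)[OF s(1) _ C C0(1)] by simp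
 show "sq (\<lambda>x. of_real (p x) * g x + of_real (\<psi>' x) * f x)"
  using b1(1)[OF s(2) _ C C0(1)] b1(1)[OF s(1) _ C' C0(2)] by (intro sq_add) auto
 define q where "q n x = (?d n x) / inv_nat n" for n x
 have [measurable]: "q n \<in> borel_measurable borel" for n unfolding q_def[abs_def] by measurable
 have qb: "\<bar>q n x\<bar> \<le> C'" for n x
  using line_Lipschitz[OF D, of C' x "inv_nat n"] C' by (simp add: q_def abs_divide pos_divide_le_eq mult.commute)
 have ql: "(\<lambda>n. q n x) \<longlonglongrightarrow> \<psi>' x" for x
 proof -
  have D0: "((\<lambda>s. complex_of_real (p (x + s *\<^sub>R b))) has_vector_derivative of_real (\<psi>' x)) (at 0)"
   using has_vector_derivative_of_real[of "\<lambda>s. p (x + s *\<^sub>R b)" "\<psi>' x"] D[of x 0]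
   by (simp add: has_real_derivative_iff_has_vector_derivative)
  have "(\<lambda>n. dq b (inv_nat n) (\<lambda>x. complex_of_real (p x)) x) \<longlonglongrightarrow> of_real (\<psi>' x)"
   by (rule line_derivative_dq[OF D0 inv_nat_tendsto]) simp
  then have "(\<lambda>n. Re (dq b (inv_nat n) (\<lambda>x. complex_of_real (p x)) x)) \<longlonglongrightarrow> Re (of_real (\<psi>' x))"
   by (rule tendsto_Re)
  moreover have "Re (dq b (inv_nat n) (\<lambda>x. complex_of_real (p x)) x) = q n x" for n
  proof -
   have "dq b (inv_nat n) (\<lambda>x. complex_of_real (p x)) x = of_real (q n x)"
    unfolding dq_def q_def by simp
   then show ?thesis by simp
  qed
  ultimately show ?thesis by simp
 qed
 have cl: "(\<lambda>n. p (x + inv_nat n *\<^sub>R b)) \<longlonglongrightarrow> p x" for x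
 proof -
  have "(\<lambda>n. x + inv_nat n *\<^sub>R b) \<longlonglongrightarrow> x + 0 *\<^sub>R b"
   by (intro tendsto_intros inv_nat_tendsto)
  then show ?thesis using continuous_on_tendsto_compose[OF m(1)] by simp
 qed
 have L2: "(\<lambda>n. n2 (\<lambda>x. of_real (?d n x) * g x)) \<longlonglongrightarrow> 0"
 proof (rule n2_dominated_convergence[OF sq_cmult[OF s(2), of "of_real (2 * C)"]])
  have "(\<lambda>n. complex_of_real (?d n x) * g x) \<longlonglongrightarrow> of_real (p x - p x) * g x" for x
   by (intro tendsto_intros cl)
  then show "AE x in lborel. (\<lambda>n. complex_of_real (?d n x) * g x) \<longlonglongrightarrow> 0" by simp
  have "\<bar>?d n x\<bar> \<le> 2 * C" for n x
   using C[of x] C[of "x + inv_nat n *\<^sub>R b"] by linarith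
  then show "norm (complex_of_real (?d n x) * g x) \<le> norm (complex_of_real (2 * C) * g x)" for n x
   using C0 by (simp only: norm_mult norm_of_real) (simp add: mult_right_mono)
 qed measurable
 have L3: "(\<lambda>n. n2 (\<lambda>x. of_real (q n x - \<psi>' x) * f x)) \<longlonglongrightarrow> 0"
 proof (rule n2_dominated_convergence[OF sq_cmult[OF s(1), of "of_real (2 * C')"]])
  have "(\<lambda>n. complex_of_real (q n x - \<psi>' x) * f x) \<longlonglongrightarrow> of_real (\<psi>' x - \<psi>' x) * f x" for x
   by (intro tendsto_intros ql)
  then show "AE x in lborel. (\<lambda>n. complex_of_real (q n x - \<psi>' x) * f x) \<longlonglongrightarrow> 0" by simp
  have "\<bar>q n x - \<psi>' x\<bar> \<le> 2 * C'" for n x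
   using qb[of n x] C'[of x] by linarith
  then show "norm (complex_of_real (q n x - \<psi>' x) * f x) \<le> norm (complex_of_real (2 * C') * f x)" for n x
   using C0 by (simp only: norm_mult norm_of_real) (simp add: mult_right_mono)
 qed measurable
 have L1: "(\<lambda>n. C * n2 (\<lambda>x. dq b (inv_nat n) f x - g x)) \<longlonglongrightarrow> 0"
  by (rule tendsto_mult_right_zero[OF wd_seq_nat[OF b 1]])
 show "(\<lambda>n. n2 (?F n)) \<longlonglongrightarrow> 0"
 proof (rule tendsto_zero_le[OF tendsto_add_zero[OF tendsto_add_zero[OF L1 L2] L3] always_eventually[OF allI]])
  show "n2 (?F n) \<le>
   C * n2 (\<lambda>x. dq b (inv_nat n) f x - g x) + n2 (\<lambda>x. of_real (?d n x) * g x)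
   + n2 (\<lambda>x. of_real (q n x - \<psi>' x) * f x)" for n
  proof -
   \<comment> \<open>Discrete product rule: the first term is small because the quotients of f
     converge, the other two by dominated convergence.\<close>
   have "(?F n) =
    (\<lambda>x. of_real (p (x + inv_nat n *\<^sub>R b)) * (dq b (inv_nat n) f x - g x) +
      of_real (?d n x) * g x + of_real (q n x - \<psi>' x) * f x)"
    by (auto simp: fun_eq_iff dq_def q_def field_simps)
   then have "n2 (?F n) \<le>
    n2 (\<lambda>x. of_real (p (x + inv_nat n *\<^sub>R b)) * (dq b (inv_nat n) f x - g x)) +
    n2 (\<lambda>x. of_real (?d n x) * g x) + n2 (\<lambda>x. of_real (q n x - \<psi>' x) * f x)"
   proof (simp only:, intro n2_triangle3)
    show "sq (\<lambda>x. of_real (p (x + inv_nat n *\<^sub>R b)) * (dq b (inv_nat n) f x - g x))"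
     by (rule b1(1)[of _ _ C]) (use C C0 s in \<open>auto intro!: sq_diff sq_dq\<close>)
    show "sq (\<lambda>x. of_real (?d n x) * g x)"
    proof (rule b1(1)[of _ _ "2 * C"])
     show "\<bar>?d n x\<bar> \<le> 2 * C" for x
      using C[of x] C[of "x + inv_nat n *\<^sub>R b"] by linarith
    qed (use C0 s in auto)
    show "sq (\<lambda>x. of_real (q n x - \<psi>' x) * f x)"
    proof (rule b1(1)[of _ _ "2 * C'"])
     show "\<bar>q n x - \<psi>' x\<bar> \<le> 2 * C'" for x
      using qb[of n x] C'[of x] by linarith
    qed (use C0 s in auto)
   qed
   also have "n2 (\<lambda>x. of_real (p (x + inv_nat n *\<^sub>R b)) * (dq b (inv_nat n) f x - g x)) \<le> C * n2 (\<lambda>x. dq b (inv_nat n) f x - g x)"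
    by (rule b1(2)) (use C C0 s in \<open>auto intro!: sq_diff sq_dq\<close>)
   finally show ?thesis by simp
  qed
 qed simp
qed

text \<open>The quotient \<open>Q\<close> replaces the increment of f by its linearisation. The
  Lipschitz bound compares it with the true quotient in L^2 and dominates it by |g|;
  differentiability of G at each point gives its pointwise limit.\<close>

lemma wd_chain:
 fixes G :: "complex \<Rightarrow> complex"
 assumes b: "b \<in> Basis" and 1: "wd b f g" and G0: "G 0 = 0"
  and L: "\<And>y z. cmod (G y - G z) \<le> L * cmod (y - z)"
  and G': "\<And>z. (G has_derivative G' z) (at z)"
 shows "wd b (\<lambda>x. G (f x)) (\<lambda>x. G' (f x) (g x))"
proof -
 note s = wd_sq[OF 1]
 have L0: "L \<ge> 0" using order_trans[OF norm_ge_zero L[of 1 0]] by simp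
 have Gc: "continuous_on UNIV G"
  by (intro continuous_at_imp_continuous_on ballI has_derivative_continuous[OF G'])
 have [measurable]: "G \<in> borel_measurable borel" using Gc by (rule borel_measurable_continuous_onI)
 note [measurable] = s
 define Q where "Q n x = (G (f x + of_real (inv_nat n) * g x) - G (f x)) / of_real (inv_nat n)" for n x
 have [measurable]: "Q n \<in> borel_measurable borel" for n unfolding Q_def[abs_def] by measurable
 have Qb: "cmod (Q n x) \<le> L * cmod (g x)" for n x
  using L[of "f x + of_real (inv_nat n) * g x" "f x"]
  by (simp add: Q_def norm_divide norm_mult pos_divide_le_eq ac_simps)
 have Ql: "(\<lambda>n. Q n x) \<longlonglongrightarrow> G' (f x) (g x)" for x
 proof -
  have "((\<lambda>s. G (f x + s *\<^sub>R g x)) has_derivative (\<lambda>s. G' (f x + 0 *\<^sub>R g x) (s *\<^sub>R g x))) (at 0)"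
   by (rule has_derivative_compose[OF _ G']) (auto intro!: derivative_eq_intros)
  then have "((\<lambda>s. G (f x + s *\<^sub>R g x)) has_vector_derivative G' (f x) (g x)) (at 0)"
   using linear_cmul[OF has_derivative_linear[OF G']] by (simp add: has_vector_derivative_def)
  \<comment> \<open>Rewritten as a function on the space \<open>real\<close> with basis vector 1, so
    that \<open>line_derivative_dq\<close> applies.\<close>
  then have "((\<lambda>s. (\<lambda>y. G (f x + of_real (y \<bullet> 1) * g x)) (0 + s *\<^sub>R (1::real))) has_vector_derivative G' (f x) (g x)) (at 0)"
   by (simp add: scaleR_conv_of_real)
  from line_derivative_dq[OF this inv_nat_tendsto]
  show ?thesis by (simp add: dq_def Q_def[abs_def])
 qed
 \<comment> \<open>G' comes without measurability; the composition is a pointwise limit of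
   measurable quotients.\<close>
 have [measurable]: "(\<lambda>x. G' (f x) (g x)) \<in> borel_measurable borel"
  by (rule borel_measurable_LIMSEQ_metric[OF _ Ql]) measurable
 have G'b: "cmod (G' (f x) (g x)) \<le> L * cmod (g x)" for x
  by (rule LIMSEQ_le_const2[OF tendsto_norm[OF Ql]]) (use Qb in blast)
 have sG': "sq (\<lambda>x. G' (f x) (g x))" using sq_bound(1)[OF s(2) _ G'b L0] by auto
 have Gf: "cmod (G (f x)) \<le> L * cmod (f x)" for x using L[of "f x" 0] G0 by simp
 have sG: "sq (\<lambda>x. G (f x))" using sq_bound(1)[OF s(1) _ Gf L0] by simp
 have lim2: "(\<lambda>n. n2 (\<lambda>x. Q n x - G' (f x) (g x))) \<longlonglongrightarrow> 0"
 proof (rule n2_dominated_convergence[OF sq_cmult[OF s(2), of "of_real (2 * L)"]])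
  show "AE x in lborel. (\<lambda>n. Q n x - G' (f x) (g x)) \<longlonglongrightarrow> 0" using LIM_zero[OF Ql] by simp
  show "norm (Q n x - G' (f x) (g x)) \<le> norm (complex_of_real (2 * L) * g x)" for n x
   using norm_triangle_ineq4[of "Q n x" "G' (f x) (g x)"] Qb[of n x] G'b[of x] L0 by (simp add: norm_mult)
 qed measurable
 show "wd b (\<lambda>x. G (f x)) (\<lambda>x. G' (f x) (g x))"
 proof (rule wdI_nat[OF b sG sG'])
  show "(\<lambda>n. n2 (\<lambda>x. dq b (inv_nat n) (\<lambda>x. G (f x)) x - G' (f x) (g x))) \<longlonglongrightarrow> 0"
  proof (rule tendsto_zero_le[OF tendsto_add_zero[OF tendsto_mult_right_zero[OF wd_seq_nat[OF b 1], of L] lim2] always_eventually[OF allI]])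
   show "n2 (\<lambda>x. dq b (inv_nat n) (\<lambda>x. G (f x)) x - G' (f x) (g x)) \<le>
    L * n2 (\<lambda>x. dq b (inv_nat n) f x - g x) + n2 (\<lambda>x. Q n x - G' (f x) (g x))" for n
   proof -
    have bd: "cmod (dq b (inv_nat n) (\<lambda>x. G (f x)) x - Q n x) \<le> L * cmod (dq b (inv_nat n) f x - g x)" for x
    proof -
     have "cmod (dq b (inv_nat n) (\<lambda>x. G (f x)) x - Q n x) =
      cmod (G (f (x + inv_nat n *\<^sub>R b)) - G (f x + of_real (inv_nat n) * g x)) / inv_nat n"
      by (simp add: dq_def Q_def norm_divide flip: diff_divide_distrib)
     also have "... \<le> L * cmod (f (x + inv_nat n *\<^sub>R b) - (f x + of_real (inv_nat n) * g x)) / inv_nat n"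
      by (intro divide_right_mono L) auto
     also have "cmod (f (x + inv_nat n *\<^sub>R b) - (f x + of_real (inv_nat n) * g x)) / inv_nat n = 
      cmod (dq b (inv_nat n) f x - g x)"
     proof -
      have "dq b (inv_nat n) f x - g x = (f (x + inv_nat n *\<^sub>R b) - (f x + of_real (inv_nat n) * g x)) / of_real (inv_nat n)"
       by (simp add: dq_def field_simps del: of_nat_Suc)
      then show ?thesis by (simp only: norm_divide norm_of_real) simp
     qed
     then have "L * cmod (f (x + inv_nat n *\<^sub>R b) - (f x + of_real (inv_nat n) * g x)) / inv_nat n = L * cmod (dq b (inv_nat n) f x - g x)"
      by (simp only: times_divide_eq_right[symmetric])
     finally show ?thesis .
    qed
    have sd: "sq (\<lambda>x. dq b (inv_nat n) f x - g x)" by (intro sq_diff sq_dq s)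
    have [measurable]: "dq b (inv_nat n) (\<lambda>x. G (f x)) \<in> borel_measurable borel"
     using sq_dq[OF sG] by (simp add: sq_def)
    note A = sq_bound[OF sd _ bd L0]
    have sQ: "sq (\<lambda>x. Q n x - G' (f x) (g x))"
     by (rule sq_diff[OF sq_bound(1)[OF s(2) _ Qb L0] sG']) measurable
    show ?thesis using n2_triangle[OF A(1) sQ] A(2) by simp
   qed
  qed simp
 qed
qed

text \<open>Difference quotients of a convolution fall on the kernel, where convergence in L^1 is
  enough by Young's inequality.\<close>

lemma wd_conv:
 assumes b: "b \<in> Basis" and k: "ker k" "ker kb" and f: "sq f"
  and lim: "(\<lambda>n. n1 (\<lambda>x. dq b (inv_nat n) k x - kb x)) \<longlonglongrightarrow> 0"
 shows "wd b (conv k f) (conv kb f)"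
proof (rule wdI_nat[OF b])
 show s: "sq (conv k f)" "sq (conv kb f)" using k f by (auto intro: conv_sq)
 have kt: "ker (\<lambda>x. k (x + t))" for t
  using k(1) lborel_integrable_translate_iff[of k t] unfolding ker_def by auto
 have kd: "ker (dq b h k)" for h
  using ker_cmult[OF ker_diff[OF kt k(1)], of "inverse (of_real h)" "h *\<^sub>R b"]
  by (simp add: dq_def[abs_def] field_simps)
 have "dq b h (conv k f) x = conv (dq b h k) f x" for h x
 proof -
  note [measurable] = ker_measurable[OF k(1)] f[THEN sq_measurable]
  have "conv k f (x + t) = conv (\<lambda>x. k (x + t)) f x" for t
   unfolding conv_def
   by (subst lborel_integral_translate[of _ t, symmetric]) (auto simp: algebra_simps)
  then have "dq b h (conv k f) x = (conv (\<lambda>x. k (x + h *\<^sub>R b)) f x - conv k f x) * inverse (of_real h)"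
   by (simp add: dq_def divide_inverse)
  also have "... = conv (\<lambda>x. inverse (of_real h) * (k (x + h *\<^sub>R b) - k x)) f x"
   unfolding conv_cmult_left conv_diff_left[OF kt k(1) f] by simp
  finally show ?thesis by (simp add: dq_def[abs_def] divide_inverse mult.commute)
 qed
 then have "n2 (\<lambda>x. dq b h (conv k f) x - conv kb f x) \<le> n1 (\<lambda>x. dq b h k x - kb x) * n2 f" for h
 proof -
  have "conv (\<lambda>x. dq b h k x - kb x) f = (\<lambda>x. conv (dq b h k) f x - conv kb f x)"
   by (rule ext) (rule conv_diff_left[OF kd k(2) f])
  then show ?thesis
   using conv_sq(2)[OF ker_diff[OF kd k(2)] f, of h] \<open>\<And>h x. dq b h (conv k f) x = conv (dq b h k) f x\<close> by simp
 qed
 then show "(\<lambda>n. n2 (\<lambda>x. dq b (inv_nat n) (conv k f) x - conv kb f x)) \<longlonglongrightarrow> 0"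
  by (intro tendsto_zero_le[OF tendsto_mult_left_zero[OF lim, of "n2 f"]]) auto
qed

section \<open>Complex Gaussian kernels\<close>

lemma integrable_exp_inner:
 assumes c: "c > 0"
 shows "integrable lborel (\<lambda>x::'a::euclidean_space. exp (- c * (x \<bullet> x)))"
proof -
 \<comment> \<open>The standard deviation for which exp(-c t^2) is a multiple of the normal
   density.\<close>
 define s where "s = sqrt (1 / (2 * c))"
 have s: "s > 0" "2 * s^2 = 1 / c" using c by (simp_all add: s_def)
 have "(\<lambda>t. exp (- c * t^2)) = (\<lambda>t. sqrt (2 * pi * s^2) * normal_density 0 s t)"
  using s c by (auto simp: normal_density_def fun_eq_iff)
 then have i1: "integrable lborel (\<lambda>t::real. exp (- c * t^2))"
  using integrable_normal_density[OF s(1)] by simp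
 have "(\<integral>\<^sup>+(x::'a). ennreal (exp (- c * (x \<bullet> x))) \<partial>lborel) = (\<integral>\<^sup>+(x::'a). (\<Prod>b\<in>Basis. ennreal (exp (- c * (x \<bullet> b)^2))) \<partial>lborel)"
 proof (rule nn_integral_cong)
  fix x :: 'a
  have "x \<bullet> x = (\<Sum>b\<in>Basis. (x \<bullet> b)^2)"
   by (subst euclidean_inner) (simp add: power2_eq_square)
  then have "exp (- c * (x \<bullet> x)) = (\<Prod>b\<in>Basis. exp (- c * (x \<bullet> b)^2))"
   by (simp add: exp_sum sum_distrib_left)
  then show "ennreal (exp (- c * (x \<bullet> x))) = (\<Prod>b\<in>Basis. ennreal (exp (- c * (x \<bullet> b)^2)))"
   by (simp add: prod_ennreal)
 qed
 also have "... = (\<Prod>b\<in>(Basis::'a set). (\<integral>\<^sup>+(t::real). ennreal (exp (- c * t^2)) \<partial>lborel))"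
  by (rule nn_integral_lborel_prod) auto
 also have "... < \<infinity>"
  using i1 by (simp add: integrable_iff_bounded power_less_top_ennreal)
 finally show ?thesis by (auto simp: integrable_iff_bounded)
qed

lemma polynomial_le_exp:
 assumes c: "c > 0" shows "\<exists>C>0. \<forall>t\<ge>0. (1 + t) ^ m \<le> C * exp (c * t :: real)"
proof (cases "m = 0")
 case False
 \<comment> \<open>Then k (1 + t) \<le> 1 + c t / m \<le> exp(c t / m), and the m-th power of this
   is the claim.\<close>
 define k where "k = min 1 (c / m)"
 have k: "k > 0" "k \<le> 1" "k \<le> c / m" using c False by (auto simp: k_def)
 show ?thesis
 proof (intro exI[of _ "inverse (k ^ m)"] conjI allI impI)
  fix t :: real assume t: "t \<ge> 0"
  have "k * (1 + t) \<le> 1 + (c / m) * t"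
   using k t mult_right_mono[OF k(3) t] by (simp add: distrib_left)
  also have "... \<le> exp ((c / m) * t)" by (rule exp_ge_add_one_self)
  finally have "(k * (1 + t)) ^ m \<le> exp ((c / m) * t) ^ m"
   using k t by (intro power_mono) auto
  also have "... = exp (c * t)" using False by (simp flip: exp_of_nat_mult)
  finally show "(1 + t) ^ m \<le> inverse (k ^ m) * exp (c * t)"
   using k by (simp only: power_mult_distrib) (simp add: field_simps)
 qed (use k in auto)
qed (use c in \<open>auto intro!: exI[of _ 1]\<close>)

definition gauss0 :: "'a::euclidean_space itself \<Rightarrow> real" where
 "gauss0 _ = (LBINT (x::'a). exp (- (x \<bullet> x) / 4))"

text \<open>Up to the normalisation, which is left implicit in the integral \<open>gauss0\<close>, this is
 \<open>(4\<pi>z)\<^sup>-\<^sup>N\<^sup>/\<^sup>2 e\<^sup>-\<^sup>|\<^sup>x\<^sup>|\<^sup>2\<^sup>/\<^sup>4\<^sup>z\<close>: the heat kernel for real \<open>z\<close>, a regularised Schroedinger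
 kernel for \<open>z = \<epsilon> + it\<close>.\<close>

definition gauss :: "complex \<Rightarrow> 'a::euclidean_space \<Rightarrow> complex" where
 "gauss z x = z powr (- of_real (DIM('a) / 2)) * exp (- of_real (x \<bullet> x) / (4 * z)) / of_real (gauss0 TYPE('a))"

text \<open>This and the next two formulas are the first and second derivatives of
  \<open>gauss z\<close> in the direction b and its derivative in z.\<close>

definition gaussb :: "complex \<Rightarrow> 'a::euclidean_space \<Rightarrow> 'a \<Rightarrow> complex" where
 "gaussb z b x = - of_real (x \<bullet> b) / (2 * z) * gauss z x"

definition gaussbb :: "complex \<Rightarrow> 'a::euclidean_space \<Rightarrow> 'a \<Rightarrow> complex" where
 "gaussbb z b x = (of_real ((x \<bullet> b)^2) / (4 * z^2) - 1 / (2 * z)) * gauss z x"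

definition gaussL :: "complex \<Rightarrow> 'a::euclidean_space \<Rightarrow> complex" where
 "gaussL z x = (of_real (x \<bullet> x) / (4 * z^2) - of_real (DIM('a) / 2) / z) * gauss z x"

lemma gauss0_pos: "gauss0 TYPE('a::euclidean_space) > 0"
proof -
 have i: "integrable lborel (\<lambda>x::'a. exp (- (x \<bullet> x) / 4))"
  using integrable_exp_inner[of "1/4", where 'a='a] by simp
 have "gauss0 TYPE('a) \<noteq> 0"
 proof
  assume "gauss0 TYPE('a) = 0"
  then have "AE x::'a in lborel. exp (- (x \<bullet> x) / 4) = (0::real)"
   unfolding gauss0_def using i by (subst (asm) integral_nonneg_eq_0_iff_AE) simp_all
  then have "AE x::'a in lborel. False" by simp
  then have "emeasure lborel (UNIV::'a set) = 0" by (subst (asm) AE_iff_null) auto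
  then show False by simp
 qed
 then show ?thesis by (simp add: gauss0_def order_less_le)
qed

text \<open>The heat equation for the kernel: \<open>gaussL\<close>, the derivative in z, is also
  the Laplacian in x.\<close>

lemma gaussL_sum: "gaussL z x = (\<Sum>b\<in>Basis. gaussbb z b (x::'a::euclidean_space))"
proof -
 have "x \<bullet> x = (\<Sum>b\<in>Basis. (x \<bullet> b)^2)"
  by (subst euclidean_inner) (simp add: power2_eq_square)
 then have "(\<Sum>b\<in>(Basis::'a set). of_real ((x \<bullet> b)^2) / (4 * z^2) - 1 / (2 * z)) =
  of_real (x \<bullet> x) / (4 * z^2) - of_real (DIM('a) / 2) / z"
  by (simp add: sum_subtractf sum_divide_distrib)
 then show ?thesis
  unfolding gaussL_def gaussbb_def by (simp flip: sum_distrib_right)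
qed

lemma gauss_even [simp]: "gauss z (- x) = gauss z x" by (simp add: gauss_def)
lemma gauss_cnj: "Re z > 0 \<Longrightarrow> cnj (gauss z x) = gauss (cnj z) x"
 by (simp add: gauss_def cnj_powr exp_cnj)

lemma gauss_continuous:
 "continuous_on UNIV (gauss z :: 'a::euclidean_space \<Rightarrow> complex)"
 "continuous_on UNIV (gaussb z b :: 'a \<Rightarrow> complex)"
 "continuous_on UNIV (gaussbb z b :: 'a \<Rightarrow> complex)"
 "continuous_on UNIV (gaussL z :: 'a \<Rightarrow> complex)"
proof -
 show g: "continuous_on UNIV (gauss z :: 'a \<Rightarrow> complex)"
  unfolding gauss_def[abs_def] divide_inverse by (intro continuous_intros)
 show "continuous_on UNIV (gaussb z b :: 'a \<Rightarrow> complex)" "continuous_on UNIV (gaussbb z b :: 'a \<Rightarrow> complex)"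
  "continuous_on UNIV (gaussL z :: 'a \<Rightarrow> complex)"
  unfolding gaussb_def[abs_def] gaussbb_def[abs_def] gaussL_def[abs_def] divide_inverse
  by (intro continuous_intros g)+
qed

lemmas gauss_measurable [measurable] = gauss_continuous[THEN borel_measurable_continuous_onI]

lemma Re_inverse_4z: "Re (1 / (4 * z)) = Re z / (4 * (cmod z)^2)"
proof -
 have "1 / (4 * z) = inverse z / 4"
  by (simp only: divide_divide_eq_left inverse_eq_divide mult.commute)
 then have "Re (1 / (4 * z)) = Re (inverse z) / 4" by (simp only: Re_divide_numeral)
 then show ?thesis by (simp add: cmod_power2)
qed

lemma gauss_norm:
 "cmod (gauss z (x::'a::euclidean_space)) =
  cmod z powr (- (DIM('a) / 2)) * exp (- (Re z / (4 * (cmod z)^2)) * (x \<bullet> x)) / gauss0 TYPE('a)"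
proof -
 have "cmod (exp (- of_real (x \<bullet> x) / (4 * z))) = exp (Re (- of_real (x \<bullet> x) * (1 / (4 * z))))"
  by (simp add: norm_exp_eq_Re)
 also have "Re (- of_real (x \<bullet> x) * (1 / (4 * z))) = - (Re (1 / (4 * z))) * (x \<bullet> x)"
 proof -
  have "Re (of_real r * w) = r * Re w" for r w by simp
  from this[of "- (x \<bullet> x)" "1 / (4 * z)"] show ?thesis by (simp only: of_real_minus mult.commute mult_minus_left)
 qed
 finally show ?thesis
  using gauss0_pos[where 'a='a]
  by (simp add: gauss_def norm_mult norm_divide norm_powr_real_powr' Re_inverse_4z)
qed

lemma gauss_norm_le:
 assumes "Re z > 0"
 shows "cmod (gauss z (x::'a::euclidean_space)) \<le> cmod z powr (- (DIM('a) / 2)) / gauss0 TYPE('a)"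
 unfolding gauss_norm using assms gauss0_pos[where 'a='a]
 by (intro divide_right_mono mult_right_le_one_le) auto

text \<open>A single real Gaussian dominates the kernel and its derivatives for all times in a disc
  around z; it serves as majorant when differentiating in x or z under the integral.\<close>

lemma gauss_dominated:
 assumes z: "Re z > 0"
 shows "\<exists>C>0. \<exists>c>0. \<forall>w. cmod (w - z) \<le> Re z / 2 \<longrightarrow> (\<forall>x::'a::euclidean_space. \<forall>b\<in>Basis.
  cmod (gauss w x) \<le> C * exp (- c * (x \<bullet> x)) \<and> cmod (gaussb w b x) \<le> C * exp (- c * (x \<bullet> x)) \<and>
  cmod (gaussbb w b x) \<le> C * exp (- c * (x \<bullet> x)) \<and> cmod (gaussL w x) \<le> C * exp (- c * (x \<bullet> x)))"
proof -
 \<comment> \<open>On the disc, Re w \<ge> r and r \<le> |w| \<le> R, so the Gaussian decays at a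
   rate of at least r / (4 R^2) = 2 c. Half of this absorbs the factor 1 + |x|^2, and
   \<open>B\<close> collects the coefficients of the polynomials.\<close>
 define r where "r = Re z / 2"
 define R where "R = cmod z + r"
 define c where "c = r / (8 * R^2)"
 let ?N = "real DIM('a)"
 define A where "A = r powr (- (?N / 2)) / gauss0 TYPE('a)"
 define B where "B = 1 + 1 / (2 * r) + 1 / (4 * r^2) + ?N / (2 * r)"
 have r: "r > 0" using z by (simp add: r_def)
 have R: "R > 0" using r by (simp add: R_def add_nonneg_pos)
 have c: "c > 0" using r R by (simp add: c_def)
 have A: "A > 0" using r gauss0_pos[where 'a='a] by (simp add: A_def)
 have B: "B \<ge> 1" using r by (simp add: B_def)
 obtain P where P: "P > 0" "\<And>t. t \<ge> 0 \<Longrightarrow> (1 + t) ^ 1 \<le> P * exp (c * t)"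
  using polynomial_le_exp[OF c, of 1] by blast
 have main: "cmod (p * gauss w x) \<le> B * A * P * exp (- c * (x \<bullet> x))"
  if w: "cmod (w - z) \<le> Re z / 2" and p: "cmod p \<le> B * (1 + x \<bullet> x)" for w p and x :: 'a
 proof -
  have "Re z - Re w \<le> r" using w abs_Re_le_cmod[of "w - z"] by (simp add: r_def)
  then have rw: "Re w \<ge> r" by (simp add: r_def)
  have rw': "cmod w \<ge> r" using rw complex_Re_le_cmod[of w] by linarith
  have Rw: "cmod w \<le> R" using w norm_triangle_ineq2[of w z] by (simp add: R_def r_def)
  have "2 * c = r / (4 * R^2)" by (simp add: c_def)
  also have "... \<le> Re w / (4 * (cmod w)^2)"
   using rw rw' Rw r R by (intro frac_le mult_left_mono power_mono) auto
  finally have e: "exp (- (Re w / (4 * (cmod w)^2)) * (x \<bullet> x)) \<le> exp (- (2 * c) * (x \<bullet> x))"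
   using mult_right_mono[of "2 * c" "Re w / (4 * (cmod w)^2)" "x \<bullet> x"] by simp
  have "cmod w powr (- (?N / 2)) \<le> r powr (- (?N / 2))"
   using r rw' by (intro powr_mono2') auto
  then have g: "cmod (gauss w x) \<le> A * exp (- (2 * c) * (x \<bullet> x))"
   unfolding gauss_norm A_def using e gauss0_pos[where 'a='a]
   by (auto simp: divide_simps intro!: mult_mono)
  have "cmod (p * gauss w x) \<le> (B * (1 + x \<bullet> x)) * (A * exp (- (2 * c) * (x \<bullet> x)))"
   unfolding norm_mult using B by (intro mult_mono p g) auto
  also have "... \<le> (B * (P * exp (c * (x \<bullet> x)))) * (A * exp (- (2 * c) * (x \<bullet> x)))"
   using B A P(2)[of "x \<bullet> x"] by (intro mult_right_mono mult_left_mono) auto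
  also have "... = B * A * P * exp (- c * (x \<bullet> x))"
   by (simp add: mult_ac flip: exp_add)
  finally show ?thesis .
 qed
 have w2: "1 / (2 * cmod w) \<le> 1 / (2 * r)" "1 / (4 * (cmod w)^2) \<le> 1 / (4 * r^2)" "?N / (2 * cmod w) \<le> ?N / (2 * r)"
  if "cmod (w - z) \<le> Re z / 2" for w
 proof -
  have "Re z - Re w \<le> r" using that abs_Re_le_cmod[of "w - z"] by (simp add: r_def)
  then have "cmod w \<ge> r" using complex_Re_le_cmod[of w] by (simp add: r_def)
  then show "1 / (2 * cmod w) \<le> 1 / (2 * r)" "1 / (4 * (cmod w)^2) \<le> 1 / (4 * r^2)" "?N / (2 * cmod w) \<le> ?N / (2 * r)"
   using r by (auto intro!: divide_left_mono mult_pos_pos power_mono)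
 qed
 have xb: "\<bar>x \<bullet> b\<bar> \<le> 1 + x \<bullet> x" "(x \<bullet> b)^2 \<le> 1 + x \<bullet> x" if "b \<in> Basis" for x b :: 'a
 proof -
  have n: "\<bar>x \<bullet> b\<bar> \<le> norm x" using that by (rule Basis_le_norm)
  have "2 * norm x \<le> (norm x)^2 + 1" using zero_le_power2[of "norm x - 1"] by (simp add: power2_diff)
  then have "norm x \<le> 1 + (norm x)^2" using norm_ge_zero[of x] by linarith
  then show "\<bar>x \<bullet> b\<bar> \<le> 1 + x \<bullet> x" using n by (simp add: power2_norm_eq_inner)
  have "(x \<bullet> b)^2 \<le> (norm x)^2" using n by (metis abs_ge_zero power2_abs power_mono)
  then show "(x \<bullet> b)^2 \<le> 1 + x \<bullet> x" by (simp add: power2_norm_eq_inner)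
 qed
 let ?C = "B * A * P"
 have "cmod (gauss w x) \<le> ?C * exp (- c * (x \<bullet> x)) \<and> cmod (gaussb w b x) \<le> ?C * exp (- c * (x \<bullet> x)) \<and>
  cmod (gaussbb w b x) \<le> ?C * exp (- c * (x \<bullet> x)) \<and> cmod (gaussL w x) \<le> ?C * exp (- c * (x \<bullet> x))"
  if w: "cmod (w - z) \<le> Re z / 2" and b: "b \<in> Basis" for w and x b :: 'a
 proof (intro conjI)
  note ww = w2[OF w]
  have x0: "0 \<le> x \<bullet> x" by simp
  have N1: "?N \<ge> 1" by simp
  show "cmod (gauss w x) \<le> ?C * exp (- c * (x \<bullet> x))"
   using main[OF w, of 1 x] mult_mono[OF B, of 1 "1 + x \<bullet> x"] B by simp
  show "cmod (gaussb w b x) \<le> ?C * exp (- c * (x \<bullet> x))"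
   unfolding gaussb_def
  proof (rule main[OF w])
   have "cmod (- of_real (x \<bullet> b) / (2 * w)) = (1 / (2 * cmod w)) * \<bar>x \<bullet> b\<bar>"
    by (simp add: norm_divide norm_mult)
   also have "... \<le> (1 / (2 * r)) * (1 + x \<bullet> x)" using xb(1)[OF b] ww r by (intro mult_mono) auto
   also have "... \<le> B * (1 + x \<bullet> x)" using r by (intro mult_right_mono) (auto simp: B_def)
   finally show "cmod (- of_real (x \<bullet> b) / (2 * w)) \<le> B * (1 + x \<bullet> x)" .
  qed
  show "cmod (gaussbb w b x) \<le> ?C * exp (- c * (x \<bullet> x))"
   unfolding gaussbb_def
  proof (rule main[OF w])
   have "cmod (of_real ((x \<bullet> b)^2) / (4 * w^2) - 1 / (2 * w)) \<le> (1 / (4 * (cmod w)^2)) * (x \<bullet> b)^2 + 1 / (2 * cmod w)"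
    using norm_triangle_ineq4[of "of_real ((x \<bullet> b)^2) / (4 * w^2)" "1 / (2 * w)"]
    by (simp add: norm_divide norm_mult norm_power)
   also have "... \<le> (1 / (4 * r^2)) * (1 + x \<bullet> x) + (1 / (2 * r)) * (1 + x \<bullet> x)"
    using xb(2)[OF b] ww r mult_mono[of 1 1 1 "1 + x \<bullet> x"]
    by (intro add_mono mult_mono order_trans[OF ww(1)]) (auto simp: divide_simps)
   also have "... \<le> B * (1 + x \<bullet> x)"
    unfolding distrib_right[symmetric] using r by (intro mult_right_mono) (auto simp: B_def)
   finally show "cmod (of_real ((x \<bullet> b)^2) / (4 * w^2) - 1 / (2 * w)) \<le> B * (1 + x \<bullet> x)" .
  qed
  show "cmod (gaussL w x) \<le> ?C * exp (- c * (x \<bullet> x))"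
   unfolding gaussL_def
  proof (rule main[OF w])
   have "cmod (of_real (x \<bullet> x) / (4 * w^2) - of_real (DIM('a) / 2) / w) \<le> (1 / (4 * (cmod w)^2)) * (x \<bullet> x) + ?N / (2 * cmod w)"
    using norm_triangle_ineq4[of "of_real (x \<bullet> x) / (4 * w^2)" "of_real (DIM('a) / 2) / w"]
    by (simp add: norm_divide norm_mult norm_power)
   also have "... \<le> (1 / (4 * r^2)) * (1 + x \<bullet> x) + (?N / (2 * r)) * (1 + x \<bullet> x)"
    using ww r mult_mono[of "?N / (2 * r)" "?N / (2 * r)" 1 "1 + x \<bullet> x"]
    by (intro add_mono mult_mono order_trans[OF ww(3)]) auto
   also have "... \<le> B * (1 + x \<bullet> x)"
    unfolding distrib_right[symmetric] using r by (intro mult_right_mono) (auto simp: B_def)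
   finally show "cmod (of_real (x \<bullet> x) / (4 * w^2) - of_real (DIM('a) / 2) / w) \<le> B * (1 + x \<bullet> x)" .
  qed
 qed
 moreover have "?C > 0" using A B P by simp
 ultimately show ?thesis using c by blast
qed

lemma ker_exp_bound:
 assumes [measurable]: "k \<in> borel_measurable borel" and c: "c > 0" and k: "\<And>x::'a::euclidean_space. cmod (k x) \<le> C * exp (- c * (x \<bullet> x))"
 shows "ker k"
proof -
 have i: "integrable lborel (\<lambda>x::'a. C * exp (- c * (x \<bullet> x)))" by (intro integrable_mult_right integrable_exp_inner c)
 have C0: "C \<ge> 0" using order_trans[OF norm_ge_zero k[of 0]] by simp
 have "cmod (k x) \<le> C" for x
  using k[of x] mult_left_mono[of "exp (- c * (x \<bullet> x))" 1 C] C0 c by simp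
 then show ?thesis using integrable_dominated[OF i _ k] unfolding ker_def by auto
qed

lemma ker_gauss [simp]:
 assumes z: "Re z > 0"
 shows "ker (gauss z :: 'a::euclidean_space \<Rightarrow> complex)" "ker (gaussL z :: 'a \<Rightarrow> complex)"
  "(b::'a) \<in> Basis \<Longrightarrow> ker (gaussb z b)" "b \<in> Basis \<Longrightarrow> ker (gaussbb z b)"
proof -
 obtain C c where C: "c > 0" "\<And>w x b. cmod (w - z) \<le> Re z / 2 \<Longrightarrow> (b::'a) \<in> Basis \<Longrightarrow>
  cmod (gauss w x) \<le> C * exp (- c * (x \<bullet> x)) \<and> cmod (gaussb w b x) \<le> C * exp (- c * (x \<bullet> x)) \<and>
  cmod (gaussbb w b x) \<le> C * exp (- c * (x \<bullet> x)) \<and> cmod (gaussL w x) \<le> C * exp (- c * (x \<bullet> x))"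
  using gauss_dominated[OF z, where 'a='a] by blast
 obtain b0 :: 'a where b0: "b0 \<in> Basis" using nonempty_Basis by blast
 show "ker (gauss z :: 'a \<Rightarrow> complex)" "ker (gaussL z :: 'a \<Rightarrow> complex)"
  by (rule ker_exp_bound[OF _ C(1), of _ C]; use C(2)[OF _ b0, of z] z in simp)+
 show "ker (gaussb z b)" "ker (gaussbb z b)" if "b \<in> Basis"
  by (rule ker_exp_bound[OF _ C(1), of _ C]; use C(2)[OF _ that, of z] z in simp)+
qed

lemma n1_dominated_convergence:
 fixes k :: "nat \<Rightarrow> 'a::euclidean_space \<Rightarrow> complex"
 assumes [measurable]: "\<And>n. k n \<in> borel_measurable borel" and c: "c > 0"
  and lim: "\<And>x. (\<lambda>n. k n x) \<longlonglongrightarrow> 0" and bd: "\<And>n x. cmod (k n x) \<le> C * exp (- c * (x \<bullet> x))"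
 shows "(\<lambda>n. n1 (k n)) \<longlonglongrightarrow> 0"
proof -
 have i: "integrable lborel (\<lambda>x::'a. C * exp (- c * (x \<bullet> x)))" by (intro integrable_mult_right integrable_exp_inner c)
 have "(\<lambda>n. LBINT x. cmod (k n x)) \<longlonglongrightarrow> (\<integral>x. 0 \<partial>(lborel::'a measure))"
  by (rule integral_dominated_convergence[OF _ _ i]) (use bd tendsto_norm_zero[OF lim] in auto)
 then show ?thesis by (simp add: n1_def)
qed

lemma n1_dq_tendsto:
 fixes k k' :: "'a::euclidean_space \<Rightarrow> complex"
 assumes b: "b \<in> Basis" and [measurable]: "k \<in> borel_measurable borel" "k' \<in> borel_measurable borel"
  and D: "\<And>x s. ((\<lambda>s. k (x + s *\<^sub>R b)) has_vector_derivative k' (x + s *\<^sub>R b)) (at s)"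
  and c: "c > 0" and bd: "\<And>x. cmod (k' x) \<le> C * exp (- c * (x \<bullet> x))"
 shows "(\<lambda>n. n1 (\<lambda>x. dq b (inv_nat n) k x - k' x)) \<longlonglongrightarrow> 0"
proof (rule n1_dominated_convergence)
 have C0: "C \<ge> 0" using order_trans[OF norm_ge_zero bd[of 0]] by simp
 let ?C = "C * exp c + C"
 show "c / 2 > 0" using c by simp
 have "(\<lambda>n. dq b (inv_nat n) k x) \<longlonglongrightarrow> k' x" for x
  using line_derivative_dq[OF _ inv_nat_tendsto inv_nat_neq_0, of k x b] D[of x 0] by simp
 then show "(\<lambda>n. dq b (inv_nat n) k x - k' x) \<longlonglongrightarrow> 0" for x by (rule LIM_zero)
 fix n x
 have i1: "inv_nat n \<le> 1" by (simp add: inv_nat_def divide_simps)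
 \<comment> \<open>On a segment of length at most 1, |x|^2 \<le> 2 |x + s b|^2 + 2; giving up half
   of the exponent makes the bound uniform in s.\<close>
 have seg: "cmod (k' (x + s *\<^sub>R b)) \<le> C * exp c * exp (- (c / 2) * (x \<bullet> x))" if s: "0 \<le> s" "s \<le> 1" for s
 proof -
  have "norm x \<le> norm (x + s *\<^sub>R b) + 1" using norm_triangle_ineq4[of "x + s *\<^sub>R b" "s *\<^sub>R b"] b s by simp
  then have "(norm x)^2 \<le> (norm (x + s *\<^sub>R b) + 1)^2" by (intro power_mono) auto
  also have "... \<le> 2 * (norm (x + s *\<^sub>R b))^2 + 2"
   using zero_le_power2[of "norm (x + s *\<^sub>R b) - 1"] by (simp add: power2_eq_square algebra_simps)
  finally have "x \<bullet> x \<le> 2 * ((x + s *\<^sub>R b) \<bullet> (x + s *\<^sub>R b)) + 2" by (simp only: power2_norm_eq_inner)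
  then have "c * (x \<bullet> x) \<le> c * (2 * ((x + s *\<^sub>R b) \<bullet> (x + s *\<^sub>R b)) + 2)"
   using c by (intro mult_left_mono) auto
  then have "- c * ((x + s *\<^sub>R b) \<bullet> (x + s *\<^sub>R b)) \<le> c + - (c / 2) * (x \<bullet> x)"
   by (simp add: algebra_simps)
  then have "exp (- c * ((x + s *\<^sub>R b) \<bullet> (x + s *\<^sub>R b))) \<le> exp c * exp (- (c / 2) * (x \<bullet> x))"
   by (simp flip: exp_add)
  then show ?thesis using bd[of "x + s *\<^sub>R b"] C0 mult_left_mono by (fastforce simp: mult.assoc)
 qed
 have "norm (k (x + inv_nat n *\<^sub>R b) - k (x + 0 *\<^sub>R b)) \<le> (C * exp c * exp (- (c / 2) * (x \<bullet> x))) * norm (inv_nat n - 0)"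
 proof (rule differentiable_bound[of "{0..1}"])
  show "((\<lambda>s. k (x + s *\<^sub>R b)) has_derivative (\<lambda>t. t *\<^sub>R k' (x + s *\<^sub>R b))) (at s within {0..1})" for s
   using D[of x s] by (simp add: has_vector_derivative_def has_derivative_at_withinI)
  show "onorm (\<lambda>t. t *\<^sub>R k' (x + s *\<^sub>R b)) \<le> C * exp c * exp (- (c / 2) * (x \<bullet> x))" if "s \<in> {0..1}" for s
  proof (rule onorm_le)
   show "norm (t *\<^sub>R k' (x + s *\<^sub>R b)) \<le> C * exp c * exp (- (c / 2) * (x \<bullet> x)) * norm t" for t
    using mult_left_mono[OF seg[of s], of "\<bar>t\<bar>"] that by (simp add: mult.commute)
  qed
 qed (use i1 in auto)
 then have 1: "cmod (dq b (inv_nat n) k x) \<le> C * exp c * exp (- (c / 2) * (x \<bullet> x))"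
  by (simp add: dq_def norm_divide pos_divide_le_eq)
 have "exp (- c * (x \<bullet> x)) \<le> exp (- (c / 2) * (x \<bullet> x))" using c by (simp add: mult_right_mono)
 then have 2: "cmod (k' x) \<le> C * exp (- (c / 2) * (x \<bullet> x))" using bd[of x] C0 mult_left_mono order_trans by blast
 show "cmod (dq b (inv_nat n) k x - k' x) \<le> ?C * exp (- (c / 2) * (x \<bullet> x))"
  using norm_triangle_ineq4[of "dq b (inv_nat n) k x" "k' x"] 1 2 by (simp add: distrib_right)
qed measurable

lemma gauss_line_derivative:
 assumes b: "b \<in> Basis" and z: "Re z > 0"
 shows "((\<lambda>s. gauss z (x + s *\<^sub>R b)) has_vector_derivative gaussb z b (x + s *\<^sub>R b)) (at s)"
  and "((\<lambda>s. gaussb z b (x + s *\<^sub>R b)) has_vector_derivative gaussbb z b (x + s *\<^sub>R b)) (at s)"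
proof -
 have z0: "z \<noteq> 0" using z by auto
 let ?c = "\<lambda>s. - (of_real (x \<bullet> b) + of_real s) / (2 * z)"
 have bb: "b \<bullet> b = 1" using b by simp
 show 1: "((\<lambda>s. gauss z (x + s *\<^sub>R b)) has_vector_derivative gaussb z b (x + s *\<^sub>R b)) (at s)" for s
 proof -
  let ?q = "\<lambda>u. - (of_real (x \<bullet> x) + 2 * u * of_real (x \<bullet> b) + u^2) / (4 * z) :: complex"
  let ?A = "z powr (- of_real (DIM('a) / 2)) / of_real (gauss0 TYPE('a))"
  have q': "(?q has_field_derivative (?c s)) (at (of_real s))"
   using z0 by (auto intro!: derivative_eq_intros simp: field_simps)
  have "((\<lambda>u. ?A * exp (?q u)) has_field_derivative ?A * (exp (?q (of_real s)) * ?c s)) (at (of_real s))"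
   by (intro DERIV_cmult DERIV_fun_exp q')
  then have "((\<lambda>u. ?A * exp (?q u)) has_field_derivative (?c s) * (?A * exp (?q (of_real s)))) (at (of_real s))"
   by (simp only: mult_ac)
  then have "((\<lambda>s. ?A * exp (?q (of_real s))) has_vector_derivative (?c s) * (?A * exp (?q (of_real s)))) (at s)"
   by (rule has_vector_derivative_real_field)
  moreover have "gauss z (x + s *\<^sub>R b) = ?A * exp (?q (of_real s))" for s
   by (simp add: gauss_def inner_add_left inner_add_right bb inner_commute[of b x] power2_eq_square algebra_simps)
  moreover have "?c s * (?A * exp (?q (of_real s))) = gaussb z b (x + s *\<^sub>R b)"
   using calculation(2) by (simp add: gaussb_def inner_add_left bb)
  ultimately show ?thesis by simp
 qed
 have "((\<lambda>s. ?c s * gauss z (x + s *\<^sub>R b)) has_vector_derivative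
   ?c s * gaussb z b (x + s *\<^sub>R b) + (- 1 / (2 * z)) * gauss z (x + s *\<^sub>R b)) (at s)"
 proof (rule has_vector_derivative_mult[OF _ 1])
  have "((\<lambda>u. - (of_real (x \<bullet> b) + u) / (2 * z)) has_field_derivative (- 1 / (2 * z))) (at (of_real s))"
   using z0 by (auto intro!: derivative_eq_intros)
  then show "((\<lambda>s. - (of_real (x \<bullet> b) + of_real s) / (2 * z)) has_vector_derivative (- 1 / (2 * z))) (at s)"
   by (rule has_vector_derivative_real_field)
 qed
 moreover have "?c s * gaussb z b (x + s *\<^sub>R b) + (- 1 / (2 * z)) * gauss z (x + s *\<^sub>R b)
  = gaussbb z b (x + s *\<^sub>R b)"
  using z0 by (simp add: gaussb_def gaussbb_def inner_add_left bb field_simps power2_eq_square)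
 moreover have "(\<lambda>s. ?c s * gauss z (x + s *\<^sub>R b)) = (\<lambda>s. gaussb z b (x + s *\<^sub>R b))"
  by (auto simp: gaussb_def inner_add_left bb fun_eq_iff)
 ultimately show "((\<lambda>s. gaussb z b (x + s *\<^sub>R b)) has_vector_derivative gaussbb z b (x + s *\<^sub>R b)) (at s)" by simp
qed

lemma gauss_z_derivative:
 assumes z: "Re z > 0"
 shows "((\<lambda>z. gauss z (x::'a::euclidean_space)) has_field_derivative gaussL z x) (at z)"
proof -
 have nz: "z \<notin> \<real>\<^sub>\<le>\<^sub>0" and z0: "z \<noteq> 0" using z by (auto simp: complex_nonpos_Reals_iff)
 let ?s = "- of_real (DIM('a) / 2) :: complex"
 have e: "((\<lambda>z. exp (- of_real (x \<bullet> x) / (4 * z))) has_field_derivative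
   exp (- of_real (x \<bullet> x) / (4 * z)) * (of_real (x \<bullet> x) / (4 * z^2))) (at z)"
  using z0 by (auto intro!: derivative_eq_intros simp: power2_eq_square field_simps)
 have p: "z powr (?s - 1) = z powr ?s / z" using z0 by (simp add: powr_diff)
 have "((\<lambda>z. z powr ?s * exp (- of_real (x \<bullet> x) / (4 * z)) / of_real (gauss0 TYPE('a))) has_field_derivative
   (z powr ?s * (exp (- of_real (x \<bullet> x) / (4 * z)) * (of_real (x \<bullet> x) / (4 * z^2))) +
    ?s * z powr (?s - 1) * exp (- of_real (x \<bullet> x) / (4 * z))) / of_real (gauss0 TYPE('a))) (at z)"
  by (intro DERIV_cdivide DERIV_mult' has_field_derivative_powr[OF nz] e)
 moreover have "(z powr ?s * (exp (- of_real (x \<bullet> x) / (4 * z)) * (of_real (x \<bullet> x) / (4 * z^2))) +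
    ?s * z powr (?s - 1) * exp (- of_real (x \<bullet> x) / (4 * z))) / of_real (gauss0 TYPE('a)) = gaussL z x"
  unfolding p by (simp add: gaussL_def gauss_def algebra_simps add_divide_distrib diff_divide_distrib)
 ultimately show ?thesis by (simp add: gauss_def)
qed

text \<open>The mean value theorem in z on the disc of radius Re z / 2 dominates the quotients.
  Finitely many terms of Z may lie outside the disc and are skipped.\<close>

lemma gauss_z_limits:
 fixes Z :: "nat \<Rightarrow> complex"
 assumes z: "Re z > 0" and Z: "Z \<longlonglongrightarrow> z" "\<And>n. Z n \<noteq> z"
 shows "(\<lambda>n. n1 (\<lambda>x::'a::euclidean_space. (1 / (Z n - z)) * (gauss (Z n) x - gauss z x) - gaussL z x)) \<longlonglongrightarrow> 0"
  and "b \<in> Basis \<Longrightarrow> (\<lambda>n. n1 (\<lambda>x::'a. gaussb (Z n) b x - gaussb z b x)) \<longlonglongrightarrow> 0"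
  and "(\<lambda>n. n1 (\<lambda>x::'a. gauss (Z n) x - gauss z x)) \<longlonglongrightarrow> 0"
proof -
 let ?r = "Re z / 2"
 obtain C c where C: "C > 0" "c > 0" "\<And>w x b. cmod (w - z) \<le> ?r \<Longrightarrow> (b::'a) \<in> Basis \<Longrightarrow>
  cmod (gauss w x) \<le> C * exp (- c * (x \<bullet> x)) \<and> cmod (gaussb w b x) \<le> C * exp (- c * (x \<bullet> x)) \<and>
  cmod (gaussbb w b x) \<le> C * exp (- c * (x \<bullet> x)) \<and> cmod (gaussL w x) \<le> C * exp (- c * (x \<bullet> x))"
  using gauss_dominated[OF z, where 'a='a] by blast
 obtain b0 :: 'a where b0: "b0 \<in> Basis" using nonempty_Basis by blast
 obtain N where N: "\<And>n. n \<ge> N \<Longrightarrow> cmod (Z n - z) < ?r" using LIMSEQ_D[OF Z(1), of ?r] z by auto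
 have Nn: "cmod (Z (n + N) - z) \<le> ?r" for n using N[of "n + N"] by simp
 have zz: "cmod (z - z) \<le> ?r" using z by simp
 have ZN: "(\<lambda>n. Z (n + N)) \<longlonglongrightarrow> z" using Z(1) by (rule LIMSEQ_ignore_initial_segment)
 have D: "((\<lambda>w. gauss w x) has_field_derivative gaussL w x) (at w)" if "cmod (w - z) \<le> ?r" for w and x :: 'a
 proof (rule gauss_z_derivative)
  show "Re w > 0" using that abs_Re_le_cmod[of "w - z"] z by simp
 qed
 have mv: "cmod (gauss w x - gauss z x) \<le> C * exp (- c * (x \<bullet> x)) * cmod (w - z)" if "cmod (w - z) \<le> ?r" for w and x :: 'a
 proof (rule field_differentiable_bound[of "cball z ?r"])
  show "((\<lambda>w. gauss w x) has_field_derivative gaussL y x) (at y within cball z ?r)" if "y \<in> cball z ?r" for y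
   using D[of y x] that by (auto simp: dist_norm norm_minus_commute intro: has_field_derivative_at_within)
  show "cmod (gaussL y x) \<le> C * exp (- c * (x \<bullet> x))" if "y \<in> cball z ?r" for y
   using C(3)[of y b0 x] b0 that by (auto simp: dist_norm norm_minus_commute)
 qed (use that z in \<open>auto simp: dist_norm norm_minus_commute\<close>)
 have "(\<lambda>n. n1 (\<lambda>x::'a. (1 / (Z (n + N) - z)) * (gauss (Z (n + N)) x - gauss z x) - gaussL z x)) \<longlonglongrightarrow> 0"
 proof (rule n1_dominated_convergence[OF _ C(2), of _ "C + C"])
  fix x :: 'a
  have "((\<lambda>w. (gauss w x - gauss z x) / (w - z)) \<longlongrightarrow> gaussL z x) (at z)"
   using D[OF zz, of x] by (simp add: has_field_derivative_iff)
  then have "(\<lambda>n. (gauss (Z (n + N)) x - gauss z x) / (Z (n + N) - z)) \<longlonglongrightarrow> gaussL z x"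
   using ZN Z(2) by (auto simp: tendsto_at_iff_sequentially comp_def)
  then show "(\<lambda>n. (1 / (Z (n + N) - z)) * (gauss (Z (n + N)) x - gauss z x) - gaussL z x) \<longlonglongrightarrow> 0"
   using LIM_zero by fastforce
  fix n
  have "cmod ((1 / (Z (n + N) - z)) * (gauss (Z (n + N)) x - gauss z x)) \<le> C * exp (- c * (x \<bullet> x))"
   using mv[OF Nn[of n], of x] Z(2)[of "n + N"] by (simp add: norm_mult norm_divide divide_simps)
  then show "cmod ((1 / (Z (n + N) - z)) * (gauss (Z (n + N)) x - gauss z x) - gaussL z x) \<le> (C + C) * exp (- c * (x \<bullet> x))"
   using C(3)[OF zz b0, of x] norm_triangle_ineq4[of "(1 / (Z (n + N) - z)) * (gauss (Z (n + N)) x - gauss z x)" "gaussL z x"]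
   by (simp add: distrib_right)
 qed measurable
 then show "(\<lambda>n. n1 (\<lambda>x::'a. (1 / (Z n - z)) * (gauss (Z n) x - gauss z x) - gaussL z x)) \<longlonglongrightarrow> 0"
  by (rule LIMSEQ_offset)
 have lim3: "(\<lambda>n. gauss (Z n) x - gauss z x) \<longlonglongrightarrow> 0" for x :: 'a
  using isCont_tendsto_compose[OF DERIV_isCont[OF D[OF zz, of x]] Z(1)] by (rule LIM_zero)
 have "(\<lambda>n. n1 (\<lambda>x::'a. gauss (Z (n + N)) x - gauss z x)) \<longlonglongrightarrow> 0"
 proof (rule n1_dominated_convergence[OF _ C(2), of _ "C + C"])
  show "(\<lambda>n. gauss (Z (n + N)) x - gauss z x) \<longlonglongrightarrow> 0" for x :: 'a
   using lim3 by (rule LIMSEQ_ignore_initial_segment)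
  show "cmod (gauss (Z (n + N)) x - gauss z x) \<le> (C + C) * exp (- c * (x \<bullet> x))" for n and x :: 'a
   using C(3)[OF zz b0, of x] C(3)[OF Nn b0, of n x] norm_triangle_ineq4[of "gauss (Z (n + N)) x" "gauss z x"]
   by (simp add: distrib_right)
 qed measurable
 then show "(\<lambda>n. n1 (\<lambda>x::'a. gauss (Z n) x - gauss z x)) \<longlonglongrightarrow> 0" by (rule LIMSEQ_offset)
 assume b: "b \<in> Basis"
 have "(\<lambda>n. n1 (\<lambda>x::'a. gaussb (Z (n + N)) b x - gaussb z b x)) \<longlonglongrightarrow> 0"
 proof (rule n1_dominated_convergence[OF _ C(2), of _ "C + C"])
  have z0: "z \<noteq> 0" using z by auto
  have "(\<lambda>n. gauss (Z n) x) \<longlonglongrightarrow> gauss z x" for x :: 'a using lim3 by (simp add: LIM_zero_iff)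
  then have "(\<lambda>n. gaussb (Z n) b x) \<longlonglongrightarrow> gaussb z b x" for x
   unfolding gaussb_def using z0 by (intro tendsto_intros Z(1)) auto
  then show "(\<lambda>n. gaussb (Z (n + N)) b x - gaussb z b x) \<longlonglongrightarrow> 0" for x
   using LIMSEQ_ignore_initial_segment LIM_zero by blast
  show "cmod (gaussb (Z (n + N)) b x - gaussb z b x) \<le> (C + C) * exp (- c * (x \<bullet> x))" for n x
   using C(3)[OF zz b, of x] C(3)[OF Nn b, of n x] norm_triangle_ineq4[of "gaussb (Z (n + N)) b x" "gaussb z b x"]
   by (simp add: distrib_right)
 qed measurable
 then show "(\<lambda>n. n1 (\<lambda>x::'a. gaussb (Z n) b x - gaussb z b x)) \<longlonglongrightarrow> 0" by (rule LIMSEQ_offset)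
qed

text \<open>For Re z > 0 this is the operator exp(z Laplacian).\<close>

definition heat :: "complex \<Rightarrow> ('a::euclidean_space \<Rightarrow> complex) \<Rightarrow> 'a \<Rightarrow> complex" where
 "heat z f = conv (gauss z) f"

lemma heat_sq [simp, intro]: "Re z > 0 \<Longrightarrow> sq f \<Longrightarrow> sq (heat z f)"
 unfolding heat_def by (intro conv_sq ker_gauss)

lemma sq_conv_gauss:
 assumes "Re z > 0" "sq f"
 shows "sq (conv (gaussL z) f)" "b \<in> Basis \<Longrightarrow> sq (conv (gaussbb z b) f)"
 using assms by (auto intro!: conv_sq)

lemma n2_conv_tendsto:
 assumes "(\<lambda>n. n1 (\<lambda>x. K n x - k x)) \<longlonglongrightarrow> 0" "\<And>n. ker (K n)" "ker k" "sq f"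
 shows "(\<lambda>n::nat. n2 (\<lambda>x. conv (K n) f x - conv k f x)) \<longlonglongrightarrow> 0"
proof (rule tendsto_zero_le[OF tendsto_mult_left_zero[OF assms(1), of "n2 f"]])
 have "(\<lambda>x. conv (K n) f x - conv k f x) = conv (\<lambda>x. K n x - k x) f" for n
  using conv_diff_left[OF assms(2,3,4)] by auto
 then show "\<forall>\<^sub>F n in sequentially. n2 (\<lambda>x. conv (K n) f x - conv k f x) \<le> n1 (\<lambda>x. K n x - k x) * n2 f"
  using conv_sq(2)[OF ker_diff[OF assms(2,3)] assms(4)] by simp
qed simp

lemma heat_z_limits:
 fixes Z :: "nat \<Rightarrow> complex" and f :: "'a::euclidean_space \<Rightarrow> complex"
 assumes z: "Re z > 0" and Z: "Z \<longlonglongrightarrow> z" "\<And>n. Z n \<noteq> z" "\<And>n. Re (Z n) > 0" and f: "sq f"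
 shows "(\<lambda>n. n2 (\<lambda>x. (heat (Z n) f x - heat z f x) / (Z n - z) - conv (gaussL z) f x)) \<longlonglongrightarrow> 0"
  and "b \<in> Basis \<Longrightarrow> (\<lambda>n. n2 (\<lambda>x. conv (gaussb (Z n) b) f x - conv (gaussb z b) f x)) \<longlonglongrightarrow> 0"
  and "(\<lambda>n. n2 (\<lambda>x. heat (Z n) f x - heat z f x)) \<longlonglongrightarrow> 0"
proof -
 have kd: "ker (\<lambda>x::'a. 1 / (Z n - z) * (gauss (Z n) x - gauss z x))" for n
  by (intro ker_cmult ker_diff ker_gauss z Z)
 have "conv (\<lambda>x. 1 / (Z n - z) * (gauss (Z n) x - gauss z x)) f x = (heat (Z n) f x - heat z f x) / (Z n - z)" for n x
  unfolding conv_cmult_left conv_diff_left[OF ker_gauss(1)[OF Z(3)] ker_gauss(1)[OF z] f] heat_def by simp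
 then show "(\<lambda>n. n2 (\<lambda>x. (heat (Z n) f x - heat z f x) / (Z n - z) - conv (gaussL z) f x)) \<longlonglongrightarrow> 0"
  using n2_conv_tendsto[OF gauss_z_limits(1)[OF z Z(1,2)] kd ker_gauss(2)[OF z] f] by simp
 show "b \<in> Basis \<Longrightarrow> (\<lambda>n. n2 (\<lambda>x. conv (gaussb (Z n) b) f x - conv (gaussb z b) f x)) \<longlonglongrightarrow> 0"
  by (intro n2_conv_tendsto gauss_z_limits ker_gauss z Z f)
 show "(\<lambda>n. n2 (\<lambda>x. heat (Z n) f x - heat z f x)) \<longlonglongrightarrow> 0"
  unfolding heat_def by (intro n2_conv_tendsto gauss_z_limits ker_gauss z Z f)
qed

lemma wd_heat:
 assumes b: "b \<in> Basis" and z: "Re z > 0" and f: "sq f"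
 shows "wd b (heat z f) (conv (gaussb z b) f)" "wd b (conv (gaussb z b) f) (conv (gaussbb z b) f)"
proof -
 obtain C c where C: "c > 0" "\<And>w x b. cmod (w - z) \<le> Re z / 2 \<Longrightarrow> (b::'a) \<in> Basis \<Longrightarrow>
  cmod (gauss w x) \<le> C * exp (- c * (x \<bullet> x)) \<and> cmod (gaussb w b x) \<le> C * exp (- c * (x \<bullet> x)) \<and>
  cmod (gaussbb w b x) \<le> C * exp (- c * (x \<bullet> x)) \<and> cmod (gaussL w x) \<le> C * exp (- c * (x \<bullet> x))"
  using gauss_dominated[OF z, where 'a='a] by blast
 note B = C(2)[OF _ b, of z] 
 have zz: "cmod (z - z) \<le> Re z / 2" using z by simp
 show "wd b (heat z f) (conv (gaussb z b) f)"
  unfolding heat_def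
  by (rule wd_conv[OF b ker_gauss(1)[OF z] ker_gauss(3)[OF z b] f n1_dq_tendsto[OF b _ _ gauss_line_derivative(1)[OF b z] C(1)]])
   (use B zz in auto)
 show "wd b (conv (gaussb z b) f) (conv (gaussbb z b) f)"
  by (rule wd_conv[OF b ker_gauss(3)[OF z b] ker_gauss(4)[OF z b] f n1_dq_tendsto[OF b _ _ gauss_line_derivative(2)[OF b z] C(1)]])
   (use B zz in auto)
qed

lemma conv_gaussL: 
 assumes "Re z > 0" "sq f"
 shows "conv (gaussL z) f x = (\<Sum>b\<in>Basis. conv (gaussbb z b) f (x::'a::euclidean_space))"
proof -
 have "(gaussL z :: 'a \<Rightarrow> complex) = (\<lambda>x. \<Sum>b\<in>Basis. gaussbb z b x)" using gaussL_sum by auto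
 then show ?thesis using conv_sum_left[of Basis "\<lambda>b. gaussbb z b" f x] assms by simp
qed

text \<open>The Laplacian of the kernel is split into its second derivatives, and one derivative of
  each is moved to g, for which membership in H^1 is enough.\<close>

lemma gaussL_pairing:
 fixes f :: "'a::euclidean_space \<Rightarrow> complex"
 assumes z: "Re z > 0" and f: "sq f" and g: "\<And>b. b \<in> Basis \<Longrightarrow> wd b g (g' b)"
 shows "(LBINT x. conv (gaussL z) f x * g x) = - (\<Sum>b\<in>Basis. LBINT x. conv (gaussb z b) f x * g' b x)"
proof -
 have "(LBINT x. conv (gaussL z) f x * g x) = (LBINT x. (\<Sum>b\<in>Basis. conv (gaussbb z b) f x * g x))"
  by (simp add: conv_gaussL[OF z f] sum_distrib_right)
 also have "... = (\<Sum>b\<in>Basis. LBINT x. conv (gaussbb z b) f x * g x)"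
  by (intro Bochner_Integration.integral_sum sq_CS sq_conv_gauss z f)
   (use g wd_sq nonempty_Basis in blast)+
 also have "... = (\<Sum>b\<in>Basis. - (LBINT x. conv (gaussb z b) f x * g' b x))"
  using wd_pairing[OF _ wd_heat(2)[OF _ z f] g] by (intro sum.cong) auto
 finally show ?thesis by (simp add: sum_negf)
qed

lemma gaussL_symmetric:
 assumes z: "Re z > 0" "Re w > 0" and f: "sq f" and g: "sq g"
 shows "(LBINT x. conv (gaussL z) f x * heat w g x) = (LBINT x. heat z f x * conv (gaussL w) g x)"
 using gaussL_pairing[OF z(1) f wd_heat(1)[OF _ z(2) g]] gaussL_pairing[OF z(2) g wd_heat(1)[OF _ z(1) f]]
 by (simp add: mult.commute)

lemma integral_mult_tendsto2:
 fixes a b :: "'a::euclidean_space \<Rightarrow> complex"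
 assumes A: "(\<lambda>n. n2 (\<lambda>x. A n x - a x)) \<longlonglongrightarrow> 0" "\<And>n. sq (A n)" "sq a"
  and B: "(\<lambda>n. n2 (\<lambda>x. B n x - b x)) \<longlonglongrightarrow> 0" "\<And>n. sq (B n)" "sq b"
 shows "(\<lambda>n::nat. LBINT x. A n x * B n x) \<longlonglongrightarrow> (LBINT x. a x * b x)"
proof -
 have 1: "(\<lambda>n. LBINT x. (A n x - a x) * (B n x - b x)) \<longlonglongrightarrow> 0"
  by (rule Lim_null_comparison[OF _ tendsto_mult_zero[OF A(1) B(1)]])
   (use sq_CS(2)[OF sq_diff[OF A(2,3)] sq_diff[OF B(2,3)]] in simp)
 have 2: "(\<lambda>n. LBINT x. A n x * b x) \<longlonglongrightarrow> (LBINT x. a x * b x)"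
  by (rule integral_mult_tendsto[OF A B(3)])
 have "(\<lambda>n. LBINT x. B n x * a x) \<longlonglongrightarrow> (LBINT x. b x * a x)"
  by (rule integral_mult_tendsto[OF B A(3)])
 then have 3: "(\<lambda>n. LBINT x. a x * B n x) \<longlonglongrightarrow> (LBINT x. a x * b x)" by (simp add: mult.commute)
 have "(LBINT x. A n x * B n x) = (LBINT x. (A n x - a x) * (B n x - b x)) +
   (LBINT x. A n x * b x) + (LBINT x. a x * B n x) - (LBINT x. a x * b x)" for n
  using sq_CS(1)[OF A(2) B(2), of n n] sq_CS(1)[OF A(2) B(3), of n] sq_CS(1)[OF A(3) B(2), of n] sq_CS(1)[OF A(3) B(3)]
  by (simp add: left_diff_distrib right_diff_distrib)
 then show ?thesis using tendsto_diff[OF tendsto_add[OF tendsto_add[OF 1 2] 3] tendsto_const[of "\<integral>x. a x * b x \<partial>lborel"]] by simp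
qed

text \<open>This replaces the semigroup law: only the sum of the two times matters.\<close>

lemma heat_pairing_sum:
 fixes f g :: "'a::euclidean_space \<Rightarrow> complex"
 assumes f: "sq f" and g: "sq g" and re: "Re z > 0" "Re w > 0" "Re z' > 0" "Re w' > 0" and eq: "z + w = z' + w'"
 shows "(LBINT x. heat z f x * heat w g x) = (LBINT x. heat z' f x * heat w' g x)"
proof -
 \<comment> \<open>The time u is moved from the second factor to the first. As a function on the
   strip \<open>D\<close>, \<open>p\<close> has complex derivative 0 because the Laplacian is
   symmetric.\<close>
 define p where "p u = (LBINT x. heat (z + u) f x * heat (w - u) g x)" for u
 define D where "D = {u. Re (z + u) > 0 \<and> Re (w - u) > 0}"
 have "D = {u. - Re z < Re u} \<inter> {u. Re u < Re w}" by (auto simp: D_def)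
 then have cD: "convex D" by (simp add: convex_Int convex_halfspace_Re_gt convex_halfspace_Re_lt)
 have "(p has_field_derivative 0) (at u within D)" if s: "u \<in> D" for u
  unfolding has_field_derivative_iff tendsto_at_iff_sequentially comp_def
 proof (intro allI impI)
  fix S :: "nat \<Rightarrow> complex" assume S: "\<forall>i. S i \<in> D - {u}" "S \<longlonglongrightarrow> u"
  have s': "Re (z + u) > 0" "Re (w - u) > 0" using s by (auto simp: D_def)
  have Sn: "Re (z + S n) > 0" "Re (w - S n) > 0" "S n \<noteq> u" for n using S(1) by (auto simp: D_def)
  have zl: "(\<lambda>n. z + S n) \<longlonglongrightarrow> z + u" "(\<lambda>n. w - S n) \<longlonglongrightarrow> w - u" by (intro tendsto_intros S)+
  have ne: "z + S n \<noteq> z + u" "w - S n \<noteq> w - u" for n using Sn by auto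
  note F = heat_z_limits[OF s'(1) zl(1) ne(1) Sn(1) f] and G = heat_z_limits[OF s'(2) zl(2) ne(2) Sn(2) g]
  let ?A = "\<lambda>n x. (heat (z + S n) f x - heat (z + u) f x) / (z + S n - (z + u))"
  let ?B = "\<lambda>n x. (heat (w - S n) g x - heat (w - u) g x) / (w - S n - (w - u))"
  have sA: "sq (?A n)" for n
   using sq_cmult[OF sq_diff[OF heat_sq[OF Sn(1) f] heat_sq[OF s'(1) f]], of "1 / (z + S n - (z + u))" n] by simp
  have sB: "sq (?B n)" for n
   using sq_cmult[OF sq_diff[OF heat_sq[OF Sn(2) g] heat_sq[OF s'(2) g]], of "1 / (w - S n - (w - u))" n] by simp
  note hs = heat_sq[OF Sn(1) f] heat_sq[OF Sn(2) g] heat_sq[OF s'(1) f] heat_sq[OF s'(2) g]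
  have 1: "(\<lambda>n. LBINT x. ?A n x * heat (w - S n) g x) \<longlonglongrightarrow> (LBINT x. conv (gaussL (z + u)) f x * heat (w - u) g x)"
   by (intro integral_mult_tendsto2 F(1) G(3) sA hs sq_conv_gauss s' f)
  have 2: "(\<lambda>n. LBINT x. ?B n x * heat (z + u) f x) \<longlonglongrightarrow> (LBINT x. conv (gaussL (w - u)) g x * heat (z + u) f x)"
   by (intro integral_mult_tendsto G(1) sB hs sq_conv_gauss s' g)
  have eq: "(p (S n) - p u) / (S n - u) = (LBINT x. ?A n x * heat (w - S n) g x) - (LBINT x. ?B n x * heat (z + u) f x)" for n
  proof -
   have i: "integrable lborel (\<lambda>x. heat (z + S n) f x * heat (w - S n) g x)"
    "integrable lborel (\<lambda>x. heat (z + u) f x * heat (w - S n) g x)"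
    "integrable lborel (\<lambda>x. heat (z + u) f x * heat (w - u) g x)"
    by (intro sq_CS hs)+
   have d: "S n - u \<noteq> 0" using Sn by simp
   have "(LBINT x. ?A n x * heat (w - S n) g x) = (LBINT x. (heat (z + S n) f x * heat (w - S n) g x - heat (z + u) f x * heat (w - S n) g x) / (S n - u))"
    by (intro Bochner_Integration.integral_cong) (auto simp: left_diff_distrib)
   also have "... = (p (S n) - (LBINT x. heat (z + u) f x * heat (w - S n) g x)) / (S n - u)"
    using i by (simp add: p_def)
   finally have a: "(LBINT x. ?A n x * heat (w - S n) g x) = ..." .
   have "(LBINT x. ?B n x * heat (z + u) f x) = (LBINT x. (heat (z + u) f x * heat (w - u) g x - heat (z + u) f x * heat (w - S n) g x) / (S n - u))"
    using d by (intro Bochner_Integration.integral_cong) (auto simp: field_simps)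
   also have "... = (p u - (LBINT x. heat (z + u) f x * heat (w - S n) g x)) / (S n - u)"
    using i by (simp add: p_def)
   finally show ?thesis unfolding a by (simp add: diff_divide_distrib)
  qed
  have "(LBINT x. conv (gaussL (w - u)) g x * heat (z + u) f x) = (LBINT x. conv (gaussL (z + u)) f x * heat (w - u) g x)"
   using gaussL_symmetric[OF s' f g] by (simp add: mult.commute)
  then show "(\<lambda>n. (p (S n) - p u) / (S n - u)) \<longlonglongrightarrow> 0"
   unfolding eq using tendsto_diff[OF 1 2] by simp
 qed
 then obtain k where k: "\<And>u. u \<in> D \<Longrightarrow> p u = k"
  using has_field_derivative_zero_constant[OF cD] by blast
 have w': "w - (z' - z) = w'" using eq by (simp add: algebra_simps)
 have "0 \<in> D" "z' - z \<in> D" using re w' by (auto simp: D_def)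
 then have "p 0 = p (z' - z)" using k by simp
 then show ?thesis by (simp add: p_def w')
qed

lemma gauss_real:
 assumes s: "s > 0"
 shows "gauss (of_real s) (x::'a::euclidean_space) =
  of_real (exp (- ((x /\<^sub>R sqrt s) \<bullet> (x /\<^sub>R sqrt s)) / 4) / gauss0 TYPE('a) / sqrt s ^ DIM('a))"
proof -
 have "of_real s powr (- of_real (DIM('a) / 2) :: complex) = of_real (s powr (- (DIM('a) / 2)))"
  using s powr_of_real[of s "- (DIM('a) / 2)"] by simp
 also have "s powr (- (real DIM('a) / 2)) = inverse (sqrt s ^ DIM('a))"
  using s by (simp add: powr_minus powr_half_sqrt[symmetric] powr_powr flip: powr_realpow)
 finally have p: "of_real s powr (- of_real (DIM('a) / 2) :: complex) = of_real (inverse (sqrt s ^ DIM('a)))" .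
 have e: "(x /\<^sub>R sqrt s) \<bullet> (x /\<^sub>R sqrt s) = (x \<bullet> x) / s" using s by (simp add: field_simps)
 have ex: "exp (- of_real (x \<bullet> x) / (4 * of_real s)) = complex_of_real (exp (- ((x \<bullet> x) / s) / 4))"
  by (simp add: exp_of_real[symmetric] mult.commute)
 have "inverse S * E / G = E / G / S" for S E G :: real by (simp add: field_simps)
 then show ?thesis unfolding gauss_def p e ex
  by (simp only: of_real_mult[symmetric] of_real_divide[symmetric])
qed

lemma heat_approximate_identity:
 fixes f :: "'a::euclidean_space \<Rightarrow> complex"
 assumes f: "sq f" and s: "\<And>n. s n > 0" "s \<longlonglongrightarrow> 0"
 shows "(\<lambda>n. n2 (\<lambda>x. heat (of_real (s n)) f x - f x)) \<longlonglongrightarrow> 0"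
  and "\<And>n. n1 (gauss (of_real (s n)) :: 'a \<Rightarrow> complex) = 1"
proof -
 let ?k = "\<lambda>x::'a. exp (- (x \<bullet> x) / 4) / gauss0 TYPE('a)"
 have g1: "gauss 1 = (\<lambda>x::'a. of_real (?k x))" using gauss_real[of 1, where 'a='a] by (auto simp: fun_eq_iff)
 have k: "ker (\<lambda>x. complex_of_real (?k x))" using ker_gauss(1)[of 1, where 'a='a] unfolding g1 by simp
 have kn: "?k x \<ge> 0" for x using gauss0_pos[where 'a='a] by simp
 have ki: "(LBINT x. ?k x) = 1" using gauss0_pos[where 'a='a] by (simp add: gauss0_def)
 have e: "sqrt (s n) > 0" "(\<lambda>n. sqrt (s n)) \<longlonglongrightarrow> 0" for n
  using s tendsto_real_sqrt[OF s(2)] by auto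
 have eq: "(\<lambda>x. complex_of_real (?k (x /\<^sub>R sqrt (s n)) / sqrt (s n) ^ DIM('a))) = gauss (of_real (s n))" for n
  by (rule ext) (rule gauss_real[OF s(1), symmetric])
 show "(\<lambda>n. n2 (\<lambda>x. heat (of_real (s n)) f x - f x)) \<longlonglongrightarrow> 0"
  using approximate_identity(3)[OF k kn ki f e] unfolding eq heat_def .
 show "n1 (gauss (of_real (s n)) :: 'a \<Rightarrow> complex) = 1" for n
  using approximate_identity(2)[OF k kn ki f e, of n] unfolding eq .
qed

lemma n1_gauss_real: 
 assumes "s > 0" shows "n1 (gauss (of_real s) :: 'a::euclidean_space \<Rightarrow> complex) = 1"
proof -
 \<comment> \<open>A null sequence whose member with index 0 is s itself.\<close>
 have "(\<lambda>n. s * inv_nat n) \<longlonglongrightarrow> 0" using tendsto_mult_right_zero[OF inv_nat_tendsto] .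
 from heat_approximate_identity(2)[OF _ _ this, of "\<lambda>x::'a. 0" 0]
 show ?thesis using assms by (simp add: sq_def inv_nat_def)
qed

lemma heat_cnj:
 assumes "Re z > 0" shows "cnj (heat z f x) = heat (cnj z) (\<lambda>x. cnj (f x)) x"
proof -
 have "cnj (LBINT y. gauss z y * f (x - y)) = (LBINT y. cnj (gauss z y * f (x - y)))"
  by (rule Bochner_Integration.integral_cnj[symmetric])
 then show ?thesis by (simp add: heat_def conv_def gauss_cnj assms)
qed

lemma heat_real_contraction: "s > 0 \<Longrightarrow> sq f \<Longrightarrow> n2 (heat (of_real s) f) \<le> n2 f"
 using conv_sq(2)[OF ker_gauss(1)[of "of_real s"], of f] n1_gauss_real[of s, where 'a='a] by (simp add: heat_def)

lemma n2_square_cnj: "complex_of_real ((n2 f)^2) = (LBINT x. f x * cnj (f x))"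
proof -
 have "(LBINT x. f x * cnj (f x)) = (LBINT x. complex_of_real ((cmod (f x))^2))"
  by (intro Bochner_Integration.integral_cong) (auto simp: complex_norm_square[symmetric])
 then show ?thesis by (simp only: n2_square integral_complex_of_real)
qed

text \<open>The squared norm is a pairing at times z and \<open>cnj z\<close>. Their sum is twice Re
  z, so both may be replaced by Re z, where the kernel is positive with integral 1.\<close>

lemma heat_contraction:
 assumes z: "Re z > 0" and f: "sq f"
 shows "n2 (heat z f) \<le> n2 f"
proof -
 let ?s = "of_real (Re z) :: complex"
 have "complex_of_real ((n2 (heat z f))^2) = (LBINT x. heat z f x * heat (cnj z) (\<lambda>x. cnj (f x)) x)"
  unfolding n2_square_cnj heat_cnj[OF z] ..
 also have "... = (LBINT x. heat ?s f x * heat ?s (\<lambda>x. cnj (f x)) x)"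
  by (rule heat_pairing_sum) (use z f in \<open>auto intro: sq_cnj simp: complex_add_cnj\<close>)
 finally have "(n2 (heat z f))^2 = cmod (LBINT x. heat ?s f x * heat ?s (\<lambda>x. cnj (f x)) x)"
  by (metis abs_power2 norm_of_real)
 also have "... \<le> n2 (heat ?s f) * n2 (heat ?s (\<lambda>x. cnj (f x)))"
  by (intro sq_CS heat_sq) (use z f in \<open>auto intro: sq_cnj\<close>)
 also have "... \<le> n2 f * n2 (\<lambda>x. cnj (f x))"
  by (intro mult_mono heat_real_contraction sq_cnj z f) auto
 finally have "(n2 (heat z f))^2 \<le> (n2 f)^2" by (simp add: power2_eq_square)
 then show ?thesis by (simp add: power2_le_iff_abs_le)
qed

lemma heat_symmetric:
 assumes "Re z > 0" "sq f" "sq g"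
 shows "(LBINT x. heat z f x * g x) = (LBINT x. f x * heat z g x)"
 unfolding heat_def using assms by (intro conv_adjoint) auto

lemma heat_sup_bound:
 fixes f :: "'a::euclidean_space \<Rightarrow> complex"
 assumes z: "Re z > 0" and f: "integrable lborel f" "f \<in> borel_measurable borel"
 shows "cmod (conv (gauss z) f x) \<le> cmod z powr (- (DIM('a) / 2)) / gauss0 TYPE('a) * (LBINT x. cmod (f x))"
  and "integrable lborel (\<lambda>y. gauss z y * f (x - y))"
proof -
 note [measurable] = f(2)
 let ?A = "cmod z powr (- (DIM('a) / 2)) / gauss0 TYPE('a)"
 have i: "integrable lborel (\<lambda>y. f (x - y))"
  using lborel_integrable_affine_iff[of f "-1" x] f by simp
 have bd: "cmod (gauss z y * f (x - y)) \<le> ?A * cmod (f (x - y))" for y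
  unfolding norm_mult using gauss_norm_le[OF z, of y] by (intro mult_right_mono) auto
 have i2: "integrable lborel (\<lambda>y. ?A * cmod (f (x - y)))" using i by (intro integrable_mult_right integrable_norm)
 show I: "integrable lborel (\<lambda>y. gauss z y * f (x - y))"
  by (rule integrable_dominated[OF i2 _ bd]) measurable
 have "cmod (conv (gauss z) f x) \<le> (LBINT y. cmod (gauss z y * f (x - y)))"
  unfolding conv_def by (rule integral_norm_bound)
 also have "... \<le> (LBINT y. ?A * cmod (f (x - y)))"
  by (intro integral_mono bd i2 integrable_norm I)
 also have "... = ?A * (LBINT y. cmod (f y))"
  using lborel_integral_affine[of "\<lambda>y. cmod (f y)" "-1" x] by simp
 finally show "cmod (conv (gauss z) f x) \<le> ?A * (LBINT x. cmod (f x))" .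
qed

section \<open>The dispersive estimate\<close>

lemma nn_integral_powr_Icc:
 assumes "p > 0" "a \<ge> 0"
 shows "(\<integral>\<^sup>+s. ennreal (indicator {0..a} s * s powr (p - 1)) \<partial>lborel) = ennreal (a powr p / p)"
 using nn_integral_has_integral_lebesgue[OF _ has_integral_powr_from_0[of "p - 1" a]] assms by simp

lemma layer_cake:
 fixes F :: "'a::euclidean_space \<Rightarrow> real"
 assumes [measurable]: "F \<in> borel_measurable borel" and F: "\<And>x. F x \<ge> 0" and r: "r > 0"
 shows "(\<integral>\<^sup>+x. ennreal (F x powr r) \<partial>lborel) =
  (\<integral>\<^sup>+s. ennreal (r * s powr (r - 1)) * indicator {0..} s * emeasure lborel {x. s \<le> F x} \<partial>lborel)"
proof -
 have "(\<integral>\<^sup>+x. ennreal (F x powr r) \<partial>lborel) =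
   (\<integral>\<^sup>+x. (\<integral>\<^sup>+s. ennreal (r * s powr (r - 1)) * indicator {0..F x} s \<partial>lborel) \<partial>lborel)"
 proof (rule nn_integral_cong)
  fix x
  have "(\<integral>\<^sup>+s. ennreal (r * s powr (r - 1)) * indicator {0..F x} s \<partial>lborel) =
    (\<integral>\<^sup>+s. ennreal r * ennreal (indicator {0..F x} s * s powr (r - 1)) \<partial>lborel)"
   using r by (intro nn_integral_cong) (auto simp: indicator_def ennreal_mult)
  also have "... = ennreal r * ennreal (F x powr r / r)"
   using nn_integral_powr_Icc[OF r F] by (subst nn_integral_cmult) auto
  also have "... = ennreal (F x powr r)" using r by (simp flip: ennreal_mult)
  finally show "ennreal (F x powr r) = (\<integral>\<^sup>+s. ennreal (r * s powr (r - 1)) * indicator {0..F x} s \<partial>lborel)" ..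
 qed
 also have "... = (\<integral>\<^sup>+x. (\<integral>\<^sup>+s. ennreal (r * s powr (r - 1)) * indicator {0..} s * indicator {x. s \<le> F x} x \<partial>lborel) \<partial>lborel)"
  by (intro nn_integral_cong) (auto simp: indicator_def)
 also have "... = (\<integral>\<^sup>+s. (\<integral>\<^sup>+x. ennreal (r * s powr (r - 1)) * indicator {0..} s * indicator {x. s \<le> F x} x \<partial>lborel) \<partial>lborel)"
  by (rule lborel_pair.Fubini') measurable
 also have "... = (\<integral>\<^sup>+s. ennreal (r * s powr (r - 1)) * indicator {0..} s * emeasure lborel {x. s \<le> F x} \<partial>lborel)"
  by (intro nn_integral_cong nn_integral_cmult_indicator) measurable
 finally show ?thesis .
qed

text \<open>Marcinkiewicz interpolation between \<open>L\<^sup>1 \<rightarrow> L\<^sup>\<infinity>\<close> (with norm \<open>A\<close>) and \<open>L\<^sup>2 \<rightarrow> L\<^sup>2\<close>: at height \<open>s\<close> the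
 function is split at the level \<open>(2A\<Lambda>/s)\<^sup>r\<^sup>-\<^sup>1\<close>, for which the large part contributes at most \<open>s/2\<close>.\<close>

lemma heat_interpolation:
 fixes f :: "'a::euclidean_space \<Rightarrow> complex"
 assumes z: "Re z > 0" and r: "r > 2" and sf: "sq f" and lf: "lp (r / (r - 1)) f"
 defines "A \<equiv> cmod z powr (- (DIM('a) / 2)) / gauss0 TYPE('a)"
  and "\<Lambda> \<equiv> (LBINT x. cmod (f x) powr (r / (r - 1)))"
 shows "(\<integral>\<^sup>+x. ennreal (cmod (heat z f x) powr r) \<partial>lborel) \<le> ennreal (4 * r / (r - 2) * (2 * A * \<Lambda>) powr (r - 2) * \<Lambda>)"
\<comment> \<open>Here f vanishes almost everywhere; the splitting level used otherwise would be
  0.\<close>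
proof (cases "\<Lambda> = 0")
 case True
 let ?q = "r / (r - 1)"
 have "AE x in lborel. cmod (f x) powr ?q = 0"
  using True lf unfolding \<Lambda>_def lp_def by (subst (asm) integral_nonneg_eq_0_iff_AE) auto
 then have "AE x in lborel. f x = 0" by eventually_elim auto
 then have "n2 f = n2 (\<lambda>x::'a. 0::complex)" using sf by (intro n2_cong_AE) (auto simp: sq_def)
 then have "n2 (heat z f) = 0" using heat_contraction[OF z sf] by (simp add: n2_def antisym)
 then have "AE x in lborel. heat z f x = 0" using n2_eq_0_AE heat_sq[OF z sf] by blast
 then have "AE x in lborel. ennreal (cmod (heat z f x) powr r) = 0" by eventually_elim simp
 then have "(\<integral>\<^sup>+x. ennreal (cmod (heat z f x) powr r) \<partial>lborel) = (\<integral>\<^sup>+(x::'a). 0 \<partial>lborel)"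
  by (rule nn_integral_cong_AE)
 then show ?thesis by simp
next
 case False
 let ?q = "r / (r - 1)"
 note [measurable] = sf[THEN sq_measurable]
 note [measurable] = heat_sq[OF z sf]
 have z0: "cmod z > 0" using z by auto
 have A: "A > 0" using z0 gauss0_pos[where 'a='a] by (simp add: A_def)
 have \<Lambda>: "\<Lambda> > 0" using False by (simp add: \<Lambda>_def order_less_le)
 have q: "?q > 1" "?q - 1 = 1 / (r - 1)" using r by (auto simp: field_simps)
 let ?c = "4 * r / (r - 2) * (2 * A * \<Lambda>) powr (r - 2)"
 define c where "c s = (2 * A * \<Lambda> / s) powr (r - 1)" for s
 let ?g = "\<lambda>s x. ennreal ((cmod (f x))^2) * indicator {x. cmod (f x) \<le> c s} x" and ?m = "\<lambda>s. ennreal (4 * r * s powr (r - 3)) * indicator {0<..} s"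
 have cm[measurable]: "c \<in> borel_measurable borel" unfolding c_def[abs_def] by measurable
 have level: "emeasure lborel {x. s \<le> cmod (heat z f x)} \<le>
   ennreal (4 / s^2) * (\<integral>\<^sup>+x. ?g s x \<partial>lborel)"
  if s: "s > 0" for s
 proof -
  have cs: "c s > 0" using s A \<Lambda> by (simp add: c_def)
  have cp: "c s powr (1 - ?q) = s / (2 * A * \<Lambda>)"
  proof -
   have "(r - 1) * (1 - ?q) = -1" using r by (simp add: field_simps)
   then show ?thesis using s A \<Lambda> by (simp add: c_def powr_powr powr_minus_divide)
  qed
  \<comment> \<open>The large part \<open>f1\<close> is in L^1, since |f| \<le> c^(1 - q) |f|^q
    above the level c for q > 1. The small part \<open>f2\<close> stays in L^2, where contractivity
    and Chebyshev's inequality at height s / 2 apply.\<close>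
  define f1 where "f1 x = (if cmod (f x) \<le> c s then 0 else f x)" for x
  define f2 where "f2 x = (if cmod (f x) \<le> c s then f x else 0)" for x
  have [measurable]: "f1 \<in> borel_measurable borel" "f2 \<in> borel_measurable borel"
   unfolding f1_def[abs_def] f2_def[abs_def] by measurable
  have f1b: "cmod (f1 x) \<le> c s powr (1 - ?q) * cmod (f x) powr ?q" for x
  proof (cases "cmod (f x) \<le> c s")
   case False
   then have "cmod (f x) > 0" using cs by linarith
   then have "cmod (f x) = cmod (f x) powr (1 - ?q) * cmod (f x) powr ?q" by (simp flip: powr_add)
   also have "... \<le> c s powr (1 - ?q) * cmod (f x) powr ?q"
    using False cs q(1) by (intro mult_right_mono powr_mono2') auto
   finally show ?thesis using False by (simp add: f1_def)
  qed (simp add: f1_def)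
  have i: "integrable lborel (\<lambda>x. c s powr (1 - ?q) * cmod (f x) powr ?q)" using lf by (simp add: lp_def)
  have i1: "integrable lborel f1" by (rule integrable_dominated[OF i _ f1b]) measurable
  have "(LBINT x. cmod (f1 x)) \<le> (LBINT x. c s powr (1 - ?q) * cmod (f x) powr ?q)"
   by (intro integral_mono i integrable_norm i1 f1b)
  also have "... = s / (2 * A)" using \<Lambda> by (simp add: cp \<Lambda>_def[symmetric])
  finally have n1f: "A * (LBINT x. cmod (f1 x)) \<le> s / 2" using A by (simp add: field_simps)
  have h1: "cmod (conv (gauss z) f1 x) \<le> s / 2" for x
   by (rule order_trans[OF heat_sup_bound(1)[OF z i1] n1f[unfolded A_def]]) measurable
  have sf2: "sq f2"
   by (rule sq_bound(1)[OF sf, of _ 1]) (auto simp: f2_def)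
  have sum: "heat z f x = conv (gauss z) f1 x + heat z f2 x" for x
  proof -
   have "heat z f x = (LBINT y. gauss z y * f1 (x - y) + gauss z y * f2 (x - y))"
    unfolding heat_def conv_def by (intro Bochner_Integration.integral_cong) (auto simp: f1_def f2_def)
   also have "... = conv (gauss z) f1 x + heat z f2 x"
    unfolding heat_def conv_def using heat_sup_bound(2)[OF z i1] conv_integrable[OF ker_gauss(1)[OF z] sf2]
    by (intro Bochner_Integration.integral_add) auto
   finally show ?thesis .
  qed
  note [measurable] = heat_sq[OF z sf2]
  have "emeasure lborel {x. s \<le> cmod (heat z f x)} \<le> emeasure lborel {x. s / 2 \<le> cmod (heat z f2 x)}"
  proof (intro emeasure_mono subsetI)
   fix x assume "x \<in> {x. s \<le> cmod (heat z f x)}"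
   then have "s \<le> cmod (conv (gauss z) f1 x) + cmod (heat z f2 x)"
    using norm_triangle_ineq[of "conv (gauss z) f1 x" "heat z f2 x"] by (simp add: sum)
   then show "x \<in> {x. s / 2 \<le> cmod (heat z f2 x)}" using h1[of x] by simp
  qed measurable
  also have "... = (\<integral>\<^sup>+x. indicator {x. s / 2 \<le> cmod (heat z f2 x)} x \<partial>lborel)"
   by (subst nn_integral_indicator) auto
  also have "... \<le> (\<integral>\<^sup>+x. ennreal (4 / s^2) * ennreal ((cmod (heat z f2 x))^2) \<partial>lborel)"
  proof (intro nn_integral_mono)
   fix x
   show "indicator {x. s / 2 \<le> cmod (heat z f2 x)} x \<le> ennreal (4 / s^2) * ennreal ((cmod (heat z f2 x))^2)"
   proof (cases "s / 2 \<le> cmod (heat z f2 x)")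
    case True
    then have "(s / 2)^2 \<le> (cmod (heat z f2 x))^2" using s by (intro power_mono) auto
    then have "1 \<le> 4 / s^2 * (cmod (heat z f2 x))^2" using s by (simp add: field_simps power2_eq_square)
    then show ?thesis using True by (simp flip: ennreal_mult)
   qed simp
  qed
  also have "... = ennreal (4 / s^2) * ennreal ((n2 (heat z f2))^2)"
   by (subst nn_integral_cmult) (auto simp: n2_nn_integral[OF heat_sq[OF z sf2]])
  also have "... \<le> ennreal (4 / s^2) * ennreal ((n2 f2)^2)"
   by (intro mult_left_mono ennreal_leI power_mono heat_contraction z sf2) auto
  also have "ennreal ((n2 f2)^2) = (\<integral>\<^sup>+x. ?g s x \<partial>lborel)"
   unfolding n2_nn_integral[OF sf2, symmetric] by (intro nn_integral_cong) (auto simp: f2_def indicator_def)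
  finally show ?thesis .
 qed
 have "(\<integral>\<^sup>+x. ennreal (cmod (heat z f x) powr r) \<partial>lborel) =
   (\<integral>\<^sup>+s. ennreal (r * s powr (r - 1)) * indicator {0..} s * emeasure lborel {x. s \<le> cmod (heat z f x)} \<partial>lborel)"
  using r by (intro layer_cake) auto
 also have "... \<le> (\<integral>\<^sup>+s. (\<integral>\<^sup>+x. ?m s * ?g s x \<partial>lborel) \<partial>lborel)"
 proof (intro nn_integral_mono)
  fix s :: real
  show "ennreal (r * s powr (r - 1)) * indicator {0..} s * emeasure lborel {x. s \<le> cmod (heat z f x)} \<le>
   (\<integral>\<^sup>+x. ?m s * ?g s x \<partial>lborel)"
  proof (cases "s > 0")
   case True
   have "s powr (r - 1) = s powr (r - 3) * s^2" using True by (simp flip: powr_numeral powr_add)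
   then have e: "r * s powr (r - 1) * (4 / s^2) = 4 * r * s powr (r - 3)" using True by simp
   have "ennreal (r * s powr (r - 1)) * emeasure lborel {x. s \<le> cmod (heat z f x)} \<le>
    ennreal (r * s powr (r - 1)) * (ennreal (4 / s^2) * (\<integral>\<^sup>+x. ?g s x \<partial>lborel))"
    by (intro mult_left_mono level True) auto
   also have "... = ennreal (4 * r * s powr (r - 3)) * (\<integral>\<^sup>+x. ?g s x \<partial>lborel)"
   proof -
    have "ennreal (r * s powr (r - 1) * (4 / s^2)) = ennreal (r * s powr (r - 1)) * ennreal (4 / s^2)"
     using r by (intro ennreal_mult) auto
    then show ?thesis unfolding e[symmetric] by (simp only: mult.assoc)
   qed
   also have "... = (\<integral>\<^sup>+x. ennreal (4 * r * s powr (r - 3)) * ?g s x \<partial>lborel)"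
    by (intro nn_integral_cmult[symmetric]) measurable
   finally show ?thesis using True by simp
  qed (auto simp: indicator_def)
 qed
 also have "... = (\<integral>\<^sup>+x. (\<integral>\<^sup>+s. ?m s * ?g s x \<partial>lborel) \<partial>lborel)"
  by (rule lborel_pair.Fubini') measurable
 also have "... \<le> (\<integral>\<^sup>+x. ennreal (?c) * ennreal (cmod (f x) powr ?q) \<partial>lborel)"
 proof (intro nn_integral_mono)
  fix x
  show "(\<integral>\<^sup>+s. ?m s * ?g s x \<partial>lborel) \<le>
   ennreal (?c) * ennreal (cmod (f x) powr ?q)"
  proof (cases "f x = 0")
   case False
   define u where "u = cmod (f x)"
   have u: "u > 0" using False by (simp add: u_def)
   \<comment> \<open>Solving u \<le> c s for s gives s \<le> a. The inner integral thus runs over a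
     bounded interval, where s powr (r - 3) is integrable because r > 2.\<close>
   define a where "a = 2 * A * \<Lambda> * u powr (- (1 / (r - 1)))"
   have a: "a \<ge> 0" using A \<Lambda> by (simp add: a_def)
   have le: "s \<le> a" if s: "s > 0" "u \<le> c s" for s
   proof -
    have "u powr (1 / (r - 1)) \<le> c s powr (1 / (r - 1))" using u s r by (intro powr_mono2) auto
    also have "... = 2 * A * \<Lambda> / s" using s A \<Lambda> r by (simp add: c_def powr_powr)
    finally have "s * u powr (1 / (r - 1)) \<le> 2 * A * \<Lambda>" using s by (simp add: field_simps)
    then show ?thesis using u by (simp add: a_def powr_minus field_simps)
   qed
   have "(\<integral>\<^sup>+s. ?m s * ?g s x \<partial>lborel)
    \<le> (\<integral>\<^sup>+s. ennreal (4 * r * u^2) * ennreal (indicator {0..a} s * s powr ((r - 2) - 1)) \<partial>lborel)"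
   proof (intro nn_integral_mono)
    fix s :: real
    show "?m s * ?g s x \<le>
      ennreal (4 * r * u^2) * ennreal (indicator {0..a} s * s powr ((r - 2) - 1))"
     using le[of s] r by (auto simp: indicator_def u_def[symmetric] ennreal_mult[symmetric] mult_ac)
   qed
   also have "... = ennreal (4 * r * u^2) * ennreal (a powr (r - 2) / (r - 2))"
    using nn_integral_powr_Icc[of "r - 2" a] r a by (subst nn_integral_cmult) auto
   also have "... = ennreal (?c) * ennreal (u powr ?q)"
   proof -
    have "a powr (r - 2) = (2 * A * \<Lambda>) powr (r - 2) * u powr (- (r - 2) / (r - 1))"
    proof -
     have "- (1 / (r - 1)) * (r - 2) = - (r - 2) / (r - 1)" using r by (simp add: field_simps)
     then have "(u powr (- (1 / (r - 1)))) powr (r - 2) = u powr (- (r - 2) / (r - 1))"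
      by (simp only: powr_powr)
     then show ?thesis using A \<Lambda> u by (simp only: a_def powr_mult)
    qed
    moreover have "u^2 * u powr (- (r - 2) / (r - 1)) = u powr ?q"
    proof -
     have "2 + - (r - 2) / (r - 1) = ?q" using r by (simp add: field_simps)
     then show ?thesis using u by (simp flip: powr_numeral powr_add)
    qed
    moreover have "4 * r * U * (X * Y / d) = 4 * r / d * X * (U * Y)" for U X Y d :: real by simp
    ultimately have "4 * r * u^2 * (a powr (r - 2) / (r - 2)) = ?c * u powr ?q"
     by (simp only:)
    then show ?thesis using r by (simp flip: ennreal_mult)
   qed
   finally show ?thesis unfolding u_def .
  qed simp
 qed
 also have "... = ennreal (?c) * ennreal \<Lambda>"
  using lf unfolding \<Lambda>_def lp_def by (subst nn_integral_cmult) (auto simp: nn_integral_eq_integral)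
 also have "... = ennreal (?c * \<Lambda>)"
  using r \<Lambda> by (simp flip: ennreal_mult)
 finally show ?thesis .
qed

lemma lp_np_le_nn:
 fixes f :: "'a::euclidean_space \<Rightarrow> 'b::{banach, second_countable_topology}"
 assumes "f \<in> borel_measurable borel" "(\<integral>\<^sup>+x. ennreal (norm (f x) powr p) \<partial>lborel) \<le> ennreal (C powr p)" "C \<ge> 0" "p > 0"
 shows "lp p f" "np p f \<le> C"
proof -
 show l: "lp p f"
  using assms by (auto simp: lp_def integrable_iff_bounded intro: le_less_trans)
 then have "(\<integral>\<^sup>+x. ennreal (norm (f x) powr p) \<partial>lborel) = ennreal (np p f powr p)"
  using assms(4) by (subst nn_integral_eq_integral) (auto simp: lp_def np_powr)
 then have "np p f powr p \<le> C powr p" using assms(2) by simp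
 then have le: "np p f powr p \<le> C powr p" using assms(2) by simp
 show "np p f \<le> C"
 proof (rule ccontr)
  assume "\<not> np p f \<le> C"
  then have "C powr p < np p f powr p" using assms(3,4) by (intro powr_less_mono2) auto
  then show False using le by simp
 qed
qed

lemma powr_minus2_mult: "x \<ge> 0 \<Longrightarrow> x powr (r - 2) * x^2 = x powr r" for x r :: real
 by (cases "x = 0") (simp_all flip: powr_numeral powr_add)

definition conj_exp :: "real \<Rightarrow> real" where "conj_exp r = r / (r - 1)"

lemma conj_exp:
 assumes "r > 1" shows "conj_exp r > 1" "1 / r + 1 / conj_exp r = 1" "1 / conj_exp r + 1 / r = 1"
 using assms by (auto simp: conj_exp_def field_simps)

text \<open>The exponent of t in the theorem. A value below 1 says both that r is subcritical for
  the embedding of H^1 into L^r and that |t| powr (- decay) is integrable near 0.\<close>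

definition decay :: "'a::euclidean_space itself \<Rightarrow> real \<Rightarrow> real" where
 "decay _ r = DIM('a) * (1 / 2 - 1 / r)"

text \<open>The r-th root of \<open>heat_interpolation\<close>: the factor A^(r - 2) gives the power
  of |z| with exponent -(N/2)(r - 2)/r, which is minus \<open>decay\<close>, and \<Lambda>^(r - 1)
  gives the norm with the conjugate exponent.\<close>

lemma dispersive:
 assumes r: "r > 2"
 obtains C where "C > 0" "\<And>z (f :: 'a::euclidean_space \<Rightarrow> complex). Re z > 0 \<Longrightarrow> sq f \<Longrightarrow> lp (conj_exp r) f \<Longrightarrow>
  lp r (heat z f) \<and> np r (heat z f) \<le> C * cmod z powr (- decay TYPE('a) r) * np (conj_exp r) f"
proof -
 let ?g = "gauss0 TYPE('a)" and ?q = "conj_exp r"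
 define C where "C = (4 * r / (r - 2) * (2 / ?g) powr (r - 2)) powr (1 / r)"
 have g: "?g > 0" by (rule gauss0_pos)
 have C: "C > 0" using r g by (simp add: C_def)
 show ?thesis
 proof (rule that[OF C])
  fix z and f :: "'a \<Rightarrow> complex" assume z: "Re z > 0" and f: "sq f" and l: "lp ?q f"
  have z0: "cmod z > 0" using z by auto
  let ?\<Lambda> = "LBINT x. cmod (f x) powr ?q"
  let ?K = "C * cmod z powr (- decay TYPE('a) r) * np ?q f"
  have L: "?\<Lambda> \<ge> 0" by simp
  have e: "4 * r / (r - 2) * (2 * (cmod z powr (- (DIM('a) / 2)) / ?g) * ?\<Lambda>) powr (r - 2) * ?\<Lambda> = ?K powr r"
  proof -
   have "?K powr r = C powr r * (cmod z powr (- decay TYPE('a) r)) powr r * np ?q f powr r"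
    using C by (simp add: powr_mult)
   also have "C powr r = 4 * r / (r - 2) * (2 / ?g) powr (r - 2)"
    using r g by (simp add: C_def powr_powr)
   also have "(cmod z powr (- decay TYPE('a) r)) powr r = (cmod z powr (- (DIM('a) / 2))) powr (r - 2)"
   proof -
    have "(1 / 2 - 1 / r) * r = (r - 2) / 2" using r by (simp add: field_simps)
    then have "- decay TYPE('a) r * r = - (DIM('a) / 2) * (r - 2)" by (simp add: decay_def mult.assoc)
    then show ?thesis by (simp only: powr_powr)
   qed
   also have "np ?q f powr r = ?\<Lambda> powr (r - 1)"
   proof -
    have "1 / ?q * r = r - 1" using r by (simp add: conj_exp_def)
    then show ?thesis by (simp only: np_def powr_powr)
   qed
   also have "?\<Lambda> powr (r - 1) = ?\<Lambda> powr (r - 2) * ?\<Lambda>"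
    using powr_mult_base[OF L, of "r - 2"] by (simp add: mult.commute)
   finally show ?thesis
    using g z0 by (simp add: powr_mult powr_divide mult_ac)
  qed
  have "(\<integral>\<^sup>+x. ennreal (cmod (heat z f x) powr r) \<partial>lborel) \<le> ennreal (?K powr r)"
   using heat_interpolation[OF z r f l[unfolded conj_exp_def], folded conj_exp_def] unfolding e .
  moreover have "heat z f \<in> borel_measurable borel" using heat_sq[OF z f] by (simp add: sq_def)
  moreover have "?K \<ge> 0" using C by (intro mult_nonneg_nonneg) auto
  moreover have "r > 0" using r by simp
  ultimately show "lp r (heat z f) \<and> np r (heat z f) \<le> ?K"
   using lp_np_le_nn[of "heat z f" r ?K] by blast
 qed
qed

text \<open>Converse of Hoelder's inequality, tested on truncations of \<open>|f|\<^sup>r\<^sup>-\<^sup>2 f\<close>.\<close>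

lemma truncated_dual:
 fixes f :: "'a::euclidean_space \<Rightarrow> complex"
 assumes r: "r > 2" and f: "sq f"
 defines "G \<equiv> \<lambda>n x. (if cmod (f x) \<le> n then of_real (cmod (f x) powr (r - 2)) * cnj (f x) else 0)"
  and "I \<equiv> \<lambda>n. \<integral>x. (if cmod (f x) \<le> n then cmod (f x) powr r else 0) \<partial>lborel"
 shows "sq (G n)" "lp (conj_exp r) (G n)" "np (conj_exp r) (G n) = I n powr (1 - 1 / r)"
  "(LBINT x. f x * G n x) = of_real (I n)"
  "integrable lborel (\<lambda>x. if cmod (f x) \<le> n then cmod (f x) powr r else 0)"
proof -
 note [measurable] = f
 have Gm[measurable]: "G n \<in> borel_measurable borel" unfolding G_def by measurable
 have nG: "cmod (G n x) = (if cmod (f x) \<le> n then cmod (f x) powr (r - 1) else 0)" for x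
  using powr_mult_base[of "cmod (f x)" "r - 2"] by (simp add: G_def norm_mult mult.commute)
 have n: "n powr (r - 2) \<ge> 0" by simp
 show "sq (G n)"
 proof (rule sq_bound(1)[OF f Gm _ n])
  fix x
  show "norm (G n x) \<le> n powr (r - 2) * norm (f x)"
   using r by (auto simp: G_def norm_mult intro!: mult_right_mono powr_mono2)
 qed
 have sq2: "integrable lborel (\<lambda>x. n powr (r - 2) * (cmod (f x))^2)" using f by (simp add: sq_def)
 show i: "integrable lborel (\<lambda>x. if cmod (f x) \<le> n then cmod (f x) powr r else 0)"
 proof (rule integrable_dominated[OF sq2])
  fix x
  have "cmod (f x) powr r = cmod (f x) powr (r - 2) * (cmod (f x))^2"
   by (rule powr_minus2_mult[symmetric]) simp
  then show "norm (if cmod (f x) \<le> n then cmod (f x) powr r else 0) \<le> n powr (r - 2) * (cmod (f x))^2"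
   using r by (auto intro!: mult_right_mono powr_mono2)
 qed measurable
 have nq: "norm (G n x) powr conj_exp r = (if cmod (f x) \<le> n then cmod (f x) powr r else 0)" for x
  using r by (simp add: nG powr_powr conj_exp_def)
 show "lp (conj_exp r) (G n)" using i unfolding lp_def nq by simp
 show "np (conj_exp r) (G n) = I n powr (1 - 1 / r)"
  using r unfolding np_def nq I_def by (simp add: conj_exp_def field_simps)
 have "f x * G n x = of_real (if cmod (f x) \<le> n then cmod (f x) powr r else 0)" for x
 proof -
  have "f x * (of_real (cmod (f x) powr (r - 2)) * cnj (f x)) = of_real (cmod (f x) powr (r - 2)) * (of_real ((cmod (f x))^2))"
   unfolding complex_norm_square by (simp only: mult_ac)
  also have "... = of_real (cmod (f x) powr r)"
  proof -
   have "cmod (f x) powr (r - 2) * (cmod (f x))^2 = cmod (f x) powr r"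
    by (rule powr_minus2_mult) simp
   then show ?thesis by (simp only: of_real_mult[symmetric])
  qed
  finally show ?thesis by (simp add: G_def)
 qed
 then have "(LBINT x. f x * G n x) = (LBINT x. complex_of_real (if cmod (f x) \<le> n then cmod (f x) powr r else 0))"
  by (intro Bochner_Integration.integral_cong) auto
 then show "(LBINT x. f x * G n x) = of_real (I n)"
  by (simp only: integral_complex_of_real I_def)
qed

lemma converse_Holder:
 fixes f :: "'a::euclidean_space \<Rightarrow> complex"
 assumes r: "r > 2" and f: "sq f" and K: "K \<ge> 0"
  and bd: "\<And>G. sq G \<Longrightarrow> lp (conj_exp r) G \<Longrightarrow> cmod (LBINT x. f x * G x) \<le> K * np (conj_exp r) G"
 shows "lp r f" "np r f \<le> K"
proof -
 have fm[measurable]: "f \<in> borel_measurable borel" using f by (simp add: sq_def)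
 let ?h = "\<lambda>n x. if cmod (f x) \<le> real n then cmod (f x) powr r else 0"
 define I where "I n = (LBINT x. ?h n x)" for n
 have I0: "I n \<ge> 0" for n unfolding I_def by (intro Bochner_Integration.integral_nonneg) auto
 have Ib: "I n \<le> K powr r" for n
 proof (cases "I n = 0")
  case False
  then have pos: "I n > 0" using I0[of n] by simp
  note T = truncated_dual[OF r f, of "real n"]
  \<comment> \<open>Truncation makes \<open>I n\<close> finite, so that its power can be
    cancelled.\<close>
  have "I n \<le> K * I n powr (1 - 1 / r)"
   using bd[OF T(1,2)] unfolding T(3,4) I_def[symmetric] using I0[of n] by simp
  then have "I n powr (1 / r) * I n powr (1 - 1 / r) \<le> K * I n powr (1 - 1 / r)"
   using pos by (simp flip: powr_add)
  then have "I n powr (1 / r) \<le> K" using pos by simp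
  then have "(I n powr (1 / r)) powr r \<le> K powr r" using r by (intro powr_mono2) auto
  then show ?thesis using pos r by (simp add: powr_powr)
 qed simp
 have "(\<integral>\<^sup>+x. ennreal (cmod (f x) powr r) \<partial>lborel) = (\<integral>\<^sup>+x. (SUP n. ennreal (?h n x)) \<partial>lborel)"
 proof (rule nn_integral_cong)
  fix x
  obtain n :: nat where n: "cmod (f x) \<le> n" using real_arch_simple by blast
  show "ennreal (cmod (f x) powr r) = (SUP n. ennreal (?h n x))"
  proof (rule antisym)
   show "ennreal (cmod (f x) powr r) \<le> (SUP n. ennreal (?h n x))" using n by (intro SUP_upper2[of n]) auto
  qed (auto intro!: SUP_least)
 qed
 also have "... = (SUP n. \<integral>\<^sup>+x. ennreal (?h n x) \<partial>lborel)"
  by (intro nn_integral_monotone_convergence_SUP) (auto simp: incseq_def le_fun_def)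
 also have "... \<le> ennreal (K powr r)"
 proof (rule SUP_least)
  fix n
  have "(\<integral>\<^sup>+x. ennreal (?h n x) \<partial>lborel) = ennreal (I n)"
   unfolding I_def by (rule nn_integral_eq_integral[OF truncated_dual(5)[OF r f]]) auto
  then show "(\<integral>\<^sup>+x. ennreal (?h n x) \<partial>lborel) \<le> ennreal (K powr r)" using Ib by (simp add: ennreal_leI)
 qed
 finally have "(\<integral>\<^sup>+x. ennreal (cmod (f x) powr r) \<partial>lborel) \<le> ennreal (K powr r)" .
 from lp_np_le_nn[OF fm this K] r show "lp r f" "np r f \<le> K" by auto
qed

text \<open>The contrapositive of \<open>converse_Holder\<close> at a constant slightly below the
  norm. An almost optimal G suffices later, where one is chosen for each time of a grid.\<close>

lemma near_dual:
 fixes f :: "'a::euclidean_space \<Rightarrow> complex"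
 assumes r: "r > 2" and f: "sq f" and l: "lp r f" and e: "e > 0"
 obtains G where "sq G" "lp (conj_exp r) G" "np (conj_exp r) G \<le> 1" "np r f - e \<le> Re (LBINT x. f x * G x)"
proof (cases "np r f \<le> e")
 case True
 then show ?thesis by (intro that[of "\<lambda>_. 0"]) (auto simp: sq_def lp_def np_def)
next
 case False
 define K where "K = np r f - e"
 have K: "0 \<le> K" "K < np r f" using False e by (auto simp: K_def)
 have "\<not> (\<forall>G. sq G \<longrightarrow> lp (conj_exp r) G \<longrightarrow> cmod (LBINT x. f x * G x) \<le> K * np (conj_exp r) G)"
  using converse_Holder(2)[OF r f K(1)] K(2) by force
 then obtain G where G: "sq G" "lp (conj_exp r) G" "cmod (LBINT x. f x * G x) > K * np (conj_exp r) G" by force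
 let ?i = "LBINT x. f x * G x"
 define g where "g = np (conj_exp r) G"
 have q: "conj_exp r > 0" using conj_exp(1)[of r] r by simp
 have "cmod ?i \<le> np r f * g"
  unfolding g_def using r by (intro lp_Holder_mult conj_exp l G) auto
 moreover have "cmod ?i > 0" using G(3) K(1) le_less_trans[OF mult_nonneg_nonneg[OF K(1) np_nonneg]] by blast
 ultimately have "g \<noteq> 0" by auto
 then have g: "g > 0" using np_nonneg[of "conj_exp r" G] by (simp add: g_def order_less_le)
 have i0: "cmod ?i > 0" by fact
 \<comment> \<open>The phase makes the pairing real and nonnegative; the modulus normalises
   G.\<close>
 define c where "c = cnj ?i / of_real (cmod ?i * g)"
 have nc: "cmod c = 1 / g" using i0 g by (simp only: c_def norm_divide norm_of_real complex_mod_cnj) simp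
 show ?thesis
 proof (rule that[of "\<lambda>x. c * G x"])
  show "sq (\<lambda>x. c * G x)" "lp (conj_exp r) (\<lambda>x. c * G x)" using G by (auto intro: sq_cmult lp_cmult)
  show "np (conj_exp r) (\<lambda>x. c * G x) \<le> 1"
   unfolding np_cmult[OF q] nc using g by (simp add: g_def)
  have "(LBINT x. f x * (c * G x)) = c * ?i" by (simp add: mult.left_commute[of _ c])
  also have "c * ?i = of_real (cmod ?i / g)"
  proof -
   have "cnj ?i * ?i = of_real ((cmod ?i)^2)" unfolding complex_norm_square by (rule mult.commute)
   then have "c * ?i = of_real ((cmod ?i)^2 / (cmod ?i * g))"
    by (simp only: c_def times_divide_eq_left of_real_divide)
   also have "(cmod ?i)^2 / (cmod ?i * g) = cmod ?i / g" using i0 by (simp add: power2_eq_square)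
   finally show ?thesis .
  qed
  finally have "Re (LBINT x. f x * (c * G x)) = cmod ?i / g" by simp
  also have "... \<ge> K" using G(3) g by (simp add: g_def field_simps)
  finally show "np r f - e \<le> Re (LBINT x. f x * (c * G x))" by (simp add: K_def)
 qed
qed

section \<open>The Sobolev embedding\<close>

text \<open>The gradient is carried along as data and not chosen by a description operator, so
  translation, conjugation and linear combination act on the pair.\<close>

definition h1 :: "('a::euclidean_space \<Rightarrow> complex) \<Rightarrow> ('a \<Rightarrow> 'a \<Rightarrow> complex) \<Rightarrow> bool" where
 "h1 f d \<longleftrightarrow> (\<forall>b\<in>Basis. wd b f (d b))"

definition gr :: "('a::euclidean_space \<Rightarrow> 'a \<Rightarrow> complex) \<Rightarrow> real" where
 "gr d = (\<Sum>b\<in>Basis. n2 (d b))"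

text \<open>A sum instead of the Euclidean combination, for the sake of the triangle inequality;
  \<open>H1_norm_le_hn\<close> and \<open>hn_le_H1_norm\<close> compare it with the H^1
  norm.\<close>

definition hn :: "('a::euclidean_space \<Rightarrow> complex) \<Rightarrow> ('a \<Rightarrow> 'a \<Rightarrow> complex) \<Rightarrow> real" where
 "hn f d = n2 f + gr d"

lemma gr_nonneg [simp]: "0 \<le> gr d" by (simp add: gr_def sum_nonneg)
lemma hn_nonneg [simp]: "0 \<le> hn f d" by (simp add: hn_def)
lemma n2_le_hn: "n2 f \<le> hn f d" by (simp add: hn_def)
lemma gr_le_hn: "gr d \<le> hn f d" by (simp add: hn_def)
lemma n2_le_gr: "b \<in> Basis \<Longrightarrow> n2 (d b) \<le> gr d"
 unfolding gr_def by (rule member_le_sum) auto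

lemma h1_wd: "h1 f d \<Longrightarrow> b \<in> Basis \<Longrightarrow> wd b f (d b)" by (simp add: h1_def)
lemma h1_sq: "h1 f d \<Longrightarrow> sq f"
 using nonempty_Basis wd_sq(1) unfolding h1_def by blast
lemma h1_sq_d: "h1 f d \<Longrightarrow> b \<in> Basis \<Longrightarrow> sq (d b)"
 using wd_sq(2) unfolding h1_def by blast

lemma h1_diff: "h1 f d \<Longrightarrow> h1 g e \<Longrightarrow> h1 (\<lambda>x. f x - g x) (\<lambda>b x. d b x - e b x)"
 by (simp add: h1_def wd_diff)
lemma h1_cmult: "h1 f d \<Longrightarrow> h1 (\<lambda>x. c * f x) (\<lambda>b x. c * d b x)"
 by (simp add: h1_def wd_cmult)
lemma h1_cnj: "h1 f d \<Longrightarrow> h1 (\<lambda>x. cnj (f x)) (\<lambda>b x. cnj (d b x))"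
 by (simp add: h1_def wd_cnj)
lemma h1_translate: "h1 f d \<Longrightarrow> h1 (\<lambda>x. f (x + t)) (\<lambda>b x. d b (x + t))"
 by (simp add: h1_def wd_translate)
lemma h1_heat: "Re z > 0 \<Longrightarrow> sq f \<Longrightarrow> h1 (heat z f) (\<lambda>b. conv (gaussb z b) f)"
 by (simp add: h1_def wd_heat)

lemma hn_cmult: "hn (\<lambda>x. c * f x) (\<lambda>b x. c * d b x) = cmod c * hn f d"
 by (simp add: hn_def gr_def n2_cmult sum_distrib_left distrib_left)
lemma hn_cnj [simp]: "hn (\<lambda>x. cnj (f x)) (\<lambda>b x. cnj (d b x)) = hn f d"
 by (simp add: hn_def gr_def)
lemma hn_translate:
 assumes "h1 f d" shows "hn (\<lambda>x. f (x + t)) (\<lambda>b x. d b (x + t)) = hn f d"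
proof -
 have "gr (\<lambda>b x. d b (x + t)) = gr d"
  unfolding gr_def by (intro sum.cong refl n2_translate h1_sq_d[OF assms])
 then show ?thesis using n2_translate[OF h1_sq[OF assms]] by (simp add: hn_def)
qed
lemma hn_add:
 assumes "h1 f d" "h1 g e"
 shows "hn (\<lambda>x. f x + g x) (\<lambda>b x. d b x + e b x) \<le> hn f d + hn g e"
proof -
 have "gr (\<lambda>b x. d b x + e b x) \<le> gr d + gr e"
  unfolding gr_def sum.distrib[symmetric]
  by (intro sum_mono n2_triangle h1_sq_d[OF assms(1)] h1_sq_d[OF assms(2)])
 then show ?thesis using n2_triangle[OF h1_sq[OF assms(1)] h1_sq[OF assms(2)]] by (simp add: hn_def)
qed
lemma hn_diff:
 assumes "h1 f d" "h1 g e"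
 shows "hn (\<lambda>x. f x - g x) (\<lambda>b x. d b x - e b x) \<le> hn f d + hn g e"
 using hn_add[OF assms(1) h1_cmult[OF assms(2), of "-1"]] hn_cmult[of "-1" g e] by simp

lemma n2_translate_basis:
 assumes "b \<in> Basis" "wd b f g"
 shows "n2 (\<lambda>x. f (x + h *\<^sub>R b) - f x) \<le> \<bar>h\<bar> * n2 g"
proof (cases "h = 0")
 case False
 have "(\<lambda>x. f (x + h *\<^sub>R b) - f x) = (\<lambda>x. of_real h * dq b h f x)"
  using False by (simp add: dq_def fun_eq_iff)
 then show ?thesis
  using wd_dq_bound[OF assms, of h] by (simp add: n2_cmult mult_left_mono)
qed (simp add: n2_def)

text \<open>The translation is carried out one coordinate at a time, each time by the bound on
  difference quotients.\<close>

lemma n2_translate_le: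
 fixes f :: "'a::euclidean_space \<Rightarrow> complex"
 assumes "h1 f d"
 shows "n2 (\<lambda>x. f (x + y) - f x) \<le> norm y * gr d"
proof -
 have s: "sq f" using h1_sq[OF assms] .
 have "n2 (\<lambda>x. f (x + (\<Sum>b\<in>B. (y \<bullet> b) *\<^sub>R b)) - f x) \<le> (\<Sum>b\<in>B. norm y * n2 (d b))" if "finite B" "B \<subseteq> Basis" for B
  using that
 proof (induction B rule: finite_induct)
  case (insert b B)
  have b: "b \<in> Basis" using insert by auto
  let ?t = "\<Sum>b\<in>B. (y \<bullet> b) *\<^sub>R b"
  have "(\<lambda>x. f (x + ((y \<bullet> b) *\<^sub>R b + ?t)) - f x) =
    (\<lambda>x. (f ((x + ?t) + (y \<bullet> b) *\<^sub>R b) - f (x + ?t)) + (f (x + ?t) - f x))"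
   by (auto simp: algebra_simps fun_eq_iff)
  then have "n2 (\<lambda>x. f (x + ((y \<bullet> b) *\<^sub>R b + ?t)) - f x) \<le>
    n2 (\<lambda>x. f ((x + ?t) + (y \<bullet> b) *\<^sub>R b) - f (x + ?t)) + n2 (\<lambda>x. f (x + ?t) - f x)"
  proof -
   have "sq (\<lambda>x. f (x + ?t + (y \<bullet> b) *\<^sub>R b))" using sq_translate[OF s, of "?t + (y \<bullet> b) *\<^sub>R b"] by (simp add: add.assoc)
   then show ?thesis
    unfolding \<open>(\<lambda>x. f (x + ((y \<bullet> b) *\<^sub>R b + ?t)) - f x) = _\<close>
    by (intro n2_triangle sq_diff sq_translate s)
  qed
  also have "n2 (\<lambda>x. f ((x + ?t) + (y \<bullet> b) *\<^sub>R b) - f (x + ?t)) = n2 (\<lambda>x. f (x + (y \<bullet> b) *\<^sub>R b) - f x)"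
   using n2_translate[OF sq_diff[OF sq_translate[OF s] s]] .
  also have "... \<le> \<bar>y \<bullet> b\<bar> * n2 (d b)" by (rule n2_translate_basis[OF b h1_wd[OF assms b]])
  also have "... \<le> norm y * n2 (d b)" by (intro mult_right_mono Basis_le_norm b) auto
  finally show ?case using insert by simp
 qed (simp add: n2_def)
 from this[of Basis] show ?thesis by (simp add: euclidean_representation gr_def sum_distrib_left)
qed

text \<open>A translation by y costs |y| times the gradient, and the second moment of the heat
  kernel at time s is s times that at time 1. The constant is the root of the latter, plus 1 to be
  positive.\<close>

lemma heat_minus_self:
 obtains M where "M > 0" "\<And>s (f :: 'a::euclidean_space \<Rightarrow> complex) d. s > 0 \<Longrightarrow> h1 f d \<Longrightarrow>
  n2 (\<lambda>x. heat (of_real s) f x - f x) \<le> M * sqrt s * gr d"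
proof -
 let ?k = "\<lambda>s x::'a. exp (- ((x /\<^sub>R sqrt s) \<bullet> (x /\<^sub>R sqrt s)) / 4) / gauss0 TYPE('a) / sqrt s ^ DIM('a)"
 define m where "m = (LBINT y. ?k 1 y * (norm y)^2)"
 have g0: "gauss0 TYPE('a) > 0" by (rule gauss0_pos)
 have m0: "m \<ge> 0" unfolding m_def using g0 by (intro Bochner_Integration.integral_nonneg) auto
 show ?thesis
 proof (rule that[of "sqrt m + 1"])
  fix s :: real and f :: "'a \<Rightarrow> complex" and d
  assume s: "s > 0" and h: "h1 f d"
  have sf: "sq f" using h1_sq[OF h] .
  have gk: "gauss (of_real s) = (\<lambda>x::'a. of_real (?k s x))" using gauss_real[OF s] by auto
  have k: "ker (\<lambda>x. complex_of_real (?k s x))" unfolding gk[symmetric] using s by simp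
  have kn: "?k s x \<ge> 0" for x using g0 s by simp
  have ki: "(LBINT x. ?k s x) = 1"
  proof -
   have "(LBINT x. ?k s x) = n1 (gauss (of_real s) :: 'a \<Rightarrow> complex)"
    unfolding n1_def gk norm_of_real by (simp only: abs_of_nonneg[OF kn])
   then show ?thesis using n1_gauss_real[OF s, where 'a='a] by (simp only:)
  qed
  have sc: "(LBINT y. ?k s y * (norm y)^2) = s * m"
  proof -
   have "(LBINT y. ?k s y * (norm y)^2) = sqrt s ^ DIM('a) * (LBINT y. ?k s (sqrt s *\<^sub>R y) * (norm (sqrt s *\<^sub>R y))^2)"
    using s by (subst lborel_integral_affine[of _ "sqrt s" 0]) auto
   also have "(LBINT y. ?k s (sqrt s *\<^sub>R y) * (norm (sqrt s *\<^sub>R y))^2) = (LBINT y. (s / sqrt s ^ DIM('a)) * (?k 1 y * (norm y)^2))"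
    using s by (intro Bochner_Integration.integral_cong) (auto simp: power_mult_distrib mult_ac)
   also have "... = (s / sqrt s ^ DIM('a)) * m" unfolding m_def by (rule integral_mult_right_zero)
   finally show ?thesis using s by simp
  qed
  have km: "(\<lambda>y. ?k s y * (norm y)^2) \<in> borel_measurable borel" by measurable
  have int2: "integrable lborel (\<lambda>y. ?k s y * (norm y)^2)"
  proof -
   obtain P where P: "\<And>t. t \<ge> 0 \<Longrightarrow> (1 + t) ^ 1 \<le> P * exp (1 / (8 * s) * t)"
    using polynomial_le_exp[of "1 / (8 * s)" 1] s by auto
   show ?thesis
   proof (rule integrable_dominated)
    show "integrable lborel (\<lambda>y::'a. (P / gauss0 TYPE('a) / sqrt s ^ DIM('a)) * exp (- (1 / (8 * s)) * (y \<bullet> y)))"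
     by (intro integrable_mult_right integrable_exp_inner) (use s in simp)
    show "(\<lambda>y. ?k s y * (norm y)^2) \<in> borel_measurable lborel" using km by simp
    fix y :: 'a
    have "exp (- ((y /\<^sub>R sqrt s) \<bullet> (y /\<^sub>R sqrt s)) / 4) * (norm y)^2 \<le> exp (- (1 / (4 * s)) * (y \<bullet> y)) * (P * exp (1 / (8 * s) * (y \<bullet> y)))"
    proof (intro mult_mono)
     show "exp (- ((y /\<^sub>R sqrt s) \<bullet> (y /\<^sub>R sqrt s)) / 4) \<le> exp (- (1 / (4 * s)) * (y \<bullet> y))"
      using s by (simp add: field_simps)
     show "(norm y)^2 \<le> P * exp (1 / (8 * s) * (y \<bullet> y))" using P[of "y \<bullet> y"] by (simp add: power2_norm_eq_inner)
    qed auto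
    also have "... = P * exp (- (1 / (8 * s)) * (y \<bullet> y))"
     using s by (simp add: mult.left_commute flip: exp_add)
    finally have "exp (- ((y /\<^sub>R sqrt s) \<bullet> (y /\<^sub>R sqrt s)) / 4) * (norm y)^2 / (gauss0 TYPE('a) * sqrt s ^ DIM('a)) \<le>
     P * exp (- (1 / (8 * s)) * (y \<bullet> y)) / (gauss0 TYPE('a) * sqrt s ^ DIM('a))"
     using g0 s by (intro divide_right_mono) auto
    then show "norm (?k s y * (norm y)^2) \<le> (P / gauss0 TYPE('a) / sqrt s ^ DIM('a)) * exp (- (1 / (8 * s)) * (y \<bullet> y))"
     using g0 s by simp
   qed
  qed
  note B = conv_minus_self_bound[OF k kn ki sf]
  have "(n2 (\<lambda>x. heat (of_real s) f x - f x))^2 \<le> (LBINT y. ?k s y * (n2 (\<lambda>x. f (x - y) - f x))^2)"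
   using B(2) unfolding heat_def gk .
  also have "... \<le> (LBINT y. (?k s y * (norm y)^2) * (gr d)^2)"
  proof (rule integral_mono[OF B(1)])
   show "integrable lborel (\<lambda>y. (?k s y * (norm y)^2) * (gr d)^2)" by (intro integrable_mult_left int2)
   fix y
   have "(n2 (\<lambda>x. f (x - y) - f x))^2 \<le> (norm y * gr d)^2"
    using n2_translate_le[OF h, of "- y"] by (intro power_mono) auto
   then show "?k s y * (n2 (\<lambda>x. f (x - y) - f x))^2 \<le> (?k s y * (norm y)^2) * (gr d)^2"
    using mult_left_mono[OF _ kn[of y]] by (simp add: power_mult_distrib mult.assoc)
  qed
  also have "... = (sqrt m * sqrt s * gr d)^2"
  proof -
   have "(LBINT y. (?k s y * (norm y)^2) * (gr d)^2) = (s * m) * (gr d)^2"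
    unfolding sc[symmetric] by (rule integral_mult_left_zero)
   also have "... = (sqrt m * sqrt s * gr d)^2" using m0 s by (simp add: power_mult_distrib)
   finally show ?thesis .
  qed
  finally have A: "(n2 (\<lambda>x. heat (of_real s) f x - f x))^2 \<le> (sqrt m * sqrt s * gr d)^2" .
  have "n2 (\<lambda>x. heat (of_real s) f x - f x) \<le> sqrt m * sqrt s * gr d"
   by (rule power2_le_imp_le[OF A]) (use m0 s in simp)
  also have "... \<le> (sqrt m + 1) * sqrt s * gr d" using s by (intro mult_right_mono) auto
  finally show "n2 (\<lambda>x. heat (of_real s) f x - f x) \<le> (sqrt m + 1) * sqrt s * gr d" .
 qed (use m0 in \<open>simp add: add_nonneg_pos\<close>)
qed

text \<open>\<open>heat_pairing_sum\<close> requires both times to have positive real part, so the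
  second time is sent to 0 through a sequence \<open>e\<close> of positive real numbers.\<close>

lemma heat_semigroup_pairing:
 assumes z: "Re z > 0" "Re w > 0" and f: "sq f" and g: "sq g"
 shows "(LBINT x. heat z f x * heat w g x) = (LBINT x. heat (z + w) f x * g x)"
proof -
 define e where "e n = Re w * inv_nat n / 2" for n
 have e: "e n > 0" "e n < Re w" for n
  using z(2) by (auto simp: e_def inv_nat_def divide_simps)
 have e0: "e \<longlonglongrightarrow> 0" unfolding e_def[abs_def] using tendsto_mult_right_zero[OF inv_nat_tendsto, of "Re w / 2"] by simp
 have eq: "(LBINT x. heat z f x * heat w g x) = (LBINT x. heat (z + w - of_real (e n)) f x * heat (of_real (e n)) g x)" for n
  by (rule heat_pairing_sum[OF f g]) (use z e(1)[of n] e(2)[of n] in auto)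
 have "(\<lambda>n. z + w - of_real (e n)) \<longlonglongrightarrow> z + w - of_real 0" by (intro tendsto_intros e0)
 then have "(\<lambda>n. LBINT x. heat (z + w - of_real (e n)) f x * heat (of_real (e n)) g x) \<longlonglongrightarrow> (LBINT x. heat (z + w) f x * g x)"
  by (intro integral_mult_tendsto2 heat_z_limits(3) heat_approximate_identity(1) heat_sq f g e e0)
   (use z e(1)[THEN less_imp_neq] e(1) add_strict_increasing2[OF less_imp_le[OF z(1)] e(2)] in auto)
 then show ?thesis unfolding eq[symmetric] by (simp add: LIMSEQ_const_iff)
qed

text \<open>Smooth both factors at time s = 2^(-k) and telescope. An increment costs sqrt s on the
  side of f, by \<open>heat_minus_self\<close>, and s^(-a/2) on the side of G; the product s^((1 -
  a)/2) is summable because a < 1.\<close>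

lemma Sobolev_pairing:
 assumes r: "r > 2" and a: "decay TYPE('a::euclidean_space) r < 1"
 obtains K where "K > 0" "\<And>(f :: 'a \<Rightarrow> complex) d G. h1 f d \<Longrightarrow> sq G \<Longrightarrow> lp (conj_exp r) G \<Longrightarrow>
  cmod (LBINT x. f x * G x) \<le> K * hn f d * np (conj_exp r) G"
proof -
 let ?a = "decay TYPE('a) r"
 obtain C where C: "C > 0" "\<And>z (f :: 'a \<Rightarrow> complex). Re z > 0 \<Longrightarrow> sq f \<Longrightarrow> lp (conj_exp r) f \<Longrightarrow>
  lp r (heat z f) \<and> np r (heat z f) \<le> C * cmod z powr (- ?a) * np (conj_exp r) f"
  using dispersive[OF r, where 'a='a] by blast
 obtain M where M: "M > 0" "\<And>s (f :: 'a \<Rightarrow> complex) d. s > 0 \<Longrightarrow> h1 f d \<Longrightarrow>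
  n2 (\<lambda>x. heat (of_real s) f x - f x) \<le> M * sqrt s * gr d"
  using heat_minus_self[where 'a='a] by blast
 have q: "conj_exp r > 1" "1 / r + 1 / conj_exp r = 1" using conj_exp[of r] r by auto
 define E where "E = sqrt (C * 2 powr (- ?a))"
 have E: "E > 0" using C by (simp add: E_def)
 \<comment> \<open>The squared norm is a pairing of G with its image at time 2 s, to which the
   dispersive estimate and Hoelder's inequality apply.\<close>
 have hG: "n2 (heat (of_real s) G) \<le> E * s powr (- ?a / 2) * np (conj_exp r) G"
  if s: "s > 0" and G: "sq G" "lp (conj_exp r) G" for s and G :: "'a \<Rightarrow> complex"
 proof -
  let ?z = "of_real s :: complex" and ?w = "of_real (2 * s) :: complex"
  have rs: "Re ?z > 0" "Re ?w > 0" using s by auto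
  have "complex_of_real ((n2 (heat ?z G))^2) = (LBINT x. heat ?z G x * heat ?z (\<lambda>x. cnj (G x)) x)"
   unfolding n2_square_cnj heat_cnj[OF rs(1)] by simp
  also have "... = (LBINT x. heat ?w G x * cnj (G x))"
   using heat_semigroup_pairing[OF rs(1) rs(1) G(1) sq_cnj[OF G(1)]] by simp
  finally have "(n2 (heat ?z G))^2 = cmod (LBINT x. heat ?w G x * cnj (G x))"
   by (metis abs_power2 norm_of_real)
  also have "... \<le> np r (heat ?w G) * np (conj_exp r) (\<lambda>x. cnj (G x))"
   using C(2)[OF rs(2) G] r by (intro lp_Holder_mult q lp_cnj G) auto
  also have "... \<le> (C * cmod ?w powr (- ?a) * np (conj_exp r) G) * np (conj_exp r) G"
   using C(2)[OF rs(2) G] by (auto intro!: mult_right_mono)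
  also have "cmod ?w powr (- ?a) = 2 powr (- ?a) * s powr (- ?a)" using s by (simp add: powr_mult)
  also have "C * (2 powr (- ?a) * s powr (- ?a)) * np (conj_exp r) G * np (conj_exp r) G = (E * s powr (- ?a / 2) * np (conj_exp r) G)^2"
  proof -
   have "(s powr (- ?a / 2))^2 = s powr (- ?a)" using s by (simp add: power2_eq_square flip: powr_add)
   moreover have "E^2 = C * 2 powr (- ?a)" using C by (simp add: E_def)
   ultimately show ?thesis by (simp add: power_mult_distrib power2_eq_square[of "np (conj_exp r) G"])
  qed
  finally show ?thesis using E by (intro power2_le_imp_le[of "n2 (heat ?z G)"]) auto
 qed
 \<comment> \<open>The power of s that remains for an increment, and in \<open>p\<close> the
   resulting ratio of the geometric series.\<close>
 define \<theta> where "\<theta> = (1 - ?a) / 2"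
 define p where "p = (1/2::real) powr \<theta>"
 have \<theta>: "\<theta> > 0" using a by (simp add: \<theta>_def)
 have p: "0 < p" "p < 1" using \<theta> powr_less_mono'[of "1/2" 0 \<theta>] by (auto simp: p_def)
 define K where "K = E + 3 * M * E / (1 - p)"
 have K: "K > 0" using E M p by (simp add: K_def add_pos_pos)
 show ?thesis
 proof (rule that[OF K])
  fix f G :: "'a \<Rightarrow> complex" and d
  assume h: "h1 f d" and G: "sq G" "lp (conj_exp r) G"
  let ?G = "np (conj_exp r) G"
  have sf: "sq f" using h1_sq[OF h] .
  define s where "s k = (1/2::real) ^ k" for k :: nat
  have s: "s k > 0" for k by (simp add: s_def)
  have s0: "s \<longlonglongrightarrow> 0" unfolding s_def[abs_def] by (rule LIMSEQ_power_zero) simp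
  define B where "B k = (LBINT x. heat (of_real (s k)) f x * heat (of_real (s k)) G x)" for k
  have Bl: "B \<longlonglongrightarrow> (LBINT x. f x * G x)"
   unfolding B_def[abs_def]
   by (intro integral_mult_tendsto2 heat_approximate_identity(1) heat_sq sf G s s0) (use s in auto)
  have B0: "cmod (B 0) \<le> n2 f * (E * ?G)"
  proof -
   have "cmod (B 0) \<le> n2 (heat (of_real (s 0)) f) * n2 (heat (of_real (s 0)) G)"
    unfolding B_def by (intro sq_CS heat_sq sf G) (use s in auto)
   also have "... \<le> n2 f * (E * s 0 powr (- ?a / 2) * ?G)"
    by (intro mult_mono heat_real_contraction hG sf G s) auto
   finally show ?thesis by (simp add: s_def)
  qed
  have Bd: "cmod (B (Suc k) - B k) \<le> 3 * M * E * gr d * ?G * p ^ Suc k" for k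
  proof -
   let ?t = "s (Suc k)"
   let ?f = "\<lambda>c. heat (of_real (c * ?t)) f"
   have t: "?t > 0" by (rule s)
   \<comment> \<open>The times 2 t and 2 t in \<open>B k\<close> are redistributed as 3 t and t, so
     that both pairings have the same second factor and the difference falls on f alone.\<close>
   have "B k = (LBINT x. ?f 3 x * heat (of_real ?t) G x)"
    unfolding B_def using t s by (intro heat_pairing_sum sf G) (auto simp: s_def)
   moreover have i: "integrable lborel (\<lambda>x. ?f 3 x * heat (of_real ?t) G x)"
    "integrable lborel (\<lambda>x. heat (of_real ?t) f x * heat (of_real ?t) G x)"
    using t by (auto intro!: sq_CS heat_sq sf G)
   ultimately have "B (Suc k) - B k = (LBINT x. (heat (of_real ?t) f x - ?f 3 x) * heat (of_real ?t) G x)"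
    unfolding B_def left_diff_distrib by simp
   then have "cmod (B (Suc k) - B k) \<le> n2 (\<lambda>x. heat (of_real ?t) f x - ?f 3 x) * n2 (heat (of_real ?t) G)"
    using t by (auto intro!: sq_CS sq_diff heat_sq sf G)
   also have "... \<le> (3 * M * sqrt ?t * gr d) * (E * ?t powr (- ?a / 2) * ?G)"
   proof (intro mult_mono hG t G)
    have sd: "sq (\<lambda>x. heat (of_real ?t) f x - f x)" "sq (\<lambda>x. f x - ?f 3 x)"
     using t by (auto intro!: sq_diff heat_sq sf)
    have "n2 (\<lambda>x. heat (of_real ?t) f x - ?f 3 x) \<le>
     n2 (\<lambda>x. heat (of_real ?t) f x - f x) + n2 (\<lambda>x. f x - ?f 3 x)"
     using n2_triangle[OF sd] by simp
    also have "n2 (\<lambda>x. f x - ?f 3 x) = n2 (\<lambda>x. ?f 3 x - f x)"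
     by (rule n2_diff_comm)
    also have "n2 (\<lambda>x. heat (of_real ?t) f x - f x) + n2 (\<lambda>x. ?f 3 x - f x) \<le>
     M * sqrt ?t * gr d + M * sqrt (3 * ?t) * gr d"
     using t by (intro add_mono M h) auto
    also have "... \<le> M * sqrt ?t * gr d + M * (2 * sqrt ?t) * gr d"
     using t M real_sqrt_le_mono[of "3 * ?t" "4 * ?t"] by (intro add_left_mono mult_right_mono mult_left_mono) (auto simp: real_sqrt_mult)
    finally show "n2 (\<lambda>x. heat (of_real ?t) f x - ?f 3 x) \<le> 3 * M * sqrt ?t * gr d"
     by (simp add: algebra_simps)
   qed (use M t in auto)
   also have "... = 3 * M * E * gr d * ?G * (sqrt ?t * ?t powr (- ?a / 2))" by (simp add: mult_ac)
   also have "sqrt ?t * ?t powr (- ?a / 2) = ?t powr \<theta>"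
    using t by (simp add: \<theta>_def diff_divide_distrib flip: powr_half_sqrt powr_add)
   also have "?t powr \<theta> = p ^ Suc k"
   proof -
    have "?t = (1/2) powr real (Suc k)" unfolding s_def by (subst powr_realpow) auto
    then have "?t powr \<theta> = ((1/2) powr \<theta>) powr real (Suc k)" by (simp only: powr_powr mult.commute)
    then show ?thesis using p(1) unfolding p_def[symmetric] by (subst (asm) powr_realpow) auto
   qed
   finally show ?thesis .
  qed
  let ?c = "3 * M * E * gr d * ?G"
  have c0: "?c \<ge> 0" using M E by simp
  have part: "cmod (B n) \<le> n2 f * (E * ?G) + ?c / (1 - p)" for n
  proof -
   have "B n = B 0 + (\<Sum>k<n. B (Suc k) - B k)" by (simp add: sum_lessThan_telescope)
   then have "cmod (B n) \<le> cmod (B 0) + cmod (\<Sum>k<n. B (Suc k) - B k)" by (metis norm_triangle_ineq)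
   also have "cmod (\<Sum>k<n. B (Suc k) - B k) \<le> (\<Sum>k<n. ?c * p ^ Suc k)"
    by (rule order_trans[OF norm_sum]) (intro sum_mono Bd)
   also have "... \<le> (\<Sum>k<n. ?c * p ^ k)"
    using p c0 by (intro sum_mono mult_left_mono power_decreasing) auto
   also have "... = ?c * (\<Sum>k<n. p ^ k)" by (rule sum_distrib_left[symmetric])
   also have "... \<le> ?c * (1 / (1 - p))"
   proof (intro mult_left_mono c0)
    have "(\<Sum>k<n. p ^ k) = (1 - p ^ n) / (1 - p)" using p by (simp add: sum_gp_strict)
    also have "... \<le> 1 / (1 - p)" using p by (intro divide_right_mono) auto
    finally show "(\<Sum>k<n. p ^ k) \<le> 1 / (1 - p)" .
   qed
   finally show ?thesis using B0 by simp
  qed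
  have "cmod (LBINT x. f x * G x) \<le> n2 f * (E * ?G) + ?c / (1 - p)"
   by (rule LIMSEQ_le_const2[OF tendsto_norm[OF Bl]]) (use part in blast)
  also have "... \<le> K * hn f d * ?G"
  proof -
   have "n2 f * (E * ?G) \<le> hn f d * (E * ?G)" using E by (intro mult_right_mono n2_le_hn) auto
   moreover have "?c / (1 - p) = (3 * M * E / (1 - p) * ?G) * gr d" by simp
   moreover have "... \<le> (3 * M * E / (1 - p) * ?G) * hn f d"
    using M E p by (intro mult_left_mono gr_le_hn) auto
   ultimately have "n2 f * (E * ?G) + ?c / (1 - p) \<le> hn f d * (E * ?G) + (3 * M * E / (1 - p) * ?G) * hn f d"
    by linarith
   also have "... = K * hn f d * ?G" by (simp add: K_def algebra_simps)
   finally show ?thesis .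
  qed
  finally show "cmod (LBINT x. f x * G x) \<le> K * hn f d * ?G" .
 qed
qed

lemma Sobolev:
 assumes p: "p \<ge> 2" and a: "decay TYPE('a::euclidean_space) p < 1"
 obtains K where "K > 0" "\<And>(f :: 'a \<Rightarrow> complex) d. h1 f d \<Longrightarrow> lp p f \<and> np p f \<le> K * hn f d"
proof (cases "p = 2")
 case True
 show ?thesis using True by (intro that[of 1]) (auto simp: h1_sq n2_le_hn)
next
 case False
 then have p: "p > 2" using p by simp
 obtain K where K: "K > 0" "\<And>(f :: 'a \<Rightarrow> complex) d G. h1 f d \<Longrightarrow> sq G \<Longrightarrow> lp (conj_exp p) G \<Longrightarrow>
  cmod (LBINT x. f x * G x) \<le> K * hn f d * np (conj_exp p) G"
  using Sobolev_pairing[OF p a] by blast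
 show ?thesis
 proof (rule that[OF K(1)])
  fix f :: "'a \<Rightarrow> complex" and d assume h: "h1 f d"
  show "lp p f \<and> np p f \<le> K * hn f d"
   using converse_Holder[OF p h1_sq[OF h], of "K * hn f d"] K(2)[OF h] K(1) by simp
 qed
qed

section \<open>The nonlinearity and its truncations\<close>

lemma mean_value_bounds:
 fixes F :: "real \<Rightarrow> real"
 assumes ab: "a \<le> b" and c: "continuous_on {a..b} F"
  and D: "\<And>x. a < x \<Longrightarrow> x < b \<Longrightarrow> (F has_real_derivative f x) (at x)"
  and lu: "\<And>x. a < x \<Longrightarrow> x < b \<Longrightarrow> l \<le> f x \<and> f x \<le> u"
 shows "l * (b - a) \<le> F b - F a" "F b - F a \<le> u * (b - a)"
proof -
 have "l * (b - a) \<le> F b - F a \<and> F b - F a \<le> u * (b - a)"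
 proof (cases "a = b")
  case False
  then have "a < b" using ab by simp
  from MVT[OF this c] D obtain m x where x: "a < x" "x < b" "DERIV F x :> m" "F b - F a = (b - a) * m"
   by (metis real_differentiable_def)
  have "m = f x" using DERIV_unique[OF x(3) D[OF x(1,2)]] .
  then show ?thesis using lu[OF x(1,2)] x ab by (simp add: mult.commute mult_left_mono)
 qed simp
 then show "l * (b - a) \<le> F b - F a" "F b - F a \<le> u * (b - a)" by auto
qed

definition rad :: "(real \<Rightarrow> real) \<Rightarrow> complex \<Rightarrow> complex" where
 "rad \<Gamma> z = of_real (\<Gamma> (cmod z)) * sgn z"

text \<open>The squared distance of two points with moduli s, t and directions e, f is (s - t)^2 + 2
  s t (1 - e \<bullet> f). Both summands grow by at most L^2 under the radial map.\<close>

lemma rad_Lipschitz: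
 assumes \<Gamma>0: "\<Gamma> 0 = 0" and L: "\<And>p u. 0 \<le> u \<Longrightarrow> u \<le> p \<Longrightarrow> p \<le> R \<Longrightarrow> 0 \<le> \<Gamma> p - \<Gamma> u \<and> \<Gamma> p - \<Gamma> u \<le> L * (p - u)"
  and R: "cmod a \<le> R" "cmod b \<le> R"
 shows "cmod (rad \<Gamma> a - rad \<Gamma> b) \<le> L * cmod (a - b)"
proof -
 let ?p = "cmod a" and ?u = "cmod b"
 have G: "0 \<le> \<Gamma> ?p" "\<Gamma> ?p \<le> L * ?p" "0 \<le> \<Gamma> ?u" "\<Gamma> ?u \<le> L * ?u"
  using L[of 0 ?p] L[of 0 ?u] R \<Gamma>0 by auto
 consider "a = 0 \<or> b = 0" | "a \<noteq> 0" "b \<noteq> 0" by blast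
 then show ?thesis
 proof cases
  case 1
  then show ?thesis using G by (auto simp: rad_def norm_mult norm_sgn)
 next
  case 2
  then have pos: "?p > 0" "?u > 0" by auto
  then have "0 \<le> L * ?p" using G by linarith
  then have L0: "L \<ge> 0" using pos by (simp add: zero_le_mult_iff)
  define e where "e = sgn a" define f where "f = sgn b"
  have ee: "e \<bullet> e = 1" "f \<bullet> f = 1" using 2 by (simp_all add: e_def f_def dot_square_norm norm_sgn)
  have ef: "e \<bullet> f \<le> 1" using norm_cauchy_schwarz[of e f] 2 by (simp add: e_def f_def norm_sgn)
  have n: "(cmod (s *\<^sub>R e - t *\<^sub>R f))^2 = (s - t)^2 + 2 * (s * t) * (1 - e \<bullet> f)" for s t
   by (simp only: power2_norm_eq_inner inner_diff_left inner_diff_right inner_scaleR_left inner_scaleR_right ee inner_commute[of f e])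
    (simp add: power2_eq_square algebra_simps)
  have ab: "a = ?p *\<^sub>R e" "b = ?u *\<^sub>R f" using 2 by (simp_all add: e_def f_def sgn_div_norm)
  have r: "rad \<Gamma> a = \<Gamma> ?p *\<^sub>R e" "rad \<Gamma> b = \<Gamma> ?u *\<^sub>R f" by (simp_all add: rad_def e_def f_def scaleR_conv_of_real)
  have "\<bar>\<Gamma> ?p - \<Gamma> ?u\<bar> \<le> L * \<bar>?p - ?u\<bar>"
   using L[of ?u ?p] L[of ?p ?u] R by (cases "?u \<le> ?p") (auto simp: abs_if)
  then have 1: "(\<Gamma> ?p - \<Gamma> ?u)^2 \<le> L^2 * (?p - ?u)^2"
   by (metis abs_ge_zero power2_abs power_mono power_mult_distrib)
  have "\<Gamma> ?p * \<Gamma> ?u \<le> (L * ?p) * (L * ?u)" using G L0 pos by (intro mult_mono) auto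
  then have 2: "2 * (\<Gamma> ?p * \<Gamma> ?u) * (1 - e \<bullet> f) \<le> 2 * (L^2 * (?p * ?u)) * (1 - e \<bullet> f)"
   using ef by (intro mult_right_mono) (auto simp: power2_eq_square mult_ac)
  have "(cmod (rad \<Gamma> a - rad \<Gamma> b))^2 = (\<Gamma> ?p - \<Gamma> ?u)^2 + 2 * (\<Gamma> ?p * \<Gamma> ?u) * (1 - e \<bullet> f)"
   unfolding r by (rule n)
  also have "... \<le> L^2 * (?p - ?u)^2 + 2 * (L^2 * (?p * ?u)) * (1 - e \<bullet> f)" using 1 2 by (rule add_mono)
  also have "... = L^2 * ((?p - ?u)^2 + 2 * (?p * ?u) * (1 - e \<bullet> f))" by (simp add: algebra_simps)
  also have "(?p - ?u)^2 + 2 * (?p * ?u) * (1 - e \<bullet> f) = (cmod (a - b))^2"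
   unfolding n[symmetric] using ab by simp
  finally have "(cmod (rad \<Gamma> a - rad \<Gamma> b))^2 \<le> (L * cmod (a - b))^2" by (simp add: power_mult_distrib)
  then show ?thesis using L0 by (rule_tac power2_le_imp_le) auto
 qed
qed

definition nl :: "real \<Rightarrow> complex \<Rightarrow> complex" where
 "nl \<alpha> z = of_real (cmod z powr \<alpha>) * z"

lemma nl_rad: "nl \<alpha> z = rad (\<lambda>p. p powr (\<alpha> + 1)) z"
proof (cases "z = 0")
 case False
 have "cmod z powr (\<alpha> + 1) = cmod z powr \<alpha> * cmod z" using False by (simp add: powr_add)
 then have "rad (\<lambda>p. p powr (\<alpha> + 1)) z = of_real (cmod z powr \<alpha>) * (of_real (cmod z) * sgn z)"
  by (simp add: rad_def)
 also have "of_real (cmod z) * sgn z = z" using False by (simp add: sgn_eq)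
 finally show ?thesis by (simp add: nl_def)
qed (simp add: nl_def rad_def)

lemma powr_Lipschitz:
 fixes \<alpha> s p R :: real
 assumes "\<alpha> \<ge> 0" "0 \<le> s" "s \<le> p" "p \<le> R"
 shows "0 \<le> p powr (\<alpha> + 1) - s powr (\<alpha> + 1)" "p powr (\<alpha> + 1) - s powr (\<alpha> + 1) \<le> (\<alpha> + 1) * R powr \<alpha> * (p - s)"
proof -
 have c: "continuous_on {s..p} (\<lambda>x. x powr (\<alpha> + 1))"
  using assms by (intro continuous_on_powr' continuous_intros) auto
 have D: "((\<lambda>x. x powr (\<alpha> + 1)) has_real_derivative (\<alpha> + 1) * x powr \<alpha>) (at x)" if "s < x" for x
  using that assms by (auto intro!: derivative_eq_intros)
 have lu: "0 \<le> (\<alpha> + 1) * x powr \<alpha> \<and> (\<alpha> + 1) * x powr \<alpha> \<le> (\<alpha> + 1) * R powr \<alpha>" if "s < x" "x < p" for x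
  using that assms by (auto intro!: mult_left_mono powr_mono2)
 from mean_value_bounds[OF assms(3) c D lu]
 show "0 \<le> p powr (\<alpha> + 1) - s powr (\<alpha> + 1)" "p powr (\<alpha> + 1) - s powr (\<alpha> + 1) \<le> (\<alpha> + 1) * R powr \<alpha> * (p - s)" by auto
qed

lemma nl_Lipschitz:
 assumes "\<alpha> \<ge> 0"
 shows "cmod (nl \<alpha> a - nl \<alpha> b) \<le> (\<alpha> + 1) * (cmod a + cmod b) powr \<alpha> * cmod (a - b)"
 unfolding nl_rad by (rule rad_Lipschitz[where R="cmod a + cmod b"]) (use powr_Lipschitz[OF assms] in auto)

lemma nl_continuous: "\<alpha> \<ge> 0 \<Longrightarrow> continuous_on UNIV (nl \<alpha>)"
proof -
 assume "\<alpha> \<ge> 0"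
 show ?thesis
 proof (intro continuous_at_imp_continuous_on ballI)
  fix z :: complex
  have lim: "((\<lambda>w. (\<alpha> + 1) * (cmod w + cmod z + 1) powr \<alpha> * cmod (w - z)) \<longlongrightarrow> (\<alpha> + 1) * (cmod z + cmod z + 1) powr \<alpha> * cmod (z - z)) (at z)"
  proof -
   have "cmod z + cmod z + 1 \<noteq> 0" using norm_ge_zero[of z] by linarith
   then show ?thesis by (intro tendsto_intros) auto
  qed
  have "((\<lambda>w. nl \<alpha> w - nl \<alpha> z) \<longlongrightarrow> 0) (at z)"
  proof (rule Lim_null_comparison[OF always_eventually[OF allI]])
   show "cmod (nl \<alpha> w - nl \<alpha> z) \<le> (\<alpha> + 1) * (cmod w + cmod z + 1) powr \<alpha> * cmod (w - z)" for w
    using nl_Lipschitz[OF \<open>\<alpha> \<ge> 0\<close>, of w z] \<open>\<alpha> \<ge> 0\<close>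
    by (rule_tac order_trans) (auto intro!: mult_right_mono mult_left_mono powr_mono2)
  qed (use lim in simp)
  then show "isCont (nl \<alpha>) z" by (simp add: isCont_def LIM_zero_iff)
 qed
qed

text \<open>The derivative of the radial profile p powr (\<alpha> + 1) is frozen at M. This makes G
  globally Lipschitz, hence admissible in the chain rule on H^1, and keeps it the gradient of a
  convex radial potential \<Phi>. The error is only due to large values, where a factor M powr (- k)
  is gained against a higher power.\<close>

lemma truncation_exists:
 assumes \<alpha>: "\<alpha> > 0" and k: "k > 0" and M: "M > 0"
 obtains G :: "complex \<Rightarrow> complex" and G' and \<Phi> :: "complex \<Rightarrow> real" and L
 where "L \<ge> 0" "G 0 = 0" "\<And>a b. cmod (G a - G b) \<le> L * cmod (a - b)"
  "\<And>z. (G has_derivative G' z) (at z)"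
  "\<And>a b. cmod ((nl \<alpha> a - G a) - (nl \<alpha> b - G b)) \<le> (\<alpha> + 1) * M powr (- k) * (cmod a + cmod b) powr (\<alpha> + k) * cmod (a - b)"
  "\<And>z. 0 \<le> \<Phi> z" "\<And>z. \<Phi> z \<le> cmod z powr (\<alpha> + 2)" "\<And>z. \<Phi> z \<le> L * (cmod z)^2"
  "\<And>z w. \<bar>\<Phi> w - \<Phi> z - Re (cnj (G z) * (w - z))\<bar> \<le> L * (cmod (w - z))^2"
  "\<And>z. \<exists>m. G z = of_real m * z"
  "continuous_on UNIV \<Phi>"
proof -
 \<comment> \<open>The derivative of the truncated profile; \<open>g\<close> is the profile of G and
   \<open>f\<close> that of \<Phi>.\<close>
 define w where "w s = (\<alpha> + 1) * (max 0 (min s M)) powr \<alpha>" for s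
 define L where "L = (\<alpha> + 1) * M powr \<alpha>"
 define g where "g q = integral {0..q} w" for q
 define f where "f q = integral {0..q} g" for q
 have L0: "L \<ge> 0" using \<alpha> by (simp add: L_def)
 have wc: "continuous_on S w" for S
  unfolding w_def using \<alpha> by (intro continuous_intros continuous_on_powr') auto
 have wb: "0 \<le> w s \<and> w s \<le> L" for s
  unfolding w_def L_def using \<alpha> M by (auto intro!: mult_left_mono powr_mono2)
 have \<gamma>D: "(g has_real_derivative w q) (at q)" if "q > 0" for q
 proof -
  have "((\<lambda>x. integral {0..x} w) has_real_derivative w q) (at q within {0..q+1})"
   by (rule integral_has_real_derivative[OF wc]) (use that in auto)
  then show ?thesis using that at_within_interior[of q "{0..q+1}"] by (simp add: g_def[abs_def] interior_atLeastAtMost_real)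
 qed
 have \<gamma>c: "continuous_on {a..b} g" if "a \<ge> 0" for a b
 proof -
  have "continuous_on {0..b} g" unfolding g_def[abs_def]
   by (rule indefinite_integral_continuous_1[OF integrable_continuous_real[OF wc]])
  then show ?thesis by (rule continuous_on_subset) (use that in auto)
 qed
 have \<gamma>0: "g 0 = 0" by (simp add: g_def)
 have \<gamma>L: "0 \<le> g q - g s \<and> g q - g s \<le> L * (q - s)" if "0 \<le> s" "s \<le> q" for q s
  using mean_value_bounds[OF that(2) \<gamma>c[OF that(1)] \<gamma>D, of 0 L] wb that by auto
 have pD: "((\<lambda>x. x powr (\<alpha> + 1)) has_real_derivative (\<alpha> + 1) * x powr \<alpha>) (at x)" if "0 < x" for x
  using that \<alpha> by (auto intro!: derivative_eq_intros)
 have pc: "continuous_on {a..b} (\<lambda>x. x powr (\<alpha> + 1))" if "a \<ge> 0" for a b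
  using that \<alpha> by (intro continuous_on_powr' continuous_intros) auto
 have dif: "0 \<le> (q powr (\<alpha> + 1) - g q) - (s powr (\<alpha> + 1) - g s) \<and>
   (q powr (\<alpha> + 1) - g q) - (s powr (\<alpha> + 1) - g s) \<le> (\<alpha> + 1) * M powr (- k) * R powr (\<alpha> + k) * (q - s)"
  if "0 \<le> s" "s \<le> q" "q \<le> R" for q s R
 proof -
  have D: "((\<lambda>x. x powr (\<alpha> + 1) - g x) has_real_derivative (\<alpha> + 1) * x powr \<alpha> - w x) (at x)" if "s < x" for x
   using that \<open>0 \<le> s\<close> by (intro DERIV_diff pD \<gamma>D) auto
  have lu: "0 \<le> (\<alpha> + 1) * x powr \<alpha> - w x \<and> (\<alpha> + 1) * x powr \<alpha> - w x \<le> (\<alpha> + 1) * M powr (- k) * R powr (\<alpha> + k)"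
   if x: "s < x" "x < q" for x
  proof (cases "x \<le> M")
   case True
   then show ?thesis using x \<open>0 \<le> s\<close> \<alpha> by (simp add: w_def)
  next
   case False
   have x0: "x > 0" using x \<open>0 \<le> s\<close> by simp
   have "M powr \<alpha> \<le> x powr \<alpha>" using False M \<alpha> by (intro powr_mono2) auto
   then have 1: "w x \<le> (\<alpha> + 1) * x powr \<alpha>" using False M \<alpha> by (simp add: w_def)
   \<comment> \<open>Beyond M, the negative power x powr (- k) is at most M powr (- k), which is the
     gain of the truncation.\<close>
   have "x powr \<alpha> = x powr (- k) * x powr (\<alpha> + k)" using x0 by (simp flip: powr_add)
   also have "... \<le> M powr (- k) * R powr (\<alpha> + k)"
    using False M x x0 \<open>q \<le> R\<close> \<alpha> k by (intro mult_mono powr_mono2 powr_mono2') auto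
   finally have "(\<alpha> + 1) * x powr \<alpha> \<le> (\<alpha> + 1) * (M powr (- k) * R powr (\<alpha> + k))" using \<alpha> by (intro mult_left_mono) auto
   then show ?thesis using 1 wb[of x] by (simp add: mult.assoc)
  qed
  show ?thesis
   using mean_value_bounds[OF that(2) continuous_on_diff[OF pc[OF that(1)] \<gamma>c[OF that(1)]] D lu] by auto
 qed
 have \<gamma>p: "g q \<le> q powr (\<alpha> + 1)" "0 \<le> g q" "g q \<le> L * q" if "q \<ge> 0" for q
  using dif[of 0 q q] \<gamma>L[of 0 q] that \<gamma>0 by auto
 have \<phi>D: "(f has_real_derivative g q) (at q)" if "q > 0" for q
 proof -
  have "((\<lambda>x. integral {0..x} g) has_real_derivative g q) (at q within {0..q+1})"
   by (rule integral_has_real_derivative[OF \<gamma>c]) (use that in auto)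
  then show ?thesis using that at_within_interior[of q "{0..q+1}"] by (simp add: f_def[abs_def] interior_atLeastAtMost_real)
 qed
 have \<phi>c0: "continuous_on {0..b} f" for b unfolding f_def[abs_def]
  by (rule indefinite_integral_continuous_1[OF integrable_continuous_real[OF \<gamma>c]]) simp
 have \<phi>c: "continuous_on {a..b} f" if "a \<ge> 0" for a b
  by (rule continuous_on_subset[OF \<phi>c0[of b]]) (use that in auto)
 \<comment> \<open>The subgradient inequality for \<open>f\<close>, which is convex because
   \<open>g\<close> is increasing.\<close>
 have sub: "g q * (t - q) \<le> f t - f q" if "q \<ge> 0" "t \<ge> 0" for q t
 proof (cases "q \<le> t")
  case True
  have "g q \<le> g x \<and> g x \<le> g t" if "q < x" "x < t" for x using \<gamma>L[of q x] \<gamma>L[of x t] that \<open>q \<ge> 0\<close> by auto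
  then show ?thesis using mean_value_bounds(1)[OF True \<phi>c[OF that(1)] \<phi>D] that by auto
 next
  case False
  then have "t \<le> q" by simp
  have "g t \<le> g x \<and> g x \<le> g q" if "t < x" "x < q" for x using \<gamma>L[of t x] \<gamma>L[of x q] that \<open>t \<ge> 0\<close> by auto
  from mean_value_bounds(2)[OF \<open>t \<le> q\<close> \<phi>c[OF that(2)] \<phi>D this]
  have "f q - f t \<le> g q * (q - t)" using that by auto
  then show ?thesis by (simp add: algebra_simps)
 qed
 have \<phi>0: "f 0 = 0" by (simp add: f_def)
 have \<phi>b: "0 \<le> f q" "f q \<le> q * g q" if "q \<ge> 0" for q
  using sub[of 0 q] sub[of q 0] that \<phi>0 \<gamma>0 by (auto simp: mult.commute)
 let ?G = "rad g" and ?\<Phi> = "\<lambda>z. f (cmod z)"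
 have GL: "cmod (?G a - ?G b) \<le> L * cmod (a - b)" for a b
  by (rule rad_Lipschitz[of g "max (cmod a) (cmod b)"]) (use \<gamma>L \<gamma>0 in auto)
 \<comment> \<open>At the origin |G h| \<le> |h| powr (\<alpha> + 1) with \<alpha> > 0, so the
   derivative is 0; elsewhere the norm is differentiable.\<close>
 have Gdiff: "?G differentiable (at z)" for z
 proof (cases "z = 0")
  case True
  have "(?G has_derivative (\<lambda>h. 0)) (at 0)"
   unfolding has_derivative_at
  proof (intro conjI)
   have "((\<lambda>h::complex. cmod h powr \<alpha>) \<longlongrightarrow> 0 powr \<alpha>) (at 0)"
    using \<alpha> by (intro tendsto_powr' tendsto_norm_zero tendsto_ident_at tendsto_const) auto
   then have lim: "((\<lambda>h::complex. cmod h powr \<alpha>) \<longlongrightarrow> 0) (at 0)" by simp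
   have "norm (?G (0 + h) - ?G 0 - 0) / norm h \<le> cmod h powr \<alpha>" for h
   proof (cases "h = 0")
    case False
    have "cmod (?G h) = g (cmod h)" using False \<gamma>p(2)[of "cmod h"] by (simp add: rad_def norm_mult norm_sgn)
    also have "... \<le> cmod h powr (\<alpha> + 1)" using \<gamma>p(1)[of "cmod h"] by simp
    finally show ?thesis using False by (simp add: powr_add field_simps rad_def \<gamma>0)
   qed (simp add: rad_def)
   then show "((\<lambda>h. norm (?G (0 + h) - ?G 0 - 0) / norm h) \<longlongrightarrow> 0) (at 0)"
    by (intro tendsto_zero_le[OF lim]) auto
  qed simp
  then show ?thesis using True by (auto simp: differentiable_def)
 next
  case False
  have "(g has_real_derivative w (cmod z)) (at (cmod z))" using \<gamma>D False by simp
  then have "(g \<circ> cmod) differentiable (at z)"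
   using False by (intro differentiable_chain_at differentiable_norm_at) (auto simp: real_differentiable_def)
  then have "(\<lambda>z. g (cmod z) / cmod z) differentiable (at z)"
   using False by (intro differentiable_divide differentiable_norm_at) (auto simp: o_def)
  then have "(\<lambda>z. (g (cmod z) / cmod z) *\<^sub>R z) differentiable (at z)"
   by (intro differentiable_scaleR) auto
  moreover have "(\<lambda>z. (g (cmod z) / cmod z) *\<^sub>R z) = ?G"
   by (auto simp: rad_def fun_eq_iff sgn_div_norm scaleR_conv_of_real divide_inverse)
  ultimately show ?thesis by simp
 qed
 define G' where "G' z = frechet_derivative ?G (at z)" for z
 have G': "(?G has_derivative G' z) (at z)" for z
  using Gdiff[of z] by (simp add: G'_def frechet_derivative_works)
 have Gre: "\<exists>m. ?G z = of_real m * z" for z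
  by (intro exI[of _ "g (cmod z) / cmod z"]) (simp add: rad_def sgn_eq)
 \<comment> \<open>Convexity of \<Phi> with gradient G. Exchanging the two points and using the
   Lipschitz bound gives the matching upper estimate, hence the quadratic remainder.\<close>
 have sub': "Re (cnj (?G z) * (v - z)) \<le> ?\<Phi> v - ?\<Phi> z" for z v
 proof -
  have "Re (cnj (sgn z) * v) \<le> cmod (cnj (sgn z) * v)" by (rule complex_Re_le_cmod)
  also have "... \<le> cmod v" by (auto simp: norm_mult norm_sgn)
  finally have 1: "Re (cnj (sgn z) * v) \<le> cmod v" .
  have 2: "Re (cnj (sgn z) * z) = cmod z"
  proof (cases "z = 0")
   case False
   have "cnj (sgn z) * z = of_real (cmod z)"
    using False complex_norm_square[of z] by (simp add: sgn_eq field_simps power2_eq_square)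
   then show ?thesis by simp
  qed simp
  have "Re (cnj (?G z) * (v - z)) = g (cmod z) * (Re (cnj (sgn z) * v) - Re (cnj (sgn z) * z))"
  proof -
   have "cnj (?G z) * (v - z) = of_real (g (cmod z)) * (cnj (sgn z) * v - cnj (sgn z) * z)"
    by (simp add: rad_def algebra_simps)
   then show ?thesis by simp
  qed
  also have "... \<le> g (cmod z) * (cmod v - cmod z)"
   using \<gamma>p(2)[of "cmod z"] 1 2 by (intro mult_left_mono) auto
  also have "... \<le> ?\<Phi> v - ?\<Phi> z" by (rule sub) auto
  finally show ?thesis .
 qed
 show ?thesis
 proof (rule that[of L ?G G' ?\<Phi>])
  show "L \<ge> 0" by (rule L0)
  show "?G 0 = 0" by (simp add: rad_def)
  show "cmod ((nl \<alpha> a - ?G a) - (nl \<alpha> b - ?G b)) \<le> (\<alpha> + 1) * M powr (- k) * (cmod a + cmod b) powr (\<alpha> + k) * cmod (a - b)" for a b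
  proof -
   have "nl \<alpha> z - ?G z = rad (\<lambda>q. q powr (\<alpha> + 1) - g q) z" for z
    by (simp add: nl_rad) (simp add: rad_def algebra_simps)
   then show ?thesis
    using rad_Lipschitz[of "\<lambda>q. q powr (\<alpha> + 1) - g q" "cmod a + cmod b" "(\<alpha> + 1) * M powr (- k) * (cmod a + cmod b) powr (\<alpha> + k)" a b] dif \<gamma>0
    by simp
  qed
  show "0 \<le> ?\<Phi> z" for z using \<phi>b by simp
  show "?\<Phi> z \<le> cmod z powr (\<alpha> + 2)" for z
  proof -
   have "?\<Phi> z \<le> cmod z * cmod z powr (\<alpha> + 1)"
    using \<phi>b(2)[of "cmod z"] \<gamma>p(1)[of "cmod z"] mult_left_mono[of "g (cmod z)" "cmod z powr (\<alpha> + 1)" "cmod z"] by simp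
   also have "... = cmod z powr (\<alpha> + 2)" using powr_mult_base[of "cmod z" "\<alpha> + 1"] by (simp add: add.commute)
   finally show ?thesis .
  qed
  show "?\<Phi> z \<le> L * (cmod z)^2" for z
   using \<phi>b(2)[of "cmod z"] mult_left_mono[OF \<gamma>p(3)[of "cmod z"], of "cmod z"] by (simp add: power2_eq_square mult_ac)
  show "\<bar>?\<Phi> v - ?\<Phi> z - Re (cnj (?G z) * (v - z))\<bar> \<le> L * (cmod (v - z))^2" for z v
  proof -
   have "?\<Phi> v - ?\<Phi> z \<le> Re (cnj (?G v) * (v - z))"
    using sub'[of v z] by (simp add: algebra_simps)
   also have "... = Re (cnj (?G z) * (v - z)) + Re (cnj (?G v - ?G z) * (v - z))"
    by (simp add: algebra_simps)
   also have "Re (cnj (?G v - ?G z) * (v - z)) \<le> cmod (?G v - ?G z) * cmod (v - z)"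
    by (metis complex_Re_le_cmod complex_mod_cnj norm_mult)
   also have "... \<le> L * cmod (v - z) * cmod (v - z)" by (intro mult_right_mono GL) auto
   finally show ?thesis using sub'[of z v] by (simp add: power2_eq_square)
  qed
  show "continuous_on UNIV ?\<Phi>"
  proof (intro continuous_at_imp_continuous_on ballI)
   fix z :: complex
   have "continuous_on (ball z 1) ?\<Phi>"
    by (rule continuous_on_compose2[OF \<phi>c0[of "cmod z + 1"]])
     (auto intro!: continuous_intros simp: dist_norm, smt (verit) norm_minus_commute norm_triangle_ineq2)
   then show "isCont ?\<Phi> z" by (simp add: continuous_on_eq_continuous_at)
  qed
 qed (use GL G' Gre in auto)
qed

lemma Holder3:
 fixes w v :: "'a::euclidean_space \<Rightarrow> complex" and W :: "'a \<Rightarrow> real"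
 assumes r: "r > 2" and W: "lp (r / (r - 2)) W" and w: "lp r w" and v: "lp r v"
 shows "integrable lborel (\<lambda>x. \<bar>W x\<bar> * (cmod (w x) * cmod (v x)))"
  and "(LBINT x. \<bar>W x\<bar> * (cmod (w x) * cmod (v x))) \<le> np (r / (r - 2)) W * (np r w * np r v)"
proof -
 have [measurable]: "w \<in> borel_measurable borel" "v \<in> borel_measurable borel" "W \<in> borel_measurable borel"
  using W w v by (auto simp: lp_def)
 have pq: "r / (r - 2) > 1" "r / 2 > 1" "1 / (r / (r - 2)) + 1 / (r / 2) = 1"
  using r by (auto simp: field_simps)
 let ?wv = "\<lambda>x. cmod (w x) * cmod (v x)"
 have e: "norm (?wv x) powr (r / 2) = cmod (w x) powr (r / 2) * cmod (v x) powr (r / 2)" for x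
  by (simp add: powr_mult)
 have p2: "(cmod (w x) powr (r / 2)) powr 2 = cmod (w x) powr r" "(cmod (v x) powr (r / 2)) powr 2 = cmod (v x) powr r" for x
  by (simp_all only: powr_powr) simp_all
 note H = Holder[of 2 2 "\<lambda>x. cmod (w x) powr (r / 2)" lborel "\<lambda>x. cmod (v x) powr (r / 2)", unfolded p2]
 have wv: "lp (r / 2) ?wv" unfolding lp_def e using H(1) w v by (simp add: lp_def)
 have "np (r / 2) ?wv \<le> ((LBINT x. cmod (w x) powr r) powr (1/2) * (LBINT x. cmod (v x) powr r) powr (1/2)) powr (1 / (r / 2))"
  unfolding np_def e using H(2) w v r by (intro powr_mono2) (auto simp: lp_def)
 also have "... = np r w * np r v"
  using r by (simp add: np_def powr_mult powr_powr)
 finally have n: "np (r / 2) ?wv \<le> np r w * np r v" .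
 show "integrable lborel (\<lambda>x. \<bar>W x\<bar> * ?wv x)"
  using lp_Holder(1)[OF pq W wv] by (simp add: abs_mult)
 have "(LBINT x. \<bar>W x\<bar> * ?wv x) \<le> np (r / (r - 2)) W * np (r / 2) ?wv"
  using lp_Holder(2)[OF pq W wv] by (simp add: abs_mult)
 also have "... \<le> np (r / (r - 2)) W * (np r w * np r v)" using n by (intro mult_left_mono) auto
 finally show "(LBINT x. \<bar>W x\<bar> * ?wv x) \<le> np (r / (r - 2)) W * (np r w * np r v)" .
qed

text \<open>Hoelder's inequality with w and v in L^r leaves the weight in L^(r/(r - 2)), that is, f
  in the exponent q r / (r - 2). The hypotheses on q place this exponent between 2 and r, where the
  Sobolev embedding is available.\<close>

lemma weighted_Holder:
 assumes r: "r > 2" and a: "decay TYPE('a::euclidean_space) r < 1" and g: "q > 0" "q * r / (r - 2) \<ge> 2" "q \<le> r - 2"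
 obtains K where "K > 0" "\<And>(f :: 'a \<Rightarrow> complex) d w v t. h1 f d \<Longrightarrow> lp r w \<Longrightarrow> lp r v \<Longrightarrow>
  integrable lborel (\<lambda>x. (cmod (f (x + t)) + cmod (f x)) powr q * (cmod (w x) * cmod (v x))) \<and>
  (LBINT x. (cmod (f (x + t)) + cmod (f x)) powr q * (cmod (w x) * cmod (v x))) \<le> K * hn f d powr q * (np r w * np r v)"
proof -
 let ?\<beta> = "q * r / (r - 2)"
 have \<beta>r: "?\<beta> \<le> r"
 proof -
  have "q * r \<le> (r - 2) * r" using g r by (intro mult_right_mono) auto
  then show ?thesis using r by (simp add: field_simps)
 qed
 have "decay TYPE('a) ?\<beta> \<le> decay TYPE('a) r"
 proof -
  have "1 / r \<le> 1 / ?\<beta>" using \<beta>r g r by (intro divide_left_mono) auto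
  then show ?thesis unfolding decay_def by (intro mult_left_mono) auto
 qed
 then have a': "decay TYPE('a) ?\<beta> < 1" using a by simp
 obtain K where K: "K > 0" "\<And>(f :: 'a \<Rightarrow> complex) d. h1 f d \<Longrightarrow> lp ?\<beta> f \<and> np ?\<beta> f \<le> K * hn f d"
  using Sobolev[OF g(2) a'] by blast
 show ?thesis
 proof (rule that[of "(2 * K) powr q"])
  show "(2 * K) powr q > 0" using K by simp
  fix f w v :: "'a \<Rightarrow> complex" and d t
  assume h: "h1 f d" and w: "lp r w" and v: "lp r v"
  have b1: "?\<beta> > 1" using g by linarith
  have lf: "lp ?\<beta> f" "np ?\<beta> f \<le> K * hn f d" using K(2)[OF h] by auto
  let ?s = "\<lambda>x. cmod (f (x + t)) + cmod (f x)"
  have l1: "lp ?\<beta> (\<lambda>x. cmod (f (x + t)))" "lp ?\<beta> (\<lambda>x. cmod (f x))"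
   using lp_translate[OF lf(1), of t] lf(1) unfolding lp_def by auto
  have n1: "np ?\<beta> (\<lambda>x. cmod (f (x + t))) = np ?\<beta> f" "np ?\<beta> (\<lambda>x. cmod (f x)) = np ?\<beta> f"
   using np_translate[OF lf(1), of t] by (auto simp: np_def)
  have ls: "lp ?\<beta> ?s" using b1 by (intro lp_add l1) auto
  have ns: "np ?\<beta> ?s \<le> 2 * K * hn f d" using np_triangle[OF l1 b1] n1 lf(2) by simp
  let ?W = "\<lambda>x. ?s x powr q"
  have e: "norm (?W x) powr (r / (r - 2)) = norm (?s x) powr ?\<beta>" for x by (simp add: powr_powr)
  have lW: "lp (r / (r - 2)) ?W" unfolding lp_def e using ls by (auto simp: lp_def)
  have "np (r / (r - 2)) ?W = np ?\<beta> ?s powr q"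
  proof -
   have "1 / (r / (r - 2)) = 1 / ?\<beta> * q" using r g by (simp add: field_simps)
   then show ?thesis unfolding np_def e by (simp only: powr_powr)
  qed
  also have "... \<le> (2 * K * hn f d) powr q" using ns g by (intro powr_mono2) auto
  also have "... = (2 * K) powr q * hn f d powr q" using K by (simp add: powr_mult)
  finally have nW: "np (r / (r - 2)) ?W \<le> (2 * K) powr q * hn f d powr q" .
  have "(LBINT x. ?W x * (cmod (w x) * cmod (v x))) \<le> np (r / (r - 2)) ?W * (np r w * np r v)"
   using Holder3(2)[OF r lW w v] by simp
  also have "... \<le> (2 * K) powr q * hn f d powr q * (np r w * np r v)" using nW by (intro mult_right_mono) auto
  finally show "integrable lborel (\<lambda>x. ?s x powr q * (cmod (w x) * cmod (v x))) \<and>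
    (LBINT x. ?s x powr q * (cmod (w x) * cmod (v x))) \<le> (2 * K) powr q * hn f d powr q * (np r w * np r v)"
   using Holder3(1)[OF r lW w v] by simp
 qed
qed

section \<open>Identities for solutions\<close>

text \<open>A global solution in terms of Borel representatives \<open>U\<close> with gradients
  \<open>D\<close>. \<open>E\<close> is the equation solved for the time derivative and tested on
  H^1; \<open>B\<close> is a local Lipschitz bound in H^-1, uniform over test functions, needed
  where the test function itself varies with time.\<close>

locale nls =
 fixes lam \<alpha> :: real and U :: "real \<Rightarrow> 'a::euclidean_space \<Rightarrow> complex" and D :: "real \<Rightarrow> 'a \<Rightarrow> 'a \<Rightarrow> complex"
 assumes lam: "lam \<le> 0" and al: "0 \<le> \<alpha>"
  and sub: "DIM('a) \<ge> 3 \<Longrightarrow> \<alpha> < 4 / (real DIM('a) - 2)"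
  and H: "h1 (U t) (D t)"
  and C: "((\<lambda>s. hn (\<lambda>x. U s x - U t x) (\<lambda>b x. D s b x - D t b x)) \<longlongrightarrow> 0) (at t)"
  and E: "h1 v dv \<Longrightarrow> ((\<lambda>s. (LBINT x. (U s x - U t x) * v x) / of_real (s - t)) \<longlongrightarrow>
   \<i> * (- (\<Sum>b\<in>Basis. LBINT x. D t b x * dv b x) + of_real lam * (LBINT x. nl \<alpha> (U t x) * v x))) (at t)"
  and B: "\<exists>C. \<forall>\<^sub>F s in at t. \<forall>v dv. h1 v dv \<longrightarrow> cmod (LBINT x. (U s x - U t x) * v x) \<le> C * \<bar>s - t\<bar> * hn v dv"
begin

lemma U_sq: "sq (U t)" using h1_sq[OF H] .
lemma D_sq: "b \<in> Basis \<Longrightarrow> sq (D t b)" using h1_sq_d[OF H] .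
lemma U_diff_sq: "sq (\<lambda>x. U s x - U t x)" by (intro sq_diff U_sq)

lemma measurable_U [measurable]: "U t \<in> borel_measurable borel" using U_sq by (simp add: sq_def)

text \<open>Interpolation between \<open>H\<^sup>1\<close> and \<open>H\<^sup>-\<^sup>1\<close>: quadratic errors in \<open>L\<^sup>2\<close> do not contribute to time derivatives.\<close>

lemma n2_diff_quotient_tendsto:
 "((\<lambda>s. (n2 (\<lambda>x. U s x - U t x))^2 / \<bar>s - t\<bar>) \<longlongrightarrow> 0) (at t)"
proof -
 obtain K where K: "\<forall>\<^sub>F s in at t. \<forall>v dv. h1 v dv \<longrightarrow> cmod (LBINT x. (U s x - U t x) * v x) \<le> K * \<bar>s - t\<bar> * hn v dv"
  using B by blast
 show ?thesis
 proof (rule tendsto_zero_le[OF tendsto_mult_right_zero[OF C[of t], of K]])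
  show "\<forall>\<^sub>F s in at t. (n2 (\<lambda>x. U s x - U t x))^2 / \<bar>s - t\<bar> \<le> K * hn (\<lambda>x. U s x - U t x) (\<lambda>b x. D s b x - D t b x)"
   using K eventually_neq_at_within[of t t UNIV]
  proof eventually_elim
   case (elim s)
   let ?\<delta> = "\<lambda>x. U s x - U t x"
   have h: "h1 (\<lambda>x. cnj (?\<delta> x)) (\<lambda>b x. cnj (D s b x - D t b x))" by (intro h1_cnj h1_diff H)
   have "(n2 ?\<delta>)^2 = cmod (LBINT x. ?\<delta> x * cnj (?\<delta> x))"
    unfolding n2_square_cnj[symmetric] by (simp add: norm_power)
   also have "... \<le> K * \<bar>s - t\<bar> * hn (\<lambda>x. cnj (?\<delta> x)) (\<lambda>b x. cnj (D s b x - D t b x))"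
    using elim(1) h by blast
   also have "hn (\<lambda>x. cnj (?\<delta> x)) (\<lambda>b x. cnj (D s b x - D t b x)) = hn ?\<delta> (\<lambda>b x. D s b x - D t b x)"
    by (rule hn_cnj)
   finally show ?case using elim(2) by (simp add: divide_simps mult_ac)
  qed
 qed simp
qed

text \<open>The chain rule across the duality of H^1 and H^-1: a functional of the solution may be
  differentiated in time if its gradient v at U t is in H^1 and the remainder is quadratic in L^2.
  Localised mass, shift norms and truncated potential energy are instances.\<close>

lemma functional_derivative:
 assumes v: "h1 v dv" and K: "\<And>s. \<bar>P s - P t - Re (LBINT x. (U s x - U t x) * v x)\<bar> \<le> K * (n2 (\<lambda>x. U s x - U t x))^2"
 shows "(P has_real_derivative Re (\<i> * (- (\<Sum>b\<in>Basis. LBINT x. D t b x * dv b x) + of_real lam * (LBINT x. nl \<alpha> (U t x) * v x)))) (at t)"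
  (is "(P has_real_derivative ?R) (at t)")
proof -
 let ?I = "\<lambda>s. LBINT x. (U s x - U t x) * v x"
 have 1: "((\<lambda>s. Re (?I s / of_real (s - t))) \<longlongrightarrow> ?R) (at t)" by (intro tendsto_Re E v)
 have 2: "((\<lambda>s. (P s - P t) / (s - t) - Re (?I s / of_real (s - t))) \<longlongrightarrow> 0) (at t)"
 proof (rule Lim_null_comparison[OF always_eventually[OF allI] tendsto_mult_right_zero[OF n2_diff_quotient_tendsto[of t], of K]])
  show "norm ((P s - P t) / (s - t) - Re (?I s / of_real (s - t))) \<le> K * ((n2 (\<lambda>x. U s x - U t x))^2 / \<bar>s - t\<bar>)" for s
  proof -
   have "(P s - P t) / (s - t) - Re (?I s / of_real (s - t)) = (P s - P t - Re (?I s)) / (s - t)"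
    by (simp add: Re_divide_of_real diff_divide_distrib)
   then show ?thesis using K[of s] by (simp add: abs_divide divide_right_mono)
  qed
 qed
 from tendsto_add[OF 2 1] show ?thesis by (simp add: has_field_derivative_iff)
qed

lemma integral_real_multiple:
 assumes "\<And>x. \<exists>m. f x = complex_of_real m"
 shows "Im (LBINT x. f x) = 0"
proof -
 have "f = (\<lambda>x. complex_of_real (Re (f x)))" using assms by (auto simp: fun_eq_iff) (metis Re_complex_of_real)
 then have "(LBINT x. f x) = (LBINT x. complex_of_real (Re (f x)))" by simp
 then show ?thesis by (simp only: integral_complex_of_real Im_complex_of_real)
qed

text \<open>Gauge invariance: tested with real multiples of the conjugate solution, the nonlinearity
  has no imaginary part and drops out of the time derivative.\<close>

lemma nl_real: "\<exists>m. nl \<alpha> z * (of_real p * cnj z) = complex_of_real m"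
proof -
 have "nl \<alpha> z * (of_real p * cnj z) = of_real (cmod z powr \<alpha> * p) * (z * cnj z)" by (simp add: nl_def)
 also have "... = of_real (cmod z powr \<alpha> * p * (cmod z)^2)" unfolding complex_norm_square[symmetric] by simp
 finally show ?thesis by blast
qed

text \<open>The test function is 2 g times the conjugate solution. The nonlinear term and g |D|^2
  are real, so only the term with the derivative of the weight g contributes.\<close>

lemma localised_mass_derivative:
 fixes g :: "'a \<Rightarrow> real" and \<psi>' :: "'a \<Rightarrow> 'a \<Rightarrow> real"
 assumes m: "continuous_on UNIV g" "\<And>b. \<psi>' b \<in> borel_measurable borel"
  and D\<psi>: "\<And>b x s. b \<in> Basis \<Longrightarrow> ((\<lambda>s. g (x + s *\<^sub>R b)) has_vector_derivative \<psi>' b (x + s *\<^sub>R b)) (at s)"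
  and b1: "\<And>x. \<bar>g x\<bar> \<le> 1" and b2: "\<And>b x. b \<in> Basis \<Longrightarrow> \<bar>\<psi>' b x\<bar> \<le> C'"
 obtains Q where "((\<lambda>s. LBINT x. g x * (cmod (U s x))^2) has_real_derivative Q) (at t)"
  "\<bar>Q\<bar> \<le> 2 * C' * gr (D t) * n2 (U t)"
proof -
 have [measurable]: "g \<in> borel_measurable borel" using m(1) by (rule borel_measurable_continuous_onI)
 note [measurable] = m(2)
 let ?v = "\<lambda>x. 2 * (of_real (g x) * cnj (U t x))"
 let ?dv = "\<lambda>b x. 2 * (of_real (g x) * cnj (D t b x) + of_real (\<psi>' b x) * cnj (U t x))"
 have v: "h1 ?v ?dv"
  unfolding h1_def by (intro ballI wd_cmult wd_mult[OF _ _ m D\<psi> b1 b2] wd_cnj h1_wd[OF H]) auto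
 let ?P = "\<lambda>s. LBINT x. g x * (cmod (U s x))^2"
 let ?u = "\<lambda>s x. U s x - U t x"
 have iP: "integrable lborel (\<lambda>x. g x * (cmod (f x))^2)" if "sq f" for f :: "'a \<Rightarrow> complex"
 proof (rule integrable_dominated)
  show "integrable lborel (\<lambda>x. (cmod (f x))^2)" using that by (simp add: sq_def)
  note [measurable] = that
  show "(\<lambda>x. g x * (cmod (f x))^2) \<in> borel_measurable lborel" by measurable
  show "norm (g x * (cmod (f x))^2) \<le> (cmod (f x))^2" for x
   using b1[of x] by (simp add: abs_mult mult_left_le_one_le)
 qed
 \<comment> \<open>The remainder is exactly the integral of g times the squared difference, and |g|
   \<le> 1.\<close>
 have K: "\<bar>?P s - ?P t - Re (LBINT x. ?u s x * ?v x)\<bar> \<le> 1 * (n2 (?u s))^2" for s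
 proof -
  have i1: "integrable lborel (\<lambda>x. ?u s x * ?v x)" by (intro sq_CS U_diff_sq h1_sq[OF v])
  have "(LBINT x. g x * (cmod (?u s x))^2) =
    (LBINT x. g x * (cmod (U s x))^2 - g x * (cmod (U t x))^2 - Re (?u s x * ?v x))"
  proof (intro Bochner_Integration.integral_cong refl)
   fix x
   have "(cmod (?u s x))^2 = (cmod (U s x))^2 - (cmod (U t x))^2 - 2 * Re (?u s x * cnj (U t x))"
    by (simp add: cmod_power2) (simp add: power2_eq_square algebra_simps)
   moreover have "Re (?u s x * ?v x) = g x * (2 * Re (?u s x * cnj (U t x)))"
   proof -
    have "?u s x * ?v x = of_real (g x * 2) * (?u s x * cnj (U t x))" by simp
    moreover have "Re (of_real p * q) = p * Re q" for p q by simp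
    ultimately show ?thesis by (simp only: mult.assoc)
   qed
   ultimately show "g x * (cmod (?u s x))^2 = g x * (cmod (U s x))^2 - g x * (cmod (U t x))^2 - Re (?u s x * ?v x)"
    by (simp only: right_diff_distrib)
  qed
  also have "... = ?P s - ?P t - Re (LBINT x. ?u s x * ?v x)"
   using iP[OF U_sq, of s] iP[OF U_sq, of t] i1 by (simp del: times_complex.sel)
  finally have "\<bar>?P s - ?P t - Re (LBINT x. ?u s x * ?v x)\<bar> = \<bar>\<integral>x. g x * (cmod (?u s x))^2 \<partial>lborel\<bar>" by simp
  also have "... \<le> (LBINT x. \<bar>g x * (cmod (?u s x))^2\<bar>)" by (rule integral_abs_bound)
  also have "... \<le> (LBINT x. (cmod (?u s x))^2)"
  proof (rule integral_mono[OF integrable_abs[OF iP[OF U_diff_sq]]])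
   show "integrable lborel (\<lambda>x. (cmod (?u s x))^2)" using U_diff_sq[of s t] by (simp add: sq_def)
   show "\<bar>g x * (cmod (?u s x))^2\<bar> \<le> (cmod (?u s x))^2" for x
    using b1[of x] by (simp add: abs_mult mult_left_le_one_le)
  qed
  finally show ?thesis by (simp add: n2_square)
 qed
 define Q where "Q = Re (\<i> * (- (\<Sum>b\<in>Basis. LBINT x. D t b x * ?dv b x) + of_real lam * (LBINT x. nl \<alpha> (U t x) * ?v x)))"
 have der: "(?P has_real_derivative Q) (at t)" unfolding Q_def by (rule functional_derivative[OF v K])
 have nl0: "Im (LBINT x. nl \<alpha> (U t x) * ?v x) = 0"
  by (rule integral_real_multiple) (use nl_real[of _ "2 * g _"] in \<open>simp add: mult.assoc\<close>)
 have each: "\<bar>Im (LBINT x. D t b x * ?dv b x)\<bar> \<le> 2 * C' * n2 (D t b) * n2 (U t)" if b: "b \<in> Basis" for b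
 proof -
  note s = D_sq[OF b, of t] U_sq[of t]
  let ?p = "\<lambda>x. of_real (g x) * cnj (D t b x)" and ?r = "\<lambda>x. of_real (\<psi>' b x) * cnj (U t x)"
  have sp: "sq (\<lambda>x. of_real (p x) * cnj (f x))" "n2 (\<lambda>x. of_real (p x) * cnj (f x)) \<le> c * n2 f"
   if "p \<in> borel_measurable borel" "\<And>x. \<bar>p x\<bar> \<le> c" "sq f" for p c and f :: "'a \<Rightarrow> complex"
  proof -
   have c: "c \<ge> 0" using that(2)[of 0] by linarith
   have bd: "norm (of_real (p x) * cnj (f x)) \<le> c * norm (f x)" for x
    using that(2)[of x] by (simp add: norm_mult mult_right_mono)
   note [measurable] = that(3)
   show "sq (\<lambda>x. of_real (p x) * cnj (f x))" "n2 (\<lambda>x. of_real (p x) * cnj (f x)) \<le> c * n2 f"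
    using sq_bound[OF that(3) _ bd c] that(1) by auto
  qed
  have i: "integrable lborel (\<lambda>x. D t b x * ?p x)"
   "integrable lborel (\<lambda>x. D t b x * ?r x)"
   using sp(1)[OF _ b1 s(1)] sp(1)[OF m(2) b2[OF b] s(2)] s by (auto intro!: sq_CS)
  have "(LBINT x. D t b x * ?dv b x) = 2 * ((LBINT x. D t b x * ?p x) + (LBINT x. D t b x * ?r x))"
   unfolding Bochner_Integration.integral_add[OF i, symmetric] integral_mult_right_zero[symmetric]
   by (intro Bochner_Integration.integral_cong) (auto simp: algebra_simps)
  moreover have "Im (LBINT x. D t b x * ?p x) = 0"
  proof (rule integral_real_multiple)
   fix x
   have "D t b x * ?p x = of_real (g x) * (D t b x * cnj (D t b x))" by simp
   then have "D t b x * ?p x = of_real (g x * (cmod (D t b x))^2)"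
    unfolding complex_norm_square[symmetric] by simp
   then show "\<exists>m. D t b x * ?p x = complex_of_real m" by blast
  qed
  ultimately have "\<bar>Im (LBINT x. D t b x * ?dv b x)\<bar> = 2 * \<bar>Im (LBINT x. D t b x * ?r x)\<bar>"
   by simp
  also have "... \<le> 2 * (n2 (D t b) * n2 ?r)"
   by (intro mult_left_mono order_trans[OF abs_Im_le_cmod] sq_CS s sp(1)[OF m(2) b2[OF b]]) auto
  also have "... \<le> 2 * (n2 (D t b) * (C' * n2 (U t)))"
   by (intro mult_left_mono sp(2)[OF m(2) b2[OF b]] s) auto
  finally show ?thesis by (simp only: mult_ac)
 qed
 have "Re (\<i> * (- S + of_real lam * X)) = Im S - lam * Im X" for S X by simp
 then have "Q = Im (\<Sum>b\<in>Basis. LBINT x. D t b x * ?dv b x)"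
  unfolding Q_def using nl0 by (simp only: mult_zero_right diff_zero)
 then have "\<bar>Q\<bar> \<le> (\<Sum>b\<in>Basis. \<bar>Im (LBINT x. D t b x * ?dv b x)\<bar>)" by (simp add: sum_abs)
 also have "... \<le> (\<Sum>b\<in>Basis. 2 * C' * n2 (D t b) * n2 (U t))" by (intro sum_mono each)
 also have "... = 2 * C' * gr (D t) * n2 (U t)"
  by (simp add: gr_def sum_distrib_left sum_distrib_right)
 finally show ?thesis by (intro that[OF der])
qed

lemma mass_conservation: "n2 (U t) = n2 (U 0)"
proof -
 have "((\<lambda>s. (n2 (U s))^2) has_real_derivative 0) (at t)" for t
 proof -
  obtain Q where Q: "((\<lambda>s. LBINT x. 1 * (cmod (U s x))^2) has_real_derivative Q) (at t)"
   "\<bar>Q\<bar> \<le> 2 * 0 * gr (D t) * n2 (U t)"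
   by (rule localised_mass_derivative[of "\<lambda>_. 1" "\<lambda>_ _. 0" 0 t]) auto
  then show ?thesis by (simp add: n2_square)
 qed
 then have "(n2 (U t))^2 = (n2 (U 0))^2" using DERIV_isconst_all[of "\<lambda>s. (n2 (U s))^2" t 0] by blast
 then show ?thesis by simp
qed

end

section \<open>Choice of exponents and continuity in time\<close>

lemma exponent_exists:
 assumes al: "\<alpha> > 0" and sub: "DIM('a::euclidean_space) \<ge> 3 \<Longrightarrow> \<alpha> < 4 / (real DIM('a) - 2)"
 obtains l where "l > 0" "decay TYPE('a) (\<alpha> + 2 + l) < 1" "\<alpha> * (\<alpha> + 2 + l) / (\<alpha> + l) \<ge> 2"
proof -
 let ?N = "real DIM('a)"
 \<comment> \<open>With r = \<alpha> + 2 + l, the bound \<alpha>^2 / 2 ensures \<alpha> r / (r - 2)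
   \<ge> 2, and half the gap to 4 / (N - 2) keeps r subcritical.\<close>
 define l where "l = (if DIM('a) \<ge> 3 then min (\<alpha>^2 / 2) ((4 / (?N - 2) - \<alpha>) / 2) else \<alpha>\<^sup>2 / 2)"
 have k: "l > 0" "l \<le> \<alpha>^2 / 2" using al sub by (auto simp: l_def)
 define r where "r = \<alpha> + 2 + l"
 have r: "r > 2" using al k by (simp add: r_def)
 have N1: "?N \<ge> 1" by simp
 have "r * (?N - 2) < 2 * ?N"
 proof (cases "DIM('a) \<ge> 3")
  case True
  then have n: "?N - 2 > 0" by simp
  have "l \<le> (4 / (?N - 2) - \<alpha>) / 2" unfolding l_def using True by (simp only: if_True min.cobounded2)
  moreover have "\<alpha> < 4 / (?N - 2)" using True sub by blast
  moreover have "k \<le> (q - \<alpha>) / 2 \<Longrightarrow> \<alpha> < q \<Longrightarrow> \<alpha> + k < q" for k q :: real by simp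
  ultimately have "\<alpha> + l < 4 / (?N - 2)" by blast
  then have "(\<alpha> + l) * (?N - 2) < 4" using n by (simp add: field_simps)
  then show ?thesis by (simp add: r_def algebra_simps)
 next
  case False
  then have "?N - 2 \<le> 0" by simp
  then have "r * (?N - 2) \<le> 0" using r by (simp add: mult_nonneg_nonpos)
  then show ?thesis using N1 by linarith
 qed
 then have d: "decay TYPE('a) r < 1" using r by (simp add: decay_def field_simps)
 have "2 * l \<le> \<alpha>^2 + \<alpha> * l" using k al by (simp add: add_increasing2)
 then have "2 * (\<alpha> + l) \<le> \<alpha> * (\<alpha> + 2 + l)" by (simp add: algebra_simps power2_eq_square)
 then have "\<alpha> * (\<alpha> + 2 + l) / (\<alpha> + l) \<ge> 2" using al k by (simp add: field_simps)
 then show ?thesis using that[OF k(1)] d unfolding r_def by blast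
qed

lemma hn_triangle_diff:
 assumes "h1 f d" "h1 g e"
 shows "\<bar>hn f d - hn g e\<bar> \<le> hn (\<lambda>x. f x - g x) (\<lambda>b x. d b x - e b x)"
proof -
 have "hn f d \<le> hn (\<lambda>x. f x - g x) (\<lambda>b x. d b x - e b x) + hn g e"
  using hn_add[OF h1_diff[OF assms] assms(2)] by simp
 moreover have "hn g e \<le> hn (\<lambda>x. g x - f x) (\<lambda>b x. e b x - d b x) + hn f d"
  using hn_add[OF h1_diff[OF assms(2,1)] assms(1)] by simp
 moreover have "hn (\<lambda>x. g x - f x) (\<lambda>b x. e b x - d b x) = hn (\<lambda>x. f x - g x) (\<lambda>b x. d b x - e b x)"
  unfolding hn_def gr_def using n2_diff_comm[of g f] n2_diff_comm[of "e b" "d b" for b] by simp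
 ultimately show ?thesis by linarith
qed

lemma np_continuous:
 fixes F :: "real \<Rightarrow> 'a::euclidean_space \<Rightarrow> complex"
 assumes r: "r \<ge> 2" "decay TYPE('a) r < 1" and F: "\<And>t. h1 (F t) (d t)"
  and lim: "\<And>t. ((\<lambda>s. hn (\<lambda>x. F s x - F t x) (\<lambda>b x. d s b x - d t b x)) \<longlongrightarrow> 0) (at t)"
 shows "continuous_on UNIV (\<lambda>t. np r (F t))"
 unfolding continuous_on_def
proof
 fix t
 obtain S where S: "S > 0" "\<And>(f :: 'a \<Rightarrow> complex) d. h1 f d \<Longrightarrow> lp r f \<and> np r f \<le> S * hn f d"
  by (rule Sobolev[OF r], rule that)
 have "((\<lambda>s. np r (F s) - np r (F t)) \<longlongrightarrow> 0) (at t)"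
 proof (rule Lim_null_comparison[OF always_eventually[OF allI] tendsto_mult_right_zero[OF lim, of S]])
  fix s
  have "\<bar>np r (F s) - np r (F t)\<bar> \<le> np r (\<lambda>x. F s x - F t x)"
   by (intro np_triangle_diff) (use S(2)[OF F] r in auto)
  also have "... \<le> S * hn (\<lambda>x. F s x - F t x) (\<lambda>b x. d s b x - d t b x)"
   using S(2)[OF h1_diff[OF F F]] by blast
  finally show "norm (np r (F s) - np r (F t)) \<le> S * hn (\<lambda>x. F s x - F t x) (\<lambda>b x. d s b x - d t b x)" by simp
 qed
 then show "((\<lambda>t. np r (F t)) \<longlongrightarrow> np r (F t)) (at t)" by (simp add: LIM_zero_iff)
qed

text \<open>Moves a translation difference from the test function to the solution or its
  nonlinearity. Integrability is assumed for the products only, since the nonlinearity need not be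
  in L^2.\<close>

lemma translate_adjoint:
 fixes f g :: "'a::euclidean_space \<Rightarrow> complex"
 assumes m: "f \<in> borel_measurable borel" "g \<in> borel_measurable borel"
  and i: "integrable lborel (\<lambda>x. f x * g (x - y))" "integrable lborel (\<lambda>x. f x * g x)"
 shows "(LBINT x. f x * (g (x - y) - g x)) = (LBINT x. (f (x + y) - f x) * g x)"
proof -
 note [measurable] = m
 have m': "(\<lambda>x. f x * g (x - y)) \<in> borel_measurable borel" by measurable
 have i': "integrable lborel (\<lambda>x. f (x + y) * g x)"
  using lborel_integrable_translate_iff[OF m', of y] i(1) by simp
 have "(LBINT x. f x * g (x - y)) = (LBINT x. f (x + y) * g x)"
  using lborel_integral_translate[OF m', of y] by simp
 then show ?thesis using i i' by (simp add: left_diff_distrib right_diff_distrib)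
qed

section \<open>Translation differences of the solution and the truncated potential\<close>

context nls
begin

lemma hn_continuous: "continuous_on UNIV (\<lambda>t. hn (U t) (D t))"
 unfolding continuous_on_def
proof
 fix t
 have "((\<lambda>s. hn (U s) (D s) - hn (U t) (D t)) \<longlongrightarrow> 0) (at t)"
  by (rule Lim_null_comparison[OF _ C[of t]]) (use hn_triangle_diff[OF H H] in simp)
 then show "((\<lambda>t. hn (U t) (D t)) \<longlongrightarrow> hn (U t) (D t)) (at t)" by (simp add: LIM_zero_iff)
qed

lemma hn_bounded: "\<exists>M>0. \<forall>t\<in>{a..b}. hn (U t) (D t) \<le> M"
proof -
 have "compact ((\<lambda>t. hn (U t) (D t)) ` {a..b})"
  by (rule compact_continuous_image[OF continuous_on_subset[OF hn_continuous subset_UNIV] compact_Icc])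
 then have "bounded ((\<lambda>t. hn (U t) (D t)) ` {a..b})" by (rule compact_imp_bounded)
 then obtain K where K: "\<forall>x\<in>(\<lambda>t. hn (U t) (D t)) ` {a..b}. norm x \<le> K" unfolding bounded_iff ..
 have "hn (U t) (D t) \<le> max K 1" if "t \<in> {a..b}" for t
  using bspec[OF K imageI[OF that]] by simp
 then show ?thesis by (intro exI[of _ "max K 1"]) simp
qed

lemma nl_measurable [measurable]: "nl \<alpha> \<in> borel_measurable borel"
 using nl_continuous[OF al] by (rule borel_measurable_continuous_onI)

lemma nl_integrable:
 assumes v: "h1 v dv" shows "integrable lborel (\<lambda>x. nl \<alpha> (U t x) * v x)"
\<comment> \<open>\<open>exponent_exists\<close> needs \<alpha> > 0; for \<alpha> = 0 the
  nonlinearity is the identity.\<close>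
proof (cases "\<alpha> = 0")
 case True
 have "nl \<alpha> z = z" for z by (cases "z = 0") (auto simp: nl_def True)
 then show ?thesis using sq_CS(1)[OF U_sq h1_sq[OF v]] by simp
next
 case False
 then have a0: "\<alpha> > 0" using al by simp
 obtain q where k: "q > 0" "decay TYPE('a) (\<alpha> + 2 + q) < 1" "\<alpha> * (\<alpha> + 2 + q) / (\<alpha> + q) \<ge> 2"
  using exponent_exists[OF a0 sub] by blast
 let ?r = "\<alpha> + 2 + q"
 have r: "?r > 2" "?r \<ge> 2" using a0 k by auto
 have g: "\<alpha> * ?r / (?r - 2) \<ge> 2" "\<alpha> \<le> ?r - 2" using k by (simp_all add: add.commute)
 obtain K where "K > 0" and K': "\<And>(f :: 'a \<Rightarrow> complex) d w v t. h1 f d \<Longrightarrow> lp ?r w \<Longrightarrow> lp ?r v \<Longrightarrow>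
  integrable lborel (\<lambda>x. (cmod (f (x + t)) + cmod (f x)) powr \<alpha> * (cmod (w x) * cmod (v x))) \<and>
  (LBINT x. (cmod (f (x + t)) + cmod (f x)) powr \<alpha> * (cmod (w x) * cmod (v x))) \<le> K * hn f d powr \<alpha> * (np ?r w * np ?r v)"
  by (rule weighted_Holder[OF r(1) k(2) a0 g], rule that)
 note K = K'[THEN conjunct1]
 obtain S where "S > 0" and S': "\<And>(f :: 'a \<Rightarrow> complex) d. h1 f d \<Longrightarrow> lp ?r f \<and> np ?r f \<le> S * hn f d"
  by (rule Sobolev[OF r(2) k(2)], rule that)
 note S = S'[THEN conjunct1]
 note [measurable] = h1_sq[OF v]
 show ?thesis
 proof (rule integrable_dominated[OF K[OF H[of t] S[OF H[of t]] S[OF v], of 0]])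
  fix x
  have "cmod (U t x) powr \<alpha> \<le> (cmod (U t x) + cmod (U t x)) powr \<alpha>" using al by (intro powr_mono2) auto
  then show "norm (nl \<alpha> (U t x) * v x) \<le> (cmod (U t (x + 0)) + cmod (U t x)) powr \<alpha> * (cmod (U t x) * cmod (v x))"
   by (simp add: nl_def norm_mult mult.assoc mult_right_mono)
 qed measurable
qed

text \<open>The substitute for the gradient: after division by the length of y it approximates a
  partial derivative, yet it belongs to H^1 at every time and so may be used as a test
  function.\<close>

definition W :: "'a \<Rightarrow> real \<Rightarrow> 'a \<Rightarrow> complex" where "W y t x = U t (x + y) - U t x"

lemma W_h1: "h1 (W y t) (\<lambda>b x. D t b (x + y) - D t b x)"
 unfolding W_def[abs_def] by (intro h1_diff h1_translate H)

lemma W_sq: "sq (W y t)" using h1_sq[OF W_h1] .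

text \<open>The gradient of the squared shift norm is the second difference of the solution, which
  is in H^1. The Laplacian commutes with translations and contributes a real number, whose imaginary
  part is 0, so only the nonlinearity remains.\<close>

lemma shift_derivative:
 "((\<lambda>t. (n2 (W y t))^2) has_real_derivative
  - 2 * lam * Im (LBINT x. (nl \<alpha> (U t (x + y)) - nl \<alpha> (U t x)) * cnj (W y t x))) (at t)"
proof -
 define w where w_W: "w = W y"
 have w_def: "w t x = U t (x + y) - U t x" for t x by (simp add: w_W W_def)
 let ?wd = "\<lambda>b x. D t b (x + y) - D t b x"
 let ?v = "\<lambda>x. 2 * (cnj (w t (x - y)) - cnj (w t x))"
 let ?dv = "\<lambda>b x. 2 * (cnj (?wd b (x - y)) - cnj (?wd b x))"
 have hw: "h1 (w t) ?wd" unfolding w_def[abs_def] by (intro h1_diff h1_translate H)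
 have hwy: "h1 (\<lambda>x. cnj (w t (x - y))) (\<lambda>b x. cnj (?wd b (x - y)))"
  using h1_translate[OF h1_cnj[OF hw], of "- y"] by simp
 have v: "h1 ?v ?dv" by (intro h1_cmult h1_diff hwy h1_cnj hw)
 have sw: "sq (w s)" for s unfolding w_def[abs_def] by (intro sq_diff sq_translate U_sq)
 note [measurable] = sw
 \<comment> \<open>The remainder is the squared norm of the shift of U s - U t minus itself, which
   is at most twice as large in L^2; hence the constant 4.\<close>
 have K: "\<bar>(n2 (w s))^2 - (n2 (w t))^2 - Re (LBINT x. (U s x - U t x) * ?v x)\<bar> \<le> 4 * (n2 (\<lambda>x. U s x - U t x))^2" for s
 proof -
  let ?\<delta> = "\<lambda>x. U s x - U t x"
  have i: "integrable lborel (\<lambda>x. ?\<delta> x * cnj (w t (x - y)))" "integrable lborel (\<lambda>x. ?\<delta> x * cnj (w t x))"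
   using sq_translate[OF sw[of t], of "- y"] by (auto intro!: sq_CS U_diff_sq sq_cnj sw)
  have "(LBINT x. ?\<delta> x * ?v x) = 2 * (LBINT x. ?\<delta> x * (cnj (w t (x - y)) - cnj (w t x)))"
   unfolding integral_mult_right_zero[symmetric] by (intro Bochner_Integration.integral_cong) (auto simp: algebra_simps)
  also have "... = 2 * (LBINT x. (?\<delta> (x + y) - ?\<delta> x) * cnj (w t x))"
   by (subst translate_adjoint) (use i in auto)
  also have "(\<lambda>x. ?\<delta> (x + y) - ?\<delta> x) = (\<lambda>x. w s x - w t x)" by (auto simp: w_def fun_eq_iff)
  finally have 1: "(LBINT x. ?\<delta> x * ?v x) = 2 * (LBINT x. (w s x - w t x) * cnj (w t x))" by (simp add: fun_eq_iff)
  have sd: "sq (\<lambda>x. w s x - w t x)" by (intro sq_diff sw)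
  have i2: "integrable lborel (\<lambda>x. (w s x - w t x) * cnj (w t x))" by (intro sq_CS sd sq_cnj sw)
  have ii: "integrable lborel (\<lambda>x. (cmod (w s x))^2)" "integrable lborel (\<lambda>x. (cmod (w t x))^2)" using sw by (auto simp: sq_def)
  have "(n2 (\<lambda>x. w s x - w t x))^2 = (LBINT x. (cmod (w s x))^2 - (cmod (w t x))^2 - 2 * Re ((w s x - w t x) * cnj (w t x)))"
   unfolding n2_square
  proof (intro Bochner_Integration.integral_cong refl)
   fix x
   show "(cmod (w s x - w t x))^2 = (cmod (w s x))^2 - (cmod (w t x))^2 - 2 * Re ((w s x - w t x) * cnj (w t x))"
    by (simp add: cmod_power2) (simp add: power2_eq_square algebra_simps)
  qed
  also have "... = (n2 (w s))^2 - (n2 (w t))^2 - 2 * Re (LBINT x. (w s x - w t x) * cnj (w t x))"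
   unfolding n2_square using ii i2 by (simp del: times_complex.sel)
  also have "2 * Re (LBINT x. (w s x - w t x) * cnj (w t x)) = Re (LBINT x. ?\<delta> x * ?v x)"
   unfolding 1 by simp
  finally have e: "(n2 (\<lambda>x. w s x - w t x))^2 = (n2 (w s))^2 - (n2 (w t))^2 - Re (LBINT x. ?\<delta> x * ?v x)" .
  have "\<bar>(n2 (w s))^2 - (n2 (w t))^2 - Re (LBINT x. ?\<delta> x * ?v x)\<bar> = (n2 (\<lambda>x. w s x - w t x))^2"
   unfolding e[symmetric] by (rule abs_of_nonneg) (rule zero_le_power2)
  also have "(\<lambda>x. w s x - w t x) = (\<lambda>x. ?\<delta> (x + y) - ?\<delta> x)" by (auto simp: w_def fun_eq_iff)
  also have "(n2 (\<lambda>x. ?\<delta> (x + y) - ?\<delta> x))^2 \<le> (2 * n2 ?\<delta>)^2"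
   by (intro power_mono n2_translate_bound[OF U_diff_sq]) auto
  finally show ?thesis by (simp add: power_mult_distrib)
 qed
 have X0: "Im (LBINT x. D t b x * ?dv b x) = 0" if b: "b \<in> Basis" for b
 proof -
  have s: "sq (D t b)" "sq (?wd b)" by (intro D_sq b sq_diff sq_translate)+
  have i: "integrable lborel (\<lambda>x. D t b x * cnj (?wd b (x - y)))" "integrable lborel (\<lambda>x. D t b x * cnj (?wd b x))"
   by (rule sq_CS(1)[OF s(1) sq_cnj[OF sq_translate[OF s(2), of "- y"], folded diff_conv_add_uminus]],
     rule sq_CS(1)[OF s(1) sq_cnj[OF s(2)]])
  have "(LBINT x. D t b x * ?dv b x) = 2 * (LBINT x. D t b x * (cnj (?wd b (x - y)) - cnj (?wd b x)))"
   unfolding integral_mult_right_zero[symmetric] by (intro Bochner_Integration.integral_cong) (auto simp: algebra_simps)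
  also have "... = 2 * (LBINT x. ?wd b x * cnj (?wd b x))"
   by (subst translate_adjoint[OF _ _ i]) (use s sq_cnj[OF s(2)] in \<open>simp_all add: sq_def\<close>)
  also have "... = of_real (2 * (n2 (?wd b))^2)" unfolding n2_square_cnj[symmetric] by simp
  finally show ?thesis by (simp only: Im_complex_of_real)
 qed
 have N: "(LBINT x. nl \<alpha> (U t x) * ?v x) = 2 * (LBINT x. (nl \<alpha> (U t (x + y)) - nl \<alpha> (U t x)) * cnj (w t x))"
 proof -
  have i: "integrable lborel (\<lambda>x. nl \<alpha> (U t x) * cnj (w t (x - y)))" "integrable lborel (\<lambda>x. nl \<alpha> (U t x) * cnj (w t x))"
   by (rule nl_integrable[OF hwy], rule nl_integrable[OF h1_cnj[OF hw]])
  have "(LBINT x. nl \<alpha> (U t x) * ?v x) = 2 * (LBINT x. nl \<alpha> (U t x) * (cnj (w t (x - y)) - cnj (w t x)))"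
   unfolding integral_mult_right_zero[symmetric] by (intro Bochner_Integration.integral_cong) (auto simp: algebra_simps)
  also have "... = 2 * (LBINT x. (nl \<alpha> (U t (x + y)) - nl \<alpha> (U t x)) * cnj (w t x))"
   by (subst translate_adjoint) (use i in auto)
  finally show ?thesis .
 qed
 have R: "Re (\<i> * (- S + of_real lam * X)) = Im S - lam * Im X" for S X by simp
 have S0: "Im (\<Sum>b\<in>Basis. LBINT x. D t b x * ?dv b x) = 0"
  unfolding Im_sum by (intro sum.neutral ballI X0)
 have I2: "Im (2 * X) = 2 * Im X" for X by simp
 show ?thesis
  using functional_derivative[OF v K] unfolding R w_W[symmetric] S0 N I2 by (simp only: diff_0 mult_minus_left mult.assoc mult.left_commute)
qed

text \<open>The gradient of the functional is the conjugate of G (U t). Since G z is a real multiple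
  of z, the nonlinear term vanishes. What remains is, up to sign, the limit of the truncated shift
  fluxes in \<open>truncated_energy_flux\<close>, and so the two cancel in the energy.\<close>

lemma potential_derivative:
 fixes G :: "complex \<Rightarrow> complex"
 assumes L: "L \<ge> 0" "G 0 = 0" "\<And>a b. cmod (G a - G b) \<le> L * cmod (a - b)"
  and G': "\<And>z. (G has_derivative G' z) (at z)"
  and Phi: "\<And>z. 0 \<le> \<Phi> z" "\<And>z. \<Phi> z \<le> L * (cmod z)^2"
   "\<And>z w. \<bar>\<Phi> w - \<Phi> z - Re (cnj (G z) * (w - z))\<bar> \<le> L * (cmod (w - z))^2"
  and re: "\<And>z. \<exists>m. G z = of_real m * z" and c: "continuous_on UNIV \<Phi>"
 shows "((\<lambda>t. LBINT x. \<Phi> (U t x)) has_real_derivative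
  - (\<Sum>b\<in>Basis. Im (LBINT x. G' (U t x) (D t b x) * cnj (D t b x)))) (at t)"
proof -
 have [measurable]: "\<Phi> \<in> borel_measurable borel" using c by (rule borel_measurable_continuous_onI)
 let ?v = "\<lambda>x. cnj (G (U t x))" and ?dv = "\<lambda>b x. cnj (G' (U t x) (D t b x))"
 have v: "h1 ?v ?dv"
  unfolding h1_def by (intro ballI wd_cnj wd_chain[OF _ h1_wd[OF H] L(2,3) G'])
 have i: "integrable lborel (\<lambda>x. \<Phi> (U s x))" for s
 proof (rule integrable_dominated)
  show "integrable lborel (\<lambda>x. L * (cmod (U s x))^2)" using U_sq[of s] by (simp add: sq_def)
  show "norm (\<Phi> (U s x)) \<le> L * (cmod (U s x))^2" for x using Phi(1,2)[of "U s x"] by simp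
 qed measurable
 have K: "\<bar>(LBINT x. \<Phi> (U s x)) - (LBINT x. \<Phi> (U t x)) - Re (LBINT x. (U s x - U t x) * ?v x)\<bar> \<le> L * (n2 (\<lambda>x. U s x - U t x))^2" for s
 proof -
  have iv: "integrable lborel (\<lambda>x. (U s x - U t x) * ?v x)" by (intro sq_CS U_diff_sq h1_sq[OF v])
  have id: "integrable lborel (\<lambda>x. \<Phi> (U s x) - \<Phi> (U t x) - Re ((U s x - U t x) * ?v x))"
   using i iv by (intro Bochner_Integration.integrable_diff) (auto simp del: times_complex.sel)
  have "(LBINT x. \<Phi> (U s x)) - (LBINT x. \<Phi> (U t x)) - Re (LBINT x. (U s x - U t x) * ?v x) =
    (LBINT x. \<Phi> (U s x) - \<Phi> (U t x) - Re ((U s x - U t x) * ?v x))"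
   using i[of s] i[of t] iv by (simp del: times_complex.sel)
  then have "\<bar>(LBINT x. \<Phi> (U s x)) - (LBINT x. \<Phi> (U t x)) - Re (LBINT x. (U s x - U t x) * ?v x)\<bar> \<le>
    (LBINT x. \<bar>\<Phi> (U s x) - \<Phi> (U t x) - Re ((U s x - U t x) * ?v x)\<bar>)"
   using integral_abs_bound[of lborel "\<lambda>x. \<Phi> (U s x) - \<Phi> (U t x) - Re ((U s x - U t x) * ?v x)"] by simp
  also have "... \<le> (LBINT x. L * (cmod (U s x - U t x))^2)"
  proof (rule integral_mono[OF integrable_abs[OF id]])
   show "integrable lborel (\<lambda>x. L * (cmod (U s x - U t x))^2)" using U_diff_sq[of s t] by (simp add: sq_def)
   show "\<bar>\<Phi> (U s x) - \<Phi> (U t x) - Re ((U s x - U t x) * ?v x)\<bar> \<le> L * (cmod (U s x - U t x))^2" for x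
    using Phi(3)[of "U s x" "U t x"] by (simp only: mult.commute)
  qed
  finally show ?thesis by (simp add: n2_square)
 qed
 have N: "Im (LBINT x. nl \<alpha> (U t x) * ?v x) = 0"
 proof (rule integral_real_multiple)
  fix x
  obtain m where m: "G (U t x) = of_real m * U t x" using re by blast
  then show "\<exists>k. nl \<alpha> (U t x) * cnj (G (U t x)) = complex_of_real k"
   using nl_real[of "U t x" m] by simp
 qed
 have R: "Re (\<i> * (- S + of_real lam * X)) = Im S - lam * Im X" for S X by simp
 have each: "Im (LBINT x. D t b x * ?dv b x) = - Im (LBINT x. G' (U t x) (D t b x) * cnj (D t b x))" for b
 proof -
  have "(LBINT x. D t b x * ?dv b x) = (LBINT x. cnj (G' (U t x) (D t b x) * cnj (D t b x)))"
   by (intro Bochner_Integration.integral_cong) (auto simp: mult.commute)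
  also have "... = cnj (LBINT x. G' (U t x) (D t b x) * cnj (D t b x))" by (rule Bochner_Integration.integral_cnj)
  finally show ?thesis by (simp only: cnj.sel)
 qed
 show ?thesis
  using functional_derivative[OF v K] unfolding R N Im_sum each by (simp add: sum_negf)
qed

lemma W_hn_tendsto:
 "((\<lambda>s. hn (\<lambda>x. W y s x - W y t x) (\<lambda>b x. (D s b (x + y) - D s b x) - (D t b (x + y) - D t b x))) \<longlongrightarrow> 0) (at t)"
proof (rule tendsto_zero_le[OF tendsto_mult_right_zero[OF C[of t], of 2] always_eventually[OF allI]])
 fix s
 let ?f = "\<lambda>x. U s x - U t x" and ?d = "\<lambda>b x. D s b x - D t b x"
 have hd: "h1 ?f ?d" by (intro h1_diff H)
 have e: "(\<lambda>x. W y s x - W y t x) = (\<lambda>x. ?f (x + y) - ?f x)"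
  "(\<lambda>b x. (D s b (x + y) - D s b x) - (D t b (x + y) - D t b x)) = (\<lambda>b x. ?d b (x + y) - ?d b x)"
  by (auto simp: W_def fun_eq_iff)
 show "hn (\<lambda>x. W y s x - W y t x) (\<lambda>b x. (D s b (x + y) - D s b x) - (D t b (x + y) - D t b x)) \<le> 2 * hn ?f ?d"
  using hn_diff[OF h1_translate[OF hd] hd, of y] unfolding e hn_translate[OF hd] by simp
qed simp

lemmas np_W_continuous = np_continuous[OF _ _ W_h1 W_hn_tendsto]

end

section \<open>Heat smoothing of translation differences and Duhamel's formula\<close>

lemma heat_diff:
 assumes "Re z > 0" "sq f" "sq g"
 shows "heat z (\<lambda>x. f x - g x) = (\<lambda>x. heat z f x - heat z g x)"
 unfolding heat_def using conv_diff_right[OF ker_gauss(1)[OF assms(1)] assms(2,3)] by (simp add: fun_eq_iff)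

lemma heat_translate: "heat z (\<lambda>x. f (x + t)) = (\<lambda>x. heat z f (x + t))"
 unfolding heat_def using conv_translate[of "gauss z" f t] by (simp add: fun_eq_iff)

text \<open>In contrast to \<open>h1_heat\<close>, the gradient is the smoothed gradient, so that
  \<open>hn\<close> is bounded uniformly as the smoothing time tends to 0.\<close>

lemma h1_heat_commute:
 assumes s: "s > 0" and f: "h1 f d"
 shows "h1 (heat (of_real s) f) (\<lambda>b. heat (of_real s) (d b))"
 unfolding h1_def
proof
 fix b :: 'a assume b: "b \<in> Basis"
 let ?z = "complex_of_real s"
 have z: "Re ?z > 0" using s by simp
 note w = h1_wd[OF f b] and sf = h1_sq[OF f] and sd = h1_sq_d[OF f b]
 show "wd b (heat ?z f) (heat ?z (d b))"
 proof (rule wdI_nat[OF b heat_sq[OF z sf] heat_sq[OF z sd]])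
  show "(\<lambda>n. n2 (\<lambda>x. dq b (inv_nat n) (heat ?z f) x - heat ?z (d b) x)) \<longlonglongrightarrow> 0"
  proof (rule tendsto_zero_le[OF wd_dq_seq[OF b w] always_eventually[OF allI]])
   have "dq b h (heat ?z f) x = heat ?z (dq b h f) x" for h x
   proof -
    have "heat ?z (dq b h f) x = heat ?z (\<lambda>x. (1 / of_real h) * (f (x + h *\<^sub>R b) - f x)) x"
     by (simp add: dq_def[abs_def])
    also have "... = (1 / of_real h) * heat ?z (\<lambda>x. f (x + h *\<^sub>R b) - f x) x"
     unfolding heat_def by (rule conv_cmult_right)
    also have "... = dq b h (heat ?z f) x"
     using heat_diff[OF z sq_translate[OF sf] sf] by (simp add: heat_translate dq_def)
    finally show ?thesis by simp
   qed
   then have "(\<lambda>x. dq b h (heat ?z f) x - heat ?z (d b) x) = heat ?z (\<lambda>x. dq b h f x - d b x)" for h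
    using heat_diff[OF z sq_dq[OF sf] sd] by (simp add: fun_eq_iff)
   then show "n2 (\<lambda>x. dq b (inv_nat n) (heat ?z f) x - heat ?z (d b) x) \<le> n2 (\<lambda>x. dq b (inv_nat n) f x - d b x)" for n
    using heat_contraction[OF z sq_diff[OF sq_dq[OF sf] sd]] by simp
  qed (simp_all add: inv_nat_tendsto)
 qed
qed

lemma hn_heat_le:
 assumes s: "s > 0" and f: "h1 f d"
 shows "hn (heat (of_real s) f) (\<lambda>b. heat (of_real s) (d b)) \<le> hn f d"
 unfolding hn_def gr_def using s f
 by (intro add_mono sum_mono heat_contraction h1_sq[OF f] h1_sq_d[OF f]) auto

lemma hn_heat_tendsto:
 assumes f: "h1 f d" and s: "\<And>n. s n > 0" "s \<longlonglongrightarrow> 0"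
 shows "(\<lambda>n. hn (\<lambda>x. heat (of_real (s n)) f x - f x) (\<lambda>b x. heat (of_real (s n)) (d b) x - d b x)) \<longlonglongrightarrow> 0"
proof -
 have "(\<lambda>n. hn (\<lambda>x. heat (of_real (s n)) f x - f x) (\<lambda>b x. heat (of_real (s n)) (d b) x - d b x)) \<longlonglongrightarrow> 0 + (\<Sum>b\<in>(Basis::'a set). 0)"
  unfolding hn_def gr_def
  by (intro tendsto_add tendsto_sum heat_approximate_identity(1) s h1_sq[OF f] h1_sq_d[OF f])
 then show ?thesis by simp
qed

context nls
begin

text \<open>Duhamel's formula in weak form: the solution at time s is paired with the regularised
  flow of g over the remaining time t - s. The two linear contributions cancel by
  \<open>gaussL_pairing\<close>, and integration in s from 0 to t brings the pairing to the initial
  time.\<close>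

lemma duhamel_derivative:
 assumes e: "e > 0" and g: "sq g"
 shows "((\<lambda>s. Re (LBINT x. U s x * heat (Complex e (t - s)) g x)) has_real_derivative
  Re (\<i> * (of_real lam * (LBINT x. nl \<alpha> (U s x) * heat (Complex e (t - s)) g x)))) (at s)"
proof -
 let ?z = "\<lambda>r. Complex e (t - r)"
 let ?v = "\<lambda>r. heat (?z r) g" and ?dv = "\<lambda>r b. conv (gaussb (?z r) b) g"
 have zp: "Re (?z r) > 0" for r using e by simp
 have hv: "h1 (?v r) (?dv r)" for r by (rule h1_heat[OF zp g])
 have sv: "sq (?v r)" for r by (rule h1_sq[OF hv])
 let ?Z = "\<lambda>r. LBINT x. U r x * ?v r x"
 let ?N = "LBINT x. nl \<alpha> (U s x) * ?v s x"
 obtain K where K: "\<forall>\<^sub>F r in at s. \<forall>v dv. h1 v dv \<longrightarrow> cmod (LBINT x. (U r x - U s x) * v x) \<le> K * \<bar>r - s\<bar> * hn v dv"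
  using B by blast
 have seq: "(\<lambda>n. (?Z (S n) - ?Z s) / of_real (S n - s)) \<longlonglongrightarrow> \<i> * (of_real lam * ?N)"
  if S: "\<And>n. S n \<noteq> s" "S \<longlonglongrightarrow> s" for S
 proof -
  have zS: "(\<lambda>n. ?z (S n)) \<longlonglongrightarrow> ?z s" using S(2) by (intro tendsto_Complex tendsto_intros)
  have zn: "?z (S n) \<noteq> ?z s" for n using S(1)[of n] by simp
  \<comment> \<open>The remaining time decreases as s grows, whence the factor - \<i>.\<close>
  have zd: "?z (S n) - ?z s = - \<i> * of_real (S n - s)" for n by (simp add: complex_eq_iff)
  have fS: "filterlim S (at s) sequentially" using S by (simp add: filterlim_at)
  let ?w = "\<lambda>n x. ?v (S n) x - ?v s x" and ?dw = "\<lambda>n b x. ?dv (S n) b x - ?dv s b x" and ?d = "\<lambda>n x. U (S n) x - U s x"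
  let ?L = "LBINT x. conv (gaussL (?z s)) g x * U s x" and ?B = "\<Sum>b\<in>Basis. LBINT x. D s b x * ?dv s b x"
  have 1: "(\<lambda>n. (LBINT x. ?d n x * ?v s x) / of_real (S n - s)) \<longlonglongrightarrow>
    \<i> * (- ?B + of_real lam * ?N)"
   using filterlim_compose[OF E[OF hv[of s], of s] fS] by simp
  have hlim: "(\<lambda>n. hn (?w n) (?dw n)) \<longlonglongrightarrow> 0"
  proof -
   have "(\<lambda>n. hn (?w n) (?dw n)) \<longlonglongrightarrow> 0 + (\<Sum>b\<in>(Basis::'a set). 0)"
    unfolding hn_def gr_def
    by (intro tendsto_add tendsto_sum heat_z_limits(2,3) zS zn zp g)
   then show ?thesis by simp
  qed
  \<comment> \<open>The cross term: the increment of U, divided by that of s, is bounded in H^-1 by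
    the assumption \<open>B\<close>, while the increment of the test function tends to 0 in
    H^1.\<close>
  have 2: "(\<lambda>n. (LBINT x. ?d n x * ?w n x) / of_real (S n - s)) \<longlonglongrightarrow> 0"
  proof (rule Lim_null_comparison[OF _ tendsto_mult_right_zero[OF hlim, of K]])
   show "\<forall>\<^sub>F n in sequentially. norm ((LBINT x. ?d n x * ?w n x) / of_real (S n - s)) \<le>
    K * hn (?w n) (?dw n)"
    using eventually_compose_filterlim[OF K fS]
   proof eventually_elim
    case (elim n)
    have "\<bar>S n - s\<bar> > 0" using S(1)[of n] by simp
    then show ?case using elim[rule_format, OF h1_diff[OF hv[of "S n"] hv[of s]]]
     by (simp add: norm_divide divide_simps mult_ac del: of_real_diff)
   qed
  qed
  have 3: "(\<lambda>n. (LBINT x. ?w n x * U s x) / of_real (S n - s)) \<longlonglongrightarrow> - \<i> * ?L"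
  proof -
   have "(\<lambda>n. LBINT x. (?w n x / (?z (S n) - ?z s)) * U s x) \<longlonglongrightarrow> ?L"
   proof (rule integral_mult_tendsto[OF heat_z_limits(1)[OF zp zS zn zp g] _ _ U_sq])
    show "sq (\<lambda>x. ?w n x / (?z (S n) - ?z s))" for n
     using sq_cmult[OF sq_diff[OF sv sv], of "1 / (?z (S n) - ?z s)"] by simp
    show "sq (conv (gaussL (?z s)) g)" by (rule sq_conv_gauss(1)[OF zp g])
   qed
   then have "(\<lambda>n. - \<i> * (LBINT x. (?w n x / (?z (S n) - ?z s)) * U s x)) \<longlonglongrightarrow> - \<i> * ?L"
    by (rule tendsto_mult_left)
   moreover have "- \<i> * (LBINT x. (?w n x / (?z (S n) - ?z s)) * U s x) =
    (LBINT x. ?w n x * U s x) / of_real (S n - s)" for n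
   proof -
    have "(LBINT x. (?w n x / (?z (S n) - ?z s)) * U s x) =
     (LBINT x. (1 / (?z (S n) - ?z s)) * (?w n x * U s x))" by simp
    also have "... = (1 / (?z (S n) - ?z s)) * (LBINT x. ?w n x * U s x)"
     by (rule integral_mult_right_zero)
    finally show ?thesis unfolding zd using S(1)[of n] by (simp add: field_simps)
   qed
   ultimately show ?thesis by simp
  qed
  have G: "?L = - ?B"
   using gaussL_pairing[OF zp g h1_wd[OF H]] by (simp add: mult.commute)
  have split: "(?Z (S n) - ?Z s) / of_real (S n - s) =
    (LBINT x. ?d n x * ?v s x) / of_real (S n - s)
    + (LBINT x. ?d n x * ?w n x) / of_real (S n - s)
    + (LBINT x. ?w n x * U s x) / of_real (S n - s)" for n
  proof -
   have i: "integrable lborel (\<lambda>x. U p x * ?v q x)" for p q by (rule sq_CS(1)[OF U_sq sv])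
   have "?Z (S n) - ?Z s = (LBINT x. ?d n x * ?v s x) + (LBINT x. ?d n x * ?w n x)
    + (LBINT x. ?w n x * U s x)"
    using i by (simp add: left_diff_distrib right_diff_distrib mult.commute[of _ "U s _"])
   then show ?thesis by (simp add: add_divide_distrib)
  qed
  have "(\<lambda>n. (?Z (S n) - ?Z s) / of_real (S n - s)) \<longlonglongrightarrow>
   \<i> * (- ?B + of_real lam * ?N) + 0
    + - \<i> * - ?B"
   unfolding split using 3 unfolding G by (intro tendsto_add 1 2)
  then show ?thesis by (simp add: algebra_simps)
 qed
 show ?thesis
  unfolding has_field_derivative_iff
 proof (rule tendsto_at_iff_sequentially[THEN iffD2], intro allI impI)
  fix S :: "nat \<Rightarrow> real" assume a: "\<forall>i. S i \<in> UNIV - {s}" "S \<longlonglongrightarrow> s"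
  have "(\<lambda>n. Re ((?Z (S n) - ?Z s) / of_real (S n - s))) \<longlonglongrightarrow> Re (\<i> * (of_real lam * ?N))"
   using seq[of S] a by (intro tendsto_Re) auto
  then show "((\<lambda>r. (Re (?Z r) - Re (?Z s)) / (r - s)) \<circ> S) \<longlonglongrightarrow> Re (\<i> * (of_real lam * ?N))"
   by (simp add: o_def del: of_real_diff)
 qed
qed

text \<open>The previous lemma applied to the difference g (x - y) - g x, which is then moved to the
  solution.\<close>

lemma duhamel_shift:
 assumes e: "e > 0" and g: "sq g"
 shows "((\<lambda>s. Re (LBINT x. W y s x * heat (Complex e (t - s)) g x)) has_real_derivative
  - lam * Im (LBINT x. (nl \<alpha> (U s (x + y)) - nl \<alpha> (U s x)) * heat (Complex e (t - s)) g x)) (at s)"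
proof -
 let ?g = "\<lambda>x. g (x - y) - g x"
 have sg: "sq (\<lambda>x. g (x - y))" using sq_translate[OF g, of "- y"] by simp
 have sq: "sq ?g" by (rule sq_diff[OF sg g])
 have z: "Re (Complex e r) > 0" for r using e by simp
 have h: "heat (Complex e r) ?g = (\<lambda>x. heat (Complex e r) g (x - y) - heat (Complex e r) g x)" for r
  using heat_diff[OF z sg g] heat_translate[of _ g "- y"] by simp
 have hs: "h1 (\<lambda>x. heat (Complex e r) g (x - y)) (\<lambda>b x. conv (gaussb (Complex e r) b) g (x - y))" for r
  using h1_translate[OF h1_heat[OF z g], of _ "- y"] by simp
 have m: "heat (Complex e r) g \<in> borel_measurable borel" for r using heat_sq[OF z g] by (simp add: sq_def)
 have 1: "(LBINT x. U s x * heat (Complex e r) ?g x) = (LBINT x. W y s x * heat (Complex e r) g x)" for s r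
  unfolding h W_def
  by (rule translate_adjoint[OF measurable_U m]) (intro sq_CS U_sq h1_sq[OF hs] heat_sq z g)+
 have 2: "(LBINT x. nl \<alpha> (U s x) * heat (Complex e r) ?g x) =
  (LBINT x. (nl \<alpha> (U s (x + y)) - nl \<alpha> (U s x)) * heat (Complex e r) g x)" for s r
  unfolding h
  by (rule translate_adjoint[OF _ m nl_integrable[OF hs] nl_integrable[OF h1_heat[OF z g]]]) measurable
 show ?thesis using duhamel_derivative[OF e sq, of t s] unfolding 1 2 by simp
qed

end

section \<open>The regularised kernel |t|^(-a), Riemann sums and Schur's test\<close>

definition kap :: "real \<Rightarrow> real \<Rightarrow> real \<Rightarrow> real" where
 "kap e a t = cmod (Complex e t) powr (- a)"

lemma cmod_Complex_pos: "e > 0 \<Longrightarrow> cmod (Complex e t) > 0"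
 by (simp add: complex_eq_iff)

lemma kap_nonneg [simp]: "kap e a t \<ge> 0" by (simp add: kap_def)

lemma kap_even: "kap e a (- t) = kap e a t" by (simp add: kap_def cmod_def)
lemma kap_minus: "kap e a (s - t) = kap e a (t - s)" using kap_even[of e a "t - s"] by simp

lemma kap_continuous:
 assumes e: "e > 0" and g: "continuous_on S g"
 shows "continuous_on S (\<lambda>x. kap e a (g x))"
 unfolding kap_def
proof (intro continuous_on_powr continuous_on_const continuous_on_norm ballI)
 show "continuous_on S (\<lambda>x. Complex e (g x))" by (intro continuous_on_Complex continuous_on_const g)
 show "cmod (Complex e (g x)) \<noteq> 0" for x using cmod_Complex_pos[OF e, of "g x"] by simp
qed

lemma kap_le:
 assumes "a \<ge> 0" "e > 0" "t \<noteq> 0" shows "kap e a t \<le> \<bar>t\<bar> powr (- a)"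
 unfolding kap_def using assms abs_Im_le_cmod[of "Complex e t"] by (intro powr_mono2') auto

lemma kap_mono:
 assumes "a \<ge> 0" "0 < e" "e \<le> e'" shows "kap e' a t \<le> kap e a t"
proof -
 have "cmod (Complex e t) \<le> cmod (Complex e' t)"
  using assms by (auto simp: cmod_def intro!: power_mono)
 then show ?thesis unfolding kap_def using assms cmod_Complex_pos[of e t] by (intro powr_mono2') auto
qed

text \<open>Below the scale e the kernel changes by at most a factor 2; sums over a grid of mesh at
  most e are therefore comparable with the integral.\<close>

lemma kap_doubling:
 assumes a: "0 \<le> a" "a < 1" and e: "e > 0" and d: "\<bar>t - \<tau>'\<bar> \<le> e"
 shows "kap e a t \<le> 2 * kap e a \<tau>'"
proof -
 have "cmod (Complex e \<tau>') \<le> cmod (Complex e t) + cmod (Complex e \<tau>' - Complex e t)"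
  by (rule norm_triangle_sub)
 also have "cmod (Complex e \<tau>' - Complex e t) = \<bar>\<tau>' - t\<bar>" by (simp add: cmod_def)
 also have "\<bar>\<tau>' - t\<bar> \<le> cmod (Complex e t)" using d e abs_Re_le_cmod[of "Complex e t"] by simp
 finally have "cmod (Complex e \<tau>') / 2 \<le> cmod (Complex e t)" by simp
 then have "kap e a t \<le> (cmod (Complex e \<tau>') / 2) powr (- a)"
  unfolding kap_def using a cmod_Complex_pos[OF e, of \<tau>'] by (intro powr_mono2') auto
 also have "... = 2 powr a * kap e a \<tau>'"
  by (simp add: kap_def powr_divide powr_minus_divide)
 also have "2 powr a \<le> (2::real)" using a powr_mono[of a 1 2] by simp
 finally show ?thesis by (simp add: mult_right_mono)
qed

text \<open>The bound is independent of e: the kernel lies below |t - s| powr (- a), whose primitive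
  \<open>P\<close> is continuous because a < 1.\<close>

lemma kap_integral:
 assumes a: "0 \<le> a" "a < 1" and e: "e > 0" and T: "T > 0" and s: "0 \<le> s" "s \<le> T"
 shows "integral {0..T} (\<lambda>t. kap e a (t - s)) \<le> 2 * T powr (1 - a) / (1 - a)"
proof -
 define P where "P t = (if t \<le> s then - ((s - t) powr (1 - a) / (1 - a)) else (t - s) powr (1 - a) / (1 - a))" for t
 have P1: "continuous_on {0..T} P"
 proof -
  have "continuous_on ({0..s} \<union> {s..T}) (\<lambda>t. if t \<le> s then - ((s - t) powr (1 - a) / (1 - a)) else (t - s) powr (1 - a) / (1 - a))"
   using a by (intro continuous_on_If continuous_intros continuous_on_powr') auto
  moreover have "{0..s} \<union> {s..T} = {0..T}" using s by auto
  ultimately show ?thesis by (simp add: P_def)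
 qed
 have I: "((\<lambda>t. \<bar>t - s\<bar> powr (- a)) has_integral (P T - P 0)) {0..T}"
 proof (rule fundamental_theorem_of_calculus_interior_strong[of "{s}"])
  fix x assume x: "x \<in> {0<..<T} - {s}"
  have "(P has_real_derivative \<bar>x - s\<bar> powr (- a)) (at x)"
  proof (cases "x > s")
   case True
   have "((\<lambda>t. (t - s) powr (1 - a) / (1 - a)) has_real_derivative (x - s) powr (- a)) (at x)"
    using True a by (auto intro!: derivative_eq_intros)
   then have "(P has_real_derivative (x - s) powr (- a)) (at x)"
    by (rule has_field_derivative_transform_within_open[where S="{s<..}"]) (use True in \<open>auto simp: P_def\<close>)
   then show ?thesis using True by simp
  next
   case False
   then have xs: "x < s" using x by auto
   have "((\<lambda>t. - ((s - t) powr (1 - a) / (1 - a))) has_real_derivative (s - x) powr (- a)) (at x)"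
    using xs a by (auto intro!: derivative_eq_intros)
   then have "(P has_real_derivative (s - x) powr (- a)) (at x)"
    by (rule has_field_derivative_transform_within_open[where S="{..<s}"]) (use xs in \<open>auto simp: P_def\<close>)
   then show ?thesis using xs by simp
  qed
  then show "(P has_vector_derivative \<bar>x - s\<bar> powr (- a)) (at x)"
   by (simp add: has_real_derivative_iff_has_vector_derivative)
 qed (use P1 T in auto)
 \<comment> \<open>The power of 0 is 0 by convention, which is below the kernel at t = s; the
   majorant is changed at this one point.\<close>
 have j: "((\<lambda>t. if t = s then kap e a 0 else \<bar>t - s\<bar> powr (- a)) has_integral (P T - P 0)) {0..T}"
  by (rule has_integral_spike_finite[of "{s}", OF _ _ I]) auto
 have "(\<lambda>t. kap e a (t - s)) integrable_on {0..T}"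
  by (intro integrable_continuous_real kap_continuous e continuous_intros)
 then have "integral {0..T} (\<lambda>t. kap e a (t - s)) \<le> P T - P 0"
 proof (rule has_integral_le[OF integrable_integral j])
  fix t show "kap e a (t - s) \<le> (if t = s then kap e a 0 else \<bar>t - s\<bar> powr (- a))"
   using kap_le[OF a(1) e, of "t - s"] by simp
 qed
 moreover have "P T \<le> T powr (1 - a) / (1 - a)" "- P 0 \<le> T powr (1 - a) / (1 - a)"
  unfolding P_def using s a by (auto intro!: divide_right_mono powr_mono2)
 ultimately show ?thesis by simp
qed


lemma sum_integral_grid:
 fixes f :: "real \<Rightarrow> real"
 assumes f: "continuous_on UNIV f" and d: "d \<ge> 0"
 shows "(\<Sum>k<n. integral {real k * d..real (Suc k) * d} f) = integral {0..real n * d} f"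
proof (induction n)
 case (Suc n)
 have "integral {0..real n * d} f + integral {real n * d..real (Suc n) * d} f = integral {0..real (Suc n) * d} f"
  using d by (intro Henstock_Kurzweil_Integration.integral_combine integrable_continuous_real continuous_on_subset[OF f])
   (auto intro!: mult_right_mono)
 then show ?case using Suc by simp
qed simp

lemma Riemann_sum_tendsto:
 fixes f :: "real \<Rightarrow> real"
 assumes f: "continuous_on UNIV f" and T: "T > 0"
 shows "(\<lambda>n. (\<Sum>k<Suc n. T / real (Suc n) * f (real k * (T / real (Suc n))))) \<longlonglongrightarrow> integral {0..T} f"
proof (rule LIMSEQ_I)
 fix j :: real assume j: "j > 0"
 define q where "q = j / (2 * T)"
 have z: "q > 0" "q * T < j" using j T by (auto simp: q_def)
 have "uniformly_continuous_on {0..T} f"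
  by (rule compact_uniformly_continuous[OF continuous_on_subset[OF f subset_UNIV] compact_Icc])
 then obtain d where d: "d > 0" "\<And>x y. x \<in> {0..T} \<Longrightarrow> y \<in> {0..T} \<Longrightarrow> dist y x < d \<Longrightarrow> dist (f y) (f x) < q"
  unfolding uniformly_continuous_on_def using z(1) by blast
 obtain N where N: "T / d < real N" using reals_Archimedean2 by blast
 show "\<exists>no. \<forall>n\<ge>no. norm ((\<Sum>k<Suc n. T / real (Suc n) * f (real k * (T / real (Suc n)))) - integral {0..T} f) < j"
 proof (intro exI[of _ N] allI impI)
  fix n assume n: "n \<ge> N"
  define h where "h = T / real (Suc n)"
  have h: "h > 0" "h < d" "real (Suc n) * h = T"
  proof -
   have "T / d < real (Suc n)" using N n by simp
   then show "h < d" using d(1) by (simp add: h_def field_simps)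
  qed (use T in \<open>auto simp: h_def\<close>)
  have each: "\<bar>h * f (real k * h) - integral {real k * h..real (Suc k) * h} f\<bar> \<le> q * h" if k: "k < Suc n" for k
  proof -
   have le: "real k * h \<le> real (Suc k) * h" using h by (simp add: mult_right_mono)
   have top: "real (Suc k) * h \<le> T"
   proof -
    have "real (Suc k) * h \<le> real (Suc n) * h" using k h(1) by (intro mult_right_mono) auto
    then show ?thesis using h(3) by simp
   qed
   have len: "real (Suc k) * h - real k * h = h" by (simp add: algebra_simps)
   have c: "f integrable_on {real k * h..real (Suc k) * h}"
    by (rule integrable_continuous_real[OF continuous_on_subset[OF f subset_UNIV]])
   have "integral {real k * h..real (Suc k) * h} (\<lambda>x. f (real k * h) - f x) = h * f (real k * h) - integral {real k * h..real (Suc k) * h} f"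
    using c le len by (subst integral_diff) (auto simp del: of_nat_Suc)
   moreover have "norm (integral {real k * h..real (Suc k) * h} (\<lambda>x. f (real k * h) - f x)) \<le> q * (real (Suc k) * h - real k * h)"
   proof (rule integral_bound[OF le])
    show "continuous_on {real k * h..real (Suc k) * h} (\<lambda>x. f (real k * h) - f x)"
     by (intro continuous_intros continuous_on_subset[OF f]) auto
    fix x assume x: "x \<in> {real k * h..real (Suc k) * h}"
    have k0: "0 \<le> real k * h" using h by simp
    have "\<bar>x - real k * h\<bar> < d" using x len h(2) by auto
    then have "dist (f (real k * h)) (f x) < q"
     using x le top k0 by (intro d(2)) (auto simp: dist_real_def)
    then show "norm (f (real k * h) - f x) \<le> q" by (simp add: dist_real_def)
   qed
   ultimately show ?thesis unfolding len by (simp add: abs_minus_commute)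
  qed
  have "(\<Sum>k<Suc n. h * f (real k * h)) - integral {0..T} f = (\<Sum>k<Suc n. h * f (real k * h) - integral {real k * h..real (Suc k) * h} f)"
   using sum_integral_grid[OF f, of h "Suc n"] h unfolding sum_subtractf by simp
  also have "\<bar>...\<bar> \<le> (\<Sum>k<Suc n. q * h)"
   by (rule order_trans[OF sum_abs sum_mono]) (use each in auto)
  also have "... = q * T" using h(3) by (simp add: mult_ac)
  finally have "\<bar>(\<Sum>k<Suc n. h * f (real k * h)) - integral {0..T} f\<bar> < j" using z(2) by simp
  then show "norm ((\<Sum>k<Suc n. T / real (Suc n) * f (real k * (T / real (Suc n)))) - integral {0..T} f) < j"
   by (simp add: h_def)
 qed
qed

lemma kap_sum:
 assumes a: "0 \<le> a" "a < 1" and e: "e > 0" and T: "T > 0" and s: "0 \<le> s" "s \<le> T"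
  and d: "0 < d" "d \<le> e" "real n * d = T"
 shows "(\<Sum>k<n. d * kap e a (real k * d - s)) \<le> 2 * (2 * T powr (1 - a) / (1 - a))"
proof -
 let ?f = "\<lambda>t. kap e a (t - s)"
 have cf: "continuous_on S ?f" for S by (intro kap_continuous e continuous_intros)
 have "(\<Sum>k<n. d * kap e a (real k * d - s)) \<le> (\<Sum>k<n. 2 * integral {real k * d..real (Suc k) * d} ?f)"
 proof (rule sum_mono)
  fix k
  let ?I = "{real k * d..real (Suc k) * d}"
  have le: "real k * d \<le> real (Suc k) * d" using d by (simp add: mult_right_mono)
  have "d * kap e a (real k * d - s) = integral ?I (\<lambda>_. kap e a (real k * d - s))"
   using le by (simp add: algebra_simps)
  also have "... \<le> integral ?I (\<lambda>t. 2 * ?f t)"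
  proof (rule integral_le)
   show "(\<lambda>t. 2 * ?f t) integrable_on ?I" by (intro integrable_continuous_real continuous_intros cf)
   fix t assume "t \<in> ?I"
   then have "\<bar>(real k * d - s) - (t - s)\<bar> \<le> e" using d by (auto simp: algebra_simps)
   then show "kap e a (real k * d - s) \<le> 2 * ?f t" by (rule kap_doubling[OF a e])
  qed (rule integrable_const_ivl)
  finally show "d * kap e a (real k * d - s) \<le> 2 * integral ?I ?f" by simp
 qed
 also have "... = 2 * integral {0..T} ?f"
  unfolding sum_distrib_left[symmetric] using sum_integral_grid[OF cf, of d n] d by simp
 also have "... \<le> 2 * (2 * T powr (1 - a) / (1 - a))" using kap_integral[OF a e T s] by simp
 finally show ?thesis .
qed

lemma n2_sum:
 fixes f :: "nat \<Rightarrow> 'a::euclidean_space \<Rightarrow> complex"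
 assumes f: "\<And>j. sq (f j)"
 shows "sq (\<lambda>x. \<Sum>j<n. c j * f j x)"
  and "(n2 (\<lambda>x. \<Sum>j<n. c j * f j x))^2 \<le> (\<Sum>j<n. \<Sum>k<n. cmod (c j) * cmod (c k) * cmod (LBINT x. f j x * cnj (f k x)))"
proof -
 show "sq (\<lambda>x. \<Sum>j<n. c j * f j x)"
  by (induction n) (auto intro!: sq_add sq_cmult f simp: sq_def[of "\<lambda>x. 0"])
 let ?V = "\<lambda>x. \<Sum>j<n. c j * f j x"
 have i: "integrable lborel (\<lambda>x. (c j * f j x) * cnj (c k * f k x))" for j k
  by (intro sq_CS(1) sq_cnj sq_cmult f)
 have "complex_of_real ((n2 ?V)^2) = (LBINT x. (\<Sum>j<n. \<Sum>k<n. (c j * f j x) * cnj (c k * f k x)))"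
  unfolding n2_square_cnj by (simp only: cnj_sum sum_product)
 also have "... = (\<Sum>j<n. \<Sum>k<n. LBINT x. (c j * f j x) * cnj (c k * f k x))"
  using i by (simp only: Bochner_Integration.integral_sum Bochner_Integration.integrable_sum)
 also have "... = (\<Sum>j<n. \<Sum>k<n. c j * cnj (c k) * (LBINT x. f j x * cnj (f k x)))"
 proof (intro sum.cong refl)
  fix j k
  have "(\<lambda>x. (c j * f j x) * cnj (c k * f k x)) = (\<lambda>x. c j * cnj (c k) * (f j x * cnj (f k x)))" by (auto simp: mult_ac)
  then show "(LBINT x. (c j * f j x) * cnj (c k * f k x)) = c j * cnj (c k) * (LBINT x. f j x * cnj (f k x))"
   by (simp only: integral_mult_right_zero)
 qed
 finally have e: "complex_of_real ((n2 ?V)^2) = (\<Sum>j<n. \<Sum>k<n. c j * cnj (c k) * (LBINT x. f j x * cnj (f k x)))" .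
 have "(n2 ?V)^2 = cmod (complex_of_real ((n2 ?V)^2))" by (simp only: norm_of_real abs_power2)
 also have "... \<le> (\<Sum>j<n. \<Sum>k<n. cmod (c j * cnj (c k) * (LBINT x. f j x * cnj (f k x))))"
  unfolding e by (intro sum_norm_le order_refl)
 finally show "(n2 ?V)^2 \<le> (\<Sum>j<n. \<Sum>k<n. cmod (c j) * cmod (c k) * cmod (LBINT x. f j x * cnj (f k x)))"
  by (simp add: norm_mult)
qed

text \<open>Schur's test in the symmetric case, from 2 y j y k \<le> (y j)^2 + (y k)^2.\<close>

lemma symmetric_double_sum:
 fixes K :: "nat \<Rightarrow> nat \<Rightarrow> real"
 assumes K: "\<And>j k. K j k \<ge> 0" "\<And>j k. K j k = K k j" and S: "\<And>j. j < n \<Longrightarrow> (\<Sum>k<n. K j k) \<le> S"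
 shows "(\<Sum>j<n. \<Sum>k<n. y j * y k * K j k) \<le> S * (\<Sum>j<n. (y j)^2)"
proof -
 have "(\<Sum>j<n. \<Sum>k<n. y j * y k * K j k) \<le> (\<Sum>j<n. \<Sum>k<n. (y j)^2 * K j k / 2 + (y k)^2 * K j k / 2)"
 proof (intro sum_mono)
  fix j k
  have "y j * y k \<le> (y j)^2 / 2 + (y k)^2 / 2" using sum_squares_bound[of "y j" "y k"] by simp
  from mult_right_mono[OF this K(1)[of j k]]
  show "y j * y k * K j k \<le> (y j)^2 * K j k / 2 + (y k)^2 * K j k / 2" by (simp add: distrib_right)
 qed
 also have "... = (\<Sum>j<n. \<Sum>k<n. (y j)^2 * K j k / 2) + (\<Sum>j<n. \<Sum>k<n. (y k)^2 * K j k / 2)"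
  by (simp only: sum.distrib)
 also have "(\<Sum>j<n. \<Sum>k<n. (y k)^2 * K j k / 2) = (\<Sum>j<n. \<Sum>k<n. (y j)^2 * K j k / 2)"
  by (subst sum.swap) (simp add: K(2))
 also have "(\<Sum>j<n. \<Sum>k<n. (y j)^2 * K j k / 2) + (\<Sum>j<n. \<Sum>k<n. (y j)^2 * K j k / 2) = (\<Sum>j<n. (y j)^2 * (\<Sum>k<n. K j k))"
  unfolding sum.distrib[symmetric] sum_distrib_left by (simp only: field_sum_of_halves)
 also have "... \<le> (\<Sum>j<n. (y j)^2 * S)" using S by (intro sum_mono mult_left_mono) auto
 finally show ?thesis by (simp add: sum_distrib_left mult.commute)
qed


text \<open>The \<open>TT\<^sup>*\<close> argument, on a time grid so that the dual functions can be chosen one by one.\<close>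

lemma smoothed_Strichartz:
 fixes w :: "real \<Rightarrow> 'a::euclidean_space \<Rightarrow> complex"
 assumes r: "r > 2" and a: "0 \<le> a" "a < 1" and e: "e > 0" and T: "T > 0"
  and w: "\<And>v. sq (w v)" "\<And>v. lp r (heat (of_real e) (w v))"
  and C0: "C0 \<ge> 0" "\<And>z (f :: 'a \<Rightarrow> complex). Re z > 0 \<Longrightarrow> sq f \<Longrightarrow> lp (conj_exp r) f \<Longrightarrow>
   lp r (heat z f) \<and> np r (heat z f) \<le> C0 * cmod z powr (- a) * np (conj_exp r) f"
  and A: "A \<ge> 0" and y: "continuous_on UNIV y"
  and yE: "continuous_on UNIV (\<lambda>v. np r (heat (of_real e) (w v)))"
  and duhamel: "\<And>v g. 0 \<le> v \<Longrightarrow> v \<le> T \<Longrightarrow> sq g \<Longrightarrow> lp (conj_exp r) g \<Longrightarrow> np (conj_exp r) g \<le> 1 \<Longrightarrow>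
   Re (LBINT x. w v x * heat (of_real e) g x) \<le>
   Re (LBINT x. w 0 x * heat (Complex e v) g x) + A * integral {0..v} (\<lambda>u. kap e a (v - u) * y u)"
 defines "c \<equiv> 2 * T powr (1 - a) / (1 - a)"
  and "E \<equiv> integral {0..T} (\<lambda>v. (np r (heat (of_real e) (w v)))^2)" and "Y \<equiv> integral {0..T} (\<lambda>v. (y v)^2)"
 shows "E \<le> n2 (w 0) * sqrt (2 * C0 * c * E) + A * c / 2 * E + A * c * Y"
proof -
 let ?q = "conj_exp r"
 let ?J = "\<lambda>v. integral {0..v} (\<lambda>u. kap e a (v - u) * y u)" and ?R = "\<lambda>s. n2 (w 0) * sqrt (2 * C0 * c * s) + A * c / 2 * s + A * c * Y"
 define p where "p v = np r (heat (of_real e) (w v))" for v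
 have p0: "p v \<ge> 0" for v by (simp add: p_def)
 have c0: "c \<ge> 0" using a by (simp add: c_def)
 have cq: "?q > 1" "1 / r + 1 / ?q = 1" using conj_exp[of r] r by auto
 define S where "S n = (\<Sum>k<Suc n. T / real (Suc n) * (p (real k * (T / real (Suc n))))^2)" for n
 have S: "S \<longlonglongrightarrow> E"
  unfolding S_def[abs_def] E_def p_def by (intro Riemann_sum_tendsto T continuous_intros yE)
 \<comment> \<open>The inequality is proved first for Riemann sums with mesh at most e, as
   \<open>kap_sum\<close> demands; both sides then pass to the limit.\<close>
 have main: "S n \<le> ?R (S n)"
  if n: "T / real (Suc n) \<le> e" for n
 proof -
  define d where "d = T / real (Suc n)"
  let ?N = "Suc n"
  have d: "0 < d" "d \<le> e" "real ?N * d = T" using T n by (auto simp: d_def)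
  define t where "t k = real k * d" for k
  let ?L = "\<lambda>k u. d * kap e a (t k - u) * (y u)^2" and ?G = "\<lambda>k g. LBINT x. heat (of_real e) (w (t k)) x * g x"
  have t: "0 \<le> t k" for k using d by (simp add: t_def)
  have tT: "t k \<le> T" if "k < ?N" for k
  proof -
   have "real k * d \<le> real ?N * d" using that d by (intro mult_right_mono) auto
   then show ?thesis using d by (simp only: t_def)
  qed
  have Sn: "S n = (\<Sum>k<?N. d * (p (t k))^2)" by (simp only: S_def d_def t_def)
  have ks: "(\<Sum>k<?N. d * kap e a (t k - s)) \<le> 2 * c" if "0 \<le> s" "s \<le> T" for s
   using kap_sum[OF a e T that d] by (simp only: t_def c_def)
  have ck: "continuous_on X (\<lambda>u. kap e a (s - u))" for s X by (intro kap_continuous e continuous_intros)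
  have cy: "continuous_on X y" for X using y continuous_on_subset by blast
  \<comment> \<open>The product p y is split by Young's inequality. Integrating the kernel in u
    costs c and gives c / 2 times the sum; summing it over the grid costs 2 c and gives c times
    Y.\<close>
  have Aterm: "(\<Sum>k<?N. d * p (t k) * ?J (t k)) \<le> c / 2 * S n + c * Y"
  proof -
   have "d * p (t k) * ?J (t k) \<le>
     c / 2 * (d * (p (t k))^2) + integral {0..T} (?L k) / 2" if k: "k < ?N" for k
   proof -
    let ?h = "\<lambda>u. (p (t k))^2 / 2 * kap e a (t k - u) + 1 / 2 * (kap e a (t k - u) * (y u)^2)"
    have "p (t k) * ?J (t k) = integral {0..t k} (\<lambda>u. p (t k) * (kap e a (t k - u) * y u))" by simp
    also have "... \<le> integral {0..t k} ?h"
    proof (rule integral_le)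
     show "(\<lambda>u. p (t k) * (kap e a (t k - u) * y u)) integrable_on {0..t k}" "?h integrable_on {0..t k}"
      by (intro integrable_continuous_real continuous_intros ck cy)+
     fix u
     have "p (t k) * y u \<le> (p (t k))^2 / 2 + (y u)^2 / 2" using sum_squares_bound[of "p (t k)" "y u"] by simp
     from mult_right_mono[OF this kap_nonneg[of e a "t k - u"]]
     show "p (t k) * (kap e a (t k - u) * y u) \<le> ?h u" by (simp add: algebra_simps)
    qed
    also have "... \<le> integral {0..T} ?h"
     by (rule integral_subset_le) (use tT[OF k] in \<open>auto intro!: integrable_continuous_real continuous_intros ck cy\<close>)
    also have "... = (p (t k))^2 / 2 * integral {0..T} (\<lambda>u. kap e a (t k - u)) + 1 / 2 * integral {0..T} (\<lambda>u. kap e a (t k - u) * (y u)^2)"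
     by (subst Henstock_Kurzweil_Integration.integral_add) (auto intro!: integrable_continuous_real continuous_intros ck cy)
    also have "integral {0..T} (\<lambda>u. kap e a (t k - u)) \<le> c"
     using kap_integral[OF a e T t tT[OF k]] unfolding c_def by (simp add: kap_minus[of e a "t k"])
    finally have "p (t k) * ?J (t k) \<le>
     (p (t k))^2 / 2 * c + 1 / 2 * integral {0..T} (\<lambda>u. kap e a (t k - u) * (y u)^2)" by (simp add: mult_left_mono)
    from mult_left_mono[OF this less_imp_le[OF d(1)]]
    show ?thesis by (simp add: mult.assoc algebra_simps)
   qed
   then have "(\<Sum>k<?N. d * p (t k) * ?J (t k)) \<le>
    (\<Sum>k<?N. c / 2 * (d * (p (t k))^2) + integral {0..T} (?L k) / 2)"
    by (intro sum_mono) auto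
   also have "... = c / 2 * S n + (\<Sum>k<?N. integral {0..T} (?L k)) / 2"
    unfolding Sn by (simp only: sum.distrib sum_distrib_left sum_divide_distrib)
   also have "(\<Sum>k<?N. integral {0..T} (?L k)) =
     integral {0..T} (\<lambda>u. \<Sum>k<?N. ?L k u)"
    by (rule Henstock_Kurzweil_Integration.integral_sum[symmetric]) (auto intro!: integrable_continuous_real continuous_intros ck cy)
   also have "... \<le> integral {0..T} (\<lambda>u. 2 * c * (y u)^2)"
   proof (rule integral_le)
    show "(\<lambda>u. \<Sum>k<?N. ?L k u) integrable_on {0..T}" "(\<lambda>u. 2 * c * (y u)^2) integrable_on {0..T}"
     by (intro integrable_continuous_real continuous_intros ck cy)+
    fix u assume "u \<in> {0..T}"
    then have "(\<Sum>k<?N. d * kap e a (t k - u)) * (y u)^2 \<le> 2 * c * (y u)^2"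
     by (intro mult_right_mono ks) auto
    then show "(\<Sum>k<?N. ?L k u) \<le> 2 * c * (y u)^2" by (simp only: sum_distrib_right)
   qed
   also have "... = 2 * c * Y" by (simp add: Y_def)
   finally show ?thesis by simp
  qed
  show ?thesis
  proof (rule field_le_epsilon)
   fix \<epsilon> :: real assume \<epsilon>: "\<epsilon> > 0"
   define P where "P = (\<Sum>k<?N. d * p (t k))"
   have P: "P \<ge> 0" unfolding P_def using d p0 by (intro sum_nonneg mult_nonneg_nonneg) auto
   \<comment> \<open>The defect allowed in the choice of each dual function; weighted with d p (t
     k), the defects add up to m P \<le> \<epsilon>.\<close>
   define m where "m = \<epsilon> / (P + 1)"
   have m: "m > 0" using \<epsilon> P by (simp add: m_def)
   have \<eta>P: "m * P \<le> \<epsilon>"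
   proof -
    have "m * P \<le> m * (P + 1)" using m by simp
    also have "... = \<epsilon>" using P by (simp add: m_def)
    finally show ?thesis .
   qed
   have "\<forall>k. \<exists>G. sq G \<and> lp ?q G \<and> np ?q G \<le> 1 \<and> p (t k) - m \<le> Re (?G k G)"
   proof
    fix k
    have sqh: "sq (heat (of_real e) (w (t k)))" using e w(1) by (intro heat_sq) auto
    show "\<exists>G. sq G \<and> lp ?q G \<and> np ?q G \<le> 1 \<and> p (t k) - m \<le> Re (?G k G)"
     using near_dual[OF r sqh w(2) m] unfolding p_def by blast
   qed
   from choice[OF this] obtain G where "\<forall>k. sq (G k) \<and> lp ?q (G k) \<and> np ?q (G k) \<le> 1 \<and>
    p (t k) - m \<le> Re (?G k (G k))" ..
   then have G: "\<And>k. sq (G k)" "\<And>k. lp ?q (G k)" "\<And>k. np ?q (G k) \<le> 1"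
    "\<And>k. p (t k) - m \<le> Re (?G k (G k))" by blast+
   define f where "f k = heat (Complex e (t k)) (G k)" for k
   define V where "V x = (\<Sum>k<?N. of_real (d * p (t k)) * f k x)" for x
   have z: "Re (Complex e s) > 0" for s using e by simp
   have sf: "sq (f k)" for k unfolding f_def by (rule heat_sq[OF z G(1)])
   have sV: "sq V" unfolding V_def[abs_def] by (rule n2_sum(1)[OF sf])
   \<comment> \<open>The kernel of the composition with the adjoint: conjugation reverses one time,
     so the times combine to 2 e + i (t j - t k), where the dispersive estimate applies.\<close>
   have pairs: "cmod (LBINT x. f j x * cnj (f k x)) \<le> C0 * kap e a (t k - t j)" for j k
   proof -
    let ?z = "Complex (2 * e) (t j - t k)"
    have zz: "Complex e (t j) + cnj (Complex e (t k)) = ?z" by (simp add: complex_eq_iff)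
    have z2: "Re ?z > 0" "Re (cnj (Complex e (t k))) > 0" using e by auto
    have "(LBINT x. f j x * cnj (f k x)) = (LBINT x. heat (Complex e (t j)) (G j) x * heat (cnj (Complex e (t k))) (\<lambda>x. cnj (G k x)) x)"
     unfolding f_def heat_cnj[OF z] ..
    also have "... = (LBINT x. heat ?z (G j) x * cnj (G k x))"
     unfolding zz[symmetric] by (rule heat_semigroup_pairing[OF z z2(2) G(1) sq_cnj[OF G(1)]])
    also have "cmod ... \<le> np r (heat ?z (G j)) * np ?q (\<lambda>x. cnj (G k x))"
    proof (rule lp_Holder_mult(2)[OF _ cq])
     show "lp r (heat ?z (G j))" using C0(2)[OF z2(1) G(1,2)] by blast
     show "lp ?q (\<lambda>x. cnj (G k x))" using G(2) by (simp add: lp_cnj)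
    qed (use r in simp)
    also have "... \<le> (C0 * cmod ?z powr (- a)) * 1"
    proof (rule mult_mono)
     have "np r (heat ?z (G j)) \<le> C0 * cmod ?z powr (- a) * np ?q (G j)" using C0(2)[OF z2(1) G(1,2)] by blast
     also have "... \<le> C0 * cmod ?z powr (- a) * 1" using C0(1) by (intro mult_left_mono G(3)) auto
     finally show "np r (heat ?z (G j)) \<le> C0 * cmod ?z powr (- a)" by simp
     show "np ?q (\<lambda>x. cnj (G k x)) \<le> 1" using G(3) by simp
    qed (use C0 in auto)
    also have "... = C0 * kap (2 * e) a (t j - t k)" by (simp add: kap_def)
    also have "... \<le> C0 * kap e a (t j - t k)" using C0(1) a e by (intro mult_left_mono kap_mono) auto
    finally show ?thesis by (simp only: kap_minus)
   qed
   \<comment> \<open>Schur's test with row sums at most 2 c.\<close>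
   have V2: "(n2 V)^2 \<le> 2 * C0 * c * S n"
   proof -
    have "(n2 V)^2 \<le> (\<Sum>j<?N. \<Sum>k<?N. cmod (of_real (d * p (t j))) * cmod (of_real (d * p (t k))) * cmod (LBINT x. f j x * cnj (f k x)))"
     unfolding V_def[abs_def] by (rule n2_sum(2)[OF sf])
    also have "... \<le> (\<Sum>j<?N. \<Sum>k<?N. p (t j) * p (t k) * (d * C0 * (d * kap e a (t k - t j))))"
    proof (intro sum_mono)
     fix j k
     have n: "cmod (of_real (d * p (t j))) = d * p (t j)" for j
      unfolding norm_of_real by (rule abs_of_nonneg) (use d p0 in simp)
     have "d * p (t j) * (d * p (t k)) * cmod (LBINT x. f j x * cnj (f k x)) \<le> d * p (t j) * (d * p (t k)) * (C0 * kap e a (t k - t j))"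
      using d p0 by (intro mult_left_mono pairs mult_nonneg_nonneg) auto
     then show "cmod (of_real (d * p (t j))) * cmod (of_real (d * p (t k))) * cmod (LBINT x. f j x * cnj (f k x)) \<le>
      p (t j) * p (t k) * (d * C0 * (d * kap e a (t k - t j)))" unfolding n by (simp only: mult_ac)
    qed
    also have "... \<le> (d * C0 * (2 * c)) * (\<Sum>j<?N. (p (t j))^2)"
    proof (rule symmetric_double_sum)
     show "d * C0 * (d * kap e a (t k - t j)) \<ge> 0" for j k using d C0 by simp
     show "d * C0 * (d * kap e a (t k - t j)) = d * C0 * (d * kap e a (t j - t k))" for j k by (simp only: kap_minus)
     fix j assume "j < ?N"
     then show "(\<Sum>k<?N. d * C0 * (d * kap e a (t k - t j))) \<le> d * C0 * (2 * c)"
      using mult_left_mono[OF ks[OF t tT], of j "d * C0"] d C0 by (simp only: sum_distrib_left) simp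
    qed
    also have "... = 2 * C0 * c * S n" unfolding Sn sum_distrib_left[symmetric] by (simp only: mult_ac)
    finally show ?thesis .
   qed
   \<comment> \<open>Each norm is replaced by its nearly optimal pairing, which Duhamel's formula
     carries back to time 0. There the contributions of all grid times combine to a pairing of w 0
     with the single function V.\<close>
   have "S n - m * P = (\<Sum>k<?N. d * p (t k) * (p (t k) - m))"
    unfolding Sn P_def sum_distrib_left sum_subtractf[symmetric]
    by (intro sum.cong refl) (simp add: power2_eq_square algebra_simps)
   also have "... \<le> (\<Sum>k<?N. d * p (t k) * (Re (LBINT x. w 0 x * f k x) + A * ?J (t k)))"
   proof (intro sum_mono mult_left_mono)
    fix k assume "k \<in> {..<?N}"
    then have k: "t k \<le> T" using tT by simp
    have "p (t k) - m \<le> Re (?G k (G k))" by (rule G(4))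
    also have "(?G k (G k)) = (LBINT x. w (t k) x * heat (of_real e) (G k) x)"
     using e by (intro heat_symmetric w G) auto
    also have "Re ... \<le> Re (LBINT x. w 0 x * f k x) + A * ?J (t k)"
     unfolding f_def by (rule duhamel[OF t k G(1-3)])
    finally show "p (t k) - m \<le> Re (LBINT x. w 0 x * f k x) + A * ?J (t k)" .
    show "0 \<le> d * p (t k)" using d p0 by simp
   qed
   also have "... = Re (\<Sum>k<?N. of_real (d * p (t k)) * (LBINT x. w 0 x * f k x)) +
     A * (\<Sum>k<?N. d * p (t k) * ?J (t k))"
    unfolding Re_sum sum_distrib_left sum.distrib[symmetric]
    by (intro sum.cong refl) (simp add: algebra_simps)
   also have "(\<Sum>k<?N. of_real (d * p (t k)) * (LBINT x. w 0 x * f k x)) = (LBINT x. w 0 x * V x)"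
   proof -
    have "(LBINT x. w 0 x * V x) = (LBINT x. (\<Sum>k<?N. of_real (d * p (t k)) * (w 0 x * f k x)))"
     by (simp only: V_def sum_distrib_left mult.left_commute)
    also have "... = (\<Sum>k<?N. LBINT x. of_real (d * p (t k)) * (w 0 x * f k x))"
     by (intro Bochner_Integration.integral_sum integrable_mult_right sq_CS(1) w sf)
    finally show ?thesis by (simp only: integral_mult_right_zero)
   qed
   also have "Re (LBINT x. w 0 x * V x) \<le> n2 (w 0) * sqrt (2 * C0 * c * S n)"
   proof -
    have "Re (LBINT x. w 0 x * V x) \<le> cmod (LBINT x. w 0 x * V x)" by (rule complex_Re_le_cmod)
    also have "... \<le> n2 (w 0) * n2 V" by (rule sq_CS(2)[OF w(1) sV])
    also have "n2 V \<le> sqrt (2 * C0 * c * S n)" by (rule real_le_rsqrt[OF V2])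
    finally show ?thesis by (simp add: mult_left_mono)
   qed
   also have "A * (\<Sum>k<?N. d * p (t k) * ?J (t k)) \<le> A * (c / 2 * S n + c * Y)"
    by (rule mult_left_mono[OF Aterm A])
   finally show "S n \<le> ?R (S n) + \<epsilon>"
    using \<eta>P by (simp add: algebra_simps)
  qed
 qed
 have "(\<lambda>n. ?R (S n)) \<longlonglongrightarrow> ?R E"
  by (intro tendsto_intros S)
 then show ?thesis
 proof (rule LIMSEQ_le[OF S])
  obtain N where N: "T / e < real N" using reals_Archimedean2 by blast
  have "S n \<le> ?R (S n)" if "n \<ge> N" for n
  proof (rule main)
   have "T / e \<le> real (Suc n)" using N that by simp
   then show "T / real (Suc n) \<le> e" using e by (simp add: field_simps)
  qed
  then show "\<exists>N. \<forall>n\<ge>N. S n \<le> ?R (S n)" by blast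
 qed
qed

section \<open>Strichartz estimates for translation differences\<close>

lemma derivative_le_integral:
 fixes F q :: "real \<Rightarrow> real"
 assumes ab: "a \<le> b" and q: "continuous_on {a..b} q"
  and F: "\<And>s. (F has_real_derivative F' s) (at s)" and le: "\<And>s. a \<le> s \<Longrightarrow> s \<le> b \<Longrightarrow> F' s \<le> q s"
 shows "F b \<le> F a + integral {a..b} q"
proof -
 let ?G = "\<lambda>s. integral {a..s} q - F s"
 have "?G a \<le> ?G b"
 proof (rule DERIV_nonneg_imp_increasing_open[OF ab])
  have "continuous_on {a..b} F"
   using F by (intro continuous_at_imp_continuous_on ballI DERIV_isCont)
  then show "continuous_on {a..b} ?G"
   by (intro continuous_on_diff indefinite_integral_continuous_1 integrable_continuous_real q)
  fix s assume s: "a < s" "s < b"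
  have "((\<lambda>s. integral {a..s} q) has_real_derivative q s) (at s within {a..b})"
   using s by (intro integral_has_real_derivative q) auto
  then have "((\<lambda>s. integral {a..s} q) has_real_derivative q s) (at s)"
   using s by (simp add: at_within_Icc_at)
  then have "(?G has_real_derivative q s - F' s) (at s)" by (intro derivative_intros F)
  then show "\<exists>y. (?G has_real_derivative y) (at s) \<and> 0 \<le> y" using le[of s] s by (intro exI conjI) auto
 qed
 then show ?thesis by simp
qed

context nls
begin

lemma nl_shift_pairing:
 assumes r: "r > 2" and a: "decay TYPE('a) r < 1" and a0: "\<alpha> > 0" "\<alpha> * r / (r - 2) \<ge> 2" "\<alpha> \<le> r - 2"
 obtains K where "K > 0" "\<And>s y v. lp r v \<Longrightarrow>
  cmod (LBINT x. (nl \<alpha> (U s (x + y)) - nl \<alpha> (U s x)) * v x) \<le> K * hn (U s) (D s) powr \<alpha> * np r (W y s) * np r v"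
proof -
 obtain K where K: "K > 0" "\<And>(f :: 'a \<Rightarrow> complex) d w v t. h1 f d \<Longrightarrow> lp r w \<Longrightarrow> lp r v \<Longrightarrow>
  integrable lborel (\<lambda>x. (cmod (f (x + t)) + cmod (f x)) powr \<alpha> * (cmod (w x) * cmod (v x))) \<and>
  (LBINT x. (cmod (f (x + t)) + cmod (f x)) powr \<alpha> * (cmod (w x) * cmod (v x))) \<le> K * hn f d powr \<alpha> * (np r w * np r v)"
  by (rule weighted_Holder[OF r a a0], rule that)
 obtain S where S: "S > 0" "\<And>(f :: 'a \<Rightarrow> complex) d. h1 f d \<Longrightarrow> lp r f \<and> np r f \<le> S * hn f d"
  by (rule Sobolev[OF less_imp_le[OF r] a], rule that)
 show ?thesis
 proof (rule that[of "(\<alpha> + 1) * K"])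
  show "(\<alpha> + 1) * K > 0" using K(1) a0 by simp
  fix s y and v :: "'a \<Rightarrow> complex" assume v: "lp r v"
  note [measurable] = v
  note k = K(2)[OF H[of s] conjunct1[OF S(2)[OF W_h1]] v, of y y s]
  let ?b = "\<lambda>x. (cmod (U s (x + y)) + cmod (U s x)) powr \<alpha> * (cmod (W y s x) * cmod (v x))"
  let ?f = "\<lambda>x. (nl \<alpha> (U s (x + y)) - nl \<alpha> (U s x)) * v x"
  have i: "integrable lborel (\<lambda>x. (\<alpha> + 1) * ?b x)" using k by (intro integrable_mult_right) blast
  have le: "norm (?f x) \<le> (\<alpha> + 1) * ?b x" for x
   using mult_right_mono[OF nl_Lipschitz[OF al, of "U s (x + y)" "U s x"] norm_ge_zero[of "v x"]]
   by (simp add: norm_mult W_def mult.assoc)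
  have "integrable lborel ?f" by (rule integrable_dominated[OF i _ le]) measurable
  then have "cmod (LBINT x. ?f x) \<le> (LBINT x. (\<alpha> + 1) * ?b x)"
   using integral_norm_bound[of lborel ?f] integral_mono[OF integrable_norm i le] by (rule_tac order_trans)
  also have "... = (\<alpha> + 1) * (LBINT x. ?b x)" by (rule integral_mult_right_zero)
  also have "... \<le> (\<alpha> + 1) * (K * hn (U s) (D s) powr \<alpha> * (np r (W y s) * np r v))"
   using k al by (intro mult_left_mono) auto
  finally show "cmod (LBINT x. ?f x) \<le> (\<alpha> + 1) * K * hn (U s) (D s) powr \<alpha> * np r (W y s) * np r v"
   by (simp only: mult.assoc)
 qed
qed

text \<open>The difference of the nonlinearity is bounded by the L^r norm of W times a power of the
  H^1 bound M, and the dispersive estimate controls the evolved g by the kernel. The constant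
  depends neither on the shift y nor on e or the initial time.\<close>

lemma duhamel_inequality:
 assumes r: "r > 2" and a: "decay TYPE('a) r < 1" and a0: "\<alpha> > 0" "\<alpha> * r / (r - 2) \<ge> 2" "\<alpha> \<le> r - 2"
  and C0: "C0 \<ge> 0" "\<And>z (f :: 'a \<Rightarrow> complex). Re z > 0 \<Longrightarrow> sq f \<Longrightarrow> lp (conj_exp r) f \<Longrightarrow>
   lp r (heat z f) \<and> np r (heat z f) \<le> C0 * cmod z powr (- decay TYPE('a) r) * np (conj_exp r) f"
 obtains A where "A > 0" "\<And>y e t0 t g. e > 0 \<Longrightarrow> 0 \<le> t \<Longrightarrow> sq g \<Longrightarrow> lp (conj_exp r) g \<Longrightarrow> np (conj_exp r) g \<le> 1 \<Longrightarrow>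
  \<forall>s\<in>{t0..t0 + t}. hn (U s) (D s) \<le> M \<Longrightarrow>
  Re (LBINT x. W y (t0 + t) x * heat (of_real e) g x) \<le> Re (LBINT x. W y t0 x * heat (Complex e t) g x)
   + A * integral {0..t} (\<lambda>u. kap e (decay TYPE('a) r) (t - u) * np r (W y (t0 + u)))"
proof -
 let ?a = "decay TYPE('a) r"
 obtain K where K: "K > 0" "\<And>s y v. lp r v \<Longrightarrow>
  cmod (LBINT x. (nl \<alpha> (U s (x + y)) - nl \<alpha> (U s x)) * v x) \<le> K * hn (U s) (D s) powr \<alpha> * np r (W y s) * np r v"
  by (rule nl_shift_pairing[OF r a a0], rule that)
 define A where "A = \<bar>lam\<bar> * (K * M powr \<alpha> * C0)"
 have A: "A \<ge> 0" using K C0 by (simp add: A_def)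
 show ?thesis
 \<comment> \<open>A vanishes if lam = 0, whereas \<open>local_Strichartz\<close> divides by the
   constant.\<close>
 proof (rule that[of "A + 1"])
  fix y :: 'a and e t0 t :: real and g :: "'a \<Rightarrow> complex"
  assume e: "e > 0" and t: "0 \<le> t" and g: "sq g" "lp (conj_exp r) g" "np (conj_exp r) g \<le> 1"
   and M: "\<forall>s\<in>{t0..t0 + t}. hn (U s) (D s) \<le> M"
  let ?q = "\<lambda>u. kap e ?a (t - u) * np r (W y (t0 + u))"
  let ?F = "\<lambda>u. Re (LBINT x. W y (t0 + u) x * heat (Complex e (t - u)) g x)"
  let ?F' = "\<lambda>u. - lam * Im (LBINT x. (nl \<alpha> (U (t0 + u) (x + y)) - nl \<alpha> (U (t0 + u) x)) * heat (Complex e (t - u)) g x)"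
  have cq: "continuous_on X ?q" for X
  proof -
   have "continuous_on UNIV (\<lambda>u. np r (W y (t0 + u)))"
    by (rule continuous_on_compose2[OF np_W_continuous[OF less_imp_le[OF r] a]]) (auto intro!: continuous_intros)
   then show ?thesis by (intro continuous_intros kap_continuous e) (rule continuous_on_subset, auto)
  qed
  have F: "(?F has_real_derivative ?F' u) (at u)" for u
  proof -
   have "((\<lambda>u. t0 + u) has_real_derivative 1) (at u)" by (auto intro!: derivative_eq_intros)
   from DERIV_chain2[OF duhamel_shift[OF e g(1), of y "t0 + t" "t0 + u"] this]
   show ?thesis by simp
  qed
  have "?F t \<le> ?F 0 + integral {0..t} (\<lambda>u. A * ?q u)"
  proof (rule derivative_le_integral[OF t _ F])
   show "continuous_on {0..t} (\<lambda>u. A * ?q u)" by (intro continuous_intros cq)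
   fix u assume s: "0 \<le> u" "u \<le> t"
   let ?v = "heat (Complex e (t - u)) g"
   have z: "Re (Complex e (t - u)) > 0" using e by simp
   have v: "lp r ?v" "np r ?v \<le> C0 * kap e ?a (t - u) * np (conj_exp r) g"
    using C0(2)[OF z g(1,2)] by (auto simp: kap_def)
   have v1: "np r ?v \<le> C0 * kap e ?a (t - u)"
   proof -
    have "C0 * kap e ?a (t - u) * np (conj_exp r) g \<le> C0 * kap e ?a (t - u) * 1"
     using C0(1) g(3) by (intro mult_left_mono) auto
    then show ?thesis using v(2) by simp
   qed
   let ?I = "LBINT x. (nl \<alpha> (U (t0 + u) (x + y)) - nl \<alpha> (U (t0 + u) x)) * ?v x"
   have "- lam * Im ?I \<le> \<bar>lam\<bar> * cmod ?I"
   proof -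
    have "- lam * Im ?I \<le> \<bar>lam\<bar> * \<bar>Im ?I\<bar>" unfolding abs_mult[symmetric] by simp
    also have "... \<le> \<bar>lam\<bar> * cmod ?I" by (intro mult_left_mono abs_Im_le_cmod) simp
    finally show ?thesis .
   qed
   also have "... \<le> \<bar>lam\<bar> * (K * M powr \<alpha> * np r (W y (t0 + u)) * (C0 * kap e ?a (t - u)))"
   proof (rule mult_left_mono)
    have "cmod ?I \<le> K * hn (U (t0 + u)) (D (t0 + u)) powr \<alpha> * np r (W y (t0 + u)) * np r ?v" by (rule K(2)[OF v(1)])
    also have "... \<le> K * M powr \<alpha> * np r (W y (t0 + u)) * (C0 * kap e ?a (t - u))"
     using K(1) al bspec[OF M, of "t0 + u"] s by (intro mult_mono v1 powr_mono2) auto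
    finally show "cmod ?I \<le> K * M powr \<alpha> * np r (W y (t0 + u)) * (C0 * kap e ?a (t - u))" .
   qed simp
   also have "... = A * ?q u" by (simp only: A_def mult_ac)
   finally show "?F' u \<le> A * ?q u" .
  qed
  also have "integral {0..t} (\<lambda>u. A * ?q u) = A * integral {0..t} ?q" by simp
  also have "... \<le> (A + 1) * integral {0..t} ?q"
   by (intro mult_right_mono Henstock_Kurzweil_Integration.integral_nonneg integrable_continuous_real cq) auto
  finally show "Re (LBINT x. W y (t0 + t) x * heat (of_real e) g x) \<le> Re (LBINT x. W y t0 x * heat (Complex e t) g x)
   + (A + 1) * integral {0..t} ?q" by (simp add: complex_of_real_def)
 qed (use A in simp)
qed

lemma np_heat_W_continuous:
 assumes r: "r \<ge> 2" "decay TYPE('a) r < 1" and e: "e > 0"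
 shows "continuous_on UNIV (\<lambda>t. np r (heat (of_real e) (W y t)))"
proof (rule np_continuous[OF r h1_heat_commute[OF e W_h1]])
 fix t
 let ?e = "complex_of_real e"
 let ?d = "\<lambda>t b x. D t b (x + y) - D t b x"
 have z: "Re ?e > 0" using e by simp
 have sd: "b \<in> Basis \<Longrightarrow> sq (?d t b)" for t b by (rule h1_sq_d[OF W_h1])
 show "((\<lambda>s. hn (\<lambda>x. heat ?e (W y s) x - heat ?e (W y t) x) (\<lambda>b x. heat ?e (?d s b) x - heat ?e (?d t b) x)) \<longlongrightarrow> 0) (at t)"
 proof (rule tendsto_zero_le[OF W_hn_tendsto always_eventually[OF allI]])
  show "hn (\<lambda>x. heat ?e (W y s) x - heat ?e (W y t) x) (\<lambda>b x. heat ?e (?d s b) x - heat ?e (?d t b) x) \<le>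
   hn (\<lambda>x. W y s x - W y t x) (\<lambda>b x. ?d s b x - ?d t b x)" for s
   using hn_heat_le[OF e h1_diff[OF W_h1 W_h1], of y s y t] heat_diff[OF z W_sq W_sq, of y s y t] heat_diff[OF z sd sd]
   by (simp add: hn_def gr_def)
 qed simp
qed

lemma hn_W_le: "hn (W y t) (\<lambda>b x. D t b (x + y) - D t b x) \<le> 2 * hn (U t) (D t)"
 using hn_diff[OF h1_translate[OF H] H, of t y t] unfolding hn_translate[OF H] W_def[abs_def] by simp

text \<open>Removes the smoothing. Real heat times do not increase the H^1 norm, so the Sobolev
  embedding bounds the integrands uniformly on the time interval.\<close>

lemma heat_W_square_integral_tendsto:
 assumes r: "r > 2" "decay TYPE('a) r < 1"
 shows "(\<lambda>n. integral {0..T} (\<lambda>u. (np r (heat (of_real (inv_nat n)) (W y (t0 + u))))^2)) \<longlonglongrightarrow>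
  integral {0..T} (\<lambda>u. (np r (W y (t0 + u)))^2)"
proof -
 have r2: "r \<ge> 2" using r by simp
 obtain S where S: "S > 0" "\<And>(f :: 'a \<Rightarrow> complex) d. h1 f d \<Longrightarrow> lp r f \<and> np r f \<le> S * hn f d"
  by (rule Sobolev[OF r2 r(2)], rule that)
 obtain M where M: "M > 0" "\<forall>t\<in>{t0..t0 + T}. hn (U t) (D t) \<le> M" using hn_bounded by blast
 let ?w = "\<lambda>u. W y (t0 + u)" and ?d = "\<lambda>u b x. D (t0 + u) b (x + y) - D (t0 + u) b x"
 let ?h = "\<lambda>n. heat (of_real (inv_nat n)) :: ('a \<Rightarrow> complex) \<Rightarrow> 'a \<Rightarrow> complex"
 have lim: "(\<lambda>n. np r (?h n (?w u))) \<longlonglongrightarrow> np r (?w u)" for u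
 proof -
  have hh: "h1 (?h n (?w u)) (\<lambda>b. ?h n (?d u b))" for n by (rule h1_heat_commute[OF inv_nat_pos W_h1])
  have "(\<lambda>n. np r (?h n (?w u)) - np r (?w u)) \<longlonglongrightarrow> 0"
  proof (rule Lim_null_comparison[OF always_eventually[OF allI] tendsto_mult_right_zero[OF hn_heat_tendsto[OF W_h1 inv_nat_pos inv_nat_tendsto], of S]])
   show "norm (np r (?h n (?w u)) - np r (?w u)) \<le> S * hn (\<lambda>x. ?h n (?w u) x - ?w u x) (\<lambda>b x. ?h n (?d u b) x - ?d u b x)" for n
   proof -
    have "\<bar>np r (?h n (?w u)) - np r (?w u)\<bar> \<le> np r (\<lambda>x. ?h n (?w u) x - ?w u x)"
     by (intro np_triangle_diff) (use S(2)[OF hh] S(2)[OF W_h1] r in auto)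
    also have "... \<le> S * hn (\<lambda>x. ?h n (?w u) x - ?w u x) (\<lambda>b x. ?h n (?d u b) x - ?d u b x)"
     using S(2)[OF h1_diff[OF hh W_h1]] by blast
    finally show ?thesis by simp
   qed
  qed
  then show ?thesis by (simp add: LIM_zero_iff)
 qed
 show ?thesis
 proof (rule dominated_convergence(2))
  show "(\<lambda>u. (np r (?h n (?w u)))^2) integrable_on {0..T}" for n
  proof (intro integrable_continuous_real continuous_intros)
   have "continuous_on UNIV (\<lambda>u. np r (?h n (?w u)))"
    by (rule continuous_on_compose2[OF np_heat_W_continuous[OF r2 r(2) inv_nat_pos]]) (auto intro!: continuous_intros)
   then show "continuous_on {0..T} (\<lambda>u. np r (?h n (?w u)))" by (rule continuous_on_subset) simp
  qed
  show "(\<lambda>_. (S * (2 * M))^2) integrable_on {0..T}" by (rule integrable_const_ivl)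
  show "norm ((np r (?h n (?w u)))^2) \<le> (S * (2 * M))^2" if "u \<in> {0..T}" for n u
  proof -
   have "np r (?h n (?w u)) \<le> S * hn (?h n (?w u)) (\<lambda>b. ?h n (?d u b))"
    using S(2)[OF h1_heat_commute[OF inv_nat_pos W_h1]] by blast
   also have "... \<le> S * (2 * M)"
    using order_trans[OF hn_heat_le[OF inv_nat_pos W_h1] hn_W_le, of n y "t0 + u"] bspec[OF M(2), of "t0 + u"] that S(1)
    by (intro mult_left_mono) auto
   finally have "(np r (?h n (?w u)))^2 \<le> (S * (2 * M))^2" by (intro power_mono) auto
   then show ?thesis by simp
  qed
  show "(\<lambda>n. (np r (?h n (?w u)))^2) \<longlonglongrightarrow> (np r (?w u))^2" for u
   by (intro tendsto_intros lim)
 qed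
qed

text \<open>On a short interval the nonlinear terms are absorbed into the left-hand side. Its length
  T and the constant depend on the solution only through M, so the estimate can be iterated.\<close>

lemma local_Strichartz:
 assumes r: "r > 2" and a: "decay TYPE('a) r < 1" and a0: "\<alpha> > 0" "\<alpha> * r / (r - 2) \<ge> 2" "\<alpha> \<le> r - 2"
 obtains T B where "0 < T" "T \<le> 1" "B \<ge> 0" "\<And>y t0. \<forall>s\<in>{t0..t0 + T}. hn (U s) (D s) \<le> M \<Longrightarrow>
  integral {0..T} (\<lambda>t. (np r (W y (t0 + t)))^2) \<le> B * (n2 (W y t0))^2"
proof -
 let ?a = "decay TYPE('a) r"
 have a1: "?a \<ge> 0" using r by (simp add: decay_def)
 obtain C0 where C0: "C0 > 0" "\<And>z (f :: 'a \<Rightarrow> complex). Re z > 0 \<Longrightarrow> sq f \<Longrightarrow> lp (conj_exp r) f \<Longrightarrow>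
   lp r (heat z f) \<and> np r (heat z f) \<le> C0 * cmod z powr (- ?a) * np (conj_exp r) f"
  by (rule dispersive[OF r], rule that)
 obtain A where A: "A > 0" "\<And>y e t0 t g. e > 0 \<Longrightarrow> 0 \<le> t \<Longrightarrow> sq g \<Longrightarrow> lp (conj_exp r) g \<Longrightarrow> np (conj_exp r) g \<le> 1 \<Longrightarrow>
  \<forall>s\<in>{t0..t0 + t}. hn (U s) (D s) \<le> M \<Longrightarrow>
  Re (LBINT x. W y (t0 + t) x * heat (of_real e) g x) \<le> Re (LBINT x. W y t0 x * heat (Complex e t) g x)
   + A * integral {0..t} (\<lambda>u. kap e ?a (t - u) * np r (W y (t0 + u)))"
  by (rule duhamel_inequality[OF r a a0 less_imp_le[OF C0(1)] C0(2)], assumption+, rule that)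
 \<comment> \<open>Solves A c \<le> 1/3 for T, where c = 2 T powr (1 - a) / (1 - a).\<close>
 define T where "T = min 1 (((1 - ?a) / (6 * A)) powr (1 / (1 - ?a)))"
 have T: "T > 0" "T \<le> 1" using a A by (auto simp: T_def)
 define c where "c = 2 * T powr (1 - ?a) / (1 - ?a)"
 have c0: "c \<ge> 0" using a by (simp add: c_def)
 have Ac: "A * c \<le> 1 / 3"
 proof -
  have "T powr (1 - ?a) \<le> (((1 - ?a) / (6 * A)) powr (1 / (1 - ?a))) powr (1 - ?a)"
   using T a unfolding T_def by (intro powr_mono2) auto
  also have "... = (1 - ?a) / (6 * A)" using a A by (simp add: powr_powr)
  finally show ?thesis using a A by (simp add: c_def field_simps)
 qed
 show ?thesis
 proof (rule that[OF T, of "8 * C0 * c"])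
  show "8 * C0 * c \<ge> 0" using C0 c0 by simp
  fix y t0 assume M: "\<forall>s\<in>{t0..t0 + T}. hn (U s) (D s) \<le> M"
  let ?w = "\<lambda>t. W y (t0 + t)"
  define Y where "Y = integral {0..T} (\<lambda>t. (np r (?w t))^2)"
  define E where "E n = integral {0..T} (\<lambda>t. (np r (heat (of_real (inv_nat n)) (?w t)))^2)" for n
  have EY: "E \<longlonglongrightarrow> Y" unfolding E_def[abs_def] Y_def by (rule heat_W_square_integral_tendsto[OF r a])
  have "E n \<le> n2 (W y t0) * sqrt (2 * C0 * c * E n) + A * c / 2 * E n + A * c * Y" for n
  proof -
   obtain S where S: "S > 0" "\<And>(f :: 'a \<Rightarrow> complex) d. h1 f d \<Longrightarrow> lp r f \<and> np r f \<le> S * hn f d"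
    by (rule Sobolev[OF less_imp_le[OF r] a], rule that)
   have "E n \<le> n2 (?w 0) * sqrt (2 * C0 * c * E n) + A * c / 2 * E n + A * c * Y"
    unfolding E_def Y_def c_def
   proof (rule smoothed_Strichartz[OF r a1 a inv_nat_pos T(1) W_sq _ less_imp_le[OF C0(1)] C0(2) less_imp_le[OF A(1)]])
    show "lp r (heat (of_real (inv_nat n)) (?w t))" for t
     using S(2)[OF h1_heat_commute[OF inv_nat_pos W_h1]] by blast
    show "continuous_on UNIV (\<lambda>t. np r (?w t))"
     by (rule continuous_on_compose2[OF np_W_continuous[OF less_imp_le[OF r] a]]) (auto intro!: continuous_intros)
    show "continuous_on UNIV (\<lambda>t. np r (heat (of_real (inv_nat n)) (?w t)))"
     by (rule continuous_on_compose2[OF np_heat_W_continuous[OF less_imp_le[OF r] a inv_nat_pos]]) (auto intro!: continuous_intros)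
    fix t and g :: "'a \<Rightarrow> complex" assume *: "0 \<le> t" "t \<le> T" "sq g" "lp (conj_exp r) g" "np (conj_exp r) g \<le> 1"
    have M': "\<forall>s\<in>{t0..t0 + t}. hn (U s) (D s) \<le> M" using M *(2) by auto
    show "Re (LBINT x. ?w t x * heat (of_real (inv_nat n)) g x) \<le> Re (LBINT x. ?w 0 x * heat (Complex (inv_nat n) t) g x)
      + A * integral {0..t} (\<lambda>u. kap (inv_nat n) ?a (t - u) * np r (?w u))"
     using A(2)[OF inv_nat_pos *(1,3-5) M'] by simp
   qed assumption+
   then show ?thesis by simp
  qed
  moreover have "(\<lambda>n. n2 (W y t0) * sqrt (2 * C0 * c * E n) + A * c / 2 * E n + A * c * Y) \<longlonglongrightarrow>
   n2 (W y t0) * sqrt (2 * C0 * c * Y) + A * c / 2 * Y + A * c * Y"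
   by (intro tendsto_intros EY)
  ultimately have ineq: "Y \<le> n2 (W y t0) * sqrt (2 * C0 * c * Y) + A * c / 2 * Y + A * c * Y"
   by (intro LIMSEQ_le[OF EY]) auto
  have Y0: "Y \<ge> 0" unfolding Y_def
   by (intro Henstock_Kurzweil_Integration.integral_nonneg integrable_continuous_real continuous_intros
    continuous_on_compose2[OF np_W_continuous[OF less_imp_le[OF r] a]]) auto
  \<comment> \<open>After the limit E n has become Y, so the nonlinear terms amount to at most (1/6
    + 1/3) Y = Y / 2.\<close>
  have "A * c * Y \<le> 1 / 3 * Y" by (rule mult_right_mono[OF Ac Y0])
  then have "Y / 2 \<le> n2 (W y t0) * sqrt (2 * C0 * c * Y)" using ineq by (simp add: field_simps)
  then have "(Y / 2)^2 \<le> (n2 (W y t0) * sqrt (2 * C0 * c * Y))^2" using Y0 by (intro power_mono) auto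
  also have "... = (n2 (W y t0))^2 * (2 * C0 * c * Y)" using C0 c0 Y0 by (simp add: power_mult_distrib)
  finally have "Y * Y \<le> (8 * C0 * c * (n2 (W y t0))^2) * Y" by (simp add: power2_eq_square field_simps)
  then have "Y \<le> 8 * C0 * c * (n2 (W y t0))^2"
   using Y0 C0 c0 by (cases "Y = 0") auto
  then show "integral {0..T} (\<lambda>t. (np r (?w t))^2) \<le> 8 * C0 * c * (n2 (W y t0))^2" by (simp only: Y_def)
 qed
qed

text \<open>The point is the factor (norm y)^2: at a fixed time the Sobolev embedding would need
  second derivatives for it. Each short interval starts with the L^2 norm of W, which is at most
  norm y times the gradient.\<close>

lemma Strichartz:
 assumes r: "r > 2" and a: "decay TYPE('a) r < 1" and a0: "\<alpha> > 0" "\<alpha> * r / (r - 2) \<ge> 2" "\<alpha> \<le> r - 2" and T: "T \<ge> 0"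
 obtains B where "B \<ge> 0" "\<And>y. integral {0..T} (\<lambda>t. (np r (W y t))^2) \<le> B * (norm y)^2"
proof -
 \<comment> \<open>The last of the short intervals may extend beyond T, by at most 1.\<close>
 obtain M where M: "M > 0" "\<forall>t\<in>{0..T + 1}. hn (U t) (D t) \<le> M" using hn_bounded by blast
 obtain d B where d: "0 < d" "d \<le> 1" and B: "B \<ge> 0" "\<And>y t0. \<forall>s\<in>{t0..t0 + d}. hn (U s) (D s) \<le> M \<Longrightarrow>
  integral {0..d} (\<lambda>u. (np r (W y (t0 + u)))^2) \<le> B * (n2 (W y t0))^2"
  by (rule local_Strichartz[OF r a a0], rule that)
 define N where "N = nat \<lceil>T / d\<rceil>"
 have N: "T \<le> real N * d" "real N * d \<le> T + 1"
 proof -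
  have "T / d \<le> real N" unfolding N_def by linarith
  then show "T \<le> real N * d" using d by (simp add: field_simps)
  have "real N \<le> T / d + 1" unfolding N_def using T d by simp
  then have "real N * d \<le> T + d" using d by (simp add: field_simps)
  then show "real N * d \<le> T + 1" using d by simp
 qed
 show ?thesis
 proof (rule that[of "real N * (B * M^2)"])
  show "real N * (B * M^2) \<ge> 0" using B by simp
  fix y :: 'a
  let ?f = "\<lambda>t. (np r (W y t))^2"
  have cf: "continuous_on X ?f" for X
   by (intro continuous_intros continuous_on_subset[OF np_W_continuous[OF less_imp_le[OF r] a]]) auto
  have "integral {0..T} ?f \<le> integral {0..real N * d} ?f"
   by (rule integral_subset_le) (use N in \<open>auto intro!: integrable_continuous_real cf\<close>)
  also have "... = (\<Sum>k<N. integral {real k * d..real (Suc k) * d} ?f)"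
   using sum_integral_grid[OF cf, of d N] d by simp
  also have "... \<le> (\<Sum>k<N. B * M^2 * (norm y)^2)"
  proof (rule sum_mono)
   fix k assume "k \<in> {..<N}"
   then have "real (Suc k) * d \<le> real N * d" using d by (intro mult_right_mono) auto
   then have k: "real k * d + d \<le> T + 1" using N(2) by (simp add: algebra_simps)
   have k0: "0 \<le> real k * d" using d by simp
   have "integral {real k * d..real (Suc k) * d} ?f = integral {0..d} (?f \<circ> ((+) (real k * d)))"
    unfolding integral_shift_Icc_real by (simp add: algebra_simps)
   also have "... = integral {0..d} (\<lambda>u. (np r (W y (real k * d + u)))^2)" by (simp add: o_def)
   also have "... \<le> B * (n2 (W y (real k * d)))^2"
    by (rule B(2)) (use M(2) k k0 in auto)
   also have "... \<le> B * (norm y * M)^2"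
   proof (intro mult_left_mono power_mono B)
    have "n2 (W y (real k * d)) \<le> norm y * gr (D (real k * d))"
     unfolding W_def[abs_def] by (rule n2_translate_le[OF H])
    also have "... \<le> norm y * M"
     using gr_le_hn[of "D (real k * d)" "U (real k * d)"] M(2) k k0 d by (intro mult_left_mono) (auto intro: order_trans)
    finally show "n2 (W y (real k * d)) \<le> norm y * M" .
   qed auto
   finally show "integral {real k * d..real (Suc k) * d} ?f \<le> B * M^2 * (norm y)^2" by (simp add: power_mult_distrib mult_ac)
  qed
  also have "... = real N * (B * M^2) * (norm y)^2" by simp
  finally show "integral {0..T} ?f \<le> real N * (B * M^2) * (norm y)^2" .
 qed
qed

end

section \<open>The energy inequality and the gradient bound\<close>

lemma n2_tendsto:
 assumes "(\<lambda>n. n2 (\<lambda>x. F n x - f x)) \<longlonglongrightarrow> 0" "\<And>n. sq (F n)" "sq f"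
 shows "(\<lambda>n::nat. n2 (F n)) \<longlonglongrightarrow> n2 f"
proof -
 have "(\<lambda>n. n2 (F n) - n2 f) \<longlonglongrightarrow> 0"
  by (rule Lim_null_comparison[OF _ assms(1)]) (use n2_triangle_diff[OF assms(2,3)] in simp)
 then show ?thesis by (simp add: LIM_zero_iff)
qed

context nls
begin

lemma U_n2_tendsto:
 assumes "X \<longlonglongrightarrow> t" shows "(\<lambda>n. n2 (\<lambda>x. U (X n) x - U t x)) \<longlonglongrightarrow> 0"
proof -
 have "((\<lambda>s. n2 (\<lambda>x. U s x - U t x)) \<longlongrightarrow> 0) (at t)"
  by (rule tendsto_zero_le[OF C[of t]]) (auto intro!: always_eventually n2_le_hn)
 then have "isCont (\<lambda>s. n2 (\<lambda>x. U s x - U t x)) t" by (simp add: isCont_def n2_def)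
 from isCont_tendsto_compose[OF this assms] show ?thesis by (simp add: n2_def)
qed

lemma W_scaled_n2_tendsto:
 assumes b: "b \<in> Basis"
 shows "(\<lambda>n. (n2 (W (inv_nat n *\<^sub>R b) t))^2 / (inv_nat n)^2) \<longlonglongrightarrow> (n2 (D t b))^2"
proof -
 have "(\<lambda>n. n2 (dq b (inv_nat n) (U t))) \<longlonglongrightarrow> n2 (D t b)"
  by (intro n2_tendsto wd_seq_nat[OF b h1_wd[OF H b]] sq_dq U_sq D_sq b)
 moreover have "(n2 (W (inv_nat n *\<^sub>R b) t))^2 / (inv_nat n)^2 = (n2 (dq b (inv_nat n) (U t)))^2" for n
 proof -
  have "W (inv_nat n *\<^sub>R b) t = (\<lambda>x. of_real (inv_nat n) * dq b (inv_nat n) (U t) x)"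
   by (auto simp: W_def dq_def fun_eq_iff)
  then show ?thesis by (simp add: n2_cmult power_mult_distrib)
 qed
 ultimately show ?thesis by (auto intro: tendsto_intros)
qed

text \<open>For \<alpha> = 0 the equation is linear: the nonlinear term of
  \<open>shift_derivative\<close> is the imaginary part of a squared norm, so every shift norm is
  constant.\<close>

lemma gradient_conserved:
 assumes "\<alpha> = 0" shows "gr (D t) = gr (D 0)"
proof -
 have nl: "nl \<alpha> z = z" for z by (cases "z = 0") (auto simp: nl_def assms)
 have "(n2 (W y t))^2 = (n2 (W y 0))^2" for y
 proof (rule DERIV_isconst_all[of "\<lambda>t. (n2 (W y t))^2"], rule allI)
  fix t
  have "(LBINT x. (nl \<alpha> (U t (x + y)) - nl \<alpha> (U t x)) * cnj (W y t x)) = of_real ((n2 (W y t))^2)"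
   unfolding n2_square_cnj nl W_def ..
  then show "((\<lambda>t. (n2 (W y t))^2) has_real_derivative 0) (at t)"
   using shift_derivative[of y t] by (simp del: of_real_power)
 qed
 then have "(n2 (D t b))^2 = (n2 (D 0 b))^2" if "b \<in> Basis" for b
  using LIMSEQ_unique[OF W_scaled_n2_tendsto[OF that, of t]] W_scaled_n2_tendsto[OF that, of 0] by simp
 then have "n2 (D t b) = n2 (D 0 b)" if "b \<in> Basis" for b
  using that by (simp add: power2_eq_iff_nonneg)
 then show ?thesis unfolding gr_def by simp
qed

text \<open>Continuity in time makes the truncated flux integrable over bounded intervals; G
  preserves L^2 convergence because it is Lipschitz.\<close>

lemma shifted_truncation_continuous:
 assumes L: "L \<ge> 0" "G 0 = 0" "\<And>a b. cmod (G a - G b) \<le> L * cmod (a - b)"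
  and m: "G \<in> borel_measurable borel"
 shows "sq (\<lambda>x. G (U t (x + y)) - G (U t x))"
  and "continuous_on UNIV (\<lambda>t. LBINT x. (G (U t (x + y)) - G (U t x)) * cnj (W y t x))"
proof -
 note [measurable] = m
 have sG: "sq (\<lambda>x. G (U t x))" for t
 proof (rule sq_bound(1)[OF U_sq])
  show "norm (G (U t x)) \<le> L * norm (U t x)" for x using L(3)[of "U t x" 0] L(2) by simp
 qed (use L in auto)
 show s: "sq (\<lambda>x. G (U t (x + y)) - G (U t x))" for t by (intro sq_diff sq_translate[OF sG] sG)
 show "continuous_on UNIV (\<lambda>t. LBINT x. (G (U t (x + y)) - G (U t x)) * cnj (W y t x))"
  unfolding continuous_on_sequentially o_def
 proof (intro allI ballI impI)
  fix X and t :: real assume "(\<forall>n. X n \<in> UNIV) \<and> X \<longlonglongrightarrow> t"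
  then have X: "X \<longlonglongrightarrow> t" by simp
  let ?\<delta> = "\<lambda>n x. U (X n) x - U t x"
  let ?g = "\<lambda>n x. G (U (X n) x) - G (U t x)" and ?h = "\<lambda>n x. G (U (X n) (x + y)) - G (U (X n) x) - (G (U t (x + y)) - G (U t x))"
  show "(\<lambda>n. LBINT x. (G (U (X n) (x + y)) - G (U (X n) x)) * cnj (W y (X n) x)) \<longlonglongrightarrow>
   (LBINT x. (G (U t (x + y)) - G (U t x)) * cnj (W y t x))"
  proof (rule integral_mult_tendsto2[OF _ s s _ sq_cnj[OF W_sq] sq_cnj[OF W_sq]])
   have d: "n2 (?g n) \<le> L * n2 (?\<delta> n)" for n
    by (rule sq_bound(2)[OF U_diff_sq]) (use L in auto)
   have "(?h n) =
     (\<lambda>x. (?g n) (x + y) - (?g n) x)" for n by auto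
   then have "n2 (?h n) \<le> 2 * n2 (?g n)" for n
    using n2_translate_bound[OF sq_diff[OF sG sG]] by simp
   then have "n2 (?h n) \<le> 2 * (L * n2 (?\<delta> n))" for n
    by (rule order_trans) (simp add: d)
   then show "(\<lambda>n. n2 (?h n)) \<longlonglongrightarrow> 0"
    by (intro tendsto_zero_le[OF tendsto_mult_right_zero[OF tendsto_mult_right_zero[OF U_n2_tendsto[OF X], of L], of 2]]) auto
   have "(\<lambda>x. cnj (W y (X n) x) - cnj (W y t x)) = (\<lambda>x. cnj (?\<delta> n (x + y) - ?\<delta> n x))" for n by (auto simp: W_def)
   then have "n2 (\<lambda>x. cnj (W y (X n) x) - cnj (W y t x)) \<le> 2 * n2 (?\<delta> n)" for n
    using n2_translate_bound[OF U_diff_sq] by (simp only: n2_cnj)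
   then show "(\<lambda>n. n2 (\<lambda>x. cnj (W y (X n) x) - cnj (W y t x))) \<longlonglongrightarrow> 0"
    by (intro tendsto_zero_le[OF tendsto_mult_right_zero[OF U_n2_tendsto[OF X], of 2]]) auto
  qed
 qed
qed

text \<open>The truncated nonlinearity \<open>G\<close> differs from the true one by a term that tends to 0 as \<open>M\<close> grows, but only
 when tested against functions controlled by the Strichartz estimate.\<close>

lemma nl_truncation_pairing:
 assumes k: "q > 0" "decay TYPE('a) (\<alpha> + 2 + q) < 1" and a0: "\<alpha> > 0"
 obtains K where "K > 0" "\<And>G L M y t. L \<ge> 0 \<Longrightarrow> G 0 = 0 \<Longrightarrow> \<forall>a b. cmod (G a - G b) \<le> L * cmod (a - b) \<Longrightarrow>
  G \<in> borel_measurable borel \<Longrightarrow> M > 0 \<Longrightarrow>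
  \<forall>a b. cmod ((nl \<alpha> a - G a) - (nl \<alpha> b - G b)) \<le> (\<alpha> + 1) * M powr (- q) * (cmod a + cmod b) powr (\<alpha> + q) * cmod (a - b) \<Longrightarrow>
  \<bar>Im (LBINT x. (nl \<alpha> (U t (x + y)) - nl \<alpha> (U t x)) * cnj (W y t x))
   - Im (LBINT x. (G (U t (x + y)) - G (U t x)) * cnj (W y t x))\<bar>
   \<le> M powr (- q) * K * hn (U t) (D t) powr (\<alpha> + q) * (np (\<alpha> + 2 + q) (W y t))^2"
proof -
 let ?r = "\<alpha> + 2 + q"
 have r: "?r > 2" using a0 k by simp
 have g: "\<alpha> + q > 0" "(\<alpha> + q) * ?r / (?r - 2) \<ge> 2" "\<alpha> + q \<le> ?r - 2" using a0 k by auto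
 obtain K where K: "K > 0" "\<And>(f :: 'a \<Rightarrow> complex) d w v t. h1 f d \<Longrightarrow> lp ?r w \<Longrightarrow> lp ?r v \<Longrightarrow>
  integrable lborel (\<lambda>x. (cmod (f (x + t)) + cmod (f x)) powr (\<alpha> + q) * (cmod (w x) * cmod (v x))) \<and>
  (LBINT x. (cmod (f (x + t)) + cmod (f x)) powr (\<alpha> + q) * (cmod (w x) * cmod (v x))) \<le> K * hn f d powr (\<alpha> + q) * (np ?r w * np ?r v)"
  by (rule weighted_Holder[OF r k(2) g], rule that)
 obtain S where S: "S > 0" "\<And>(f :: 'a \<Rightarrow> complex) d. h1 f d \<Longrightarrow> lp ?r f \<and> np ?r f \<le> S * hn f d"
  by (rule Sobolev[OF less_imp_le[OF r] k(2)], rule that)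
 show ?thesis
 proof (rule that[of "(\<alpha> + 1) * K"])
  show "(\<alpha> + 1) * K > 0" using K(1) a0 by simp
  fix G L M and y :: 'a and t
  assume L: "L \<ge> 0" "G 0 = 0" "\<forall>a b. cmod (G a - G b) \<le> L * cmod (a - b)" and m[measurable]: "G \<in> borel_measurable borel" and M: "M > 0"
   and N: "\<forall>a b. cmod ((nl \<alpha> a - G a) - (nl \<alpha> b - G b)) \<le> (\<alpha> + 1) * M powr (- q) * (cmod a + cmod b) powr (\<alpha> + q) * cmod (a - b)"
  have lW: "lp ?r (W y t)" using S(2)[OF W_h1] by blast
  note kk = K(2)[OF H[of t] lW lp_cnj[OF lW], of y]
  let ?b = "\<lambda>x. (cmod (U t (x + y)) + cmod (U t x)) powr (\<alpha> + q) * (cmod (W y t x) * cmod (cnj (W y t x)))"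
  let ?g = "\<lambda>x. (G (U t (x + y)) - G (U t x)) * cnj (W y t x)"
  let ?n = "\<lambda>x. (nl \<alpha> (U t (x + y)) - nl \<alpha> (U t x)) * cnj (W y t x)"
  let ?f = "\<lambda>x. ((nl \<alpha> (U t (x + y)) - G (U t (x + y))) - (nl \<alpha> (U t x) - G (U t x))) * cnj (W y t x)"
  let ?c = "(\<alpha> + 1) * M powr (- q)"
  have c: "?c \<ge> 0" using al by simp
  note [measurable] = W_sq[of y t]
  have i: "integrable lborel (\<lambda>x. ?c * ?b x)" using kk by (intro integrable_mult_right) blast
  have le: "norm (?f x) \<le> ?c * ?b x" for x
   using mult_right_mono[OF N[rule_format, of "U t (x + y)" "U t x"] norm_ge_zero[of "cnj (W y t x)"]]
   by (simp add: norm_mult W_def mult.assoc)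
  have fi: "integrable lborel ?f" by (rule integrable_dominated[OF i _ le]) measurable
  have gi: "integrable lborel ?g"
   using L by (intro sq_CS(1) shifted_truncation_continuous(1)[of L] sq_cnj W_sq m) auto
  have "?n = (\<lambda>x. ?f x + ?g x)" by (auto simp: algebra_simps)
  then have "(LBINT x. ?n x) = (LBINT x. ?f x) + (LBINT x. ?g x)"
   using Bochner_Integration.integral_add[OF fi gi] by simp
  then have "\<bar>Im (LBINT x. ?n x) - Im (LBINT x. ?g x)\<bar> \<le> cmod (LBINT x. ?f x)"
   using abs_Im_le_cmod[of "\<integral>x. ?f x \<partial>lborel"] by simp
  also have "... \<le> (LBINT x. ?c * ?b x)"
   using integral_norm_bound[of lborel ?f] integral_mono[OF integrable_norm[OF fi] i le] by (rule order_trans)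
  also have "... = ?c * (LBINT x. ?b x)" by (rule integral_mult_right_zero)
  also have "... \<le> ?c * (K * hn (U t) (D t) powr (\<alpha> + q) * (np ?r (W y t) * np ?r (\<lambda>x. cnj (W y t x))))"
   using kk c by (intro mult_left_mono) auto
  also have "... = M powr (- q) * ((\<alpha> + 1) * K) * hn (U t) (D t) powr (\<alpha> + q) * (np ?r (W y t))^2"
   by (simp add: power2_eq_square mult_ac)
  finally show "\<bar>Im (LBINT x. ?n x) - Im (LBINT x. ?g x)\<bar> \<le>
   M powr (- q) * ((\<alpha> + 1) * K) * hn (U t) (D t) powr (\<alpha> + q) * (np ?r (W y t))^2" .
 qed
qed

text \<open>With the nonlinearity truncated, the flux divided by the squared step is a pairing of
  two difference quotients. It converges at each time and is bounded independently of the step,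
  which permits dominated convergence in time.\<close>

lemma truncated_energy_flux:
 assumes L: "L \<ge> 0" "G 0 = 0" "\<And>a b. cmod (G a - G b) \<le> L * cmod (a - b)"
  and G': "\<And>z. (G has_derivative G' z) (at z)" and m: "G \<in> borel_measurable borel" and b: "b \<in> Basis"
 defines "Q \<equiv> \<lambda>n t. Im (LBINT x. (G (U t (x + inv_nat n *\<^sub>R b)) - G (U t x)) * cnj (W (inv_nat n *\<^sub>R b) t x)) / (inv_nat n)^2"
 shows "(\<lambda>n. Q n t) \<longlonglongrightarrow> Im (LBINT x. G' (U t x) (D t b x) * cnj (D t b x))"
  and "\<bar>Q n t\<bar> \<le> L * (n2 (D t b))^2"
proof -
 let ?h = inv_nat
 let ?G = "\<lambda>x. G (U t x)"
 note w = h1_wd[OF H b, of t]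
 note wG = wd_chain[OF b w L(2,3) G']
 have sG: "sq ?G" by (rule wd_sq(1)[OF wG])
 have Qe: "Q n t = Im (LBINT x. dq b (?h n) ?G x * cnj (dq b (?h n) (U t) x))" for n
 proof -
  have "(\<lambda>x. (G (U t (x + ?h n *\<^sub>R b)) - G (U t x)) * cnj (W (?h n *\<^sub>R b) t x)) =
    (\<lambda>x. of_real ((?h n)^2) * (dq b (?h n) ?G x * cnj (dq b (?h n) (U t) x)))"
   by (auto simp: W_def dq_def fun_eq_iff power2_eq_square)
  then have "(LBINT x. (G (U t (x + ?h n *\<^sub>R b)) - G (U t x)) * cnj (W (?h n *\<^sub>R b) t x)) =
    of_real ((?h n)^2) * (LBINT x. dq b (?h n) ?G x * cnj (dq b (?h n) (U t) x))"
   by (simp only: integral_mult_right_zero)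
  then have "Im (LBINT x. (G (U t (x + ?h n *\<^sub>R b)) - G (U t x)) * cnj (W (?h n *\<^sub>R b) t x)) =
    (?h n)^2 * Im (LBINT x. dq b (?h n) ?G x * cnj (dq b (?h n) (U t) x))" by simp
  then show ?thesis by (simp add: Q_def)
 qed
 show "(\<lambda>n. Q n t) \<longlonglongrightarrow> Im (LBINT x. G' (U t x) (D t b x) * cnj (D t b x))"
  unfolding Qe
 proof (intro tendsto_Im integral_mult_tendsto2 wd_seq_nat[OF b wG] sq_dq sG wd_sq(2)[OF wG] sq_cnj U_sq D_sq b)
  have "(\<lambda>x. cnj (dq b (?h n) (U t) x) - cnj (D t b x)) = (\<lambda>x. cnj (dq b (?h n) (U t) x - D t b x))" for n by simp
  then have "n2 (\<lambda>x. cnj (dq b (?h n) (U t) x) - cnj (D t b x)) = n2 (\<lambda>x. dq b (?h n) (U t) x - D t b x)" for n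
   by (simp only: n2_cnj)
  then show "(\<lambda>n. n2 (\<lambda>x. cnj (dq b (?h n) (U t) x) - cnj (D t b x))) \<longlonglongrightarrow> 0"
   using wd_seq_nat[OF b w] by simp
 qed
 have "\<bar>Q n t\<bar> \<le> cmod (LBINT x. dq b (?h n) ?G x * cnj (dq b (?h n) (U t) x))"
  unfolding Qe by (rule abs_Im_le_cmod)
 also have "... \<le> n2 (dq b (?h n) ?G) * n2 (\<lambda>x. cnj (dq b (?h n) (U t) x))"
  by (intro sq_CS(2) sq_dq sG sq_cnj U_sq)
 also have "... \<le> (L * n2 (D t b)) * n2 (D t b)"
 proof (intro mult_mono)
  have "n2 (dq b (?h n) ?G) \<le> L * n2 (dq b (?h n) (U t))"
  proof (rule sq_bound(2)[OF sq_dq[OF U_sq]])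
   show "dq b (?h n) ?G \<in> borel_measurable borel" using sq_dq[OF sG] by (simp add: sq_def)
   show "norm (dq b (?h n) ?G x) \<le> L * norm (dq b (?h n) (U t) x)" for x
    using L(3)[of "U t (x + ?h n *\<^sub>R b)" "U t x"] by (simp add: dq_def norm_divide divide_right_mono)
  qed (rule L)
  also have "... \<le> L * n2 (D t b)" by (intro mult_left_mono wd_dq_bound[OF b w] L)
  finally show "n2 (dq b (?h n) ?G) \<le> L * n2 (D t b)" .
  show "n2 (\<lambda>x. cnj (dq b (?h n) (U t) x)) \<le> n2 (D t b)" using wd_dq_bound[OF b w] by simp
 qed (use L in auto)
 finally show "\<bar>Q n t\<bar> \<le> L * (n2 (D t b))^2" by (simp add: power2_eq_square mult.assoc)
qed

text \<open>Half the sum of scaled shift norms tends to the kinetic energy. Its growth is bounded by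
  the truncated flux, whose limit is a decrease of the truncated potential, and by an error
  controlled through Strichartz. The potential is estimated by the full power and not by its sharp
  multiple 1 / (\<alpha> + 2), as only boundedness is wanted.\<close>

lemma energy_inequality:
 assumes a0: "\<alpha> > 0" and T: "T \<ge> 0"
 shows "(\<Sum>b\<in>Basis. (n2 (D T b))^2) / 2 \<le> (\<Sum>b\<in>Basis. (n2 (D 0 b))^2) / 2 + \<bar>lam\<bar> * (LBINT x. cmod (U 0 x) powr (\<alpha> + 2))"
proof -
 obtain l where k: "l > 0" "decay TYPE('a) (\<alpha> + 2 + l) < 1" "\<alpha> * (\<alpha> + 2 + l) / (\<alpha> + l) \<ge> 2"
  by (rule exponent_exists[OF a0 sub], assumption, rule that)
 define r where "r = \<alpha> + 2 + l"
 have r: "r > 2" "decay TYPE('a) r < 1" and ar: "\<alpha> * r / (r - 2) \<ge> 2" "\<alpha> \<le> r - 2"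
  using k a0 by (auto simp: r_def)
 define I where "I = (LBINT x. cmod (U 0 x) powr (\<alpha> + 2))"
 have Ii: "integrable lborel (\<lambda>x. cmod (U 0 x) powr (\<alpha> + 2))"
 proof -
  have "decay TYPE('a) (\<alpha> + 2) \<le> decay TYPE('a) r"
  proof -
   have "1 / r \<le> 1 / (\<alpha> + 2)" using a0 k by (intro divide_left_mono) (auto simp: r_def)
   then show ?thesis unfolding decay_def by (intro mult_left_mono) auto
  qed
  then have "decay TYPE('a) (\<alpha> + 2) < 1" using r(2) by simp
  moreover have "\<alpha> + 2 \<ge> 2" using a0 by simp
  ultimately obtain S where "S > 0" and S: "\<And>(f :: 'a \<Rightarrow> complex) d. h1 f d \<Longrightarrow> lp (\<alpha> + 2) f \<and> np (\<alpha> + 2) f \<le> S * hn f d"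
   using Sobolev[of "\<alpha> + 2", where 'a='a] by blast
  from S[OF H[of 0]] show ?thesis by (simp add: lp_def)
 qed
 obtain Mh where Mh: "Mh > 0" "\<forall>t\<in>{0..T}. hn (U t) (D t) \<le> Mh" using hn_bounded by blast
 obtain B where B: "B \<ge> 0" "\<And>y. integral {0..T} (\<lambda>t. (np r (W y t))^2) \<le> B * (norm y)^2"
  by (rule Strichartz[OF r a0 ar T], rule that)
 obtain K where K: "K > 0" "\<And>G L M y t. L \<ge> 0 \<Longrightarrow> G 0 = 0 \<Longrightarrow> \<forall>a b. cmod (G a - G b) \<le> L * cmod (a - b) \<Longrightarrow>
  G \<in> borel_measurable borel \<Longrightarrow> M > 0 \<Longrightarrow>
  \<forall>a b. cmod ((nl \<alpha> a - G a) - (nl \<alpha> b - G b)) \<le> (\<alpha> + 1) * M powr (- l) * (cmod a + cmod b) powr (\<alpha> + l) * cmod (a - b) \<Longrightarrow>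
  \<bar>Im (LBINT x. (nl \<alpha> (U t (x + y)) - nl \<alpha> (U t x)) * cnj (W y t x))
   - Im (LBINT x. (G (U t (x + y)) - G (U t x)) * cnj (W y t x))\<bar>
   \<le> M powr (- l) * K * hn (U t) (D t) powr (\<alpha> + l) * (np (\<alpha> + 2 + l) (W y t))^2"
  by (rule nl_truncation_pairing[OF k(1,2) a0], rule that)
 define E where "E t = (\<Sum>b\<in>Basis. (n2 (D t b))^2) / 2" for t
 define c0 where "c0 = K * Mh powr (\<alpha> + l)"
 have c0: "c0 \<ge> 0" using K by (simp add: c0_def)
 \<comment> \<open>For a fixed truncation level M the difference step tends to 0 first; the
   constants B and c0 do not depend on M.\<close>
 have main: "E T \<le> E 0 + \<bar>lam\<bar> * (M powr (- l) * c0 * B * DIM('a) + I)" if M: "M > 0" for M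
 proof -
  obtain G :: "complex \<Rightarrow> complex" and G' and \<Phi> :: "complex \<Rightarrow> real" and L
   where G: "L \<ge> 0" "G 0 = 0" "\<And>a b. cmod (G a - G b) \<le> L * cmod (a - b)"
    "\<And>z. (G has_derivative G' z) (at z)"
    "\<And>a b. cmod ((nl \<alpha> a - G a) - (nl \<alpha> b - G b)) \<le> (\<alpha> + 1) * M powr (- l) * (cmod a + cmod b) powr (\<alpha> + l) * cmod (a - b)"
    "\<And>z. 0 \<le> \<Phi> z" "\<And>z. \<Phi> z \<le> cmod z powr (\<alpha> + 2)" "\<And>z. \<Phi> z \<le> L * (cmod z)^2"
    "\<And>z w. \<bar>\<Phi> w - \<Phi> z - Re (cnj (G z) * (w - z))\<bar> \<le> L * (cmod (w - z))^2"
    "\<And>z. \<exists>m. G z = of_real m * z" "continuous_on UNIV \<Phi>"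
   by (rule truncation_exists[OF a0 k(1) M], rule that)
  have Gm: "G \<in> borel_measurable borel"
   by (intro borel_measurable_continuous_onI continuous_at_imp_continuous_on ballI has_derivative_continuous[OF G(4)])
  define P where "P t = (LBINT x. \<Phi> (U t x))" for t
  define J where "J t = (\<Sum>b\<in>Basis. Im (LBINT x. G' (U t x) (D t b x) * cnj (D t b x)))" for t
  have PD: "(P has_real_derivative - J t) (at t)" for t
   unfolding P_def[abs_def] J_def by (rule potential_derivative[OF G(1-4,6,8-11)])
  have "((\<lambda>t. - J t) has_integral (P T - P 0)) {0..T}"
   by (rule fundamental_theorem_of_calculus[OF T])
    (use PD in \<open>auto simp: has_real_derivative_iff_has_vector_derivative[symmetric] intro: has_field_derivative_at_within\<close>)
  from has_integral_neg[OF this] have Jint: "integral {0..T} J = P 0 - P T" by (simp add: integral_unique)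
  have P0: "P 0 \<le> I" unfolding P_def I_def
   by (rule integral_mono'[OF Ii]) (use G(6,7) in auto)
  \<comment> \<open>For lam \<le> 0 the final potential energy has a favourable sign and is dropped,
    which leaves an inequality.\<close>
  have PT: "P T \<ge> 0" unfolding P_def using G(6) by (intro Bochner_Integration.integral_nonneg) auto
  let ?y = "\<lambda>n b. inv_nat n *\<^sub>R (b::'a)"
  let ?I = "\<lambda>n b t. Im (LBINT x. (nl \<alpha> (U t (x + ?y n b)) - nl \<alpha> (U t x)) * cnj (W (?y n b) t x))"
  let ?Q = "\<lambda>n b t. Im (LBINT x. (G (U t (x + ?y n b)) - G (U t x)) * cnj (W (?y n b) t x))"
  define N where "N n t = (\<Sum>b\<in>Basis. (n2 (W (?y n b) t))^2 / (inv_nat n)^2) / 2" for n t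
  define Jn where "Jn n t = (\<Sum>b\<in>Basis. ?Q n b t / (inv_nat n)^2)" for n t
  define c where "c = M powr (- l) * c0"
  have c: "c \<ge> 0" using c0 by (simp add: c_def)
  have cJ: "continuous_on X (Jn n)" for X n
  proof -
   have "continuous_on X (?Q n b)" for b
   proof (intro continuous_on_Im)
    show "continuous_on X (\<lambda>t. LBINT x. (G (U t (x + ?y n b)) - G (U t x)) * cnj (W (?y n b) t x))"
     by (rule continuous_on_subset[OF shifted_truncation_continuous(2)[OF G(1-3) Gm] subset_UNIV])
   qed
   then show ?thesis unfolding Jn_def[abs_def] by (intro continuous_on_sum continuous_on_divide continuous_on_const) auto
  qed
  \<comment> \<open>The shifts are the steps along the basis vectors. Strichartz yields the square
    of the step, which cancels the scaling, so the error is uniform in n.\<close>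
  have step: "N n T \<le> N n 0 + \<bar>lam\<bar> * (c * B * DIM('a) + integral {0..T} (Jn n))" for n
  proof -
   let ?h = "inv_nat n"
   let ?p = "\<lambda>b t. c * (np r (W (?y n b) t))^2 / ?h^2"
   let ?q = "\<lambda>t. \<bar>lam\<bar> * ((\<Sum>b\<in>Basis. ?p b t) + Jn n t)"
   have cp: "continuous_on X (?p b)" for X b
    by (intro continuous_intros continuous_on_subset[OF np_W_continuous[OF less_imp_le[OF r(1)] r(2)]]) auto
   have ND: "(N n has_real_derivative (\<Sum>b\<in>Basis. (- 2 * lam * ?I n b t) / ?h^2) / 2) (at t)" for t
    unfolding N_def[abs_def] by (intro DERIV_cdivide DERIV_sum shift_derivative)
   have "N n T \<le> N n 0 + integral {0..T} ?q"
   proof (rule derivative_le_integral[OF T _ ND])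
    show "continuous_on {0..T} ?q" by (intro continuous_intros cp cJ)
    fix t assume t: "0 \<le> t" "t \<le> T"
    have "(- 2 * lam * ?I n b t) / ?h^2 \<le> 2 * (\<bar>lam\<bar> * (?p b t + ?Q n b t / ?h^2))" if "b \<in> Basis" for b
    proof -
     have "\<bar>?I n b t - ?Q n b t\<bar> \<le> M powr (- l) * K * hn (U t) (D t) powr (\<alpha> + l) * (np (\<alpha> + 2 + l) (W (?y n b) t))^2"
      by (rule K(2)[OF G(1,2) _ Gm M]) (use G(3,5) in auto)
     also have "... \<le> M powr (- l) * K * Mh powr (\<alpha> + l) * (np (\<alpha> + 2 + l) (W (?y n b) t))^2"
      using Mh t K(1) a0 k(1) by (intro mult_right_mono mult_left_mono powr_mono2) auto
     also have "... = c * (np r (W (?y n b) t))^2" by (simp add: c_def c0_def r_def mult.assoc)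
     finally have "?I n b t \<le> c * (np r (W (?y n b) t))^2 + ?Q n b t" by linarith
     from mult_left_mono[OF this, of "\<bar>lam\<bar>"]
     have "\<bar>lam\<bar> * ?I n b t / ?h^2 \<le> \<bar>lam\<bar> * (c * (np r (W (?y n b) t))^2 + ?Q n b t) / ?h^2"
      by (intro divide_right_mono) auto
     moreover have "(- 2 * lam * ?I n b t) / ?h^2 = 2 * (\<bar>lam\<bar> * ?I n b t / ?h^2)" using lam by simp
     moreover have "\<bar>lam\<bar> * (?p b t + ?Q n b t / ?h^2) = \<bar>lam\<bar> * (c * (np r (W (?y n b) t))^2 + ?Q n b t) / ?h^2"
      by (simp add: add_divide_distrib distrib_left)
     ultimately show ?thesis by linarith
    qed
    then have "(\<Sum>b\<in>Basis. (- 2 * lam * ?I n b t) / ?h^2) \<le> (\<Sum>b\<in>Basis. 2 * (\<bar>lam\<bar> * (?p b t + ?Q n b t / ?h^2)))"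
     by (intro sum_mono)
    also have "... = 2 * ?q t" unfolding Jn_def by (simp only: sum_distrib_left[symmetric] sum.distrib)
    finally show "(\<Sum>b\<in>Basis. (- 2 * lam * ?I n b t) / ?h^2) / 2 \<le> ?q t" by simp
   qed
   also have "integral {0..T} ?q = \<bar>lam\<bar> * (integral {0..T} (\<lambda>t. \<Sum>b\<in>Basis. ?p b t) + integral {0..T} (Jn n))"
   proof -
    have "integral {0..T} (\<lambda>t. (\<Sum>b\<in>Basis. ?p b t) + Jn n t) = integral {0..T} (\<lambda>t. \<Sum>b\<in>Basis. ?p b t) + integral {0..T} (Jn n)"
     by (intro Henstock_Kurzweil_Integration.integral_add integrable_continuous_real continuous_on_sum cp cJ)
    then show ?thesis by simp
   qed
   also have "integral {0..T} (\<lambda>t. \<Sum>b\<in>Basis. ?p b t) \<le> c * B * DIM('a)"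
   proof -
    have "integral {0..T} (\<lambda>t. \<Sum>b\<in>Basis. ?p b t) = (\<Sum>b\<in>Basis. integral {0..T} (?p b))"
     by (intro Henstock_Kurzweil_Integration.integral_sum integrable_continuous_real cp) auto
    also have "... \<le> (\<Sum>b\<in>(Basis::'a set). c * B)"
    proof (rule sum_mono)
     fix b :: 'a assume "b \<in> Basis"
     then have nb: "(norm (?y n b))^2 = ?h^2" by simp
     have "integral {0..T} (?p b) = c / ?h^2 * integral {0..T} (\<lambda>t. (np r (W (?y n b) t))^2)"
      unfolding integral_mult_right[symmetric] by simp
     also have "... \<le> c / ?h^2 * (B * ?h^2)" using B(2)[of "?y n b"] c unfolding nb by (intro mult_left_mono) auto
     also have "... = c * B" by simp
     finally show "integral {0..T} (?p b) \<le> c * B" .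
    qed
    finally show ?thesis by (simp add: mult_ac)
   qed
   finally show ?thesis by (simp add: mult_left_mono)
  qed
  have Nlim: "(\<lambda>n. N n t) \<longlonglongrightarrow> E t" for t
   unfolding N_def E_def by (intro tendsto_divide tendsto_sum tendsto_const W_scaled_n2_tendsto) auto
  have Jlim: "(\<lambda>n. integral {0..T} (Jn n)) \<longlonglongrightarrow> integral {0..T} J"
  proof (rule dominated_convergence(2))
   show "Jn n integrable_on {0..T}" for n by (intro integrable_continuous_real cJ)
   show "(\<lambda>_. DIM('a) * (L * Mh^2)) integrable_on {0..T}" by (rule integrable_const_ivl)
   show "norm (Jn n t) \<le> DIM('a) * (L * Mh^2)" if t: "t \<in> {0..T}" for n t
   proof -
    have "norm (Jn n t) \<le> (\<Sum>b\<in>(Basis::'a set). L * Mh^2)"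
     unfolding Jn_def
    proof (rule sum_norm_le)
     fix b :: 'a assume b: "b \<in> Basis"
     have "norm (?Q n b t / (inv_nat n)^2) \<le> L * (n2 (D t b))^2"
      using truncated_energy_flux(2)[OF G(1-4) Gm b] by simp
     also have "... \<le> L * Mh^2"
      using order_trans[OF n2_le_gr[OF b] order_trans[OF gr_le_hn bspec[OF Mh(2) t]]]
      by (intro mult_left_mono power_mono G(1)) auto
     finally show "norm (?Q n b t / (inv_nat n)^2) \<le> L * Mh^2" .
    qed
    then show ?thesis by simp
   qed
   show "(\<lambda>n. Jn n t) \<longlonglongrightarrow> J t" for t
    unfolding Jn_def J_def by (intro tendsto_sum truncated_energy_flux(1)[OF G(1-4) Gm])
  qed
  have "E T \<le> E 0 + \<bar>lam\<bar> * (c * B * DIM('a) + integral {0..T} J)"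
   by (rule LIMSEQ_le[OF Nlim tendsto_add[OF Nlim tendsto_mult_left[OF tendsto_add[OF tendsto_const Jlim]]]]) (use step in auto)
  also have "... \<le> E 0 + \<bar>lam\<bar> * (c * B * DIM('a) + I)"
   using Jint P0 PT by (intro add_left_mono mult_left_mono) auto
  finally show ?thesis by (simp add: c_def)
 qed
 \<comment> \<open>Now the truncation level tends to infinity and the error disappears.\<close>
 have "(\<lambda>n. E 0 + \<bar>lam\<bar> * (real (Suc n) powr (- l) * c0 * B * DIM('a) + I)) \<longlonglongrightarrow> E 0 + \<bar>lam\<bar> * (0 * c0 * B * DIM('a) + I)"
 proof (intro tendsto_intros)
  have "(\<lambda>n. real n powr (- l)) \<longlonglongrightarrow> 0"
   using tendsto_neg_powr[OF _ filterlim_real_sequentially, of "- l"] k(1) by simp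
  then show "(\<lambda>n. real (Suc n) powr (- l)) \<longlonglongrightarrow> 0" by (rule LIMSEQ_Suc)
 qed
 from LIMSEQ_le_const[OF this, of "E T"] have "E T \<le> E 0 + \<bar>lam\<bar> * I"
  using main[of "real (Suc _)"] by auto
 then show ?thesis by (simp add: E_def I_def)
qed

lemma gradient_bounded: "\<exists>K>0. \<forall>t\<ge>0. gr (D t) \<le> K"
proof (cases "\<alpha> = 0")
 case True
 have "gr (D t) \<le> gr (D 0) + 1" for t using gradient_conserved[OF True, of t] by linarith
 then show ?thesis by (intro exI[of _ "gr (D 0) + 1"]) (auto intro: add_nonneg_pos)
next
 case False
 then have a0: "\<alpha> > 0" using al by simp
 define e where "e = (\<Sum>b\<in>Basis. (n2 (D 0 b))^2) / 2 + \<bar>lam\<bar> * (LBINT x. cmod (U 0 x) powr (\<alpha> + 2))"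
 have e: "e \<ge> 0" unfolding e_def by (auto intro!: add_nonneg_nonneg sum_nonneg mult_nonneg_nonneg)
 show ?thesis
 proof (intro exI[of _ "DIM('a) + 2 * e"] conjI allI impI)
  fix t :: real assume t: "t \<ge> 0"
  have "gr (D t) \<le> (\<Sum>b\<in>(Basis::'a set). 1 + (n2 (D t b))^2)"
   unfolding gr_def
  proof (rule sum_mono)
   fix b
   have "2 * n2 (D t b) \<le> 1 + (n2 (D t b))^2" using sum_squares_bound[of 1 "n2 (D t b)"] by simp
   then show "n2 (D t b) \<le> 1 + (n2 (D t b))^2" using n2_nonneg[of "D t b"] by linarith
  qed
  also have "... = DIM('a) + (\<Sum>b\<in>Basis. (n2 (D t b))^2)" by (simp add: sum.distrib)
  also have "... \<le> DIM('a) + 2 * e" using energy_inequality[OF a0 t] by (simp add: e_def)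
  finally show "gr (D t) \<le> DIM('a) + 2 * e" .
 qed (use e in \<open>simp add: add_pos_nonneg\<close>)
qed

end

section \<open>Lower bounds\<close>

lemma exp_inner_scaled:
 assumes c: "c > 0" and R: "R > 0"
 shows "integrable lborel (\<lambda>x::'a::euclidean_space. exp (- c * (x \<bullet> x) / R^2))"
  and "(LBINT (x::'a). exp (- c * (x \<bullet> x) / R^2)) = R ^ DIM('a) * (LBINT (x::'a). exp (- c * (x \<bullet> x)))"
proof -
 show "integrable lborel (\<lambda>x::'a. exp (- c * (x \<bullet> x) / R^2))"
  using integrable_exp_inner[of "c / R^2", where 'a='a] c R by simp
 have "(LBINT (x::'a). exp (- c * (x \<bullet> x) / R^2)) = \<bar>R\<bar> ^ DIM('a) *\<^sub>R (LBINT (x::'a). exp (- c * ((0 + R *\<^sub>R x) \<bullet> (0 + R *\<^sub>R x)) / R^2))"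
  using R by (subst lborel_integral_affine[of _ R 0]) auto
 also have "(\<lambda>x::'a. exp (- c * ((0 + R *\<^sub>R x) \<bullet> (0 + R *\<^sub>R x)) / R^2)) = (\<lambda>x. exp (- c * (x \<bullet> x)))"
  using R by (auto simp: power2_eq_square)
 finally show "(LBINT (x::'a). exp (- c * (x \<bullet> x) / R^2)) = R ^ DIM('a) * (LBINT (x::'a). exp (- c * (x \<bullet> x)))"
  using R by simp
qed

lemma integral_exp_inner_pos:
 assumes c: "c > 0" shows "(LBINT (x::'a::euclidean_space). exp (- c * (x \<bullet> x))) > 0"
proof (rule ccontr)
 assume n: "\<not> ?thesis"
 have i: "integrable lborel (\<lambda>x::'a. exp (- c * (x \<bullet> x)))" by (rule integrable_exp_inner[OF c])
 have "(LBINT (x::'a). exp (- c * (x \<bullet> x))) \<ge> 0" by (intro Bochner_Integration.integral_nonneg) auto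
 with n have "(LBINT (x::'a). exp (- c * (x \<bullet> x))) = 0" by linarith
 then have "AE x::'a in lborel. exp (- c * (x \<bullet> x)) = 0"
  using integral_nonneg_eq_0_iff_AE[OF i] by simp
 then have "AE x::'a in lborel. False" by simp
 then have "emeasure (lborel :: 'a measure) (space lborel) = 0" by (auto simp: AE_iff_null null_sets_def)
 then show False by simp
qed

lemma mult_exp_square_le: "s * exp (- s\<^sup>2 / 2) \<le> (1::real)"
proof -
 have "s \<le> 1 + s^2 / 2" using sum_squares_bound[of 1 s] by simp
 also have "... \<le> exp (s^2 / 2)" by (rule exp_ge_add_one_self)
 finally show ?thesis by (simp add: exp_minus field_simps)
qed

context nls
begin

text \<open>The weight 1 - exp(-|x|^2 / (2 R^2)) is smooth with values in [0, 1], and its partial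
  derivatives are at most 1 / R because s exp(-s^2 / 2) \<le> 1.\<close>

lemma mass_outside_growth:
 assumes K: "\<forall>t\<ge>0. gr (D t) \<le> K" and R: "R > 0" and T: "T \<ge> 0"
 shows "(LBINT x. (1 - exp (- (x \<bullet> x) / (2 * R^2))) * (cmod (U T x))^2) \<le>
  (LBINT x. (1 - exp (- (x \<bullet> x) / (2 * R^2))) * (cmod (U 0 x))^2) + 2 / R * K * n2 (U 0) * T"
proof -
 let ?p = "\<lambda>x::'a. 1 - exp (- (x \<bullet> x) / (2 * R^2))"
 let ?p' = "\<lambda>b x::'a. (x \<bullet> b) / R^2 * exp (- (x \<bullet> x) / (2 * R^2))"
 let ?P = "\<lambda>s. LBINT x. ?p x * (cmod (U s x))^2"
 have d: "((\<lambda>s. ?p (x + s *\<^sub>R b)) has_vector_derivative ?p' b (x + s *\<^sub>R b)) (at s)" if b: "b \<in> Basis" for b x s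
 proof -
  have e: "(x + s *\<^sub>R b) \<bullet> (x + s *\<^sub>R b) = x \<bullet> x + 2 * s * (x \<bullet> b) + s^2" for s
   using b by (simp add: inner_simps inner_commute power2_eq_square)
  have e2: "(x + s *\<^sub>R b) \<bullet> b = x \<bullet> b + s" using b by (simp add: inner_simps)
  have "((\<lambda>s. 1 - exp (- (x \<bullet> x + 2 * s * (x \<bullet> b) + s^2) / (2 * R^2))) has_real_derivative
   (x \<bullet> b + s) / R^2 * exp (- (x \<bullet> x + 2 * s * (x \<bullet> b) + s^2) / (2 * R^2))) (at s)"
   using R by (auto intro!: derivative_eq_intros simp: field_simps)
  then show ?thesis unfolding e e2 by (simp add: has_real_derivative_iff_has_vector_derivative)
 qed
 have b1: "\<bar>?p x\<bar> \<le> 1" for x using R by simp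
 have b2: "\<bar>?p' b x\<bar> \<le> 1 / R" if b: "b \<in> Basis" for b x
 proof -
  have "\<bar>?p' b x\<bar> = \<bar>x \<bullet> b\<bar> / R^2 * exp (- (x \<bullet> x) / (2 * R^2))" by (simp add: abs_mult)
  also have "... \<le> norm x / R^2 * exp (- (x \<bullet> x) / (2 * R^2))"
   by (intro mult_right_mono divide_right_mono Basis_le_norm b) auto
  also have "... = 1 / R * (norm x / R * exp (- (norm x / R)\<^sup>2 / 2))"
   using R by (simp add: power2_norm_eq_inner power_divide power2_eq_square[of R] mult.commute)
  also have "... \<le> 1 / R * 1" using R by (intro mult_left_mono mult_exp_square_le) auto
  finally show ?thesis by simp
 qed
 have "\<exists>Q. (?P has_real_derivative Q) (at t) \<and> \<bar>Q\<bar> \<le> 2 * (1 / R) * gr (D t) * n2 (U t)" for t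
 proof -
  have m: "continuous_on UNIV ?p" by (intro continuous_intros) (use R in auto)
  have m': "?p' b \<in> borel_measurable borel" for b by measurable
  show ?thesis by (rule localised_mass_derivative[OF m m' d b1 b2, of t]) blast+
 qed
 then have "\<forall>t. \<exists>Q. (?P has_real_derivative Q) (at t) \<and> \<bar>Q\<bar> \<le> 2 * (1 / R) * gr (D t) * n2 (U t)" ..
 from choice[OF this] obtain Q where "\<forall>t. (?P has_real_derivative Q t) (at t) \<and> \<bar>Q t\<bar> \<le> 2 * (1 / R) * gr (D t) * n2 (U t)" ..
 then have Q: "\<And>t. (?P has_real_derivative Q t) (at t)" "\<And>t. \<bar>Q t\<bar> \<le> 2 * (1 / R) * gr (D t) * n2 (U t)" by blast+
 have "?P T \<le> ?P 0 + integral {0..T} (\<lambda>_. 2 / R * K * n2 (U 0))"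
 proof (rule derivative_le_integral[OF T _ Q(1)])
  fix t assume t: "0 \<le> t" "t \<le> T"
  have "Q t \<le> 2 * (1 / R) * gr (D t) * n2 (U t)" using Q(2)[of t] by simp
  also have "... \<le> 2 * (1 / R) * K * n2 (U t)" using K t R by (intro mult_right_mono mult_left_mono) auto
  finally show "Q t \<le> 2 / R * K * n2 (U 0)" unfolding mass_conservation[of t] by simp
 qed simp
 then show ?thesis using T by (simp add: mult_ac)
qed

text \<open>At time 0 less than a quarter of the mass lies outside once T is large, and up to time T
  at most another quarter can leave.\<close>

lemma mass_concentrated:
 assumes nz: "n2 (U 0) > 0"
 obtains p where "p > 0"
  "\<forall>\<^sub>F T in at_top. (n2 (U 0))^2 / 2 \<le> (LBINT x. exp (- (1/2) * (x \<bullet> x) / (p * T)^2) * (cmod (U T x))^2)"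
proof -
 obtain K where K: "K > 0" "\<forall>t\<ge>0. gr (D t) \<le> K" using gradient_bounded by blast
 let ?m = "n2 (U 0)"
 \<comment> \<open>With R = p T the possible growth 2 / R * K * m * T equals m^2 / 4 for the norm m
   of U 0.\<close>
 define p where "p = 8 * K / ?m"
 have p: "p > 0" using K nz by (simp add: p_def)
 let ?e = "\<lambda>R x::'a. exp (- (x \<bullet> x) / (2 * R^2))"
 have ie: "integrable lborel (\<lambda>x. ?e R x * (cmod (U t x))^2)" for R t
 proof (rule integrable_dominated)
  show "integrable lborel (\<lambda>x. (cmod (U t x))^2)" using U_sq[of t] by (simp add: sq_def)
  show "norm (?e R x * (cmod (U t x))^2) \<le> (cmod (U t x))^2" for x
   by (simp add: mult_left_le_one_le)
 qed measurable
 have split: "(LBINT x. (1 - ?e R x) * (cmod (U t x))^2) = ?m^2 - (LBINT x. ?e R x * (cmod (U t x))^2)" for R t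
 proof -
  have "(LBINT x. (1 - ?e R x) * (cmod (U t x))^2) = (LBINT x. (cmod (U t x))^2 - ?e R x * (cmod (U t x))^2)"
   by (simp add: left_diff_distrib)
  also have "... = (n2 (U t))^2 - (LBINT x. ?e R x * (cmod (U t x))^2)"
   unfolding n2_square using U_sq[of t] ie[of R t] by (intro Bochner_Integration.integral_diff) (auto simp: sq_def)
  finally show ?thesis unfolding mass_conservation[of t] .
 qed
 have "((\<lambda>R. LBINT x. ?e R x * (cmod (U 0 x))^2) \<longlongrightarrow> (LBINT x. (cmod (U 0 x))^2)) at_top"
 proof (rule integral_dominated_convergence_at_top)
  show "integrable lborel (\<lambda>x. (cmod (U 0 x))^2)" using U_sq[of 0] by (simp add: sq_def)
  show "\<forall>\<^sub>F R in at_top. AE x in lborel. norm (?e R x * (cmod (U 0 x))^2) \<le> (cmod (U 0 x))^2"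
   by (intro always_eventually allI AE_I2) (simp add: mult_left_le_one_le)
  show "AE x in lborel. ((\<lambda>R. ?e R x * (cmod (U 0 x))^2) \<longlongrightarrow> (cmod (U 0 x))\<^sup>2) at_top"
  proof (rule AE_I2)
   fix x :: 'a
   have "((\<lambda>R::real. exp (- ((x \<bullet> x) / (2 * R^2))) * (cmod (U 0 x))^2) \<longlongrightarrow> exp (- 0) * (cmod (U 0 x))^2) at_top"
   proof (intro tendsto_intros)
    show "((\<lambda>R::real. (x \<bullet> x) / (2 * R^2)) \<longlongrightarrow> 0) at_top"
     by (intro real_tendsto_divide_at_top[OF tendsto_const] filterlim_tendsto_pos_mult_at_top[OF tendsto_const] filterlim_pow_at_top filterlim_ident) auto
   qed
   then show "((\<lambda>R. ?e R x * (cmod (U 0 x))^2) \<longlongrightarrow> (cmod (U 0 x))\<^sup>2) at_top" by simp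
  qed
 qed measurable
 then have l: "((\<lambda>R. LBINT x. ?e R x * (cmod (U 0 x))^2) \<longlongrightarrow> ?m\<^sup>2) at_top" by (simp add: n2_square)
 have f: "filterlim (\<lambda>T. p * T) at_top at_top"
  by (rule filterlim_tendsto_pos_mult_at_top[OF tendsto_const p filterlim_ident])
 have "\<forall>\<^sub>F T in at_top. ?m^2 * (3/4) < (LBINT x. ?e (p * T) x * (cmod (U 0 x))^2)"
  by (rule order_tendstoD(1)[OF filterlim_compose[OF l f]]) (use nz in simp)
 then have "\<forall>\<^sub>F T in at_top. ?m^2 / 2 \<le> (LBINT x. ?e (p * T) x * (cmod (U T x))^2)"
  using eventually_gt_at_top[of 0]
 proof eventually_elim
  case (elim T)
  have R: "p * T > 0" using p elim by simp
  have "2 / (p * T) * K * ?m * T = ?m^2 / 4"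
   using elim K nz by (simp add: p_def power2_eq_square field_simps)
  then show ?case using mass_outside_growth[OF K(2) R less_imp_le[OF elim(2)]] elim(1) unfolding split by simp
 qed
 then show ?thesis using that[OF p] by simp
qed

text \<open>Hoelder's inequality with exponents r / (r - 2) and r / 2. A Gaussian of width
  proportional to T has norm proportional to T^(N (r - 2) / r) in the former, which is T to twice
  \<open>decay\<close>.\<close>

lemma Lr_lower_bound:
 assumes nz: "n2 (U 0) > 0" and r: "r > 2"
 obtains c where "c > 0" "\<forall>\<^sub>F T in at_top. lp r (U T) \<longrightarrow> c \<le> T powr decay TYPE('a) r * np r (U T)"
proof -
 obtain p where p: "p > 0"
  "\<forall>\<^sub>F T in at_top. (n2 (U 0))^2 / 2 \<le> (LBINT x. exp (- (1/2) * (x \<bullet> x) / (p * T)^2) * (cmod (U T x))^2)"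
  by (rule mass_concentrated[OF nz], rule that)
 let ?q = "r / (r - 2)"
 have pq: "?q > 1" "r / 2 > 1" "1 / ?q + 1 / (r / 2) = 1" using r by (auto simp: field_simps)
 define c0 where "c0 = ?q / 2"
 have c0: "c0 > 0" using pq by (simp add: c0_def)
 let ?N = "real DIM('a)"
 define G where "G = (LBINT (x::'a). exp (- c0 * (x \<bullet> x)))"
 have G: "G > 0" unfolding G_def by (rule integral_exp_inner_pos[OF c0])
 define A where "A = (p powr ?N * G) powr (1 / ?q)"
 have A: "A > 0" using p G by (simp add: A_def)
 define c where "c = sqrt ((n2 (U 0))^2 / 2 / A)"
 have c: "c > 0" using nz A by (simp add: c_def)
 show ?thesis
 proof (rule that[OF c])
  show "\<forall>\<^sub>F T in at_top. lp r (U T) \<longrightarrow> c \<le> T powr decay TYPE('a) r * np r (U T)"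
   using p(2) eventually_gt_at_top[of 0]
  proof eventually_elim
   case (elim T)
   show ?case
   proof
    assume l: "lp r (U T)"
    have R: "p * T > 0" using p elim by simp
    let ?e = "\<lambda>x::'a. exp (- (1/2) * (x \<bullet> x) / (p * T)^2)"
    have eq: "norm (?e x) powr ?q = exp (- c0 * (x \<bullet> x) / (p * T)^2)" for x
     by (simp add: c0_def powr_def)
    have le: "lp ?q ?e" unfolding lp_def eq using exp_inner_scaled(1)[OF c0 R] by simp
    have "np ?q ?e = ((p * T) ^ DIM('a) * G) powr (1 / ?q)"
     unfolding np_def eq exp_inner_scaled(2)[OF c0 R] G_def ..
    also have "... = A * T powr (?N * (1 / ?q))"
    proof -
     have e: "(p * T) ^ DIM('a) * G = (p powr ?N * G) * T powr ?N"
      using p(1) elim(2) by (simp add: powr_realpow power_mult_distrib)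
     show ?thesis unfolding e A_def by (subst powr_mult) (simp_all only: powr_powr)
    qed
    also have "?N * (1 / ?q) = 2 * decay TYPE('a) r" using r by (simp add: decay_def field_simps)
    finally have ne: "np ?q ?e = A * T powr (2 * decay TYPE('a) r)" .
    let ?u = "\<lambda>x. (cmod (U T x))^2"
    have uq: "norm (?u x) powr (r / 2) = norm (U T x) powr r" for x
    proof -
     have e: "norm (?u x) = norm (U T x) powr 2" by simp
     show ?thesis unfolding e powr_powr by simp
    qed
    have lu: "lp (r / 2) ?u" unfolding lp_def uq using l by (simp add: lp_def)
    have nu: "np (r / 2) ?u = (np r (U T))^2"
     unfolding np_def uq by (simp add: power2_eq_square powr_add[symmetric])
    have "(n2 (U 0))^2 / 2 \<le> (LBINT x. ?e x * ?u x)" by (rule elim(1))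
    also have "... \<le> np ?q ?e * np (r / 2) ?u" using lp_Holder(2)[OF pq le lu] by simp
    also have "... = A * (T powr decay TYPE('a) r * np r (U T))^2"
    proof -
     have "T powr (2 * decay TYPE('a) r) = (T powr decay TYPE('a) r)^2"
      by (simp add: power2_eq_square powr_add[symmetric])
     then show ?thesis unfolding ne nu by (simp add: power_mult_distrib)
    qed
    finally have "(n2 (U 0))^2 / 2 / A \<le> (T powr decay TYPE('a) r * np r (U T))^2" using A by (simp add: field_simps)
    then have "c \<le> \<bar>T powr decay TYPE('a) r * np r (U T)\<bar>" unfolding c_def real_sqrt_abs[symmetric] by (rule real_sqrt_le_mono)
    then show "c \<le> T powr decay TYPE('a) r * np r (U T)" by simp
   qed
  qed
 qed
qed

text \<open>Formulated for every essential bound S, so that no real value has to be assigned to the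
  supremum when it is infinite.\<close>

lemma Linf_lower_bound:
 assumes nz: "n2 (U 0) > 0"
 obtains c where "c > 0" "\<forall>\<^sub>F T in at_top. \<forall>S\<ge>0. (AE x in lborel. cmod (U T x) \<le> S) \<longrightarrow> c \<le> T powr (DIM('a) / 2) * S"
proof -
 obtain p where p: "p > 0"
  "\<forall>\<^sub>F T in at_top. (n2 (U 0))^2 / 2 \<le> (LBINT x. exp (- (1/2) * (x \<bullet> x) / (p * T)^2) * (cmod (U T x))^2)"
  by (rule mass_concentrated[OF nz], rule that)
 define G where "G = (LBINT (x::'a). exp (- (1/2) * (x \<bullet> x)))"
 have G: "G > 0" unfolding G_def by (rule integral_exp_inner_pos) simp
 let ?n = "DIM('a)"
 define A where "A = p ^ ?n * G"
 have A: "A > 0" using p G by (simp add: A_def)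
 define c where "c = sqrt ((n2 (U 0))^2 / 2 / A)"
 have c: "c > 0" using nz A by (simp add: c_def)
 show ?thesis
 proof (rule that[OF c])
  show "\<forall>\<^sub>F T in at_top. \<forall>S\<ge>0. (AE x in lborel. cmod (U T x) \<le> S) \<longrightarrow> c \<le> T powr (?n / 2) * S"
   using p(2) eventually_gt_at_top[of 0]
  proof eventually_elim
   case (elim T)
   show ?case
   proof (intro allI impI)
    fix S :: real assume S: "S \<ge> 0" and ae: "AE x in lborel. cmod (U T x) \<le> S"
    have R: "p * T > 0" using p elim by simp
    let ?e = "\<lambda>x::'a. exp (- (1/2) * (x \<bullet> x) / (p * T)^2)"
    have ei: "integrable lborel ?e" by (rule exp_inner_scaled(1)[OF _ R]) simp
    have "(n2 (U 0))^2 / 2 \<le> (LBINT x. ?e x * (cmod (U T x))^2)" by (rule elim(1))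
    also have "... \<le> (LBINT x. ?e x * S^2)"
    proof (rule integral_mono_AE)
     have le: "norm (?e x * (cmod (U T x))^2) \<le> (cmod (U T x))^2" for x by (simp add: mult_left_le_one_le)
     show "integrable lborel (\<lambda>x. ?e x * (cmod (U T x))^2)"
      by (rule integrable_dominated[OF _ _ le]) (use U_sq[of T] in \<open>auto simp: sq_def\<close>)
     show "integrable lborel (\<lambda>x. ?e x * S^2)" by (intro integrable_mult_left ei)
     show "AE x in lborel. ?e x * (cmod (U T x))^2 \<le> ?e x * S^2"
      using ae by eventually_elim (intro mult_left_mono power_mono, auto)
    qed
    also have "... = S^2 * ((p * T) ^ ?n * G)"
     using exp_inner_scaled(2)[OF _ R, of "1/2", where 'a='a] by (simp add: G_def mult.commute)
    also have "... = A * (T powr (?n / 2) * S)^2"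
    proof -
     have "(T powr (?n / 2))^2 = T powr ?n" by (simp add: power2_eq_square powr_add[symmetric])
     then show ?thesis using elim(2) by (simp add: A_def power_mult_distrib powr_realpow mult_ac)
    qed
    finally have "(n2 (U 0))^2 / 2 / A \<le> (T powr (?n / 2) * S)^2" using A by (simp add: field_simps)
    then have "c \<le> \<bar>T powr (?n / 2) * S\<bar>" unfolding c_def real_sqrt_abs[symmetric] by (rule real_sqrt_le_mono)
    then show "c \<le> T powr (?n / 2) * S" using S by simp
   qed
  qed
 qed
qed

end

section \<open>Borel representatives\<close>

text \<open>Lebesgue measurability of f is part of the relation because \<open>Lp_norm\<close> is
  infinite without it.\<close>

definition rep :: "('a::euclidean_space \<Rightarrow> complex) \<Rightarrow> ('a \<Rightarrow> complex) \<Rightarrow> bool" where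
 "rep f g \<longleftrightarrow> f \<in> borel_measurable lebesgue \<and> g \<in> borel_measurable borel \<and> (AE x in lborel. f x = g x)"

lemma rep_exists:
 assumes f: "f \<in> borel_measurable lebesgue" obtains g where "rep f g"
proof -
 have "(\<lambda>x. Re (f x)) \<in> borel_measurable lebesgue" "(\<lambda>x. Im (f x)) \<in> borel_measurable lebesgue"
  using f by measurable
 then obtain a b where a: "a \<in> borel_measurable lborel" "AE x in lborel. Re (f x) = a x"
  and b: "b \<in> borel_measurable lborel" "AE x in lborel. Im (f x) = b x"
  using completion_ex_borel_measurable_real by metis
 have "AE x in lborel. f x = Complex (a x) (b x)"
  using a(2) b(2) by eventually_elim (simp add: complex_eq_iff)
 moreover have "(\<lambda>x. Complex (a x) (b x)) \<in> borel_measurable borel"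
  using a(1) b(1) unfolding borel_measurable_complex_iff by simp
 ultimately show ?thesis using f that by (auto simp: rep_def)
qed

lemma rep_refl: "g \<in> borel_measurable borel \<Longrightarrow> rep g g"
 by (auto simp: rep_def intro!: measurable_completion)

lemma rep_diff: "rep f g \<Longrightarrow> rep f' g' \<Longrightarrow> rep (\<lambda>x. f x - f' x) (\<lambda>x. g x - g' x)"
 unfolding rep_def by (auto elim: eventually_elim2)

lemma rep_nn_integral: "rep f g \<Longrightarrow> (\<integral>\<^sup>+x. F (f x) \<partial>lebesgue) = (\<integral>\<^sup>+x. F (g x) \<partial>lborel)"
 unfolding nn_integral_completion rep_def by (intro nn_integral_cong_AE) (auto elim: eventually_mono)

lemma rep_pairing:
 assumes "rep f g" "rep v w" shows "pairing f v = (LBINT x. g x * w x)"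
proof -
 have m: "(\<lambda>x. g x * w x) \<in> borel_measurable lborel" using assms by (auto simp: rep_def)
 have "pairing f v = (\<integral>x. g x * w x \<partial>lebesgue)"
  unfolding pairing_def
 proof (rule integral_cong_AE)
  show "(\<lambda>x. f x * v x) \<in> borel_measurable lebesgue" using assms by (auto simp: rep_def)
  show "(\<lambda>x. g x * w x) \<in> borel_measurable lebesgue" by (rule measurable_completion[OF m])
  have "AE x in lborel. f x * v x = g x * w x"
   using assms unfolding rep_def by (auto elim: eventually_elim2)
  then show "AE x in lebesgue. f x * v x = g x * w x" by (rule AE_completion)
 qed
 also have "... = (LBINT x. g x * w x)" by (rule integral_completion[OF m])
 finally show ?thesis .
qed

lemma ennpow_ennreal: "x \<ge> 0 \<Longrightarrow> ennpow (ennreal x) a = ennreal (x powr a)"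
 by (simp add: ennpow_def)

lemma Lp_norm_rep:
 assumes "rep f g" "p > 0"
 shows "Lp_norm (ennreal p) f = (if lp p g then ennreal (np p g) else \<infinity>)"
proof -
 have e: "Lp_norm (ennreal p) f = ennpow (\<integral>\<^sup>+x. ennreal (cmod (g x) powr p) \<partial>lborel) (1 / p)"
  using assms rep_nn_integral[OF assms(1), of "\<lambda>z. ennreal (cmod z powr p)"] by (simp add: Lp_norm_def rep_def)
 have m: "g \<in> borel_measurable borel" using assms by (simp add: rep_def)
 show ?thesis
 proof (cases "lp p g")
  case True
  then have "(\<integral>\<^sup>+x. ennreal (cmod (g x) powr p) \<partial>lborel) = ennreal (LBINT x. cmod (g x) powr p)"
   by (intro nn_integral_eq_integral) (auto simp: lp_def)
  then show ?thesis using True e by (simp add: ennpow_ennreal np_def)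
 next
  case False
  then have "(\<integral>\<^sup>+x. ennreal (cmod (g x) powr p) \<partial>lborel) = \<infinity>"
   using m by (auto simp: lp_def integrable_iff_bounded less_top[symmetric])
  then show ?thesis using False e by (simp add: ennpow_def)
 qed
qed

lemma Lp_norm_2_rep: "rep f g \<Longrightarrow> Lp_norm 2 f = (if sq g then ennreal (n2 g) else \<infinity>)"
 using Lp_norm_rep[of f g 2] by simp

lemma rep_has_weak_partial:
 assumes b: "b \<in> Basis" and r: "rep f g" "rep d e" and sg: "sq g"
 shows "has_weak_partial b f d \<longleftrightarrow> wd b g e"
proof -
 have "pairing f (partial_deriv b h) = (LBINT x. g x * partial_deriv b h x)"
  "pairing d h = (LBINT x. e x * h x)" if "test_function h" for h
  using test_function_sq[OF that b] by (auto intro!: rep_pairing r rep_refl simp: sq_def)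
 then show ?thesis
  unfolding has_weak_partial_def wd_def Lp_norm_2_rep[OF r(2)] using sg by auto
qed

lemma has_weak_partial_weak_partial:
 assumes "f \<in> H1" "b \<in> Basis"
 shows "has_weak_partial b f (weak_partial b f)" "weak_partial b f \<in> borel_measurable lebesgue"
proof -
 show h: "has_weak_partial b f (weak_partial b f)"
 proof -
  have "\<exists>g. has_weak_partial b f g" using assms by (simp add: H1_def)
  then show ?thesis unfolding weak_partial_def by (rule someI_ex)
 qed
 show "weak_partial b f \<in> borel_measurable lebesgue"
 proof (rule ccontr)
  assume "weak_partial b f \<notin> borel_measurable lebesgue"
  then have "Lp_norm 2 (weak_partial b f) = \<infinity>" by (simp add: Lp_norm_def)
  then show False using h by (simp add: has_weak_partial_def)
 qed
qed

lemma H1_measurable: "f \<in> H1 \<Longrightarrow> f \<in> borel_measurable lebesgue"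
 by (rule ccontr) (simp add: H1_def Lp_norm_def)

lemma h1_of_H1:
 assumes f: "f \<in> H1" and g: "rep f g" and d: "\<And>b. b \<in> Basis \<Longrightarrow> rep (weak_partial b f) (d b)"
 shows "h1 g d"
 unfolding h1_def
proof
 fix b :: 'a assume b: "b \<in> Basis"
 have "sq g" using f Lp_norm_2_rep[OF g] by (auto simp: H1_def split: if_splits)
 then show "wd b g (d b)" using rep_has_weak_partial[OF b g d[OF b]] has_weak_partial_weak_partial(1)[OF f b] by simp
qed

text \<open>\<open>weak_partial\<close> is an arbitrary choice, so it agrees with the given d only
  almost everywhere, by uniqueness of weak derivatives.\<close>

lemma H1_of_h1:
 assumes h: "h1 g d" and f: "rep f g"
 shows "f \<in> H1" and "b \<in> Basis \<Longrightarrow> rep (weak_partial b f) (d b)"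
proof -
 have sg: "sq g" by (rule h1_sq[OF h])
 have w: "has_weak_partial b f (d b)" if b: "b \<in> Basis" for b
  using rep_has_weak_partial[OF b f rep_refl sg] h1_wd[OF h b] h1_sq_d[OF h b] by (simp add: sq_def)
 show H: "f \<in> H1" using w Lp_norm_2_rep[OF f] sg by (auto simp: H1_def)
 assume b: "b \<in> Basis"
 obtain e where e: "rep (weak_partial b f) e" using rep_exists[OF has_weak_partial_weak_partial(2)[OF H b]] .
 have "wd b g e" using rep_has_weak_partial[OF b f e sg] has_weak_partial_weak_partial(1)[OF H b] by simp
 from wd_unique[OF this h1_wd[OF h b]] have z: "n2 (\<lambda>x. e x - d b x) = 0" .
 have "sq (\<lambda>x. e x - d b x)" using \<open>wd b g e\<close> h1_sq_d[OF h b] by (intro sq_diff) (auto simp: wd_def)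
 from n2_eq_0_AE[OF this z] have "AE x in lborel. e x = d b x" by simp
 then have "AE x in lborel. weak_partial b f x = d b x"
  using e unfolding rep_def by (auto elim: eventually_elim2)
 then show "rep (weak_partial b f) (d b)" using e h1_sq_d[OF h b] by (simp add: rep_def sq_def)
qed

lemma H1_norm_rep:
 assumes h: "h1 g d" and f: "rep f g"
 shows "H1_norm f = ennreal (sqrt ((n2 g)^2 + (\<Sum>b\<in>Basis. (n2 (d b))^2)))"
proof -
 have 1: "Lp_norm 2 f = ennreal (n2 g)" using Lp_norm_2_rep[OF f] h1_sq[OF h] by simp
 have 2: "Lp_norm 2 (weak_partial b f) = ennreal (n2 (d b))" if "b \<in> Basis" for b
  using Lp_norm_2_rep[OF H1_of_h1(2)[OF h f that]] h1_sq_d[OF h that] by simp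
 have "(Lp_norm 2 f)^2 + (\<Sum>b\<in>Basis. (Lp_norm 2 (weak_partial b f))^2) = ennreal ((n2 g)^2 + (\<Sum>b\<in>Basis. (n2 (d b))^2))"
  by (simp add: 1 2 ennreal_power sum_nonneg)
 then show ?thesis
  unfolding H1_norm_def by (simp add: ennpow_ennreal sum_nonneg powr_half_sqrt del: ennreal_plus)
qed

lemma H1_norm_le_hn: "h1 g d \<Longrightarrow> rep f g \<Longrightarrow> H1_norm f \<le> ennreal (hn g d)"
proof -
 assume h: "h1 g d" "rep f g"
 have "sqrt ((n2 g)^2 + (\<Sum>b\<in>Basis. (n2 (d b))^2)) \<le> n2 g + sqrt (\<Sum>b\<in>Basis. (n2 (d b))^2)"
  using sqrt_add_le_add_sqrt[of "(n2 g)^2" "\<Sum>b\<in>Basis. (n2 (d b))^2"] by (simp add: sum_nonneg)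
 also have "sqrt (\<Sum>b\<in>Basis. (n2 (d b))^2) \<le> gr d"
  using L2_set_le_sum[of Basis "\<lambda>b. n2 (d b)"] by (simp add: L2_set_def gr_def)
 finally have "sqrt ((n2 g)^2 + (\<Sum>b\<in>Basis. (n2 (d b))^2)) \<le> n2 g + gr d" by simp
 then show ?thesis unfolding H1_norm_rep[OF h] hn_def by (rule ennreal_leI)
qed

lemma hn_le_H1_norm:
 fixes g :: "'a::euclidean_space \<Rightarrow> complex" and e :: real
 assumes h: "h1 g d" "rep f g" and e: "H1_norm f \<le> ennreal e" "e \<ge> 0"
 shows "hn g d \<le> (1 + DIM('a)) * e"
proof -
 let ?s = "(n2 g)^2 + (\<Sum>b\<in>Basis. (n2 (d b))^2)"
 have s: "sqrt ?s \<le> e" using e unfolding H1_norm_rep[OF h] by simp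
 have "n2 g \<le> sqrt ?s" by (rule real_le_rsqrt) (simp add: sum_nonneg)
 moreover have "n2 (d b) \<le> sqrt ?s" if "b \<in> Basis" for b
  by (rule real_le_rsqrt) (use member_le_sum[OF that, of "\<lambda>b. (n2 (d b))^2"] in \<open>simp add: add_increasing\<close>)
 ultimately have "n2 g \<le> e" "\<And>b. b \<in> Basis \<Longrightarrow> n2 (d b) \<le> e" using s by (auto intro: order_trans)
 then have "n2 g + (\<Sum>b\<in>Basis. n2 (d b)) \<le> e + (\<Sum>b\<in>(Basis::'a set). e)" by (intro add_mono sum_mono)
 then show ?thesis by (simp add: hn_def gr_def algebra_simps)
qed

text \<open>Rescales v into the unit ball of H^1. Homogeneity is assumed for the modulus and
  positive scalars only, since functionals in H^-1 are arbitrary maps here.\<close>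

lemma Hm1_norm_bound:
 assumes e: "Hm1_norm \<Lambda> \<le> ennreal e" "e \<ge> 0" and v: "h1 v dv" and hom: "\<And>c. c > 0 \<Longrightarrow> cmod (\<Lambda> (\<lambda>x. of_real c * v x)) = c * cmod (\<Lambda> v)"
 shows "cmod (\<Lambda> v) \<le> e * hn v dv"
proof (rule field_le_epsilon)
 fix q :: real assume q: "q > 0"
 \<comment> \<open>Positive even when \<open>hn v dv\<close> is 0; the surplus adds at most q to the
   final bound.\<close>
 define k where "k = hn v dv + q / (e + 1)"
 have k: "k > 0" "hn v dv \<le> k" using q e(2) by (auto simp: k_def add_nonneg_pos)
 let ?w = "\<lambda>x. of_real (1 / k) * v x" and ?dw = "\<lambda>b x. of_real (1 / k) * dv b x"
 have w: "h1 ?w ?dw" by (rule h1_cmult[OF v])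
 have "?w \<in> borel_measurable borel" using h1_sq[OF w] by (simp add: sq_def)
 note rw = rep_refl[OF this]
 have "H1_norm ?w \<le> ennreal (hn ?w ?dw)" by (rule H1_norm_le_hn[OF w rw])
 also have "... \<le> ennreal 1" unfolding hn_cmult using k by (intro ennreal_leI) (simp add: norm_divide)
 finally have "?w \<in> {v \<in> H1. H1_norm v \<le> 1}" using H1_of_h1(1)[OF w rw] by simp
 then have "ennreal (cmod (\<Lambda> ?w)) \<le> Hm1_norm \<Lambda>" unfolding Hm1_norm_def by (rule SUP_upper)
 then have "ennreal (cmod (\<Lambda> ?w)) \<le> ennreal e" using e(1) by (rule order_trans)
 then have "1 / k * cmod (\<Lambda> v) \<le> e" unfolding hom[of "1 / k", OF divide_pos_pos[OF zero_less_one k(1)]] using e(2) by simp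
 then have "cmod (\<Lambda> v) \<le> e * k" using k(1) by (simp add: field_simps)
 also have "... = e * hn v dv + q * (e / (e + 1))" using e(2) by (simp add: k_def field_simps)
 also have "... \<le> e * hn v dv + q * 1" using q e(2) by (intro add_left_mono mult_left_mono) auto
 finally show "cmod (\<Lambda> v) \<le> e * hn v dv + q" by simp
qed

text \<open>Translates the abstract notion of solution into the locale. The norms pass over up to
  constants, and the unspecified time derivative is eliminated by means of the equation.\<close>

lemma nls_solution_representative:
 fixes u :: "real \<Rightarrow> 'a::euclidean_space \<Rightarrow> complex"
 assumes lam: "lam \<le> 0" and al: "0 \<le> \<alpha>" and sub: "DIM('a) \<ge> 3 \<longrightarrow> \<alpha> < 4 / (real DIM('a) - 2)"
  and u: "nls_solution lam \<alpha> \<phi> \<infinity> \<infinity> u"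
 obtains U D where "nls lam \<alpha> U D" "\<And>t. rep (u t) (U t)"
proof -
 have UNIV: "time_interval \<infinity> \<infinity> = UNIV" by (auto simp: time_interval_def)
 have uH: "u t \<in> H1" and uc: "((\<lambda>s. H1_norm (\<lambda>x. u s x - u t x)) \<longlongrightarrow> 0) (at t)" for t
  using u unfolding nls_solution_def UNIV by blast+
 from u obtain u' :: "real \<Rightarrow> ('a \<Rightarrow> complex) \<Rightarrow> complex"
  where ud: "\<And>t. ((\<lambda>s. Hm1_norm (\<lambda>v. pairing (\<lambda>x. u s x - u t x) v / of_real (s - t) - u' t v)) \<longlongrightarrow> 0) (at t)"
  and ue: "\<And>t v. v \<in> H1 \<Longrightarrow> \<i> * u' t v + weak_laplacian (u t) v + of_real lam * pairing (nonlinearity \<alpha> (u t)) v = 0"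
  unfolding nls_solution_def UNIV by blast
 have "\<exists>g. rep (u t) g" for t using rep_exists[OF H1_measurable[OF uH]] by blast
 then have "\<forall>t. \<exists>g. rep (u t) g" ..
 from choice[OF this] obtain U where U: "\<And>t. rep (u t) (U t)" by blast
 define D where "D t b = (SOME g. rep (weak_partial b (u t)) g)" for t b
 have D: "rep (weak_partial b (u t)) (D t b)" if b: "b \<in> Basis" for t b
 proof -
  have "\<exists>g. rep (weak_partial b (u t)) g"
   using rep_exists[OF has_weak_partial_weak_partial(2)[OF uH b]] by blast
  then show ?thesis unfolding D_def by (rule someI_ex)
 qed
 have H: "h1 (U t) (D t)" for t by (rule h1_of_H1[OF uH U D])
 have hd: "h1 (\<lambda>x. U s x - U t x) (\<lambda>b x. D s b x - D t b x)" for s t by (rule h1_diff[OF H H])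
 let ?Q = "\<lambda>s t v. pairing (\<lambda>x. u s x - u t x) v / of_real (s - t) - u' t v"
 have rd: "rep (\<lambda>x. u s x - u t x) (\<lambda>x. U s x - U t x)" for s t by (rule rep_diff[OF U U])
 define \<Lambda> where "\<Lambda> t v dv = \<i> * (- (\<Sum>b\<in>Basis. LBINT x. D t b x * dv b x) + of_real lam * (LBINT x. nl \<alpha> (U t x) * v x))"
  for t and v :: "'a \<Rightarrow> complex" and dv
 have nlm: "nl \<alpha> \<in> borel_measurable borel" by (rule borel_measurable_continuous_onI[OF nl_continuous[OF al]])
 \<comment> \<open>The equation determines the time derivative on H^1 uniquely, so linearity need
   not be assumed of \<open>u'\<close>.\<close>
 have u'\<Lambda>: "u' t v = \<Lambda> t v dv" if v: "h1 v dv" for t v dv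
 proof -
  have "v \<in> borel_measurable borel" using h1_sq[OF v] by (simp add: sq_def)
  note rv = rep_refl[OF this]
  have rn: "rep (nonlinearity \<alpha> (u t)) (\<lambda>x. nl \<alpha> (U t x))"
  proof -
   have e: "nonlinearity \<alpha> (u t) = (\<lambda>x. nl \<alpha> (u t x))" by (simp add: nonlinearity_def nl_def fun_eq_iff)
   show ?thesis unfolding e rep_def
   proof (intro conjI)
    show "(\<lambda>x. nl \<alpha> (u t x)) \<in> borel_measurable lebesgue" by (rule measurable_compose[OF H1_measurable[OF uH] nlm])
    show "(\<lambda>x. nl \<alpha> (U t x)) \<in> borel_measurable borel" using U[of t] nlm unfolding rep_def by (auto intro: measurable_compose)
    show "AE x in lborel. nl \<alpha> (u t x) = nl \<alpha> (U t x)" using U[of t] unfolding rep_def by (auto elim: eventually_mono)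
   qed
  qed
  have wl: "weak_laplacian (u t) v = - (\<Sum>b\<in>Basis. LBINT x. D t b x * dv b x)"
   unfolding weak_laplacian_def using rep_pairing[OF D H1_of_h1(2)[OF v rv]] by simp
  have eq: "\<i> * u' t v + (- (\<Sum>b\<in>Basis. LBINT x. D t b x * dv b x) + of_real lam * (LBINT x. nl \<alpha> (U t x) * v x)) = 0"
   using ue[OF H1_of_h1(1)[OF v rv], of t] unfolding rep_pairing[OF rn rv] wl by (simp only: add.assoc)
  have alg: "\<i> * p + q = 0 \<Longrightarrow> p = \<i> * q" for p q :: complex
   by (auto simp: complex_eq_iff)
  show ?thesis unfolding \<Lambda>_def by (rule alg[OF eq])
 qed
 have \<Lambda>_cmult: "\<Lambda> t (\<lambda>x. c * v x) (\<lambda>b x. c * dv b x) = c * \<Lambda> t v dv" for t c v dv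
 proof -
  have "(LBINT x. f x * (c * g x)) = c * (LBINT x. f x * g x)" for f g :: "'a \<Rightarrow> complex"
   by (simp only: mult.left_commute[of _ c] integral_mult_right_zero)
  then show ?thesis unfolding \<Lambda>_def by (simp add: sum_distrib_left algebra_simps)
 qed
 have pair: "pairing (\<lambda>x. u s x - u t x) v = (LBINT x. (U s x - U t x) * v x)" if v: "h1 v dv" for s t v dv
 proof -
  have "v \<in> borel_measurable borel" using h1_sq[OF v] by (simp add: sq_def)
  from rep_pairing[OF rd rep_refl[OF this]] show ?thesis .
 qed
 have Hbound: "cmod ((LBINT x. (U s x - U t x) * v x) / of_real (s - t) - \<Lambda> t v dv) \<le> e * hn v dv"
  if e: "Hm1_norm (?Q s t) \<le> ennreal e" "e \<ge> 0" and v: "h1 v dv" for s t v dv e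
 proof -
  have eq: "?Q s t v = (LBINT x. (U s x - U t x) * v x) / of_real (s - t) - \<Lambda> t v dv"
   if "h1 v dv" for v dv unfolding pair[OF that] u'\<Lambda>[OF that] ..
  have "cmod (?Q s t v) \<le> e * hn v dv"
  proof (rule Hm1_norm_bound[OF e v])
   fix c :: real assume c: "c > 0"
   have "(LBINT x. (U s x - U t x) * (of_real c * v x)) = of_real c * (LBINT x. (U s x - U t x) * v x)"
    by (simp only: mult.left_commute[of _ "of_real c"] integral_mult_right_zero)
   then show "cmod (pairing (\<lambda>x. u s x - u t x) (\<lambda>x. of_real c * v x) / of_real (s - t) - u' t (\<lambda>x. of_real c * v x)) =
    c * cmod (?Q s t v)"
    unfolding eq[OF h1_cmult[OF v, of "of_real c"]] eq[OF v] \<Lambda>_cmult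
    using c by (simp add: norm_mult flip: right_diff_distrib times_divide_eq_right)
  qed
  then show ?thesis unfolding eq[OF v] .
 qed
 have "nls lam \<alpha> U D"
 proof
  show "lam \<le> 0" "0 \<le> \<alpha>" by fact+
  show "\<alpha> < 4 / (real DIM('a) - 2)" if "3 \<le> DIM('a)" using sub that by blast
  show "h1 (U t) (D t)" for t by (rule H)
  show "((\<lambda>s. hn (\<lambda>x. U s x - U t x) (\<lambda>b x. D s b x - D t b x)) \<longlongrightarrow> 0) (at t)" for t
  proof (rule tendstoI)
   fix \<epsilon> :: real assume \<epsilon>: "\<epsilon> > 0"
   define N where "N = 1 + real DIM('a)"
   define e where "e = \<epsilon> / (2 * N)"
   have N: "N > 0" by (simp add: N_def)
   have e: "e > 0" using \<epsilon> N by (simp add: e_def)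
   have "\<forall>\<^sub>F s in at t. H1_norm (\<lambda>x. u s x - u t x) < ennreal e" using order_tendstoD(2)[OF uc[of t]] e by simp
   then show "\<forall>\<^sub>F s in at t. dist (hn (\<lambda>x. U s x - U t x) (\<lambda>b x. D s b x - D t b x)) 0 < \<epsilon>"
   proof eventually_elim
    case (elim s)
    have "hn (\<lambda>x. U s x - U t x) (\<lambda>b x. D s b x - D t b x) \<le> N * e"
     using hn_le_H1_norm[OF hd rd less_imp_le[OF elim] less_imp_le[OF e]] by (simp add: N_def)
    also have "... = \<epsilon> / 2" using N by (simp add: e_def)
    finally show ?case using \<epsilon> by simp
   qed
  qed
  show "((\<lambda>s. (LBINT x. (U s x - U t x) * v x) / of_real (s - t)) \<longlongrightarrow>
   \<i> * (- (\<Sum>b\<in>Basis. LBINT x. D t b x * dv b x) + of_real lam * (LBINT x. nl \<alpha> (U t x) * v x))) (at t)"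
   if v: "h1 v dv" for v dv t
   unfolding \<Lambda>_def[symmetric]
  proof (rule tendstoI)
   fix \<epsilon> :: real assume \<epsilon>: "\<epsilon> > 0"
   define e where "e = \<epsilon> / (hn v dv + 1)"
   have e: "e > 0" "e * hn v dv < \<epsilon>"
   proof -
    show "e > 0" using \<epsilon> by (simp add: e_def add_nonneg_pos)
    then have "e * hn v dv < e * (hn v dv + 1)" by simp
    also have "... = \<epsilon>" using hn_nonneg[of v dv] by (simp add: e_def add_nonneg_eq_0_iff)
    finally show "e * hn v dv < \<epsilon>" .
   qed
   have "\<forall>\<^sub>F s in at t. Hm1_norm (?Q s t) < ennreal e"
    using order_tendstoD(2)[OF ud[of t]] e by simp
   then show "\<forall>\<^sub>F s in at t. dist ((LBINT x. (U s x - U t x) * v x) / of_real (s - t)) (\<Lambda> t v dv) < \<epsilon>"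
   proof eventually_elim
    case (elim s)
    then show ?case using Hbound[OF less_imp_le[OF elim] less_imp_le[OF e(1)] v] e(2) unfolding dist_norm by linarith
   qed
  qed
  show "\<exists>C. \<forall>\<^sub>F s in at t. \<forall>v dv. h1 v dv \<longrightarrow> cmod (LBINT x. (U s x - U t x) * v x) \<le> C * \<bar>s - t\<bar> * hn v dv" for t
  proof -
   have ev: "\<forall>\<^sub>F s in at t. Hm1_norm (?Q s t) < ennreal 1"
    using order_tendstoD(2)[OF ud[of t]] by simp
   then have "\<exists>s. Hm1_norm (?Q s t) < ennreal 1"
    by (rule eventually_happens'[OF at_neq_bot])
   then obtain s0 where s0: "Hm1_norm (?Q s0 t) < ennreal 1" ..
   \<comment> \<open>Boundedness of \<open>\<Lambda>\<close> on H^1 follows without estimating the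
     nonlinearity: at one time s0 the difference quotient, which is in L^2, is within 1 of it in
     H^-1.\<close>
   define K where "K = n2 (\<lambda>x. U s0 x - U t x) / \<bar>s0 - t\<bar> + 1"
   have K: "cmod (\<Lambda> t v dv) \<le> K * hn v dv" if v: "h1 v dv" for v dv
   proof -
    let ?q = "(LBINT x. (U s0 x - U t x) * v x) / of_real (s0 - t)"
    have "cmod ?q \<le> n2 (\<lambda>x. U s0 x - U t x) * n2 v / \<bar>s0 - t\<bar>"
     using sq_CS(2)[OF h1_sq[OF hd] h1_sq[OF v]] by (simp add: norm_divide divide_right_mono flip: of_real_diff)
    also have "... \<le> n2 (\<lambda>x. U s0 x - U t x) / \<bar>s0 - t\<bar> * hn v dv"
     using n2_le_hn[of v dv] by (simp add: divide_right_mono mult_left_mono)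
    finally have 1: "cmod ?q \<le> n2 (\<lambda>x. U s0 x - U t x) / \<bar>s0 - t\<bar> * hn v dv" .
    have 2: "cmod (?q - \<Lambda> t v dv) \<le> 1 * hn v dv" using Hbound[OF less_imp_le[OF s0] _ v] by simp
    have "cmod (\<Lambda> t v dv) \<le> cmod ?q + cmod (?q - \<Lambda> t v dv)" by (metis norm_minus_commute norm_triangle_sub)
    then show ?thesis using 1 2 by (simp add: K_def distrib_right)
   qed
   show ?thesis
   proof (intro exI[of _ "K + 1"])
    show "\<forall>\<^sub>F s in at t. \<forall>v dv. h1 v dv \<longrightarrow> cmod (LBINT x. (U s x - U t x) * v x) \<le> (K + 1) * \<bar>s - t\<bar> * hn v dv"
     using ev eventually_neq_at_within[of t t UNIV]
    proof eventually_elim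
     case (elim s)
     show ?case
     proof (intro allI impI)
      fix v :: "'a \<Rightarrow> complex" and dv assume v: "h1 v dv"
      let ?i = "LBINT x. (U s x - U t x) * v x"
      have st: "\<bar>s - t\<bar> > 0" using elim(2) by simp
      have "cmod (?i / of_real (s - t) - \<Lambda> t v dv) \<le> 1 * hn v dv" using Hbound[OF less_imp_le[OF elim(1)] _ v] by simp
      moreover have "cmod (?i / of_real (s - t)) \<le> cmod (\<Lambda> t v dv) + cmod (?i / of_real (s - t) - \<Lambda> t v dv)" by (rule norm_triangle_sub)
      ultimately have "cmod (?i / of_real (s - t)) \<le> (K + 1) * hn v dv" using K[OF v] by (simp add: distrib_right)
      then have "cmod ?i / \<bar>s - t\<bar> \<le> (K + 1) * hn v dv" by (simp add: norm_divide flip: of_real_diff)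
      then show "cmod ?i \<le> (K + 1) * \<bar>s - t\<bar> * hn v dv" using st by (simp add: field_simps)
     qed
    qed
   qed
  qed
 qed
 then show ?thesis using that U by blast
qed

section \<open>The lower bound for the original Lebesgue norms\<close>

theorem theorem2p1:
 fixes lam \<alpha> :: real
  and \<phi> :: "'a::euclidean_space \<Rightarrow> complex"
  and u :: "real \<Rightarrow> 'a \<Rightarrow> complex"
  and r :: ennreal
 assumes "lam \<le> 0"
  and "0 \<le> \<alpha>"
  and "DIM('a) \<ge> 3 \<longrightarrow> \<alpha> < 4 / (real DIM('a) - 2)"
  and "\<phi> \<in> H1"
  and "nls_maximal_solution lam \<alpha> \<phi> \<infinity> \<infinity> u"
  and "\<alpha> \<le> 4 / real DIM('a) \<longrightarrow> \<phi> \<in> X_space"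
  and "\<not> (AE x in lebesgue. \<phi> x = 0)"
  and "2 \<le> r"
 shows "0 < Liminf at_top (\<lambda>t::real.
      ennreal (\<bar>t\<bar> powr (real DIM('a) * (1/2 - enn2real (1 / r)))) * Lp_norm r (u t))"
proof -
 have u: "nls_solution lam \<alpha> \<phi> \<infinity> \<infinity> u" using assms(5) by (simp add: nls_maximal_solution_def)
 obtain U D where nls: "nls lam \<alpha> U D" and rep: "\<And>t. rep (u t) (U t)"
  by (rule nls_solution_representative[OF assms(1-3) u], rule that)
 have pos: "n2 (U 0) > 0"
 proof (rule ccontr)
  assume "\<not> n2 (U 0) > 0"
  then have "n2 (U 0) = 0" using n2_nonneg[of "U 0"] by linarith
  then have "AE x in lborel. U 0 x = 0" using n2_eq_0_AE nls.U_sq[OF nls] by blast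
  then have "AE x in lborel. u 0 x = 0" using rep[of 0] unfolding rep_def by (auto elim: eventually_elim2)
  moreover have "AE x in lborel. u 0 x = \<phi> x" using u unfolding nls_solution_def AE_completion_iff by blast
  ultimately have "AE x in lborel. \<phi> x = 0" by (auto elim: eventually_elim2)
  then show False using assms(7) by (simp add: AE_completion_iff)
 qed
 let ?f = "\<lambda>t::real. ennreal (\<bar>t\<bar> powr (real DIM('a) * (1/2 - enn2real (1 / r)))) * Lp_norm r (u t)"
 have "\<exists>c>0. \<forall>\<^sub>F t in at_top. ennreal c \<le> ?f t"
 proof (cases "r = \<infinity>")
  case True
  obtain c where c: "c > 0" "\<forall>\<^sub>F T in at_top. \<forall>S\<ge>0. (AE x in lborel. cmod (U T x) \<le> S) \<longrightarrow> c \<le> T powr (DIM('a) / 2) * S"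
   by (rule nls.Linf_lower_bound[OF nls pos], rule that)
  have "\<forall>\<^sub>F t in at_top. ennreal c \<le> ?f t"
   using c(2) eventually_gt_at_top[of 0]
  proof eventually_elim
   case (elim t)
   let ?e = "esssup lebesgue (\<lambda>x. ennreal (cmod (u t x)))"
   have f: "?f t = ennreal (t powr (DIM('a) / 2)) * ?e"
    using True elim(2) rep[of t] by (simp add: Lp_norm_def rep_def)
   show ?case
   proof (cases ?e)
    case (real S)
    have "AE x in lebesgue. ennreal (cmod (u t x)) \<le> ?e" by (rule esssup_AE)
    then have "AE x in lborel. cmod (u t x) \<le> S" using real by (simp add: AE_completion_iff)
    then have "AE x in lborel. cmod (U t x) \<le> S" using rep[of t] unfolding rep_def by (auto elim: eventually_elim2)
    then have "c \<le> t powr (DIM('a) / 2) * S" using elim(1) real by blast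
    then show ?thesis unfolding f using real by (simp add: ennreal_leI flip: ennreal_mult)
   next
    \<comment> \<open>An infinite norm satisfies the bound because the power of t is
      positive.\<close>
    case top
    then show ?thesis unfolding f using elim(2) by (simp add: ennreal_mult_top)
   qed
  qed
  then show ?thesis using c(1) by blast
 next
  case False
  then obtain p where p: "r = ennreal p" "p \<ge> 0" by (cases r) auto
  have p2: "p \<ge> 2"
  proof -
   have "ennreal 2 \<le> ennreal p" using assms(8) p by simp
   then show ?thesis using p(2) by (simp only: ennreal_le_iff)
  qed
  have "1 / r = ennreal (1 / p)" using p p2 by (simp add: divide_ennreal flip: ennreal_1)
  then have e: "real DIM('a) * (1/2 - enn2real (1 / r)) = decay TYPE('a) p" using p2 by (simp add: decay_def)
  obtain c where c: "c > 0" "\<forall>\<^sub>F T in at_top. lp p (U T) \<longrightarrow> c \<le> T powr decay TYPE('a) p * np p (U T)"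
  \<comment> \<open>For p = 2 the exponent of t is 0 and conservation of mass suffices;
    \<open>Lr_lower_bound\<close> requires p > 2.\<close>
  proof (cases "p = 2")
   case True
   have "\<forall>\<^sub>F T in at_top. lp p (U T) \<longrightarrow> n2 (U 0) \<le> T powr decay TYPE('a) p * np p (U T)"
    using eventually_gt_at_top[of 0]
   proof eventually_elim
    case (elim T)
    then show ?case using nls.mass_conservation[OF nls, of T] True by (simp add: decay_def)
   qed
   then show ?thesis by (rule that[OF pos])
  next
   case False
   then have "p > 2" using p2 by simp
   show ?thesis by (rule nls.Lr_lower_bound[OF nls pos \<open>p > 2\<close>], rule that)
  qed
  have "\<forall>\<^sub>F t in at_top. ennreal c \<le> ?f t"
   using c(2) eventually_gt_at_top[of 0]
  proof eventually_elim
   case (elim t)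
   have L: "Lp_norm r (u t) = (if lp p (U t) then ennreal (np p (U t)) else \<infinity>)"
    unfolding p(1) by (rule Lp_norm_rep[OF rep]) (use p2 in simp)
   show ?case
   proof (cases "lp p (U t)")
    case True
    then have "c \<le> t powr decay TYPE('a) p * np p (U t)" using elim by blast
    then show ?thesis unfolding e L using True elim(2) by (simp add: ennreal_leI flip: ennreal_mult)
   next
    case False
    then show ?thesis unfolding e L using elim(2) by (simp add: ennreal_mult_top)
   qed
  qed
  then show ?thesis using c(1) by blast
 qed
 then obtain c where c: "c > 0" "\<forall>\<^sub>F t in at_top. ennreal c \<le> ?f t" by blast
 have "0 < ennreal c" using c(1) by simp
 also have "ennreal c \<le> Liminf at_top ?f" by (rule Liminf_bounded[OF c(2)])
 finally show ?thesis .
qed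

end
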